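(* Let $S\subset\mathbb{R}^3$ be a connected oriented surface with nowhere vanishing Gaussian curvature, given by an immersion $X:S\to\mathbb{R}^3$ and regarded as a Riemann surface. Then $S$ is an HQSF-surface if, and only if, there exist $c\in\mathbb{R}$ and holomorphic functions $g,f_1,f_2:S\to\mathbb{C}_\infty$ with $|g'|\neq 0$ and $|f_1f_2'-f_2f_1'|\neq 0$ such that $X(S)$ is locally parametrized by $$X(z)=\left(\frac{2(|f_1|^2+c|f_2|^2)}{T^2}\left(2T\left(f_1\overline{\left(\frac{f_1'}{g'}\right)}+c f_2\overline{\left(\frac{f_2'}{g'}\right)}\right)-g\left(|f_1|^2+c|f_2|^2\right)\right),\,0\right)-\frac{2R}{T}(g,1),$$ where $T=1+|g|^2$ and $$R=\frac{|f_1|^2+c|f_2|^2}{T^2}\left(4T\left\langle 1,\frac{(\overline{f_1}f_1'+c\overline{f_2}f_2')g}{g'}\right\rangle-(3|g|^2+1)(|f_1|^2+c|f_2|^2)\right).$$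
   Context: Notation: $\mathbb{R}^3$ is identified with $\mathbb{C}\times\mathbb{R}$. $\mathbb{C}_\infty$ is the Riemann sphere. Primes denote complex derivatives with respect to a local holomorphic coordinate $z=u_1+iu_2$ of $S$. For complex numbers $a,b$, $\langle a,b\rangle=\mathrm{Re}(\bar a b)$, so $\langle 1,a\rangle=\mathrm{Re}(a)$. For a surface $S\subset\mathbb{R}^3$ oriented by its unit normal Gauss map $N$, the support function is $\Psi(p)=\langle p,N(p)\rangle$ and the quadratic distance function is $\Lambda(p)=\langle p,p\rangle$, with the Euclidean scalar product of $\mathbb{R}^3$. $K$ is the Gaussian curvature and $H$ is the mean curvature, i.e. half the trace of $-dN$ (the unit sphere with outward normal has $H=-1$). The third fundamental form is $III=\langle dN,dN\rangle$, which is a Riemannian metric where $K\ne0$. Gauss map convention: in the local parametrization the Gauss map is $N=\frac{1}{1+|g|^2}(2g,\,1-|g|^2)$ with $g$ holomorphic, so the Riemann surface structure is the conformal structure of $III$. The local parametrization is understood to be a regular immersion. Definition: an oriented surface $S\subset\mathbb{R}^3$ is a surface with quadratic support function of harmonic type (HQSF-surface) if $$2\Psi H+(c\Psi e^{2\mu}+\Lambda-\Psi^2)K=0$$ on $S$, where $c$ is a real constant and $\mu$ is a function on $S$ that is harmonic with respect to the third fundamental form.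
   Formalization: As stated it fails: here X(S) avoids the origin, f1 and f2 are given on each simply connected open part of S (c, g global), the complex structure may be the conjugate one, and at poles of f1 or f2 the condition on f1f2'-f2f1' means f2/f1 is unramified. *)

theory Defs
  imports "HOL-Complex_Analysis.Complex_Analysis"
begin

text \<open>
  Euclidean 3-space is the type \<open>complex \<times> real\<close> with the library's inner product,
  and a parameter \<open>z = u1 + \<i> u2\<close> is a complex number.
\<close>

section \<open>Riemann surfaces given by an atlas\<close>

type_synonym 'a chart = "'a set \<times> ('a \<Rightarrow> complex)"

definition loc :: "'a chart \<Rightarrow> ('a \<Rightarrow> 'b) \<Rightarrow> complex \<Rightarrow> 'b" where
  "loc C F = F \<circ> inv_into (fst C) (snd C)"

definition coords :: "'a chart \<Rightarrow> 'a set \<Rightarrow> complex set" where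
  "coords C U = snd C ` (U \<inter> fst C)"

definition riemann_surface :: "'a::topological_space set \<Rightarrow> 'a chart set \<Rightarrow> bool" where
  "riemann_surface S A \<longleftrightarrow>
     (\<Union>C\<in>A. fst C) = S \<and>
     (\<forall>(V, \<phi>)\<in>A. openin (top_of_set S) V \<and> open (\<phi> ` V) \<and>
        homeomorphism V (\<phi> ` V) \<phi> (inv_into V \<phi>)) \<and>
     (\<forall>C\<in>A. \<forall>D\<in>A. loc C (snd D) holomorphic_on coords C (fst D))"

definition conj_atlas :: "'a chart set \<Rightarrow> 'a chart set" where
  "conj_atlas A = (\<lambda>(V, \<phi>). (V, cnj \<circ> \<phi>)) ` A"

text \<open>
  A holomorphic map into the Riemann sphere that is not identically \<open>\<infinity>\<close> on a component is the
  same as a meromorphic function. In the library's normal form \<open>nicely_meromorphic_on\<close> the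
  value at a pole is \<open>0\<close>; the points where the map takes the value \<open>\<infinity>\<close> are those
  satisfying \<open>is_pole\<close>.
\<close>

definition sphere_holomorphic :: "'a chart set \<Rightarrow> 'a set \<Rightarrow> ('a \<Rightarrow> complex) \<Rightarrow> bool" where
  "sphere_holomorphic A U f \<longleftrightarrow> (\<forall>C\<in>A. loc C f nicely_meromorphic_on coords C U)"

text \<open>
  Non-vanishing of the derivative of a map into the sphere. At a pole the derivative is taken
  in the coordinate \<open>1/w\<close> of the sphere.
\<close>

definition sphere_deriv_nz :: "(complex \<Rightarrow> complex) \<Rightarrow> complex \<Rightarrow> bool" where
  "sphere_deriv_nz f z \<longleftrightarrow>
     (if is_pole f z then deriv (\<lambda>w. inverse (f w)) z \<noteq> 0 else deriv f z \<noteq> 0)"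

text \<open>
  Non-vanishing of \<open>f1 f2' - f2 f1'\<close>. Since \<open>(f2/f1)' = (f1 f2' - f2 f1') / f1\<^sup>2\<close>, the condition
  is read at a pole of \<open>f1\<close> or \<open>f2\<close> as non-vanishing of the derivative of the map \<open>f2/f1\<close> into
  the sphere. The operator \<open>remove_sings\<close> puts the quotient into normal form.
\<close>

definition wronskian_nz :: "(complex \<Rightarrow> complex) \<Rightarrow> (complex \<Rightarrow> complex) \<Rightarrow> complex \<Rightarrow> bool" where
  "wronskian_nz f1 f2 z \<longleftrightarrow>
     (if is_pole f1 z \<or> is_pole f2 z
      then sphere_deriv_nz (remove_sings (\<lambda>w. f2 w / f1 w)) z
      else f1 z * deriv f2 z - f2 z * deriv f1 z \<noteq> 0)"

section \<open>Local differential geometry\<close>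

definition du :: "(complex \<Rightarrow> 'b::real_normed_vector) \<Rightarrow> complex \<Rightarrow> 'b" where
  "du Y z = frechet_derivative Y (at z) 1"

definition dv :: "(complex \<Rightarrow> 'b::real_normed_vector) \<Rightarrow> complex \<Rightarrow> 'b" where
  "dv Y z = frechet_derivative Y (at z) \<i>"

fun Ck_on :: "nat \<Rightarrow> complex set \<Rightarrow> (complex \<Rightarrow> 'b::real_normed_vector) \<Rightarrow> bool" where
  "Ck_on 0 W Y \<longleftrightarrow> continuous_on W Y"
| "Ck_on (Suc k) W Y \<longleftrightarrow>
     (\<forall>z\<in>W. Y differentiable (at z)) \<and> Ck_on k W (du Y) \<and> Ck_on k W (dv Y)"

definition smooth_on :: "complex set \<Rightarrow> (complex \<Rightarrow> 'b::real_normed_vector) \<Rightarrow> bool" where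
  "smooth_on W Y \<longleftrightarrow> (\<forall>k. Ck_on k W Y)"

definition immersion :: "'a chart set \<Rightarrow> ('a \<Rightarrow> complex \<times> real) \<Rightarrow> bool" where
  "immersion A X \<longleftrightarrow> (\<forall>C\<in>A. smooth_on (coords C (fst C)) (loc C X) \<and>
     (\<forall>z\<in>coords C (fst C). inj (frechet_derivative (loc C X) (at z))))"

definition unit_normal :: "'a chart set \<Rightarrow> ('a \<Rightarrow> complex \<times> real) \<Rightarrow> ('a \<Rightarrow> complex \<times> real) \<Rightarrow> bool" where
  "unit_normal A X N \<longleftrightarrow> (\<forall>C\<in>A. smooth_on (coords C (fst C)) (loc C N) \<and>
     (\<forall>z\<in>coords C (fst C). norm (loc C N z) = 1 \<and>
        (\<forall>v. frechet_derivative (loc C X) (at z) v \<bullet> loc C N z = 0)))"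

text \<open>
  The curvatures of a parametrized surface \<open>X\<close> with unit normal \<open>N\<close> in terms of its first
  fundamental form \<open>\<langle>dX, dX\<rangle>\<close> and its second fundamental form \<open>-\<langle>dX, dN\<rangle>\<close>. They are the
  determinant and half the trace of \<open>-dN\<close>; the unit sphere with outward normal has mean
  curvature \<open>-1\<close>.
\<close>

definition gauss_curv :: "(complex \<Rightarrow> complex \<times> real) \<Rightarrow> (complex \<Rightarrow> complex \<times> real) \<Rightarrow> complex \<Rightarrow> real" where
  "gauss_curv X N z =
     (let E = du X z \<bullet> du X z; F = du X z \<bullet> dv X z; G = dv X z \<bullet> dv X z;
          e = - (du X z \<bullet> du N z); f = - (du X z \<bullet> dv N z); g = - (dv X z \<bullet> dv N z)
      in (e * g - f\<^sup>2) / (E * G - F\<^sup>2))"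

definition mean_curv :: "(complex \<Rightarrow> complex \<times> real) \<Rightarrow> (complex \<Rightarrow> complex \<times> real) \<Rightarrow> complex \<Rightarrow> real" where
  "mean_curv X N z =
     (let E = du X z \<bullet> du X z; F = du X z \<bullet> dv X z; G = dv X z \<bullet> dv X z;
          e = - (du X z \<bullet> du N z); f = - (du X z \<bullet> dv N z); g = - (dv X z \<bullet> dv N z)
      in (e * G - 2 * f * F + g * E) / (2 * (E * G - F\<^sup>2)))"

text \<open>The Riemann surface structure is the conformal structure of \<open>III = \<langle>dN, dN\<rangle>\<close>.\<close>

definition III_conformal :: "'a chart set \<Rightarrow> ('a \<Rightarrow> complex \<times> real) \<Rightarrow> bool" where
  "III_conformal A N \<longleftrightarrow> (\<forall>C\<in>A. \<forall>z\<in>coords C (fst C).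
     du (loc C N) z \<bullet> du (loc C N) z = dv (loc C N) z \<bullet> dv (loc C N) z \<and>
     du (loc C N) z \<bullet> dv (loc C N) z = 0)"

text \<open>The Laplace--Beltrami operator of the metric \<open>E du1\<^sup>2 + 2 F du1 du2 + G du2\<^sup>2\<close>.\<close>

definition laplace_beltrami ::
  "(complex \<Rightarrow> real) \<Rightarrow> (complex \<Rightarrow> real) \<Rightarrow> (complex \<Rightarrow> real) \<Rightarrow> (complex \<Rightarrow> real) \<Rightarrow> complex \<Rightarrow> real" where
  "laplace_beltrami E F G h z =
     (let D = (\<lambda>w. sqrt (E w * G w - (F w)\<^sup>2))
      in (du (\<lambda>w. (G w * du h w - F w * dv h w) / D w) z +
          dv (\<lambda>w. (E w * dv h w - F w * du h w) / D w) z) / D z)"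

definition III_harmonic :: "'a chart set \<Rightarrow> ('a \<Rightarrow> complex \<times> real) \<Rightarrow> ('a \<Rightarrow> real) \<Rightarrow> bool" where
  "III_harmonic A N \<mu> \<longleftrightarrow> (\<forall>C\<in>A. Ck_on 2 (coords C (fst C)) (loc C \<mu>) \<and>
     (\<forall>z\<in>coords C (fst C).
        laplace_beltrami (\<lambda>w. du (loc C N) w \<bullet> du (loc C N) w)
          (\<lambda>w. du (loc C N) w \<bullet> dv (loc C N) w)
          (\<lambda>w. dv (loc C N) w \<bullet> dv (loc C N) w) (loc C \<mu>) z = 0))"

definition HQSF :: "'a chart set \<Rightarrow> ('a \<Rightarrow> complex \<times> real) \<Rightarrow> ('a \<Rightarrow> complex \<times> real) \<Rightarrow> bool" where
  "HQSF A X N \<longleftrightarrow> (\<exists>(c::real) \<mu>. III_harmonic A N \<mu> \<and>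
     (\<forall>C\<in>A. \<forall>z\<in>coords C (fst C).
        let \<Psi> = loc C X z \<bullet> loc C N z;
            \<Lambda> = loc C X z \<bullet> loc C X z;
            H = mean_curv (loc C X) (loc C N) z;
            K = gauss_curv (loc C X) (loc C N) z
        in 2 * \<Psi> * H + (c * \<Psi> * exp (2 * loc C \<mu> z) + \<Lambda> - \<Psi>\<^sup>2) * K = 0))"

section \<open>The representation formula\<close>

definition hqsf_R ::
  "real \<Rightarrow> (complex \<Rightarrow> complex) \<Rightarrow> (complex \<Rightarrow> complex) \<Rightarrow> (complex \<Rightarrow> complex) \<Rightarrow> complex \<Rightarrow> real" where
  "hqsf_R c g f1 f2 z =
     (let T = 1 + (cmod (g z))\<^sup>2;
          P = (cmod (f1 z))\<^sup>2 + c * (cmod (f2 z))\<^sup>2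
      in P / T\<^sup>2 *
         (4 * T * (1 \<bullet> ((cnj (f1 z) * deriv f1 z + of_real c * cnj (f2 z) * deriv f2 z) * g z
                        / deriv g z))
          - (3 * (cmod (g z))\<^sup>2 + 1) * P))"

definition hqsf_X ::
  "real \<Rightarrow> (complex \<Rightarrow> complex) \<Rightarrow> (complex \<Rightarrow> complex) \<Rightarrow> (complex \<Rightarrow> complex) \<Rightarrow> complex \<Rightarrow> complex \<times> real" where
  "hqsf_X c g f1 f2 z =
     (let T = 1 + (cmod (g z))\<^sup>2;
          P = (cmod (f1 z))\<^sup>2 + c * (cmod (f2 z))\<^sup>2
      in (of_real (2 * P / T\<^sup>2) *
            (2 * of_real T * (f1 z * cnj (deriv f1 z / deriv g z)
                              + of_real c * f2 z * cnj (deriv f2 z / deriv g z))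
             - g z * of_real P), 0)
         - (2 * hqsf_R c g f1 f2 z / T) *\<^sub>R (g z, 1))"

text \<open>
  The formula only makes sense where \<open>g\<close>, \<open>f1\<close>, \<open>f2\<close> are finite. Their poles are isolated,
  so at a pole \<open>X\<close> is determined by continuity.
\<close>

definition hqsf_parametrized ::
  "'a chart set \<Rightarrow> 'a set \<Rightarrow> ('a \<Rightarrow> complex \<times> real) \<Rightarrow> real \<Rightarrow>
   ('a \<Rightarrow> complex) \<Rightarrow> ('a \<Rightarrow> complex) \<Rightarrow> ('a \<Rightarrow> complex) \<Rightarrow> bool" where
  "hqsf_parametrized A U X c g f1 f2 \<longleftrightarrow> (\<forall>C\<in>A. \<forall>z\<in>coords C U.
     \<not> is_pole (loc C g) z \<and> \<not> is_pole (loc C f1) z \<and> \<not> is_pole (loc C f2) z \<longrightarrow>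
     loc C X z = hqsf_X c (loc C g) (loc C f1) (loc C f2) z)"

end

theory Submission
  imports Defs
begin

text \<open>
  Write the support function, normalized to be positive, as \<open>2 s\<^sup>2\<close> and put
  \<open>p = (1 + |g|\<^sup>2) s\<close>. In a coordinate \<open>z\<close> that is conformal for the third fundamental form, the
  HQSF equation becomes the Liouville type equation
  \<open>p p_z_zbar - |p_z|\<^sup>2 = (c/4) e\<^bsup>2\<mu>\<^esup> |g'|\<^sup>2\<close>. It forces \<open>p\<close> to satisfy a linear second order equation in \<open>z\<close> with
  holomorphic coefficients, whence \<open>p = |f1|\<^sup>2 + c |f2|\<^sup>2\<close> for solutions with
  \<open>|f1 f2' - f2 f1'| = e\<^bsup>\<mu>\<^esup> |g'| / 2\<close>. Such a pair is unique up to the linear isometries of the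
  form \<open>|x|\<^sup>2 + c |y|\<^sup>2\<close>, so local pairs continue along paths and give global pairs over simply
  connected sets; at a pole of \<open>g\<close> the other stereographic projection is used. The position vector is
  recovered from the support function and its gradient, which is the representation formula.

  Conversely, away from the poles the formula gives the HQSF equation with
  \<open>e\<^bsup>2\<mu>\<^esup>\<close> replaced by a multiple of \<open>|u|\<^sup>2\<close>, where \<open>u = (f1 f2' - f2 f1') / g'\<close>. Since this function is
  continuous on the surface and is bounded below by a multiple of the support function, \<open>u\<close> extends
  across the poles without zeros, so that \<open>ln |u|\<close> is harmonic. The constant changes sign with the
  orientation, and the normal may be anti-holomorphic in the given atlas; hence the conjugate atlas.
\<close>

section \<open>Calculus in one complex parameter\<close>

text \<open>That the surface avoids the origin is what fixes a sign: at a zero of the support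
  function the HQSF equation forces the gradient to vanish too, and a point whose support function
  and gradient vanish is the origin. The substitution \<open>p = (1 + |g|^2) s\<close> comes from
  \<open>F F_z_zbar - |F_z|^2 = F^2 (ln F)_z_zbar\<close>, which turns products into sums: the
  factor \<open>1 + |g|^2\<close> contributes \<open>|g'|^2\<close>, exactly the curvature term of
  the sphere. The third fundamental form is \<open>4 |g'|^2 / (1 + |g|^2)^2\<close> times the flat
  metric; this produces the \<open>1/4\<close> in the Liouville equation and hence the
  \<open>1/2\<close> in the Wronskian. The main obstacle in the direct implication is
  \<open>c = 0\<close>, where \<open>|x|^2 + c |y|^2\<close> is degenerate and forgets the second
  function. The modulus of the Wronskian is therefore carried along as part of the data, and pairs
  are constructed and compared without division by \<open>c\<close>. In the converse, poles of
  \<open>f1\<close> and \<open>f2\<close> may have any order and need not be poles of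
  \<open>g\<close>; the estimates there involve only the quotient \<open>f2 / f1\<close>, whose
  derivative is controlled by hypothesis.\<close>

lemma du_dv_has_derivative:
  assumes "(f has_derivative D) (at z)"
  shows "du f z = D 1" "dv f z = D \<i>"
  using frechet_derivative_at[OF assms] by (simp_all add: du_def dv_def)

lemma complex_as_real_comb: "h = Re h *\<^sub>R 1 + Im h *\<^sub>R \<i>"
  by (simp add: complex_eq_iff)

lemma differentiable_has_derivative_du_dv:
  assumes "f differentiable (at z)"
  shows "(f has_derivative (\<lambda>h. Re h *\<^sub>R du f z + Im h *\<^sub>R dv f z)) (at z)"
proof -
  obtain D where D: "(f has_derivative D) (at z)"
    using assms by (auto simp: differentiable_def)
  interpret linear D
    using D by (rule has_derivative_linear)
  have "D h = Re h *\<^sub>R du f z + Im h *\<^sub>R dv f z" for h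
    using add[of "Re h *\<^sub>R 1" "Im h *\<^sub>R \<i>"] scale[of "Re h" 1] scale[of "Im h" \<i>]
      complex_as_real_comb[of h] du_dv_has_derivative[OF D] by simp
  then have "D = (\<lambda>h. Re h *\<^sub>R du f z + Im h *\<^sub>R dv f z)"
    by auto
  with D show ?thesis by simp
qed

lemma du_dv_cong:
  assumes "open W" "z \<in> W" "\<And>w. w \<in> W \<Longrightarrow> f w = g w"
  shows "du f z = du g z" "dv f z = dv g z"
        "f differentiable (at z) \<longleftrightarrow> g differentiable (at z)"
proof -
  have "(f has_derivative D) (at z) = (g has_derivative D) (at z)" for D
    using assms has_derivative_transform_within_open[of f D z UNIV W g]
      has_derivative_transform_within_open[of g D z UNIV W f] by auto
  then show "du f z = du g z" "dv f z = dv g z"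
        "f differentiable (at z) \<longleftrightarrow> g differentiable (at z)"
    by (simp_all add: du_def dv_def frechet_derivative_def differentiable_def)
qed

section \<open>Closure properties of functions with continuous derivatives up to order k\<close>

lemma Ck_on_cong:
  assumes "open W" "\<And>w. w \<in> W \<Longrightarrow> f w = g w"
  shows "Ck_on k W f \<longleftrightarrow> Ck_on k W g"
  using assms(2)
proof (induction k arbitrary: f g)
  case 0
  then show ?case by (auto intro: continuous_on_cong)
next
  case (Suc k)
  have "Ck_on k W (du f) = Ck_on k W (du g)" "Ck_on k W (dv f) = Ck_on k W (dv g)"
    using du_dv_cong[OF assms(1) _ Suc.prems] by (auto intro!: Suc.IH)
  then show ?case
    using du_dv_cong(3)[OF assms(1) _ Suc.prems] by auto
qed

lemma Ck_on_subset: "Ck_on k W f \<Longrightarrow> V \<subseteq> W \<Longrightarrow> Ck_on k V f"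
  by (induction k arbitrary: f) (auto intro: continuous_on_subset)

lemma Ck_on_imp_continuous_on: "Ck_on k W f \<Longrightarrow> continuous_on W f"
  by (cases k)
    (auto simp: continuous_on_eq_continuous_within
      intro: differentiable_imp_continuous_within[THEN continuous_within_subset])

lemma Ck_on_Suc_imp: "Ck_on (Suc k) W f \<Longrightarrow> Ck_on k W f"
proof (induction k arbitrary: f)
  case 0
  then show ?case using Ck_on_imp_continuous_on[OF 0] by simp
next
  case (Suc k)
  have "\<forall>z\<in>W. f differentiable (at z)" "Ck_on (Suc k) W (du f)" "Ck_on (Suc k) W (dv f)"
    using Suc.prems by simp_all
  then show ?case using Suc.IH[of "du f"] Suc.IH[of "dv f"] by (subst Ck_on.simps) blast
qed

lemma Ck_on_local:
  assumes "\<And>z. z \<in> W \<Longrightarrow> \<exists>V. open V \<and> z \<in> V \<and> Ck_on k V f"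
  shows "Ck_on k W f"
  using assms
proof (induction k arbitrary: f)
  case 0
  have "continuous (at z) f" if z: "z \<in> W" for z
  proof -
    obtain V where "open V" "z \<in> V" "continuous_on V f" using 0[OF z] by auto
    then show ?thesis by (simp add: continuous_on_eq_continuous_at)
  qed
  then show ?case
    by (simp add: continuous_at_imp_continuous_on)
next
  case (Suc k)
  have "Ck_on k W (du f)" "Ck_on k W (dv f)"
    using Suc.prems by (intro Suc.IH; fastforce)+
  moreover have "f differentiable (at z)" if "z \<in> W" for z
    using Suc.prems[OF that] by auto
  ultimately show ?case by simp
qed

lemma Ck_on_const: "Ck_on k W (\<lambda>_. c)"
proof (induction k arbitrary: c)
  case (Suc k)
  have "du (\<lambda>_. c) = (\<lambda>_. 0)" "dv (\<lambda>_. c) = (\<lambda>_. 0)"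
    by (auto simp: fun_eq_iff du_dv_has_derivative[OF has_derivative_const])
  then show ?case using Suc[of 0] by simp
qed simp

lemma du_dv_add:
  assumes "f differentiable (at z)" "g differentiable (at z)"
  shows "du (\<lambda>w. f w + g w) z = du f z + du g z" "dv (\<lambda>w. f w + g w) z = dv f z + dv g z"
  using du_dv_has_derivative[OF has_derivative_add[OF
      differentiable_has_derivative_du_dv[OF assms(1)] differentiable_has_derivative_du_dv[OF assms(2)]]]
  by auto

lemma Ck_on_add:
  assumes "open W" "Ck_on k W f" "Ck_on k W g"
  shows "Ck_on k W (\<lambda>w. f w + g w)"
  using assms(2,3)
proof (induction k arbitrary: f g)
  case (Suc k)
  have "Ck_on k W (du (\<lambda>w. f w + g w)) = Ck_on k W (\<lambda>w. du f w + du g w)"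
       "Ck_on k W (dv (\<lambda>w. f w + g w)) = Ck_on k W (\<lambda>w. dv f w + dv g w)"
    using Suc.prems by (auto intro!: Ck_on_cong[OF assms(1)] simp: du_dv_add)
  then show ?case using Suc by auto
qed (auto intro: continuous_on_add)

lemma du_dv_bounded_linear:
  assumes "bounded_linear B" "f differentiable (at z)"
  shows "du (\<lambda>w. B (f w)) z = B (du f z)" "dv (\<lambda>w. B (f w)) z = B (dv f z)"
  using du_dv_has_derivative[OF bounded_linear.has_derivative[OF assms(1)
      differentiable_has_derivative_du_dv[OF assms(2)]]] by auto

lemma bounded_linear_differentiable:
  assumes "bounded_linear B" "f differentiable (at z)"
  shows "(\<lambda>w. B (f w)) differentiable (at z)"
  using bounded_linear.has_derivative[OF assms(1)] assms(2) by (auto simp: differentiable_def)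

lemma Ck_on_bounded_linear:
  assumes "open W" "bounded_linear B" "Ck_on k W f"
  shows "Ck_on k W (\<lambda>w. B (f w))"
  using assms(3)
proof (induction k arbitrary: f)
  case 0
  then show ?case
    using bounded_linear.continuous_on[OF assms(2)] by simp
next
  case (Suc k)
  have "Ck_on k W (du (\<lambda>w. B (f w))) = Ck_on k W (\<lambda>w. B (du f w))"
       "Ck_on k W (dv (\<lambda>w. B (f w))) = Ck_on k W (\<lambda>w. B (dv f w))"
    using Suc.prems by (auto intro!: Ck_on_cong[OF assms(1)] simp: du_dv_bounded_linear[OF assms(2)])
  then show ?case using Suc by (auto intro: bounded_linear_differentiable[OF assms(2)])
qed

lemma du_dv_bilinear:
  assumes "bounded_bilinear B" "f differentiable (at z)" "g differentiable (at z)"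
  shows "du (\<lambda>w. B (f w) (g w)) z = B (f z) (du g z) + B (du f z) (g z)"
        "dv (\<lambda>w. B (f w) (g w)) z = B (f z) (dv g z) + B (dv f z) (g z)"
  using du_dv_has_derivative[OF bounded_bilinear.FDERIV[OF assms(1)
      differentiable_has_derivative_du_dv[OF assms(2)] differentiable_has_derivative_du_dv[OF assms(3)]]]
  by auto

lemma bilinear_differentiable:
  assumes "bounded_bilinear B" "f differentiable (at z)" "g differentiable (at z)"
  shows "(\<lambda>w. B (f w) (g w)) differentiable (at z)"
  using bounded_bilinear.FDERIV[OF assms(1)] assms(2,3) unfolding differentiable_def by blast

lemma Ck_on_bilinear:
  assumes "open W" "bounded_bilinear B" "Ck_on k W f" "Ck_on k W g"
  shows "Ck_on k W (\<lambda>w. B (f w) (g w))"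
  using assms(3,4)
proof (induction k arbitrary: f g)
  case 0
  then show ?case
    using bounded_bilinear.continuous_on[OF assms(2)] by simp
next
  case (Suc k)
  have eq: "Ck_on k W (du (\<lambda>w. B (f w) (g w))) = Ck_on k W (\<lambda>w. B (f w) (du g w) + B (du f w) (g w))"
       "Ck_on k W (dv (\<lambda>w. B (f w) (g w))) = Ck_on k W (\<lambda>w. B (f w) (dv g w) + B (dv f w) (g w))"
    using Suc.prems by (auto intro!: Ck_on_cong[OF assms(1)] simp: du_dv_bilinear[OF assms(2)])
  have fg: "Ck_on k W f" "Ck_on k W g"
    using Ck_on_Suc_imp[OF Suc.prems(1)] Ck_on_Suc_imp[OF Suc.prems(2)] by blast+
  have d: "Ck_on k W (du f)" "Ck_on k W (dv f)" "Ck_on k W (du g)" "Ck_on k W (dv g)"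
     "\<forall>z\<in>W. f differentiable (at z)" "\<forall>z\<in>W. g differentiable (at z)"
    using Suc.prems by simp_all
  have "\<forall>z\<in>W. (\<lambda>w. B (f w) (g w)) differentiable (at z)"
    using d by (auto intro: bilinear_differentiable[OF assms(2)])
  moreover have "Ck_on k W (\<lambda>w. B (f w) (du g w) + B (du f w) (g w))"
      "Ck_on k W (\<lambda>w. B (f w) (dv g w) + B (dv f w) (g w))"
    by (rule Ck_on_add[OF assms(1) Suc.IH Suc.IH]; fact)+
  ultimately show ?case
    by (simp only: Ck_on.simps eq simp_thms)
qed

lemma du_dv_inner:
  fixes f g :: "complex \<Rightarrow> 'b::real_inner"
  assumes "f differentiable (at z)" "g differentiable (at z)"
  shows "du (\<lambda>w. f w \<bullet> g w) z = f z \<bullet> du g z + du f z \<bullet> g z"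
        "dv (\<lambda>w. f w \<bullet> g w) z = f z \<bullet> dv g z + dv f z \<bullet> g z"
  using du_dv_bilinear[OF bounded_bilinear_inner assms] by auto

lemmas Ck_on_inner = Ck_on_bilinear[OF _ bounded_bilinear_inner]
lemmas Ck_on_mult = Ck_on_bilinear[OF _ bounded_bilinear_mult]

text \<open>The composition with the derivative is required at one order less. Since the derivatives
  of \<open>inverse\<close> and \<open>sqrt\<close> are built from these functions themselves, both
  cases then follow by induction on the order.\<close>

lemma Ck_on_real_comp:
  fixes \<phi> \<phi>' :: "real \<Rightarrow> real"
  assumes "open W" "\<And>w. w \<in> W \<Longrightarrow> (\<phi> has_field_derivative \<phi>' (f w)) (at (f w))"
    and "Ck_on (Suc k) W f" "Ck_on k W (\<lambda>w. \<phi>' (f w))"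
  shows "Ck_on (Suc k) W (\<lambda>w. \<phi> (f w))"
proof -
  have D: "((\<lambda>w. \<phi> (f w)) has_derivative
      (\<lambda>h. (Re h *\<^sub>R du f z + Im h *\<^sub>R dv f z) * \<phi>' (f z))) (at z)" if "z \<in> W" for z
  proof -
    have "(f has_derivative (\<lambda>h. Re h *\<^sub>R du f z + Im h *\<^sub>R dv f z)) (at z)"
      by (rule differentiable_has_derivative_du_dv) (use assms(3) that in simp)
    from DERIV_compose_FDERIV[OF assms(2)[OF that] this] show ?thesis .
  qed
  have "Ck_on k W (du (\<lambda>w. \<phi> (f w))) = Ck_on k W (\<lambda>w. du f w * \<phi>' (f w))"
       "Ck_on k W (dv (\<lambda>w. \<phi> (f w))) = Ck_on k W (\<lambda>w. dv f w * \<phi>' (f w))"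
    by (auto intro!: Ck_on_cong[OF assms(1)] simp: du_dv_has_derivative[OF D])
  moreover have "Ck_on k W (\<lambda>w. du f w * \<phi>' (f w))" "Ck_on k W (\<lambda>w. dv f w * \<phi>' (f w))"
    using assms by (auto intro!: Ck_on_mult)
  ultimately show ?thesis
    using D by (auto simp: differentiable_def)
qed

lemma Ck_on_inverse:
  fixes f :: "complex \<Rightarrow> real"
  assumes "open W" "Ck_on k W f" "\<And>w. w \<in> W \<Longrightarrow> f w \<noteq> 0"
  shows "Ck_on k W (\<lambda>w. inverse (f w))"
  using assms(2)
proof (induction k)
  case 0
  then show ?case using assms(3) by (auto intro!: continuous_intros)
next
  case (Suc k)
  have IH: "Ck_on k W (\<lambda>w. inverse (f w))" using Suc Ck_on_Suc_imp by blast
  show ?case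
  proof (rule Ck_on_real_comp[where \<phi> = inverse and f = f and \<phi>' = "\<lambda>x. - (inverse x * inverse x)"])
    show "Ck_on k W (\<lambda>w. - (inverse (f w) * inverse (f w)))"
      by (intro Ck_on_bounded_linear[OF assms(1) bounded_linear_minus[OF bounded_linear_ident]]
        Ck_on_mult assms(1) IH)
  qed (use assms Suc.prems in \<open>auto intro!: derivative_eq_intros simp: power2_eq_square\<close>)
qed

lemma Ck_on_sqrt:
  fixes f :: "complex \<Rightarrow> real"
  assumes "open W" "Ck_on k W f" "\<And>w. w \<in> W \<Longrightarrow> f w > 0"
  shows "Ck_on k W (\<lambda>w. sqrt (f w))"
  using assms(2)
proof (induction k)
  case 0
  then show ?case by (auto intro!: continuous_intros)
next
  case (Suc k)
  have IH: "Ck_on k W (\<lambda>w. sqrt (f w))" using Suc Ck_on_Suc_imp by blast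
  have pos: "w \<in> W \<Longrightarrow> sqrt (f w) \<noteq> 0" for w using assms(3)[of w] by simp
  show ?case
  proof (rule Ck_on_real_comp[where \<phi> = sqrt and f = f and \<phi>' = "\<lambda>x. inverse (sqrt x) * (1/2)"])
    show "Ck_on k W (\<lambda>w. inverse (sqrt (f w)) * (1/2))"
      by (intro Ck_on_mult Ck_on_inverse assms(1) IH Ck_on_const pos)
  qed (use assms Suc.prems DERIV_real_sqrt in \<open>auto simp: \<close>)
qed

text \<open>The partial derivatives of \<open>Re f\<close> are \<open>Re f'\<close> and
  \<open>Re (f' * \<i>)\<close>, again real parts of holomorphic functions, so the induction runs
  over all \<open>f\<close> at once.\<close>

lemma Ck_on_Re_holomorphic:
  assumes "open W" "f holomorphic_on W"
  shows "Ck_on k W (\<lambda>w. Re (f w))"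
  using assms(2)
proof (induction k arbitrary: f)
  case 0
  then show ?case by (auto intro!: continuous_intros holomorphic_on_imp_continuous_on)
next
  case (Suc k)
  have D: "((\<lambda>w. Re (f w)) has_derivative (\<lambda>h. Re (deriv f z * h))) (at z)" if "z \<in> W" for z
    using has_derivative_Re[OF holomorphic_derivI[OF Suc.prems assms(1) that, of UNIV,
        unfolded has_field_derivative_def]] by simp
  have hol: "deriv f holomorphic_on W" "(\<lambda>w. deriv f w * \<i>) holomorphic_on W"
    using Suc.prems assms(1) by (auto intro!: holomorphic_intros)
  have "Ck_on k W (du (\<lambda>w. Re (f w))) = Ck_on k W (\<lambda>w. Re (deriv f w))"
       "Ck_on k W (dv (\<lambda>w. Re (f w))) = Ck_on k W (\<lambda>w. Re (deriv f w * \<i>))"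
    by (auto intro!: Ck_on_cong[OF assms(1)] simp: du_dv_has_derivative[OF D])
  then show ?case
    using Suc.IH[OF hol(1)] Suc.IH[OF hol(2)] D by (auto simp: differentiable_def)
qed

section \<open>Symmetry of the second partial derivatives\<close>

lemma mvt_du_dv:
  fixes f :: "complex \<Rightarrow> real"
  assumes "0 < t"
  shows "(\<And>s. 0 \<le> s \<Longrightarrow> s \<le> t \<Longrightarrow> f differentiable (at (w + of_real s))) \<Longrightarrow>
           \<exists>s. 0 < s \<and> s < t \<and> f (w + of_real t) - f w = t * du f (w + of_real s)"
        "(\<And>s. 0 \<le> s \<Longrightarrow> s \<le> t \<Longrightarrow> f differentiable (at (w + \<i> * of_real s))) \<Longrightarrow>
           \<exists>s. 0 < s \<and> s < t \<and> f (w + \<i> * of_real t) - f w = t * dv f (w + \<i> * of_real s)"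
proof -
  have key: "\<exists>s. 0 < s \<and> s < t \<and> f (w + e * of_real t) - f w =
      t * (Re e * du f (w + e * of_real s) + Im e * dv f (w + e * of_real s))"
    if d: "\<And>s. 0 \<le> s \<Longrightarrow> s \<le> t \<Longrightarrow> f differentiable (at (w + e * of_real s))" for e
  proof -
    have D: "((\<lambda>s. f (w + e * of_real s)) has_field_derivative
        (Re e * du f (w + e * of_real s) + Im e * dv f (w + e * of_real s))) (at s)"
      if "0 \<le> s" "s \<le> t" for s
    proof -
      have "((\<lambda>s::real. w + e * of_real s) has_derivative (\<lambda>h. e * of_real h)) (at s)"
        by (auto intro!: derivative_eq_intros)
      from has_derivative_compose[OF this differentiable_has_derivative_du_dv[OF d[OF that]]]
      show ?thesis unfolding has_field_derivative_def
        by (rule has_derivative_eq_rhs) (auto simp: fun_eq_iff algebra_simps)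
    qed
    from MVT2[of 0 t "\<lambda>s. f (w + e * of_real s)", OF assms D] show ?thesis by force
  qed
  from key[of 1] show "(\<And>s. 0 \<le> s \<Longrightarrow> s \<le> t \<Longrightarrow> f differentiable (at (w + of_real s))) \<Longrightarrow>
           \<exists>s. 0 < s \<and> s < t \<and> f (w + of_real t) - f w = t * du f (w + of_real s)"
    by simp
  from key[of \<i>] show "(\<And>s. 0 \<le> s \<Longrightarrow> s \<le> t \<Longrightarrow> f differentiable (at (w + \<i> * of_real s))) \<Longrightarrow>
           \<exists>s. 0 < s \<and> s < t \<and> f (w + \<i> * of_real t) - f w = t * dv f (w + \<i> * of_real s)"
    by simp
qed

lemma mixed_partials_real:
  fixes f :: "complex \<Rightarrow> real"
  assumes W: "open W" "z \<in> W" and C2: "Ck_on 2 W f"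
  shows "du (dv f) z = dv (du f) z"
proof -
  obtain r where r: "r > 0" "ball z r \<subseteq> W" using W openE by blast
  have d: "w \<in> W \<Longrightarrow> f differentiable (at w)" "w \<in> W \<Longrightarrow> du f differentiable (at w)"
     "w \<in> W \<Longrightarrow> dv f differentiable (at w)" for w
    using C2 by (auto simp: numeral_2_eq_2)
  have cont: "continuous_on W (du (dv f))" "continuous_on W (dv (du f))"
    using C2 by (auto simp: numeral_2_eq_2)
  have in_W: "z + of_real s + \<i> * of_real s' \<in> W" if "0 \<le> s" "s \<le> t" "0 \<le> s'" "s' \<le> t" "2 * t < r" for s s' t
  proof -
    have "norm (of_real s + \<i> * of_real s' :: complex) \<le> s + s'"
      using norm_triangle_ineq[of "of_real s :: complex" "\<i> * of_real s'"] that by (simp add: norm_mult)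
    moreover have "dist z (z + e) = norm e" for e :: complex
      by (simp add: dist_norm)
    ultimately have "dist z (z + (of_real s + \<i> * of_real s')) < r"
      using that by simp
    then show ?thesis using r(2) by (auto simp: add.assoc)
  qed
  \<comment> \<open>The second difference of \<open>f\<close> over a square of side \<open>t\<close>
    is read in two ways: as an increment of the vertical difference \<open>F\<close> and as an
    increment of the horizontal difference \<open>G\<close>. Two applications of the mean value
    theorem to each turn it into \<open>t^2\<close> times either mixed derivative at some point of
    the square.\<close>
  have ex: "\<exists>a b c d. 0 \<le> a \<and> a \<le> t \<and> 0 \<le> b \<and> b \<le> t \<and> 0 \<le> c \<and> c \<le> t \<and> 0 \<le> d \<and> d \<le> t \<and>
      dv (du f) (z + of_real a + \<i> * of_real b) = du (dv f) (z + of_real c + \<i> * of_real d)"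
    if t: "0 < t" "2 * t < r" for t
  proof -
    note in_W' = in_W[OF _ _ _ _ t(2)]
    define F where "F w = f (w + \<i> * of_real t) - f w" for w
    define G where "G w = f (w + of_real t) - f w" for w
    have DF: "(F has_derivative (\<lambda>h. (Re h *\<^sub>R du f (w + \<i> * of_real t) + Im h *\<^sub>R dv f (w + \<i> * of_real t))
         - (Re h *\<^sub>R du f w + Im h *\<^sub>R dv f w))) (at w)"
      if "w + \<i> * of_real t \<in> W" "w \<in> W" for w
      unfolding F_def
      by (intro has_derivative_diff differentiable_has_derivative_du_dv d that
        has_derivative_compose[OF _ differentiable_has_derivative_du_dv[OF d(1)], of "\<lambda>w. w + \<i> * of_real t", THEN has_derivative_eq_rhs])
        (auto intro!: derivative_eq_intros)
    have DG: "(G has_derivative (\<lambda>h. (Re h *\<^sub>R du f (w + of_real t) + Im h *\<^sub>R dv f (w + of_real t))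
         - (Re h *\<^sub>R du f w + Im h *\<^sub>R dv f w))) (at w)"
      if "w + of_real t \<in> W" "w \<in> W" for w
      unfolding G_def
      by (intro has_derivative_diff differentiable_has_derivative_du_dv d that
        has_derivative_compose[OF _ differentiable_has_derivative_du_dv[OF d(1)], of "\<lambda>w. w + of_real t", THEN has_derivative_eq_rhs])
        (auto intro!: derivative_eq_intros)
    have inF: "z + of_real s + \<i> * of_real t \<in> W" "z + of_real s \<in> W" if "0 \<le> s" "s \<le> t" for s
      using in_W'[of s t] in_W'[of s 0] that t by auto
    have inG: "z + \<i> * of_real s + of_real t \<in> W" "z + \<i> * of_real s \<in> W" if "0 \<le> s" "s \<le> t" for s
      using in_W'[of t s] in_W'[of 0 s] that t by (auto simp: algebra_simps)
    obtain a where a: "0 < a" "a < t" "F (z + of_real t) - F z = t * du F (z + of_real a)"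
      using mvt_du_dv(1)[OF t(1), of F z] DF[OF inF] by (force simp: differentiable_def)
    obtain c where c: "0 < c" "c < t" "G (z + \<i> * of_real t) - G z = t * dv G (z + \<i> * of_real c)"
      using mvt_du_dv(2)[OF t(1), of G z] DG[OF inG] by (force simp: differentiable_def)
    have "du F (z + of_real a) = du f (z + of_real a + \<i> * of_real t) - du f (z + of_real a)"
      using du_dv_has_derivative(1)[OF DF[OF inF, of a]] a by simp
    moreover obtain b where b: "0 < b" "b < t"
       "du f (z + of_real a + \<i> * of_real t) - du f (z + of_real a) = t * dv (du f) (z + of_real a + \<i> * of_real b)"
      using mvt_du_dv(2)[OF t(1), of "du f" "z + of_real a"] d(2)[OF in_W'] a t by force
    moreover have "dv G (z + \<i> * of_real c) = dv f (z + \<i> * of_real c + of_real t) - dv f (z + \<i> * of_real c)"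
      using du_dv_has_derivative(2)[OF DG[OF inG, of c]] c by simp
    moreover obtain e where e: "0 < e" "e < t"
       "dv f (z + \<i> * of_real c + of_real t) - dv f (z + \<i> * of_real c) = t * du (dv f) (z + \<i> * of_real c + of_real e)"
    proof -
      have "dv f differentiable (at (z + \<i> * of_real c + of_real s))" if "0 \<le> s" "s \<le> t" for s
        using d(3)[OF in_W'[of s c]] that c by (simp add: algebra_simps)
      then show ?thesis using mvt_du_dv(1)[OF t(1), of "dv f" "z + \<i> * of_real c"] that by blast
    qed
    moreover have "F (z + of_real t) - F z = G (z + \<i> * of_real t) - G z"
      by (simp add: F_def G_def algebra_simps)
    ultimately have "t * (t * dv (du f) (z + of_real a + \<i> * of_real b)) = t * (t * du (dv f) (z + \<i> * of_real c + of_real e))"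
      using a(3) c(3) by simp
    then have "dv (du f) (z + of_real a + \<i> * of_real b) = du (dv f) (z + of_real e + \<i> * of_real c)"
      using t by (simp add: algebra_simps)
    then show ?thesis using a b c e by (intro exI[of _ a] exI[of _ b] exI[of _ e] exI[of _ c]) auto
  qed
  show ?thesis
  proof (rule ccontr)
    assume ne: "\<not> ?thesis"
    \<comment> \<open>Half of the supposed gap: the common value found in a small square would be
      closer than this to both mixed derivatives at \<open>z\<close>.\<close>
    define \<epsilon> where "\<epsilon> = \<bar>du (dv f) z - dv (du f) z\<bar> / 2"
    have "\<epsilon> > 0" using ne by (simp add: \<epsilon>_def)
    have "isCont (du (dv f)) z" "isCont (dv (du f)) z"
      using cont W by (auto simp: continuous_on_eq_continuous_at)
    then obtain s1 s2 where s: "s1 > 0" "\<And>w. dist w z < s1 \<Longrightarrow> dist (du (dv f) w) (du (dv f) z) < \<epsilon>"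
       "s2 > 0" "\<And>w. dist w z < s2 \<Longrightarrow> dist (dv (du f) w) (dv (du f) z) < \<epsilon>"
      using \<open>\<epsilon> > 0\<close> unfolding continuous_at_eps_delta dist_norm by metis
    define t where "t = min r (min s1 s2) / 4"
    have t: "0 < t" "2 * t < r" "2 * t < s1" "2 * t < s2" using r s by (auto simp: t_def)
    obtain a b c e where abce: "0 \<le> a" "a \<le> t" "0 \<le> b" "b \<le> t" "0 \<le> c" "c \<le> t" "0 \<le> e" "e \<le> t"
      and eq: "dv (du f) (z + of_real a + \<i> * of_real b) = du (dv f) (z + of_real c + \<i> * of_real e)"
      using ex[OF t(1,2)] by blast
    have "dist (z + of_real x + \<i> * of_real y) z \<le> x + y" if "0 \<le> x" "0 \<le> y" for x y
      using norm_triangle_ineq[of "of_real x :: complex" "\<i> * of_real y"] that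
      by (simp add: norm_mult dist_norm add.assoc)
    from this[of a b] this[of c e] have
      "dist (z + of_real a + \<i> * of_real b) z < s2" "dist (z + of_real c + \<i> * of_real e) z < s1"
      using abce t by linarith+
    then have "dist (dv (du f) (z + of_real a + \<i> * of_real b)) (dv (du f) z) < \<epsilon>"
       "dist (dv (du f) (z + of_real a + \<i> * of_real b)) (du (dv f) z) < \<epsilon>"
      using s eq by metis+
    moreover have "\<bar>p - q\<bar> \<le> \<bar>x - q\<bar> + \<bar>x - p\<bar>" for p q x :: real
      by linarith
    note this[of "du (dv f) z" "dv (du f) z" "dv (du f) (z + of_real a + \<i> * of_real b)"]
    ultimately show False
      unfolding \<epsilon>_def dist_real_def by argo
  qed
qed

lemma mixed_partials:
  fixes f :: "complex \<Rightarrow> 'b::real_inner"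
  assumes W: "open W" "z \<in> W" and C2: "Ck_on 2 W f"
  shows "du (dv f) z = dv (du f) z"
proof -
  have "(du (dv f) z) \<bullet> b = (dv (du f) z) \<bullet> b" for b
  proof -
    note bl = bounded_linear_inner_left[of b]
    have d: "w \<in> W \<Longrightarrow> f differentiable (at w)" "w \<in> W \<Longrightarrow> du f differentiable (at w)"
       "w \<in> W \<Longrightarrow> dv f differentiable (at w)" for w
      using C2 by (auto simp: numeral_2_eq_2)
    have "du (dv (\<lambda>w. f w \<bullet> b)) z = du (\<lambda>w. dv f w \<bullet> b) z" "dv (du (\<lambda>w. f w \<bullet> b)) z = dv (\<lambda>w. du f w \<bullet> b) z"
      by (auto intro!: du_dv_cong[OF W] du_dv_bounded_linear[OF bl] d)
    moreover have "du (\<lambda>w. dv f w \<bullet> b) z = du (dv f) z \<bullet> b" "dv (\<lambda>w. du f w \<bullet> b) z = dv (du f) z \<bullet> b"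
      using W by (auto intro!: du_dv_bounded_linear[OF bl] d)
    ultimately show ?thesis
      using mixed_partials_real[OF W Ck_on_bounded_linear[OF W(1) bl C2]] by simp
  qed
  then show ?thesis by (metis inner_eq_zero_iff inner_diff_left right_minus_eq)
qed

section \<open>Surfaces with conformal Gauss map\<close>

text \<open>The vector product of Euclidean 3-space in the notation
  \<open>complex \<times> real\<close>.\<close>

definition cross :: "complex \<times> real \<Rightarrow> complex \<times> real \<Rightarrow> complex \<times> real" where
  "cross a b = (\<i> * (of_real (snd a) * fst b - of_real (snd b) * fst a), Im (cnj (fst a) * fst b))"

lemma inner_cross:
  "cross a b \<bullet> a = 0" "cross a b \<bullet> b = 0"
  "cross a b \<bullet> cross a b = (a \<bullet> a) * (b \<bullet> b) - (a \<bullet> b)\<^sup>2"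
  by (simp_all add: cross_def inner_prod_def inner_complex_def power2_eq_square algebra_simps)

text \<open>The remainder is orthogonal to all three vectors; if it were nonzero there would be four
  independent vectors in a space of dimension 3.\<close>

lemma orthogonal_triple_expansion:
  fixes a b c v w :: "complex \<times> real"
  assumes "a \<bullet> b = 0" "a \<bullet> c = 0" "b \<bullet> c = 0" "a \<noteq> 0" "b \<noteq> 0" "c \<noteq> 0"
  shows "v = ((v \<bullet> a) / (a \<bullet> a)) *\<^sub>R a + ((v \<bullet> b) / (b \<bullet> b)) *\<^sub>R b + ((v \<bullet> c) / (c \<bullet> c)) *\<^sub>R c"
proof -
  define r where "r = v - (((v \<bullet> a) / (a \<bullet> a)) *\<^sub>R a + ((v \<bullet> b) / (b \<bullet> b)) *\<^sub>R b + ((v \<bullet> c) / (c \<bullet> c)) *\<^sub>R c)"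
  have r: "r \<bullet> a = 0" "r \<bullet> b = 0" "r \<bullet> c = 0"
    using assms by (simp_all add: r_def inner_diff_left inner_diff_right inner_add_left inner_add_right inner_commute)
  have "r = 0"
  proof (rule ccontr)
    assume "r \<noteq> 0"
    have ne: "a \<noteq> b" "a \<noteq> c" "b \<noteq> c" "r \<noteq> a" "r \<noteq> b" "r \<noteq> c"
      using assms r \<open>r \<noteq> 0\<close> by auto
    have "pairwise orthogonal {a, b, c, r}"
      using assms r by (auto simp: pairwise_def orthogonal_def inner_commute)
    then have "independent {a, b, c, r}"
      using assms \<open>r \<noteq> 0\<close> by (intro pairwise_orthogonal_independent) auto
    from independent_card_le[OF this] show False
      using ne by (simp add: eq_commute[of r])
  qed
  then show ?thesis by (simp add: r_def)
qed

locale conformal_surface =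
  fixes W :: "complex set" and X N :: "complex \<Rightarrow> complex \<times> real"
  assumes open_W: "open W"
    and smooth_X: "smooth_on W X" and smooth_N: "smooth_on W N"
    and unit: "z \<in> W \<Longrightarrow> N z \<bullet> N z = 1"
    and normal_u: "z \<in> W \<Longrightarrow> du X z \<bullet> N z = 0" and normal_v: "z \<in> W \<Longrightarrow> dv X z \<bullet> N z = 0"
    and curved: "z \<in> W \<Longrightarrow> gauss_curv X N z \<noteq> 0"
    and conf_norm: "z \<in> W \<Longrightarrow> du N z \<bullet> du N z = dv N z \<bullet> dv N z"
    and conf_orth: "z \<in> W \<Longrightarrow> du N z \<bullet> dv N z = 0"
begin

text \<open>The conformal factor: by \<open>conf_norm\<close> and \<open>conf_orth\<close> the third
  fundamental form is \<open>lam\<close> times the flat metric of the parameter.\<close>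

definition lam :: "complex \<Rightarrow> real" where "lam z = du N z \<bullet> du N z"
definition supp :: "complex \<Rightarrow> real" where "supp z = X z \<bullet> N z"

lemma C2_X: "Ck_on k W X" and C2_N: "Ck_on k W N"
  using smooth_X smooth_N by (simp_all add: smooth_on_def)

lemma diff:
  assumes "z \<in> W"
  shows "X differentiable (at z)" "N differentiable (at z)"
    "du X differentiable (at z)" "dv X differentiable (at z)"
    "du N differentiable (at z)" "dv N differentiable (at z)"
  using C2_X[of 2] C2_N[of 2] assms by (simp_all add: numeral_2_eq_2)

lemma zero_deriv:
  assumes "z \<in> W" "\<And>w. w \<in> W \<Longrightarrow> f w = (c::real)"
  shows "du f z = 0" "dv f z = 0"
  using du_dv_cong(1,2)[OF open_W assms] du_dv_has_derivative[OF has_derivative_const, of "c" z]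
  by auto

lemma N_orth:
  assumes z: "z \<in> W"
  shows "N z \<bullet> du N z = 0" "N z \<bullet> dv N z = 0"
  using zero_deriv[OF z unit] du_dv_inner[OF diff(2)[OF z] diff(2)[OF z]]
  by (auto simp: inner_commute)

text \<open>Both sides are, up to sign, the normal component of the mixed second derivative of
  \<open>X\<close>: differentiate the two normality equations crosswise.\<close>

lemma second_form_symmetric:
  assumes z: "z \<in> W"
  shows "du X z \<bullet> dv N z = dv X z \<bullet> du N z"
proof -
  have "dv (du X) z \<bullet> N z + du X z \<bullet> dv N z = 0" "du (dv X) z \<bullet> N z + dv X z \<bullet> du N z = 0"
    using zero_deriv[OF z normal_u] zero_deriv[OF z normal_v]
      du_dv_inner[OF diff(3)[OF z] diff(2)[OF z]] du_dv_inner[OF diff(4)[OF z] diff(2)[OF z]] by auto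
  then show ?thesis
    using mixed_partials[OF open_W z C2_X] by simp
qed

text \<open>If \<open>lam\<close> vanished at a point, so would both derivatives of
  \<open>N\<close>, hence the second fundamental form and the Gaussian curvature.\<close>

lemma lam_pos: "z \<in> W \<Longrightarrow> 0 < lam z"
proof (rule ccontr)
  assume z: "z \<in> W" and "\<not> 0 < lam z"
  then have "du N z = 0" "dv N z = 0"
    using conf_norm[OF z] by (auto simp: lam_def)
  then show False using curved[OF z] by (simp add: gauss_curv_def)
qed

lemma frame_nz: "z \<in> W \<Longrightarrow> N z \<noteq> 0" "z \<in> W \<Longrightarrow> du N z \<noteq> 0" "z \<in> W \<Longrightarrow> dv N z \<noteq> 0"
  using unit lam_pos conf_norm by (force simp: lam_def)+

lemma expansion:
  assumes z: "z \<in> W"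
  shows "v = (v \<bullet> N z) *\<^sub>R N z + ((v \<bullet> du N z) / lam z) *\<^sub>R du N z + ((v \<bullet> dv N z) / lam z) *\<^sub>R dv N z"
  using orthogonal_triple_expansion[of "N z" "du N z" "dv N z" v] N_orth[OF z] conf_orth[OF z]
    conf_norm[OF z] unit[OF z] frame_nz[OF z] by (simp add: lam_def)

lemma inner_expansion:
  assumes z: "z \<in> W"
  shows "v \<bullet> w = (v \<bullet> N z) * (w \<bullet> N z) +
    ((v \<bullet> du N z) * (w \<bullet> du N z) + (v \<bullet> dv N z) * (w \<bullet> dv N z)) / lam z"
  by (subst expansion[OF z, of v])
    (simp add: inner_add_left inner_add_right inner_commute add_divide_distrib)

text \<open>A conformal map into the sphere is harmonic. The normal component results from
  differentiating the orthogonality of \<open>N\<close> to its derivatives; the tangential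
  components cancel after differentiating the two conformality equations.\<close>

lemma laplace_N:
  assumes z: "z \<in> W"
  shows "(du (du N) z + dv (dv N) z) \<bullet> N z = - 2 * lam z"
    "(du (du N) z + dv (dv N) z) \<bullet> du N z = 0"
    "(du (du N) z + dv (dv N) z) \<bullet> dv N z = 0"
proof -
  note d = diff(2,5,6)[OF z]
  have mixed: "du (dv N) z = dv (du N) z"
    using mixed_partials[OF open_W z C2_N] .
  have conf0: "du N w \<bullet> du N w - dv N w \<bullet> dv N w = 0" if "w \<in> W" for w
    using conf_norm[OF that] by simp
  have 1: "N z \<bullet> du (du N) z + du N z \<bullet> du N z = 0" "N z \<bullet> dv (dv N) z + dv N z \<bullet> dv N z = 0"
    using zero_deriv[OF z N_orth(1)] zero_deriv[OF z N_orth(2)]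
      du_dv_inner[OF d(1,2)] du_dv_inner[OF d(1,3)] by auto
  have 2: "du N z \<bullet> du (dv N) z + du (du N) z \<bullet> dv N z = 0"
    "du N z \<bullet> dv (dv N) z + dv (du N) z \<bullet> dv N z = 0"
    using zero_deriv[OF z conf_orth] du_dv_inner[OF d(2,3)] by auto
  have "du (\<lambda>w. du N w \<bullet> du N w) z = du (\<lambda>w. dv N w \<bullet> dv N w) z"
       "dv (\<lambda>w. du N w \<bullet> du N w) z = dv (\<lambda>w. dv N w \<bullet> dv N w) z"
    using du_dv_cong(1,2)[OF open_W z conf_norm] by auto
  then have 3: "du (du N) z \<bullet> du N z = du (dv N) z \<bullet> dv N z" "dv (du N) z \<bullet> du N z = dv (dv N) z \<bullet> dv N z"
    using du_dv_inner[OF d(2,2)] du_dv_inner[OF d(3,3)] by (auto simp: inner_commute)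
  show "(du (du N) z + dv (dv N) z) \<bullet> N z = - 2 * lam z"
    using 1 conf_norm[OF z] by (simp add: inner_add_left inner_add_right inner_commute lam_def)
  show "(du (du N) z + dv (dv N) z) \<bullet> du N z = 0" "(du (du N) z + dv (dv N) z) \<bullet> dv N z = 0"
    using 2 3 mixed by (simp_all add: inner_add_left inner_add_right inner_commute)
qed

text \<open>The derivative of \<open>X\<close> is tangential and drops out. So the support function
  and its gradient are, up to the factor \<open>lam\<close>, the components of \<open>X\<close> in
  the frame \<open>N\<close>, \<open>du N\<close>, \<open>dv N\<close>: they determine the
  surface.\<close>

lemma supp_derivs:
  assumes z: "z \<in> W"
  shows "du supp z = X z \<bullet> du N z" "dv supp z = X z \<bullet> dv N z"
  using du_dv_inner[OF diff(1)[OF z] diff(2)[OF z]] normal_u[OF z] normal_v[OF z]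
  by (simp_all add: supp_def[abs_def])

lemma Ck_supp: "Ck_on k W supp" and Ck_lam: "Ck_on k W lam"
  unfolding supp_def[abs_def] lam_def[abs_def]
  using C2_X C2_N[of "Suc k"] C2_N[of k] by (auto intro!: Ck_on_inner open_W)

lemma laplace_supp:
  assumes z: "z \<in> W"
  shows "du (du supp) z + dv (dv supp) z =
    du X z \<bullet> du N z + dv X z \<bullet> dv N z - 2 * lam z * supp z"
proof -
  have "du (du supp) z = du (\<lambda>w. X w \<bullet> du N w) z" "dv (dv supp) z = dv (\<lambda>w. X w \<bullet> dv N w) z"
    by (auto intro!: du_dv_cong[OF open_W z] supp_derivs)
  then have "du (du supp) z + dv (dv supp) z =
      du X z \<bullet> du N z + dv X z \<bullet> dv N z + X z \<bullet> (du (du N) z + dv (dv N) z)"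
    using du_dv_inner[OF diff(1)[OF z] diff(5)[OF z]] du_dv_inner[OF diff(1)[OF z] diff(6)[OF z]]
    by (simp add: inner_add_right)
  also have "X z \<bullet> (du (du N) z + dv (dv N) z) = supp z * (- 2 * lam z)"
    using inner_expansion[OF z, of "X z" "du (du N) z + dv (dv N) z"] laplace_N[OF z]
    by (simp add: supp_def)
  finally show ?thesis by simp
qed

lemma sqnorm_X:
  assumes z: "z \<in> W"
  shows "X z \<bullet> X z = (supp z)\<^sup>2 + ((du supp z)\<^sup>2 + (dv supp z)\<^sup>2) / lam z"
  using inner_expansion[OF z, of "X z" "X z"] supp_derivs[OF z] by (simp add: supp_def power2_eq_square)

text \<open>Expanding \<open>du X\<close> and \<open>dv X\<close> in the frame of derivatives of
  \<open>N\<close> shows that the first fundamental form is the square of the second divided by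
  \<open>lam\<close>. Hence \<open>H / K\<close> is linear in the second form, and division by
  \<open>K\<close> turns the HQSF equation into one for the support function alone.\<close>

lemma mean_gauss:
  assumes z: "z \<in> W"
  shows "2 * mean_curv X N z = - (du X z \<bullet> du N z + dv X z \<bullet> dv N z) / lam z * gauss_curv X N z"
proof -
  define e f g l where "e = - (du X z \<bullet> du N z)" and "f = - (du X z \<bullet> dv N z)"
    and "g = - (dv X z \<bullet> dv N z)" and "l = lam z"
  have f': "dv X z \<bullet> du N z = - f"
    using second_form_symmetric[OF z] by (simp add: f_def)
  have l: "l > 0" using lam_pos[OF z] by (simp add: l_def)
  have E: "du X z \<bullet> du X z = (e\<^sup>2 + f\<^sup>2) / l"
    using inner_expansion[OF z, of "du X z" "du X z"] normal_u[OF z] by (simp add: e_def f_def l_def power2_eq_square)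
  have G: "dv X z \<bullet> dv X z = (f\<^sup>2 + g\<^sup>2) / l"
    using inner_expansion[OF z, of "dv X z" "dv X z"] normal_v[OF z] f' by (simp add: g_def l_def power2_eq_square)
  have F: "du X z \<bullet> dv X z = (e * f + f * g) / l"
    using inner_expansion[OF z, of "du X z" "dv X z"] normal_v[OF z] normal_u[OF z] f'
    by (simp add: e_def f_def g_def l_def)
  \<comment> \<open>The area element \<open>E G - F^2\<close> is the square of
    \<open>det II / lam\<close>. It makes \<open>K\<close> equal to \<open>lam^2 / det II\<close>,
    so the second fundamental form is nondegenerate.\<close>
  have det: "((e\<^sup>2 + f\<^sup>2) / l) * ((f\<^sup>2 + g\<^sup>2) / l) - ((e * f + f * g) / l)\<^sup>2 = ((e * g - f\<^sup>2) / l)\<^sup>2"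
    by (simp add: power2_eq_square add_divide_distrib diff_divide_distrib algebra_simps)
  have K: "gauss_curv X N z = (e * g - f\<^sup>2) / ((e * g - f\<^sup>2) / l)\<^sup>2"
    using E F G det by (simp add: gauss_curv_def e_def[symmetric] f_def[symmetric] g_def[symmetric])
  then have nz: "e * g - f\<^sup>2 \<noteq> 0" using curved[OF z] by auto
  have num: "e * ((f\<^sup>2 + g\<^sup>2) / l) - 2 * f * ((e * f + f * g) / l) + g * ((e\<^sup>2 + f\<^sup>2) / l) = (e + g) * (e * g - f\<^sup>2) / l"
    by (simp add: power2_eq_square add_divide_distrib diff_divide_distrib algebra_simps)
  have H: "mean_curv X N z = ((e + g) * (e * g - f\<^sup>2) / l) / (2 * ((e * g - f\<^sup>2) / l)\<^sup>2)"
    using E F G det num by (simp add: mean_curv_def e_def[symmetric] f_def[symmetric] g_def[symmetric])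
  have "2 * mean_curv X N z = (e + g) / l * gauss_curv X N z"
    using nz l unfolding H K by (simp add: divide_simps)
  then show ?thesis by (simp add: e_def g_def l_def)
qed

text \<open>The equation is pointwise, and \<open>c\<close> is the value of the whole coefficient at
  \<open>z\<close>: it is used both with \<open>c * exp (2 * \<mu> z)\<close> and with the
  \<open>potential\<close> introduced later. After division by \<open>K / lam\<close> the trace of
  the second form is replaced by means of \<open>laplace_supp\<close>, and
  \<open>X \<bullet> X\<close> by means of \<open>sqnorm_X\<close>.\<close>

theorem hqsf_equation_iff:
  assumes z: "z \<in> W"
  shows "2 * (X z \<bullet> N z) * mean_curv X N z + (c * (X z \<bullet> N z) + X z \<bullet> X z - (X z \<bullet> N z)\<^sup>2) * gauss_curv X N z = 0
    \<longleftrightarrow> c * lam z * supp z = supp z * (du (du supp) z + dv (dv supp) z) + 2 * lam z * (supp z)\<^sup>2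
          - ((du supp z)\<^sup>2 + (dv supp z)\<^sup>2)"
proof -
  define T where "T = du X z \<bullet> du N z + dv X z \<bullet> dv N z"
  define Q where "Q = (du supp z)\<^sup>2 + (dv supp z)\<^sup>2"
  have l: "lam z > 0" using lam_pos[OF z] .
  have H: "mean_curv X N z = - T / lam z * gauss_curv X N z / 2"
    using mean_gauss[OF z] by (simp add: T_def)
  have "2 * (X z \<bullet> N z) * mean_curv X N z + (c * (X z \<bullet> N z) + X z \<bullet> X z - (X z \<bullet> N z)\<^sup>2) * gauss_curv X N z
      = gauss_curv X N z / lam z * (- supp z * T + c * supp z * lam z + Q)"
    using l unfolding sqnorm_X[OF z] H by (simp add: supp_def[symmetric] Q_def[symmetric] field_simps)
  then have "2 * (X z \<bullet> N z) * mean_curv X N z + (c * (X z \<bullet> N z) + X z \<bullet> X z - (X z \<bullet> N z)\<^sup>2) * gauss_curv X N z = 0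
      \<longleftrightarrow> - supp z * T + c * supp z * lam z + Q = 0"
    using curved[OF z] l by simp
  moreover have L: "du (du supp) z + dv (dv supp) z = T - 2 * lam z * supp z"
    using laplace_supp[OF z] by (simp add: T_def)
  have "- supp z * T + c * supp z * lam z + Q = 0
      \<longleftrightarrow> c * lam z * supp z = supp z * (T - 2 * lam z * supp z) + 2 * lam z * (supp z)\<^sup>2 - Q"
    by (auto simp: algebra_simps power2_eq_square)
  ultimately show ?thesis
    unfolding L Q_def by blast
qed

lemma position_eq_0:
  assumes z: "z \<in> W" and "supp z = 0" "du supp z = 0" "dv supp z = 0"
  shows "X z = 0"
  using sqnorm_X[OF z] assms by simp

text \<open>For \<open>s = 1\<close> a quarter turn of the parameter corresponds to the quarter turn
  about \<open>N\<close> on the sphere, which makes the stereographic coordinate of \<open>N\<close>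
  holomorphic; for \<open>s = -1\<close> it is antiholomorphic.\<close>

definition oriented_by :: "real \<Rightarrow> complex \<Rightarrow> bool" where
  "oriented_by s z \<longleftrightarrow> dv N z = s *\<^sub>R cross (N z) (du N z)"

text \<open>\<open>cross (N z) (du N z)\<close> is orthogonal to \<open>N\<close> and
  \<open>du N\<close> and has the length of \<open>dv N\<close>, which leaves only a sign.\<close>

lemma orientation_cases:
  assumes z: "z \<in> W"
  obtains "oriented_by 1 z" | "oriented_by (-1) z"
proof -
  define C where "C = cross (N z) (du N z)"
  define t where "t = C \<bullet> dv N z"
  have l: "lam z > 0" using lam_pos[OF z] .
  have C: "C \<bullet> N z = 0" "C \<bullet> du N z = 0" "C \<bullet> C = lam z"
    using unit[OF z] N_orth[OF z] by (simp_all add: C_def inner_cross lam_def)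
  then have "lam z = t * t / lam z"
    using inner_expansion[OF z, of C C] by (simp add: t_def)
  then have "t * t = lam z * lam z" using l by (simp add: field_simps)
  then have "t = lam z \<or> t = - lam z" by (simp add: square_eq_iff)
  have sq: "(dv N z - s *\<^sub>R C) \<bullet> (dv N z - s *\<^sub>R C) = lam z - 2 * s * t + s * s * lam z" for s
    using C(3) conf_norm[OF z]
    by (simp add: inner_diff_left inner_diff_right inner_commute lam_def t_def)
  have "dv N z = 1 *\<^sub>R C" if "t = lam z"
    using sq[of 1] that by simp
  moreover have "dv N z = (-1) *\<^sub>R C" if "t = - lam z"
    using sq[of "-1"] that by (simp add: add_eq_0_iff2)
  ultimately have "dv N z = 1 *\<^sub>R C \<or> dv N z = (-1) *\<^sub>R C"
    using \<open>t = lam z \<or> t = - lam z\<close> by blast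
  then show thesis
    using that by (auto simp: oriented_by_def C_def)
qed

end

section \<open>Wirtinger derivatives\<close>

text \<open>Here \<open>a\<close> and \<open>b\<close> are the derivatives of \<open>f\<close> with
  respect to \<open>z\<close> and its conjugate. The relational form includes differentiability, so
  that differential identities are obtained by computing in two ways and applying
  \<open>wirt_unique\<close>.\<close>

definition wirt :: "(complex \<Rightarrow> complex) \<Rightarrow> complex \<Rightarrow> complex \<Rightarrow> complex \<Rightarrow> bool" where
  "wirt f a b z \<longleftrightarrow> (f has_derivative (\<lambda>h. a * h + b * cnj h)) (at z)"

lemma wirt_unique:
  assumes "wirt f a b z" "wirt f a' b' z"
  shows "a = a'" "b = b'"
proof -
  have "(\<lambda>h. a * h + b * cnj h) = (\<lambda>h. a' * h + b' * cnj h)"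
    using assms has_derivative_unique unfolding wirt_def by blast
  from fun_cong[OF this, of 1] fun_cong[OF this, of \<i>] have s: "a + b = a' + b'" "a * \<i> - b * \<i> = a' * \<i> - b' * \<i>"
    by auto
  from s(2) have "(a - b) * \<i> = (a' - b') * \<i>" by (simp add: algebra_simps)
  then have "a - b = a' - b'" by simp
  then have "(a + b) + (a - b) = (a' + b') + (a' - b')" using s(1) by (simp only:)
  then show "a = a'" by simp
  with s(1) show "b = b'" by simp
qed

lemma wirt_cong:
  assumes "wirt f a b z" "open S" "z \<in> S" "\<And>w. w \<in> S \<Longrightarrow> f w = g w"
  shows "wirt g a b z"
  using assms has_derivative_transform_within_open[of f _ z UNIV S g] by (auto simp: wirt_def)

lemma wirt_const: "wirt (\<lambda>_. c) 0 0 z"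
  by (simp add: wirt_def)

lemma wirt_holomorphic: "(f has_field_derivative f') (at z) \<Longrightarrow> wirt f f' 0 z"
  by (simp add: wirt_def has_field_derivative_def)

lemma wirt_imp_field: "wirt f a 0 z \<Longrightarrow> (f has_field_derivative a) (at z)"
  by (simp add: wirt_def has_field_derivative_def)

lemma wirt_add: "wirt f a b z \<Longrightarrow> wirt g c d z \<Longrightarrow> wirt (\<lambda>w. f w + g w) (a + c) (b + d) z"
  unfolding wirt_def by (rule has_derivative_eq_rhs[OF has_derivative_add], assumption, assumption) (auto simp: algebra_simps)

lemma wirt_diff: "wirt f a b z \<Longrightarrow> wirt g c d z \<Longrightarrow> wirt (\<lambda>w. f w - g w) (a - c) (b - d) z"
  unfolding wirt_def by (rule has_derivative_eq_rhs[OF has_derivative_diff], assumption, assumption) (auto simp: algebra_simps)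

lemma wirt_mult: "wirt f a b z \<Longrightarrow> wirt g c d z \<Longrightarrow>
    wirt (\<lambda>w. f w * g w) (a * g z + f z * c) (b * g z + f z * d) z"
  unfolding wirt_def by (rule has_derivative_eq_rhs[OF has_derivative_mult], assumption, assumption) (auto simp: algebra_simps)

lemma wirt_cnj: "wirt f a b z \<Longrightarrow> wirt (\<lambda>w. cnj (f w)) (cnj b) (cnj a) z"
  unfolding wirt_def by (rule has_derivative_eq_rhs[OF has_derivative_cnj], assumption) (auto simp: algebra_simps)

lemma wirt_divide:
  assumes "wirt f a b z" "wirt g c d z" "g z \<noteq> 0"
  shows "wirt (\<lambda>w. f w / g w) ((a * g z - f z * c) / (g z)\<^sup>2) ((b * g z - f z * d) / (g z)\<^sup>2) z"
  using assms unfolding wirt_def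
  by (intro has_derivative_eq_rhs[OF has_derivative_divide]) (auto simp: field_simps power2_eq_square)

lemma wirt_eq: "wirt f a b z \<Longrightarrow> a = a' \<Longrightarrow> b = b' \<Longrightarrow> wirt f a' b' z"
  by simp

lemmas wirt_intros = wirt_const wirt_add wirt_diff wirt_mult wirt_cnj wirt_divide

lemma holomorphic_onI_wirt:
  assumes "\<And>z. z \<in> S \<Longrightarrow> wirt f (f' z) 0 z"
  shows "f holomorphic_on S"
  using wirt_imp_field[OF assms] by (auto simp: holomorphic_on_def field_differentiable_def
      intro: has_field_derivative_at_within)

text \<open>The derivative of the conjugate of \<open>f\<close> with respect to conjugate
  \<open>z\<close> is the conjugate of \<open>f'\<close>; it vanishes when that conjugate is
  holomorphic as well.\<close>

lemma holomorphic_cnj_holomorphic_constant: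
  assumes "open S" "connected S" "f holomorphic_on S" "(\<lambda>z. cnj (f z)) holomorphic_on S" "z0 \<in> S" "z \<in> S"
  shows "f z = f z0"
proof -
  have "(f has_field_derivative 0) (at w)" if "w \<in> S" for w
  proof -
    have f: "wirt f (deriv f w) 0 w"
      using holomorphic_derivI[OF assms(3,1) that] wirt_holomorphic by blast
    have "wirt (\<lambda>z. cnj (f z)) (deriv (\<lambda>z. cnj (f z)) w) 0 w"
      using holomorphic_derivI[OF assms(4,1) that] wirt_holomorphic by blast
    from wirt_unique[OF wirt_cnj[OF f] this] have "deriv f w = 0" by simp
    then show ?thesis using f wirt_imp_field by metis
  qed
  then obtain c where "\<And>w. w \<in> S \<Longrightarrow> f w = c"
    using DERIV_zero_connected_constant[OF assms(2,1) finite.emptyI holomorphic_on_imp_continuous_on[OF assms(3)]]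
    by auto
  then show ?thesis using assms by simp
qed

section \<open>A linear second order equation\<close>

lemma convex_primitive_at:
  assumes "convex B" "open B" "z0 \<in> B" "f holomorphic_on B"
  shows "\<exists>I. I z0 = 0 \<and> (\<forall>z\<in>B. (I has_field_derivative f z) (at z))"
proof (rule holomorphic_convex_primitive'[OF assms(1,2,4)])
  fix g assume g: "\<And>z. z \<in> B \<Longrightarrow> (g has_field_derivative f z) (at z within B)"
  have d: "(g has_field_derivative f z) (at z)" if z: "z \<in> B" for z
    using g[OF z] unfolding at_within_open[OF z assms(2)] .
  have "((\<lambda>z. g z - g z0) has_field_derivative f z) (at z)" if z: "z \<in> B" for z
    using DERIV_diff[OF d[OF z] DERIV_const[of "g z0"]] by simp
  then show ?thesis by (intro exI[of _ "\<lambda>z. g z - g z0"]) auto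
qed

text \<open>Picard iteration for the system \<open>y' = u\<close>, \<open>u' = a u + q y\<close>.
  The radius does not depend on the initial values, so one disc carries a full basis of
  solutions.\<close>

lemma linear_ode_solution:
  fixes a q :: "complex \<Rightarrow> complex"
  assumes "r > 0" "a holomorphic_on ball z0 r" "q holomorphic_on ball z0 r"
  obtains \<rho> where "0 < \<rho>" "\<rho> \<le> r"
    "\<And>\<alpha> \<beta>. \<exists>y u. y z0 = \<alpha> \<and> u z0 = \<beta> \<and> (\<forall>z\<in>ball z0 \<rho>. (y has_field_derivative u z) (at z) \<and>
       (u has_field_derivative a z * u z + q z * y z) (at z))"
proof -
  have "cball z0 (r/2) \<subseteq> ball z0 r" using assms(1) by (simp add: cball_subset_ball_iff)
  then have "continuous_on (cball z0 (r/2)) a" "continuous_on (cball z0 (r/2)) q"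
    using assms(2,3) holomorphic_on_imp_continuous_on continuous_on_subset by metis+
  then have "continuous_on (cball z0 (r/2)) (\<lambda>z. cmod (a z) + cmod (q z))"
    by (intro continuous_on_add continuous_on_norm)
  then have "bounded ((\<lambda>z. cmod (a z) + cmod (q z)) ` cball z0 (r/2))"
    using compact_continuous_image[OF _ compact_cball] compact_imp_bounded by metis
  then obtain M0 where "\<forall>x\<in>(\<lambda>z. cmod (a z) + cmod (q z)) ` cball z0 (r/2). norm x \<le> M0"
    unfolding bounded_iff by blast
  then have M0: "cmod (a z) + cmod (q z) \<le> M0" if "z \<in> cball z0 (r/2)" for z
    using that by (metis (no_types, lifting) abs_le_D1 image_eqI real_norm_def)
  define M where "M = max 1 M0"
  \<comment> \<open>The bound \<open>\<rho> * M \<le> 1/2\<close> makes each integration halve the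
    estimate, so that the increments of the iteration are dominated by a geometric series.\<close>
  define \<rho> where "\<rho> = min (r/2) (1 / (2 * M))"
  have M: "M \<ge> 1" by (simp add: M_def)
  have \<rho>: "0 < \<rho>" "\<rho> \<le> r" "\<rho> * M \<le> 1/2"
  proof -
    show "0 < \<rho>" "\<rho> \<le> r" using assms(1) M by (auto simp: \<rho>_def)
    have "\<rho> * M \<le> 1 / (2 * M) * M" using M by (intro mult_right_mono) (auto simp: \<rho>_def)
    then show "\<rho> * M \<le> 1/2" using M by simp
  qed
  define B where "B = ball z0 \<rho>"
  have B: "open B" "convex B" "z0 \<in> B" "B \<subseteq> ball z0 r" using \<rho> by (auto simp: B_def)
  have bnd: "cmod (a z) + cmod (q z) \<le> M" if "z \<in> B" for z
    using M0[of z] that by (auto simp: B_def \<rho>_def M_def)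
  have hol: "a holomorphic_on B" "q holomorphic_on B"
    using holomorphic_on_subset[OF assms(2) B(4)] holomorphic_on_subset[OF assms(3) B(4)] .
  note prim = convex_primitive_at[OF B(2,1,3)]
  define I where "I f = (SOME I. I z0 = 0 \<and> (\<forall>z\<in>B. (I has_field_derivative f z) (at z)))" for f
  have I: "I f z0 = 0" "z \<in> B \<Longrightarrow> (I f has_field_derivative f z) (at z)" if "f holomorphic_on B" for f z
    using someI_ex[OF prim[OF that]] by (simp_all add: I_def)
  have Ihol: "I f holomorphic_on B" if "f holomorphic_on B" for f
    using I(2)[OF that] B(1) holomorphic_on_open by blast
  have Ibnd: "cmod (I f z) \<le> b * \<rho>" if f: "f holomorphic_on B" "\<And>z. z \<in> B \<Longrightarrow> cmod (f z) \<le> b" and z: "z \<in> B" for f b z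
  proof -
    have "norm (I f z - I f z0) \<le> b * norm (z - z0)"
      using field_differentiable_bound[OF B(2), of "I f" f b z z0] I(2)[OF f(1)] f(2) z B(3)
      by (auto intro: has_field_derivative_at_within)
    also have "\<dots> \<le> b * \<rho>"
    proof (rule mult_left_mono)
      show "norm (z - z0) \<le> \<rho>" using z by (simp add: B_def dist_norm norm_minus_commute)
      show "0 \<le> b" using f(2)[OF z] norm_ge_zero order_trans by blast
    qed
    finally show ?thesis using I(1)[OF f(1)] by simp
  qed
  have "\<exists>y u. y z0 = \<alpha> \<and> u z0 = \<beta> \<and> (\<forall>z\<in>B. (y has_field_derivative u z) (at z) \<and>
       (u has_field_derivative a z * u z + q z * y z) (at z))" for \<alpha> \<beta>
  proof -
    \<comment> \<open>\<open>Y n\<close> and \<open>U n\<close> are the increments of the iteration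
      rather than the iterates; the constants with index 0 carry the initial values, and the
      solution is the sum of the series.\<close>
    define d where "d = rec_nat (\<lambda>_. \<alpha>, \<lambda>_. \<beta>) (\<lambda>_ (y, u). (I u, I (\<lambda>z. a z * u z + q z * y z)))"
    define Y where "Y n = fst (d n)" for n
    define U where "U n = snd (d n)" for n
    have Y: "Y 0 = (\<lambda>_. \<alpha>)" "\<And>n. Y (Suc n) = I (U n)"
      and U: "U 0 = (\<lambda>_. \<beta>)" "\<And>n. U (Suc n) = I (\<lambda>z. a z * U n z + q z * Y n z)"
      by (simp_all add: Y_def U_def d_def split: prod.split)
    define C where "C = cmod \<alpha> + cmod \<beta>"
    have Cnn: "0 \<le> C" by (simp add: C_def)
    have YU: "Y n holomorphic_on B \<and> U n holomorphic_on B \<and>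
        (\<forall>z\<in>B. cmod (Y n z) \<le> C * (1/2)^n \<and> cmod (U n z) \<le> C * (1/2)^n)" for n
    proof (induction n)
      case 0
      then show ?case by (simp add: Y U C_def)
    next
      case (Suc n)
      let ?F = "\<lambda>z. a z * U n z + q z * Y n z"
      have F: "?F holomorphic_on B" using Suc hol by (auto intro!: holomorphic_intros)
      have nn: "0 \<le> C * (1/2)^n" by (simp add: C_def)
      have Fb: "cmod (?F z) \<le> M * (C * (1/2)^n)" if "z \<in> B" for z
      proof -
        have "cmod (?F z) \<le> cmod (a z) * cmod (U n z) + cmod (q z) * cmod (Y n z)"
          by (metis norm_mult norm_triangle_ineq)
        also have "\<dots> \<le> cmod (a z) * (C * (1/2)^n) + cmod (q z) * (C * (1/2)^n)"
          using Suc that by (intro add_mono mult_left_mono) auto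
        also have "\<dots> \<le> M * (C * (1/2)^n)"
          using mult_right_mono[OF bnd[OF that] nn] by (simp add: algebra_simps)
        finally show ?thesis .
      qed
      have Ub: "cmod (U n z) \<le> M * (C * (1/2)^n)" if "z \<in> B" for z
        using Suc that mult_right_mono[OF M nn] by fastforce
      have "M * (C * (1/2)^n) * \<rho> \<le> C * (1/2)^Suc n"
        using mult_right_mono[OF \<rho>(3) nn] by (simp add: algebra_simps)
      then show ?case
        using Ibnd[OF F Fb] Ibnd[of "U n", OF _ Ub] Ihol[OF F] Ihol[of "U n"] Suc
        by (fastforce simp: Y U)
    qed
    have YUh: "Y n holomorphic_on B" "U n holomorphic_on B" for n using YU by blast+
    have YUb: "cmod (Y n z) \<le> C * (1/2)^n" "cmod (U n z) \<le> C * (1/2)^n" if "z \<in> B" for n z using YU that by blast+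
    have Fh: "(\<lambda>z. a z * U m z + q z * Y m z) holomorphic_on B" for m
      by (intro holomorphic_intros hol YUh)
    have der: "(Y n has_field_derivative (case n of 0 \<Rightarrow> 0 | Suc m \<Rightarrow> U m z)) (at z)"
      "(U n has_field_derivative (case n of 0 \<Rightarrow> 0 | Suc m \<Rightarrow> a z * U m z + q z * Y m z)) (at z)"
      if z: "z \<in> B" for n z
    proof -
      show "(Y n has_field_derivative (case n of 0 \<Rightarrow> 0 | Suc m \<Rightarrow> U m z)) (at z)"
        using I(2)[OF YUh(2) z] by (cases n) (simp_all add: Y)
      show "(U n has_field_derivative (case n of 0 \<Rightarrow> 0 | Suc m \<Rightarrow> a z * U m z + q z * Y m z)) (at z)"
        using I(2)[OF Fh z] by (cases n) (simp_all add: U)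
    qed
    have geo: "summable (\<lambda>n. K * (1/2)^n)" for K :: real
      by (intro summable_mult summable_geometric) auto
    have sums: "(\<lambda>n. U n z) sums (\<Sum>n. U n z)" "(\<lambda>n. Y n z) sums (\<Sum>n. Y n z)" if "z \<in> B" for z
      by (rule summable_sums, rule summable_comparison_test'[OF geo[of C]], rule YUb, rule that)+
    \<comment> \<open>The derivative of the term with index \<open>n\<close> involves the terms with
      index \<open>n - 1\<close>, and the constant term contributes 0; so the differentiated series
      is the original one moved by one place.\<close>
    have shift: "(\<lambda>n. case n of 0 \<Rightarrow> 0 | Suc m \<Rightarrow> v m) sums s" if "v sums s" for v :: "nat \<Rightarrow> complex" and s
      using that sums_Suc_iff[of "\<lambda>n. case n of 0 \<Rightarrow> 0 | Suc m \<Rightarrow> v m" s] by simp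
    have dY: "\<exists>y. \<forall>z\<in>B. (\<lambda>n. Y n z) sums y z \<and> (y has_field_derivative (\<Sum>n. case n of 0 \<Rightarrow> 0 | Suc m \<Rightarrow> U m z)) (at z within B)"
    proof (rule has_field_derivative_series[OF B(2) _ _ B(3)])
      show "uniform_limit B (\<lambda>n x. \<Sum>i<n. case i of 0 \<Rightarrow> 0 | Suc m \<Rightarrow> U m x)
          (\<lambda>x. \<Sum>n. case n of 0 \<Rightarrow> 0 | Suc m \<Rightarrow> U m x) sequentially"
      proof (rule Weierstrass_m_test[OF _ geo[of "2 * C"]])
        fix n z assume "z \<in> B"
        then show "cmod (case n of 0 \<Rightarrow> 0 | Suc m \<Rightarrow> U m z) \<le> 2 * C * (1/2)^n"
          using YUb(2) Cnn by (cases n) simp_all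
      qed
    qed (use der(1) sums(2)[OF B(3)] in \<open>auto intro: has_field_derivative_at_within sums_summable\<close>)
    have dU: "\<exists>u. \<forall>z\<in>B. (\<lambda>n. U n z) sums u z \<and>
        (u has_field_derivative (\<Sum>n. case n of 0 \<Rightarrow> 0 | Suc m \<Rightarrow> a z * U m z + q z * Y m z)) (at z within B)"
    proof (rule has_field_derivative_series[OF B(2) _ _ B(3)])
      show "uniform_limit B (\<lambda>n x. \<Sum>i<n. case i of 0 \<Rightarrow> 0 | Suc m \<Rightarrow> a x * U m x + q x * Y m x)
          (\<lambda>x. \<Sum>n. case n of 0 \<Rightarrow> 0 | Suc m \<Rightarrow> a x * U m x + q x * Y m x) sequentially"
      proof (rule Weierstrass_m_test[OF _ geo[of "2 * (M * C)"]])
        fix n z assume z: "z \<in> B"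
        have "cmod (a z * U m z + q z * Y m z) \<le> M * (C * (1/2)^m)" for m
        proof -
          have "cmod (a z * U m z + q z * Y m z) \<le> cmod (a z) * cmod (U m z) + cmod (q z) * cmod (Y m z)"
            by (metis norm_mult norm_triangle_ineq)
          also have "\<dots> \<le> cmod (a z) * (C * (1/2)^m) + cmod (q z) * (C * (1/2)^m)"
            using YUb[OF z] by (intro add_mono mult_left_mono) auto
          also have "\<dots> \<le> M * (C * (1/2)^m)"
            using mult_right_mono[OF bnd[OF z], of "C * (1/2)^m"] by (simp add: algebra_simps C_def)
          finally show ?thesis .
        qed
        then show "cmod (case n of 0 \<Rightarrow> 0 | Suc m \<Rightarrow> a z * U m z + q z * Y m z) \<le> 2 * (M * C) * (1/2)^n"
          using M Cnn by (cases n) (simp_all add: algebra_simps)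
      qed
    qed (use der(2) sums(1)[OF B(3)] in \<open>auto intro: has_field_derivative_at_within sums_summable\<close>)
    from dY obtain y where y: "\<forall>z\<in>B. (\<lambda>n. Y n z) sums y z \<and>
        (y has_field_derivative (\<Sum>n. case n of 0 \<Rightarrow> 0 | Suc m \<Rightarrow> U m z)) (at z within B)" ..
    from dU obtain u where u: "\<forall>z\<in>B. (\<lambda>n. U n z) sums u z \<and>
        (u has_field_derivative (\<Sum>n. case n of 0 \<Rightarrow> 0 | Suc m \<Rightarrow> a z * U m z + q z * Y m z)) (at z within B)" ..
    note yu = y[rule_format, THEN conjunct1] y[rule_format, THEN conjunct2]
      u[rule_format, THEN conjunct1] u[rule_format, THEN conjunct2]
    have s1: "(\<Sum>n. case n of 0 \<Rightarrow> 0 | Suc m \<Rightarrow> U m z) = u z" if "z \<in> B" for z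
      using sums_unique[OF shift[OF yu(3)[OF that]]] by simp
    have s2: "(\<Sum>n. case n of 0 \<Rightarrow> 0 | Suc m \<Rightarrow> a z * U m z + q z * Y m z) = a z * u z + q z * y z" if "z \<in> B" for z
      using sums_unique[OF shift[OF sums_add[OF sums_mult[OF yu(3)[OF that]] sums_mult[OF yu(1)[OF that]]]]] by simp
    have init: "y z0 = \<alpha>" "u z0 = \<beta>"
    proof -
      have "(\<lambda>n. Y n z0) = (\<lambda>n. if n = 0 then \<alpha> else 0)" "(\<lambda>n. U n z0) = (\<lambda>n. if n = 0 then \<beta> else 0)"
        using I(1)[OF YUh(2)] I(1)[OF Fh] by (auto simp: fun_eq_iff Y U gr0_conv_Suc)
      then show "y z0 = \<alpha>" "u z0 = \<beta>"
        using sums_unique2[OF yu(1)[OF B(3)], of \<alpha>] sums_unique2[OF yu(3)[OF B(3)], of \<beta>]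
          sums_single[of 0 "\<lambda>_. \<alpha>"] sums_single[of 0 "\<lambda>_. \<beta>"] by simp_all
    qed
    have "(y has_field_derivative u z) (at z)" "(u has_field_derivative a z * u z + q z * y z) (at z)"
      if z: "z \<in> B" for z
      using yu(2)[OF z] yu(4)[OF z] unfolding s1[OF z] s2[OF z] at_within_open[OF z B(1)] .
    then show ?thesis using init by (intro exI[of _ y] exI[of _ u]) simp
  qed
  then show thesis using that[of \<rho>] \<rho> unfolding B_def by blast
qed

section \<open>Continuation over simply connected sets\<close>

text \<open>\<open>\<S>\<close> is a family of local sections and \<open>near\<close> is equality of
  germs. The two axioms say that the germs form a covering space of \<open>U\<close>: over a small
  connected \<open>V\<close> every germ belongs to a section on all of \<open>V\<close>, and two
  such sections that share one germ share all. The monodromy theorem follows without putting a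
  topology on the set of germs.\<close>

locale continuation =
  fixes U :: "'a::topological_space set" and \<S> :: "('a set \<times> ('a \<Rightarrow> 'y)) set"
    and near :: "'a \<Rightarrow> ('a \<Rightarrow> 'y) \<Rightarrow> ('a \<Rightarrow> 'y) \<Rightarrow> bool"
  defines "near x f g \<equiv> \<exists>Q. openin (top_of_set U) Q \<and> x \<in> Q \<and> (\<forall>w\<in>Q. f w = g w)"
  assumes evenly: "x \<in> U \<Longrightarrow> \<exists>V. openin (top_of_set U) V \<and> path_connected V \<and> x \<in> V \<and>
      (\<forall>y\<in>V. \<forall>V' f'. (V', f') \<in> \<S> \<and> y \<in> V' \<longrightarrow> (\<exists>f. (V, f) \<in> \<S> \<and> near y f f'))"
    and rigid: "(V, f) \<in> \<S> \<Longrightarrow> (V, g) \<in> \<S> \<Longrightarrow> y \<in> V \<Longrightarrow> x \<in> V \<Longrightarrow> near y f g \<Longrightarrow> near x f g"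
begin

lemma near_refl: "x \<in> U \<Longrightarrow> near x f f"
  unfolding near_def by (intro exI[of _ U]) auto

lemma near_sym: "near x f g \<Longrightarrow> near x g f"
  unfolding near_def by metis

lemma near_trans: "near x f g \<Longrightarrow> near x g h \<Longrightarrow> near x f h"
  unfolding near_def by (metis Int_iff openin_Int)

lemma near_imp_eq: "near x f g \<Longrightarrow> f x = g x"
  unfolding near_def by blast

text \<open>A continuous lift of \<open>H\<close> to the space of germs. \<open>L k\<close> is a
  function of which only the germ at \<open>H k\<close> matters; continuity means that locally a
  single section represents all these germs.\<close>

definition cont :: "'k::topological_space set \<Rightarrow> ('k \<Rightarrow> 'a) \<Rightarrow> ('k \<Rightarrow> 'a \<Rightarrow> 'y) \<Rightarrow> bool" where
  "cont K H L \<longleftrightarrow> (\<forall>k\<in>K. \<exists>V f Q. (V, f) \<in> \<S> \<and> open Q \<and> k \<in> Q \<and>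
     (\<forall>k'\<in>K \<inter> Q. H k' \<in> V \<and> near (H k') (L k') f))"

lemma preimage_open:
  assumes "continuous_on K H" "H ` K \<subseteq> U" "openin (top_of_set U) V" "k \<in> K" "H k \<in> V"
  obtains Q where "open Q" "k \<in> Q" "\<And>k'. k' \<in> K \<inter> Q \<Longrightarrow> H k' \<in> V"
proof -
  have "openin (top_of_set K) (K \<inter> H -` V)"
    using assms by (intro continuous_openin_preimage[of K H U]) auto
  then obtain T where "open T" "K \<inter> H -` V = K \<inter> T" by (auto simp: openin_open)
  then show thesis using that[of T] assms by blast
qed

text \<open>Whatever section represents the lift at \<open>k\<close> may be exchanged for one over a
  prescribed \<open>V\<close>. Two lifts can then be compared by \<open>rigid\<close>, which speaks
  of sections over one and the same domain.\<close>

lemma cont_evenly: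
  assumes K: "continuous_on K H" "H ` K \<subseteq> U" and L: "cont K H L" and k: "k \<in> K"
    and V: "openin (top_of_set U) V" "H k \<in> V"
    "\<forall>y\<in>V. \<forall>V' f'. (V', f') \<in> \<S> \<and> y \<in> V' \<longrightarrow> (\<exists>f. (V, f) \<in> \<S> \<and> near y f f')"
  obtains f Q where "(V, f) \<in> \<S>" "open Q" "k \<in> Q"
    "\<And>k'. k' \<in> K \<inter> Q \<Longrightarrow> H k' \<in> V" "\<And>k'. k' \<in> K \<inter> Q \<Longrightarrow> near (H k') (L k') f"
proof -
  obtain V' f' Q' where *: "(V', f') \<in> \<S>" "open Q'" "k \<in> Q'"
     "\<And>k'. k' \<in> K \<inter> Q' \<Longrightarrow> H k' \<in> V' \<and> near (H k') (L k') f'"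
    using L k unfolding cont_def by metis
  then obtain f where f: "(V, f) \<in> \<S>" "near (H k) f f'"
    using V k by blast
  then obtain R where R: "openin (top_of_set U) R" "H k \<in> R" "\<And>w. w \<in> R \<Longrightarrow> f w = f' w"
    unfolding near_def by blast
  obtain Q where Q: "open Q" "k \<in> Q" "\<And>k'. k' \<in> K \<inter> Q \<Longrightarrow> H k' \<in> V \<inter> R"
    using preimage_open[OF K openin_Int[OF V(1) R(1)] k] V R by blast
  have "near (H k') (L k') f" if "k' \<in> K \<inter> (Q \<inter> Q')" for k'
  proof -
    have "near (H k') f' f" using R Q(3)[of k'] that unfolding near_def by (metis Int_iff)
    then show ?thesis using *(4)[of k'] that near_trans by blast
  qed
  then show thesis using that[OF f(1), of "Q \<inter> Q'"] * Q by auto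
qed

text \<open>Uniqueness of lifts: near each point both lifts come from sections over the same
  \<open>V\<close>, so coincidence of germs spreads to a neighbourhood, and \<open>K\<close> is
  connected.\<close>

lemma cont_unique:
  assumes K: "continuous_on K H" "H ` K \<subseteq> U" "connected K" and L: "cont K H L" "cont K H L'"
    and k: "k \<in> K" "near (H k) (L k) (L' k)" and k': "k' \<in> K"
  shows "near (H k') (L k') (L' k')"
proof (rule connected_induction_simple[where P = "\<lambda>k. near (H k) (L k) (L' k)", OF K(3) k(1) k' k(2)])
  fix j assume j: "j \<in> K"
  then obtain V where V: "openin (top_of_set U) V" "H j \<in> V"
    "\<forall>y\<in>V. \<forall>V' f'. (V', f') \<in> \<S> \<and> y \<in> V' \<longrightarrow> (\<exists>f. (V, f) \<in> \<S> \<and> near y f f')"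
    using evenly[of "H j"] K by blast
  obtain f Q where f: "(V, f) \<in> \<S>" "open Q" "j \<in> Q"
    "\<And>k'. k' \<in> K \<inter> Q \<Longrightarrow> H k' \<in> V" "\<And>k'. k' \<in> K \<inter> Q \<Longrightarrow> near (H k') (L k') f"
    using cont_evenly[OF K(1,2) L(1) j V] by metis
  obtain f' Q' where f': "(V, f') \<in> \<S>" "open Q'" "j \<in> Q'"
    "\<And>k'. k' \<in> K \<inter> Q' \<Longrightarrow> H k' \<in> V" "\<And>k'. k' \<in> K \<inter> Q' \<Longrightarrow> near (H k') (L' k') f'"
    using cont_evenly[OF K(1,2) L(2) j V] by metis
  have "near (H y) (L y) (L' y)"
    if "x \<in> K \<inter> (Q \<inter> Q')" "y \<in> K \<inter> (Q \<inter> Q')" "near (H x) (L x) (L' x)" for x y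
  proof -
    have "near (H x) f f'"
      using that f(5) f'(5) by (meson IntD1 IntD2 IntI near_sym near_trans)
    then have "near (H y) f f'" using rigid[OF f(1) f'(1)] f(4) f'(4) that by blast
    then show ?thesis using that f(5) f'(5) by (meson IntD1 IntD2 IntI near_sym near_trans)
  qed
  moreover have "openin (top_of_set K) (K \<inter> (Q \<inter> Q'))"
    using f(2) f'(2) by (intro openin_open_Int open_Int)
  ultimately show "\<exists>T. openin (top_of_set K) T \<and> j \<in> T \<and>
      (\<forall>x\<in>T. \<forall>y\<in>T. near (H x) (L x) (L' x) \<longrightarrow> near (H y) (L y) (L' y))"
    using f(3) f'(3) j by (metis IntI)
qed

lemma cont_cong:
  assumes "cont K H L" "\<And>k. k \<in> K \<Longrightarrow> H k = H' k" "\<And>k. k \<in> K \<Longrightarrow> L k = L' k"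
  shows "cont K H' L'"
  using assms unfolding cont_def by (metis Int_iff)

lemma cont_compose:
  assumes "cont K H L" "continuous_on J \<phi>" "\<phi> ` J \<subseteq> K"
  shows "cont J (\<lambda>j. H (\<phi> j)) (\<lambda>j. L (\<phi> j))"
  unfolding cont_def
proof
  fix j assume j: "j \<in> J"
  then obtain V f Q where *: "(V, f) \<in> \<S>" "open Q" "\<phi> j \<in> Q"
     "\<And>k'. k' \<in> K \<inter> Q \<Longrightarrow> H k' \<in> V \<and> near (H k') (L k') f"
    using assms(1,3) unfolding cont_def by (metis image_subset_iff)
  obtain T where "open T" "T \<inter> J = \<phi> -` Q \<inter> J"
    using assms(2) \<open>open Q\<close> unfolding continuous_on_open_invariant by metis
  then show "\<exists>V f Q. (V, f) \<in> \<S> \<and> open Q \<and> j \<in> Q \<and>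
      (\<forall>k'\<in>J \<inter> Q. H (\<phi> k') \<in> V \<and> near (H (\<phi> k')) (L (\<phi> k')) f)"
    using * j assms(3) by (intro exI[of _ V] exI[of _ f] exI[of _ T]) blast
qed

lemma cont_subset: "cont K H L \<Longrightarrow> J \<subseteq> K \<Longrightarrow> cont J H L"
  using cont_compose[of K H L J "\<lambda>j. j"] by auto

text \<open>At a common point the two lifts come from sections over one \<open>V\<close>, which
  agree by \<open>rigid\<close>. At any other point closedness provides a neighbourhood that misses
  the other piece.\<close>

lemma cont_glue:
  assumes L: "cont K1 H L1" "cont K2 H L2" and cl: "closed K1" "closed K2"
    and H: "continuous_on (K1 \<union> K2) H" "H ` (K1 \<union> K2) \<subseteq> U"
    and eq: "\<And>k. k \<in> K1 \<inter> K2 \<Longrightarrow> near (H k) (L1 k) (L2 k)"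
  shows "cont (K1 \<union> K2) H (\<lambda>k. if k \<in> K1 then L1 k else L2 k)"
  unfolding cont_def
proof
  fix k assume k: "k \<in> K1 \<union> K2"
  let ?L = "\<lambda>k. if k \<in> K1 then L1 k else L2 k"
  consider "k \<in> K1 \<inter> K2" | "k \<in> K1 - K2" | "k \<in> K2 - K1" using k by blast
  then show "\<exists>V f Q. (V, f) \<in> \<S> \<and> open Q \<and> k \<in> Q \<and>
      (\<forall>k'\<in>(K1 \<union> K2) \<inter> Q. H k' \<in> V \<and> near (H k') (?L k') f)"
  proof cases
    case 1
    obtain V where V: "openin (top_of_set U) V" "H k \<in> V"
      "\<forall>y\<in>V. \<forall>V' f'. (V', f') \<in> \<S> \<and> y \<in> V' \<longrightarrow> (\<exists>f. (V, f) \<in> \<S> \<and> near y f f')"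
      using evenly[of "H k"] H k by blast
    have K: "continuous_on K1 H" "H ` K1 \<subseteq> U" "continuous_on K2 H" "H ` K2 \<subseteq> U"
      using H continuous_on_subset by blast+
    have k12: "k \<in> K1" "k \<in> K2" using 1 by auto
    obtain f Q where f: "(V, f) \<in> \<S>" "open Q" "k \<in> Q"
      "\<And>k'. k' \<in> K1 \<inter> Q \<Longrightarrow> H k' \<in> V" "\<And>k'. k' \<in> K1 \<inter> Q \<Longrightarrow> near (H k') (L1 k') f"
      using cont_evenly[OF K(1,2) L(1) k12(1) V] by metis
    obtain f' Q' where f': "(V, f') \<in> \<S>" "open Q'" "k \<in> Q'"
      "\<And>k'. k' \<in> K2 \<inter> Q' \<Longrightarrow> H k' \<in> V" "\<And>k'. k' \<in> K2 \<inter> Q' \<Longrightarrow> near (H k') (L2 k') f'"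
      using cont_evenly[OF K(3,4) L(2) k12(2) V] by metis
    have ff': "near (H k) f' f"
      using f(5)[of k] f'(5)[of k] eq[OF 1] k12 f f' by (meson IntI near_sym near_trans)
    have "H k' \<in> V \<and> near (H k') (?L k') f" if k': "k' \<in> (K1 \<union> K2) \<inter> (Q \<inter> Q')" for k'
    proof (cases "k' \<in> K1")
      case True
      then show ?thesis using f k' by auto
    next
      case False
      then have "H k' \<in> V" "near (H k') (L2 k') f'" using f' k' by auto
      then show ?thesis
        using rigid[OF f'(1) f(1) V(2) _ ff'] False near_trans by auto
    qed
    then show ?thesis using f f' by (intro exI[of _ V] exI[of _ f] exI[of _ "Q \<inter> Q'"]) auto
  next
    case 2
    then obtain V f Q where *: "(V, f) \<in> \<S>" "open Q" "k \<in> Q"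
       "\<And>k'. k' \<in> K1 \<inter> Q \<Longrightarrow> H k' \<in> V \<and> near (H k') (L1 k') f"
      using L(1) unfolding cont_def by (metis DiffD1)
    then show ?thesis
      using 2 cl by (intro exI[of _ V] exI[of _ f] exI[of _ "Q \<inter> - K2"]) (auto intro: open_Int)
  next
    case 3
    then obtain V f Q where *: "(V, f) \<in> \<S>" "open Q" "k \<in> Q"
       "\<And>k'. k' \<in> K2 \<inter> Q \<Longrightarrow> H k' \<in> V \<and> near (H k') (L2 k') f"
      using L(2) unfolding cont_def by (metis DiffD1)
    then show ?thesis
      using 3 cl by (intro exI[of _ V] exI[of _ f] exI[of _ "Q \<inter> - K1"]) (auto intro: open_Int)
  qed
qed

text \<open>The germ is prescribed at an arbitrary point of \<open>K\<close>, not at a base point;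
  in this form the property passes to subsets and can be glued.\<close>

definition extends :: "('k::topological_space \<Rightarrow> 'a) \<Rightarrow> 'k set \<Rightarrow> bool" where
  "extends H K \<longleftrightarrow> (\<forall>k\<in>K. \<forall>V f. (V, f) \<in> \<S> \<and> H k \<in> V \<longrightarrow> (\<exists>L. cont K H L \<and> near (H k) (L k) f))"

lemma extends_subset: "extends H K \<Longrightarrow> J \<subseteq> K \<Longrightarrow> extends H J"
  unfolding extends_def by (meson cont_subset subsetD)

lemma extends_local:
  assumes "continuous_on K H" "H ` K \<subseteq> U" "k \<in> K"
  obtains Q where "open Q" "k \<in> Q" "extends H (K \<inter> Q)"
proof -
  obtain V where V: "openin (top_of_set U) V" "H k \<in> V"
    "\<forall>y\<in>V. \<forall>V' f'. (V', f') \<in> \<S> \<and> y \<in> V' \<longrightarrow> (\<exists>f. (V, f) \<in> \<S> \<and> near y f f')"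
    using evenly[of "H k"] assms by blast
  obtain Q where Q: "open Q" "k \<in> Q" "\<And>k'. k' \<in> K \<inter> Q \<Longrightarrow> H k' \<in> V"
    using preimage_open[OF assms(1,2) V(1) assms(3) V(2)] by metis
  have "extends H (K \<inter> Q)"
    unfolding extends_def
  proof (intro ballI allI impI)
    fix j V' f' assume j: "j \<in> K \<inter> Q" "(V', f') \<in> \<S> \<and> H j \<in> V'"
    then obtain f where f: "(V, f) \<in> \<S>" "near (H j) f f'" using V Q by blast
    have "H k' \<in> V \<and> near (H k') f f" if "k' \<in> K \<inter> Q" for k'
      using Q(3) that assms(2) by (auto intro: near_refl)
    then have "cont (K \<inter> Q) H (\<lambda>_. f)"
      unfolding cont_def using f Q by (metis Int_iff)
    then show "\<exists>L. cont (K \<inter> Q) H L \<and> near (H j) (L j) f'"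
      using f by blast
  qed
  then show thesis using that Q by blast
qed

text \<open>A lift over one piece determines a germ at a common point, from which the other piece
  continues. Uniqueness over the connected intersection makes the two lifts agree there.\<close>

lemma extends_glue:
  assumes T: "extends H K1" "extends H K2" and cl: "closed K1" "closed K2"
    and H: "continuous_on (K1 \<union> K2) H" "H ` (K1 \<union> K2) \<subseteq> U"
    and conn: "connected (K1 \<inter> K2)" "K1 \<inter> K2 \<noteq> {}"
  shows "extends H (K1 \<union> K2)"
proof -
  \<comment> \<open>Formulated for two sets in either order, because the prescribed germ may lie
    over either piece.\<close>
  have key: "\<exists>L. cont (A \<union> B) H L \<and> near (H k) (L k) f"
    if A: "extends H A" "extends H B" "closed A" "closed B" "A \<union> B = K1 \<union> K2" "A \<inter> B = K1 \<inter> K2"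
      and k: "k \<in> A" "(V, f) \<in> \<S>" "H k \<in> V" for A B k V f
  proof -
    obtain L1 where L1: "cont A H L1" "near (H k) (L1 k) f"
      using A k unfolding extends_def by blast
    obtain j where j: "j \<in> A \<inter> B" using conn A by blast
    then obtain V' f' where f': "(V', f') \<in> \<S>" "H j \<in> V'" "near (H j) (L1 j) f'"
      using L1(1) unfolding cont_def by blast
    then obtain L2 where L2: "cont B H L2" "near (H j) (L2 j) f'"
      using A j unfolding extends_def by blast
    have "near (H i) (L1 i) (L2 i)" if "i \<in> A \<inter> B" for i
    proof (rule cont_unique[OF _ _ _ _ _ j _ that])
      show "continuous_on (A \<inter> B) H" "H ` (A \<inter> B) \<subseteq> U"
        using H A by (auto intro: continuous_on_subset)
      show "cont (A \<inter> B) H L1" "cont (A \<inter> B) H L2" using L1 L2 cont_subset by blast+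
      show "near (H j) (L1 j) (L2 j)" using f' L2 near_sym near_trans by blast
    qed (use conn A in auto)
    then have "cont (A \<union> B) H (\<lambda>k. if k \<in> A then L1 k else L2 k)"
      using cont_glue[OF L1(1) L2(1)] A H by auto
    then show ?thesis using L1(2) k by (intro exI[of _ "\<lambda>k. if k \<in> A then L1 k else L2 k"]) auto
  qed
  show ?thesis
    unfolding extends_def
  proof (intro ballI allI impI)
    fix k V f assume k: "k \<in> K1 \<union> K2" "(V, f) \<in> \<S> \<and> H k \<in> V"
    show "\<exists>L. cont (K1 \<union> K2) H L \<and> near (H k) (L k) f"
    proof (cases "k \<in> K1")
      case True
      then show ?thesis using key[OF T cl, of k] k by blast
    next
      case False
      then show ?thesis
        using key[OF T(2,1) cl(2,1) Un_commute Int_commute, of k V f] k by (simp add: Un_commute)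
    qed
  qed
qed

text \<open>Bisection takes the place of a Lebesgue number. Gluing in the second coordinate yields a
  strip of positive width about every \<open>s\<close>; gluing the strips in the first coordinate
  yields the square.\<close>

lemma extends_square:
  fixes H :: "real \<times> real \<Rightarrow> 'a"
  assumes H: "continuous_on ({0..1} \<times> {0..1}) H" "H ` ({0..1} \<times> {0..1}) \<subseteq> U"
  shows "extends H ({0..1} \<times> {0..1})"
proof -
  have H': "continuous_on K H" "H ` K \<subseteq> U" if "K \<subseteq> {0..1} \<times> {0..1}" for K
    using H that continuous_on_subset by blast+
  have strip: "\<exists>\<delta>>0. extends H (({0..1} \<inter> {s-\<delta>..s+\<delta>}) \<times> {0..1})" if s: "s \<in> {0..1}" for s
  proof -
    have "0 \<le> (0::real) \<and> (1::real) \<le> 1 \<longrightarrow> (\<exists>\<delta>>0. extends H (({0..1} \<inter> {s-\<delta>..s+\<delta>}) \<times> {0..1}))"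
    proof (rule Bolzano[where P = "\<lambda>a b. 0 \<le> a \<and> b \<le> 1 \<longrightarrow> (\<exists>\<delta>>0. extends H (({0..1} \<inter> {s-\<delta>..s+\<delta>}) \<times> {a..b}))"])
      fix a b c :: real
      assume *: "0 \<le> a \<and> b \<le> 1 \<longrightarrow> (\<exists>\<delta>>0. extends H (({0..1} \<inter> {s-\<delta>..s+\<delta>}) \<times> {a..b}))"
         "0 \<le> b \<and> c \<le> 1 \<longrightarrow> (\<exists>\<delta>>0. extends H (({0..1} \<inter> {s-\<delta>..s+\<delta>}) \<times> {b..c}))" "a \<le> b" "b \<le> c"
      show "0 \<le> a \<and> c \<le> 1 \<longrightarrow> (\<exists>\<delta>>0. extends H (({0..1} \<inter> {s-\<delta>..s+\<delta>}) \<times> {a..c}))"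
      proof
        assume ac: "0 \<le> a \<and> c \<le> 1"
        then obtain d e where d: "d > 0" "extends H (({0..1} \<inter> {s-d..s+d}) \<times> {a..b})"
          and e: "e > 0" "extends H (({0..1} \<inter> {s-e..s+e}) \<times> {b..c})" using * by auto
        define m where "m = min d e"
        define J where "J = {0..1} \<inter> {s-m..s+m}"
        have ext: "extends H (J \<times> {a..b})" "extends H (J \<times> {b..c})"
          by (rule extends_subset[OF d(2)], auto simp: J_def m_def)
            (rule extends_subset[OF e(2)], auto simp: J_def m_def)
        have un: "J \<times> {a..b} \<union> J \<times> {b..c} = J \<times> {a..c}" using * by auto
        have int: "J \<times> {a..b} \<inter> J \<times> {b..c} = J \<times> {b}" using * by auto
        have sJ: "s \<in> J" "m > 0" using s d e by (auto simp: J_def m_def)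
        have "extends H (J \<times> {a..b} \<union> J \<times> {b..c})"
        proof (rule extends_glue[OF ext])
          show "connected (J \<times> {a..b} \<inter> J \<times> {b..c})" unfolding int
            by (intro connected_Times) (auto simp: J_def Int_atLeastAtMost)
          show "closed (J \<times> {a..b})" "closed (J \<times> {b..c})"
            by (auto intro!: closed_Times simp: J_def)
          show "continuous_on (J \<times> {a..b} \<union> J \<times> {b..c}) H" "H ` (J \<times> {a..b} \<union> J \<times> {b..c}) \<subseteq> U"
            unfolding un using ac by (intro H'; force simp: J_def)+
        qed (use sJ int in auto)
        then have "extends H (J \<times> {a..c})" unfolding un .
        then show "\<exists>\<delta>>0. extends H (({0..1} \<inter> {s-\<delta>..s+\<delta>}) \<times> {a..c})"
          using sJ(2) unfolding J_def by blast
      qed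
    next
      fix t :: real assume t: "0 \<le> t" "t \<le> 1"
      obtain Q where Q: "open Q" "(s, t) \<in> Q" "extends H (({0..1} \<times> {0..1}) \<inter> Q)"
        using extends_local[OF H, of "(s, t)"] s t by auto
      obtain A B where AB: "open A" "open B" "s \<in> A" "t \<in> B" "A \<times> B \<subseteq> Q"
        using open_prod_elim[OF Q(1,2)] by (metis mem_Sigma_iff)
      obtain d e where de: "d > 0" "cball s d \<subseteq> A" "e > 0" "cball t e \<subseteq> B"
        using AB open_contains_cball by metis
      have "extends H (({0..1} \<inter> {s-d..s+d}) \<times> {a..b})" if "a \<le> t" "t \<le> b" "b - a < e" "0 \<le> a" "b \<le> 1" for a b
      proof (rule extends_subset[OF Q(3)])
        have "{s-d..s+d} \<subseteq> A" "{a..b} \<subseteq> B"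
          using de that by (auto simp: cball_eq_atLeastAtMost subset_iff)
        then have "({0..1} \<inter> {s-d..s+d}) \<times> {a..b} \<subseteq> A \<times> B" by blast
        moreover have "({0..1} \<inter> {s-d..s+d}) \<times> {a..b} \<subseteq> {0..1} \<times> {0..1}" using that by auto
        ultimately show "({0..1} \<inter> {s-d..s+d}) \<times> {a..b} \<subseteq> ({0..1} \<times> {0..1}) \<inter> Q"
          using AB(5) by blast
      qed
      then show "\<exists>e>0. \<forall>a b. a \<le> t \<and> t \<le> b \<and> b - a < e \<longrightarrow>
          0 \<le> a \<and> b \<le> 1 \<longrightarrow> (\<exists>\<delta>>0. extends H (({0..1} \<inter> {s-\<delta>..s+\<delta>}) \<times> {a..b}))"
        using de by blast
    qed simp
    then show ?thesis by simp
  qed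
  have "0 \<le> (0::real) \<and> (1::real) \<le> 1 \<longrightarrow> extends H ({0..1} \<times> {0..1})"
  proof (rule Bolzano[where P = "\<lambda>a b. 0 \<le> a \<and> b \<le> 1 \<longrightarrow> extends H ({a..b} \<times> {0..1})"])
    fix a b c :: real
    assume *: "0 \<le> a \<and> b \<le> 1 \<longrightarrow> extends H ({a..b} \<times> {0..1})"
       "0 \<le> b \<and> c \<le> 1 \<longrightarrow> extends H ({b..c} \<times> {0..1})" "a \<le> b" "b \<le> c"
    show "0 \<le> a \<and> c \<le> 1 \<longrightarrow> extends H ({a..c} \<times> {0..1})"
    proof
      assume ac: "0 \<le> a \<and> c \<le> 1"
      have un: "{a..b} \<times> {0..1} \<union> {b..c} \<times> {0..1} = {a..c} \<times> {0..1::real}" using * by auto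
      have int: "{a..b} \<times> {0..1} \<inter> {b..c} \<times> {0..1} = {b} \<times> {0..1::real}" using * by auto
      have "extends H ({a..b} \<times> {0..1} \<union> {b..c} \<times> {0..1})"
      proof (rule extends_glue)
        show "connected ({a..b} \<times> {0..1} \<inter> {b..c} \<times> {0..1::real})" unfolding int
          by (intro connected_Times) auto
        show "continuous_on ({a..b} \<times> {0..1} \<union> {b..c} \<times> {0..1}) H"
          "H ` ({a..b} \<times> {0..1} \<union> {b..c} \<times> {0..1}) \<subseteq> U"
          unfolding un using ac by (intro H'; force)+
      qed (use * ac int in \<open>auto intro: closed_Times\<close>)
      then show "extends H ({a..c} \<times> {0..1})" unfolding un .
    qed
  next
    fix s :: real assume "0 \<le> s" "s \<le> 1"
    then obtain \<delta> where "\<delta> > 0" "extends H (({0..1} \<inter> {s-\<delta>..s+\<delta>}) \<times> {0..1})"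
      using strip[of s] by auto
    then have "extends H ({a..b} \<times> {0..1})" if "a \<le> s" "s \<le> b" "b - a < \<delta>" "0 \<le> a" "b \<le> 1" for a b
      by (rule_tac extends_subset) (use that in auto)
    then show "\<exists>e>0. \<forall>a b. a \<le> s \<and> s \<le> b \<and> b - a < e \<longrightarrow> 0 \<le> a \<and> b \<le> 1 \<longrightarrow> extends H ({a..b} \<times> {0..1})"
      using \<open>\<delta> > 0\<close> by blast
  qed simp
  then show ?thesis by simp
qed

text \<open>A path is treated as a map of the square that is constant in the first
  coordinate.\<close>

lemma extends_path:
  assumes "path \<gamma>" "path_image \<gamma> \<subseteq> U"
  shows "extends \<gamma> {0..1}"
proof -
  define H :: "real \<times> real \<Rightarrow> 'a" where "H = (\<lambda>p. \<gamma> (snd p))"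
  have "continuous_on ({0..1} \<times> {0..1}) H"
    unfolding H_def using assms(1) unfolding path_def
    by (rule continuous_on_compose2) (auto intro!: continuous_intros)
  then have E: "extends H ({0..1} \<times> {0..1})"
    using assms by (intro extends_square) (auto simp: H_def path_image_def)
  show ?thesis
    unfolding extends_def
  proof (intro ballI allI impI)
    fix t V f assume t: "t \<in> {0..1}" "(V, f) \<in> \<S> \<and> \<gamma> t \<in> V"
    then have "(0::real, t) \<in> {0..1} \<times> {0..1}" "H (0, t) \<in> V" "(V, f) \<in> \<S>" by (auto simp: H_def)
    then obtain L where L: "cont ({0..1} \<times> {0..1}) H L" "near (H (0, t)) (L (0, t)) f"
      using E unfolding extends_def by blast
    have "cont {0..1} (\<lambda>t. H (0, t)) (\<lambda>t. L (0, t))"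
      by (rule cont_compose[OF L(1)]) (auto intro!: continuous_intros)
    then show "\<exists>L. cont {0..1} \<gamma> L \<and> near (\<gamma> t) (L t) f"
      using L(2) by (intro exI[of _ "\<lambda>t. L (0, t)"]) (simp add: H_def)
  qed
qed

text \<open>The germ is unchanged after one circuit: the loop is contracted to a constant one, the
  contraction is lifted to the square, and the four edges are compared by uniqueness of
  lifts.\<close>

lemma cont_loop:
  assumes sc: "simply_connected U" and \<gamma>: "path \<gamma>" "path_image \<gamma> \<subseteq> U" "pathfinish \<gamma> = pathstart \<gamma>"
    and L: "cont {0..1} \<gamma> L"
  shows "near (\<gamma> 0) (L 0) (L 1)"
proof -
  have x0: "\<gamma> 0 \<in> U" using \<gamma>(2) by (auto simp: path_image_def)
  have "homotopic_loops U \<gamma> (\<lambda>_. \<gamma> 0)"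
    by (rule sc[unfolded simply_connected_def, rule_format])
      (use \<gamma> x0 in \<open>auto simp: path_def path_image_def pathfinish_def pathstart_def\<close>)
  then obtain H where H: "continuous_on ({0..1::real} \<times> {0..1::real}) H" "H ` ({0..1} \<times> {0..1}) \<subseteq> U"
     "\<forall>t\<in>{0..1}. H (0, t) = \<gamma> t" "\<forall>t\<in>{0..1}. H (1, t) = \<gamma> 0"
     "\<forall>s\<in>{0..1}. pathfinish (H \<circ> Pair s) = pathstart (H \<circ> Pair s)"
    unfolding homotopic_loops image_subset_iff_funcset by blast
  then have H: "continuous_on ({0..1} \<times> {0..1}) H" "H ` ({0..1} \<times> {0..1}) \<subseteq> U"
     "\<And>t. t \<in> {0..1} \<Longrightarrow> H (0, t) = \<gamma> t" "\<And>t. t \<in> {0..1} \<Longrightarrow> H (1, t) = \<gamma> 0"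
     "\<And>s. s \<in> {0..1} \<Longrightarrow> H (s, 1) = H (s, 0)"
    by (auto simp: pathfinish_def pathstart_def)
  obtain V f where f: "(V, f) \<in> \<S>" "\<gamma> 0 \<in> V" "near (\<gamma> 0) (L 0) f"
    using L unfolding cont_def by (metis IntI atLeastAtMost_iff order_refl zero_le_one)
  then obtain M where M: "cont ({0..1} \<times> {0..1}) H M" "near (H (0, 0)) (M (0, 0)) f"
    using extends_square[OF H(1,2)] unfolding extends_def
    by (metis H(3) atLeastAtMost_iff mem_Sigma_iff order_refl zero_le_one)
  have hor: "cont {0..1} (\<lambda>t. H (s, t)) (\<lambda>t. M (s, t))" "continuous_on {0..1} (\<lambda>t. H (s, t))"
     "(\<lambda>t. H (s, t)) ` {0..1} \<subseteq> U" if "s \<in> {0..1}" for s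
  proof -
    have "continuous_on {0..1} (\<lambda>t. (s, t))" "(\<lambda>t. (s, t)) ` {0..1} \<subseteq> {0..1} \<times> {0..1}"
      using that by (auto intro!: continuous_intros)
    then show "cont {0..1} (\<lambda>t. H (s, t)) (\<lambda>t. M (s, t))" "continuous_on {0..1} (\<lambda>t. H (s, t))"
      by (rule cont_compose[OF M(1)], rule continuous_on_compose2[OF H(1)])
    show "(\<lambda>t. H (s, t)) ` {0..1} \<subseteq> U"
      by (rule image_subsetI) (use that in \<open>auto intro!: subsetD[OF H(2)]\<close>)
  qed
  have ver: "cont {0..1} (\<lambda>s. H (s, t)) (\<lambda>s. M (s, t))" "continuous_on {0..1} (\<lambda>s. H (s, t))"
     "(\<lambda>s. H (s, t)) ` {0..1} \<subseteq> U" if "t \<in> {0..1}" for t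
  proof -
    have "continuous_on {0..1} (\<lambda>s. (s, t))" "(\<lambda>s. (s, t)) ` {0..1} \<subseteq> {0..1} \<times> {0..1}"
      using that by (auto intro!: continuous_intros)
    then show "cont {0..1} (\<lambda>s. H (s, t)) (\<lambda>s. M (s, t))" "continuous_on {0..1} (\<lambda>s. H (s, t))"
      by (rule cont_compose[OF M(1)], rule continuous_on_compose2[OF H(1)])
    show "(\<lambda>s. H (s, t)) ` {0..1} \<subseteq> U"
      by (rule image_subsetI) (use that in \<open>auto intro!: subsetD[OF H(2)]\<close>)
  qed
  have c01: "(0::real) \<in> {0..1}" "(1::real) \<in> {0..1}" "connected {0..1::real}" by auto
  have L': "cont {0..1} (\<lambda>t. H (0, t)) L"
    by (rule cont_cong[OF L]) (auto simp: H(3))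
  have "near (H (0, 0)) (M (0, 0)) (L 0)"
    using M(2) near_trans[OF M(2)] near_sym[OF f(3)] H(3)[OF c01(1)] by simp
  from cont_unique[OF hor(2,3)[OF c01(1)] c01(3) hor(1)[OF c01(1)] L' c01(1) this c01(2)]
  have e1: "near (H (0, 1)) (M (0, 1)) (L 1)" .
  \<comment> \<open>On the edge \<open>s = 1\<close> the homotopy is constant, so a single germ is a
    lift there and both ends of this edge carry it.\<close>
  obtain V' f' where "(V', f') \<in> \<S>" "H (1, 0) \<in> V'" "near (H (1, 0)) (M (1, 0)) f'"
    using hor(1)[OF c01(2)] c01(1) unfolding cont_def by blast
  then have C: "cont {0..1} (\<lambda>t. H (1, t)) (\<lambda>_. M (1, 0))"
    unfolding cont_def using H(4) by (intro ballI exI[of _ V'] exI[of _ f'] exI[of _ UNIV]) auto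
  have "near (H (1, 0)) (M (1, 0)) (M (1, 0))" using near_refl H(4)[of 0] x0 by simp
  from cont_unique[OF hor(2,3)[OF c01(2)] c01(3) C hor(1)[OF c01(2)] c01(1) this c01(2)]
  have e2: "near (H (1, 1)) (M (1, 0)) (M (1, 1))" .
  \<comment> \<open>Every stage of the homotopy is a loop, so the edges \<open>t = 0\<close> and
    \<open>t = 1\<close> project to the same path. Their lifts agree at \<open>s = 1\<close>, hence
    also at \<open>s = 0\<close>, where they start from the two ends of the lifted loop.\<close>
  have D: "cont {0..1} (\<lambda>s. H (s, 0)) (\<lambda>s. M (s, 1))"
    by (rule cont_cong[OF ver(1)[OF c01(2)]]) (auto simp: H(5))
  have "near (H (1, 0)) (M (1, 0)) (M (1, 1))" using e2 H(4)[of 0] H(4)[of 1] by simp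
  from cont_unique[OF ver(2,3)[OF c01(1)] c01(3) ver(1)[OF c01(1)] D c01(2) this c01(1)]
  have e3: "near (H (0, 0)) (M (0, 0)) (M (0, 1))" .
  have "H (0, 0) = \<gamma> 0" "H (0, 1) = \<gamma> 0"
    using H(3) H(5) \<gamma>(3) by (auto simp: pathfinish_def pathstart_def)
  then show ?thesis
    using e1 e3 M(2) f(3) by (metis near_sym near_trans)
qed

theorem global_section:
  assumes sc: "simply_connected U" and f0: "(V0, f0) \<in> \<S>" "x0 \<in> V0" and x0: "x0 \<in> U"
  obtains F where "near x0 F f0" "\<And>x. x \<in> U \<Longrightarrow> \<exists>V f. (V, f) \<in> \<S> \<and> x \<in> V \<and> near x F f"
proof -
  \<comment> \<open>The functions obtained at \<open>x\<close> by continuing \<open>f0\<close> along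
    some path from \<open>x0\<close>.\<close>
  define reach where "reach x l \<longleftrightarrow> (\<exists>\<gamma> L. path \<gamma> \<and> path_image \<gamma> \<subseteq> U \<and> pathstart \<gamma> = x0 \<and> pathfinish \<gamma> = x \<and>
      cont {0..1} \<gamma> L \<and> near x0 (L 0) f0 \<and> l = L 1)" for x l
  have ex: "\<exists>l. reach x l" if x: "x \<in> U" for x
  proof -
    have "homotopic_loops U (\<lambda>_. x0) (\<lambda>_. x)"
      by (rule sc[unfolded simply_connected_def, rule_format])
        (use x x0 in \<open>auto simp: path_def path_image_def pathfinish_def pathstart_def\<close>)
    then obtain H where H: "continuous_on ({0..1::real} \<times> {0..1::real}) H" "H ` ({0..1} \<times> {0..1}) \<subseteq> U"
       "\<forall>t\<in>{0..1}. H (0, t) = x0" "\<forall>t\<in>{0..1}. H (1, t) = x"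
      unfolding homotopic_loops image_subset_iff_funcset by blast
    define \<gamma> where "\<gamma> s = H (s, 0)" for s :: real
    have "path \<gamma>" unfolding path_def \<gamma>_def
      by (rule continuous_on_compose2[OF H(1)]) (auto intro!: continuous_intros)
    then have \<gamma>: "path \<gamma>" "path_image \<gamma> \<subseteq> U" "pathstart \<gamma> = x0" "pathfinish \<gamma> = x"
      using H(2-4) by (auto simp: pathfinish_def pathstart_def path_image_def \<gamma>_def)
    have "\<gamma> 0 = x0" using \<gamma> by (simp add: pathstart_def)
    then obtain L where "cont {0..1} \<gamma> L" "near x0 (L 0) f0"
      using extends_path[OF \<gamma>(1,2)] f0 unfolding extends_def
      by (metis atLeastAtMost_iff order_refl zero_le_one)
    then show ?thesis using \<gamma> unfolding reach_def by blast
  qed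
  have uniq: "near x l l'" if ll': "reach x l" "reach x l'" for x l l'
  proof -
    obtain \<gamma> L where g: "path \<gamma>" "path_image \<gamma> \<subseteq> U" "pathstart \<gamma> = x0" "pathfinish \<gamma> = x"
       and L: "cont {0..1} \<gamma> L" "near x0 (L 0) f0" "l = L 1" using ll' unfolding reach_def by blast
    obtain \<delta> M where d: "path \<delta>" "path_image \<delta> \<subseteq> U" "pathstart \<delta> = x0" "pathfinish \<delta> = x"
       and M: "cont {0..1} \<delta> M" "near x0 (M 0) f0" "l' = M 1" using ll' unfolding reach_def by blast
    define \<eta> where "\<eta> = \<gamma> +++ reversepath \<delta>"
    have e: "path \<eta>" "path_image \<eta> \<subseteq> U" "pathstart \<eta> = x0" "pathfinish \<eta> = x0"
      using g d by (auto simp: \<eta>_def path_image_join)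
    have e0: "\<eta> 0 = x0" using e by (simp add: pathstart_def)
    then obtain N where N: "cont {0..1} \<eta> N" "near x0 (N 0) f0"
      using extends_path[OF e(1,2)] f0 unfolding extends_def
      by (metis atLeastAtMost_iff order_refl zero_le_one)
    have eg: "\<eta> (t / 2) = \<gamma> t" "\<eta> (1 - t / 2) = \<delta> t" if "t \<in> {0..1}" for t
    proof -
      show "\<eta> (t / 2) = \<gamma> t" using that by (simp add: \<eta>_def joinpaths_def)
      have "\<gamma> 1 = \<delta> 1" using g d by (simp add: pathfinish_def)
      then show "\<eta> (1 - t / 2) = \<delta> t"
        using that by (cases "t = 1") (auto simp: \<eta>_def joinpaths_def reversepath_def)
    qed
    have c1: "cont {0..1} \<gamma> (\<lambda>t. N (t / 2))"
      by (rule cont_cong[OF cont_compose[OF N(1), of "{0..1}" "\<lambda>t. t / 2"]])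
        (use eg(1) in \<open>auto intro!: continuous_intros\<close>)
    have c2: "cont {0..1} \<delta> (\<lambda>t. N (1 - t / 2))"
      by (rule cont_cong[OF cont_compose[OF N(1), of "{0..1}" "\<lambda>t. 1 - t / 2"]])
        (use eg(2) in \<open>auto intro!: continuous_intros\<close>)
    have N1: "near x0 (N 0) (N 1)"
      using cont_loop[OF sc e(1,2) _ N(1)] e e0 by simp
    have c01: "(0::real) \<in> {0..1}" "(1::real) \<in> {0..1}" "connected {0..1::real}" by auto
    have gd: "\<gamma> 0 = x0" "\<gamma> 1 = x" "\<delta> 0 = x0" "\<delta> 1 = x"
      using g d by (simp_all add: pathstart_def pathfinish_def)
    have gc: "continuous_on {0..1} \<gamma>" "\<gamma> ` {0..1} \<subseteq> U" and dc: "continuous_on {0..1} \<delta>" "\<delta> ` {0..1} \<subseteq> U"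
      using g(1,2) d(1,2) by (simp_all add: path_def path_image_def)
    have "near (\<gamma> 0) (N (0 / 2)) (L 0)"
      using near_trans[OF N(2) near_sym[OF L(2)]] gd by simp
    from cont_unique[OF gc c01(3) c1 L(1) c01(1) this c01(2)]
    have 1: "near x (N (1 / 2)) l" using L(3) gd by simp
    have "near (\<delta> 0) (N (1 - 0 / 2)) (M 0)"
      using near_trans[OF near_sym[OF N1] near_trans[OF N(2) near_sym[OF M(2)]]] gd by simp
    from cont_unique[OF dc c01(3) c2 M(1) c01(1) this c01(2)]
    have 2: "near x (N (1 / 2)) l'" using M(3) gd by simp
    show ?thesis
      using near_trans[OF near_sym[OF 1] 2] .
  qed
  define F where "F x = (SOME l. reach x l) x" for x
  have F_eq: "F x = l x" if "reach x l" for x l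
  proof -
    have "reach x (SOME l. reach x l)" using someI[of "reach x", OF that] .
    then show ?thesis using near_imp_eq[OF uniq[OF _ that]] by (simp add: F_def)
  qed
  \<comment> \<open>The path to \<open>x\<close> is prolonged by a path inside \<open>V\<close>,
    along which \<open>f\<close> itself is the continuation. So \<open>F\<close>, defined by values
    at end points only, agrees with \<open>f\<close> on all of \<open>V\<close>.\<close>
  have nearF: "near x F f" if reachx: "reach x l" and f: "(V, f) \<in> \<S>" "near x l f" and
       V: "openin (top_of_set U) V" "path_connected V" "x \<in> V" for x l V f
  proof -
    obtain \<gamma> L where g: "path \<gamma>" "path_image \<gamma> \<subseteq> U" "pathstart \<gamma> = x0" "pathfinish \<gamma> = x"
       and L: "cont {0..1} \<gamma> L" "near x0 (L 0) f0" "l = L 1" using reachx unfolding reach_def by blast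
    have VU: "V \<subseteq> U" using V(1) openin_imp_subset by blast
    have "reach y f" if y: "y \<in> V" for y
    proof -
      obtain \<delta> where d: "path \<delta>" "path_image \<delta> \<subseteq> V" "pathstart \<delta> = x" "pathfinish \<delta> = y"
        using V y unfolding path_connected_def by blast
      define \<eta> where "\<eta> = \<gamma> +++ \<delta>"
      have e: "path \<eta>" "path_image \<eta> \<subseteq> U" "pathstart \<eta> = x0" "pathfinish \<eta> = y"
        using g d VU by (auto simp: \<eta>_def path_image_join)
      have eq1: "\<gamma> (2 * t) = \<eta> t" if "t \<in> {0..1/2}" for t
        using that by (simp add: \<eta>_def joinpaths_def)
      have eq2: "\<delta> (2 * t - 1) = \<eta> t" if "t \<in> {1/2..1}" for t
      proof (cases "t = 1/2")
        case True
        show ?thesis unfolding True using g d by (simp add: \<eta>_def joinpaths_def pathfinish_def pathstart_def)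
      next
        case False
        then show ?thesis using that by (simp add: \<eta>_def joinpaths_def)
      qed
      have c1: "cont {0..1/2} \<eta> (\<lambda>t. L (2 * t))"
        by (rule cont_cong[OF cont_compose[OF L(1), of "{0..1/2}" "\<lambda>t. 2 * t"] eq1]) (auto intro!: continuous_intros)
      have "\<eta> t \<in> V \<and> near (\<eta> t) f f" if "t \<in> {1/2..1}" for t
      proof -
        have "\<delta> (2 * t - 1) \<in> path_image \<delta>" using that unfolding path_image_def by (intro imageI) auto
        then have "\<eta> t \<in> V" using d(2) eq2[OF that] by auto
        then show ?thesis using VU by (auto intro: near_refl)
      qed
      then have c2: "cont {1/2..1} \<eta> (\<lambda>_. f)"
        unfolding cont_def using f by (intro ballI exI[of _ V] exI[of _ f] exI[of _ UNIV]) auto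
      have U: "{0..1/2} \<union> {1/2..1} = {0..1::real}" by auto
      have "\<eta> (1/2) = x" using eq1[of "1/2"] g by (simp add: pathfinish_def)
      then have "near (\<eta> k) (L (2 * k)) f" if "k \<in> {0..1/2} \<inter> {1/2..1}" for k
      proof -
        have k: "k = 1/2" using that by auto
        show ?thesis unfolding k using f(2) L(3) \<open>\<eta> (1/2) = x\<close> by simp
      qed
      from cont_glue[OF c1 c2 closed_atLeastAtMost closed_atLeastAtMost, unfolded U, OF _ _ this]
      have "cont {0..1} \<eta> (\<lambda>t. if t \<in> {0..1/2} then L (2 * t) else f)"
        using e by (simp add: path_def path_image_def)
      then show ?thesis
        unfolding reach_def using e L by (intro exI[of _ \<eta>] exI[of _ "\<lambda>t. if t \<in> {0..1/2} then L (2 * t) else f"]) auto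
    qed
    then show ?thesis unfolding near_def using F_eq V by blast
  qed
  have loc: "\<exists>V f. (V, f) \<in> \<S> \<and> x \<in> V \<and> near x l f \<and> near x F f" if l: "reach x l" and x: "x \<in> U" for x l
  proof -
    obtain \<gamma> L where g: "path \<gamma>" "path_image \<gamma> \<subseteq> U" "pathfinish \<gamma> = x"
       and L: "cont {0..1} \<gamma> L" "l = L 1" using l unfolding reach_def by blast
    have x': "x = \<gamma> 1" using g by (simp add: pathfinish_def)
    obtain V where V: "openin (top_of_set U) V" "path_connected V" "\<gamma> 1 \<in> V"
      "\<forall>y\<in>V. \<forall>V' f'. (V', f') \<in> \<S> \<and> y \<in> V' \<longrightarrow> (\<exists>f. (V, f) \<in> \<S> \<and> near y f f')"
      using evenly[OF x] x' by blast
    have H: "continuous_on {0..1} \<gamma>" "\<gamma> ` {0..1} \<subseteq> U" "1 \<in> {0..1::real}"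
      using g by (auto simp: path_def path_image_def)
    obtain f Q where f: "(V, f) \<in> \<S>" "1 \<in> Q" "\<And>k'. k' \<in> {0..1} \<inter> Q \<Longrightarrow> near (\<gamma> k') (L k') f"
      using cont_evenly[OF H(1,2) L(1) H(3) V(1,3,4)] by metis
    have "near x l f" using f(3)[of 1] f(2) L(2) x' by simp
    then show ?thesis using nearF[OF l f(1) _ V(1,2)] V(3) f(1) x' by blast
  qed
  have "reach x0 f0"
  proof -
    have "cont {0..1} (\<lambda>_. x0) (\<lambda>_. f0)"
      unfolding cont_def using f0 near_refl[OF x0] by (intro ballI exI[of _ V0] exI[of _ f0] exI[of _ UNIV]) auto
    then show ?thesis
      unfolding reach_def using x0 near_refl[OF x0]
      by (intro exI[of _ "\<lambda>_. x0"] exI[of _ "\<lambda>_. f0"])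
        (auto simp: path_def path_image_def pathstart_def pathfinish_def)
  qed
  from loc[OF this x0] have "near x0 F f0" using near_sym near_trans by blast
  then show thesis
  proof (rule that)
    fix x assume x: "x \<in> U"
    then obtain l where "reach x l" using ex by blast
    from loc[OF this x] show "\<exists>V f. (V, f) \<in> \<S> \<and> x \<in> V \<and> near x F f" by blast
  qed
qed

end

section \<open>Liouville's equation\<close>

lemma holomorphic_field_derivative:
  assumes "open S" "f holomorphic_on S" "\<And>z. z \<in> S \<Longrightarrow> (f has_field_derivative f' z) (at z)"
  shows "f' holomorphic_on S"
proof -
  have "deriv f holomorphic_on S" using assms holomorphic_deriv by blast
  moreover have "deriv f z = f' z" if "z \<in> S" for z
    using assms(3)[OF that] by (rule DERIV_imp_deriv)
  ultimately show ?thesis by (rule holomorphic_transform)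
qed

text \<open>The names stand for derivatives of \<open>P\<close>: \<open>P1\<close> and
  \<open>P2\<close> are the first two in \<open>z\<close>, \<open>Q\<close> is the third, and
  \<open>P12\<close>, \<open>P112\<close> are \<open>P1\<close>, \<open>P2\<close> differentiated
  once more in conjugate \<open>z\<close>. A solution of a second order equation in \<open>z\<close>
  is a combination of two basis solutions with antiholomorphic coefficients; since \<open>P\<close>
  is real, it is a hermitian form in the basis with constant coefficients. Completing the square
  produces the pair.\<close>

theorem liouville_local:
  fixes P P1 P2 P12 P112 Q W :: "complex \<Rightarrow> complex" and c :: real
  assumes r: "r > 0"
    and wP: "\<And>z. z \<in> ball z0 r \<Longrightarrow> wirt P (P1 z) (cnj (P1 z)) z"
    and wP1: "\<And>z. z \<in> ball z0 r \<Longrightarrow> wirt P1 (P2 z) (P12 z) z"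
    and wP2: "\<And>z. z \<in> ball z0 r \<Longrightarrow> wirt P2 (Q z) (P112 z) z"
    and wP12: "\<And>z. z \<in> ball z0 r \<Longrightarrow> wirt P12 (P112 z) (cnj (P112 z)) z"
    and P_real: "\<And>z. z \<in> ball z0 r \<Longrightarrow> cnj (P z) = P z" "\<And>z. z \<in> ball z0 r \<Longrightarrow> Re (P z) > 0"
    and P12_real: "\<And>z. z \<in> ball z0 r \<Longrightarrow> cnj (P12 z) = P12 z"
    and W: "W holomorphic_on ball z0 r" "\<And>z. z \<in> ball z0 r \<Longrightarrow> W z \<noteq> 0"
    and eq: "\<And>z. z \<in> ball z0 r \<Longrightarrow> P z * P12 z - P1 z * cnj (P1 z) = of_real c * (W z * cnj (W z))"
  obtains \<rho> f1 f2 where "0 < \<rho>" "\<rho> \<le> r" "f1 holomorphic_on ball z0 \<rho>" "f2 holomorphic_on ball z0 \<rho>"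
    "\<And>z. z \<in> ball z0 \<rho> \<Longrightarrow> P z = f1 z * cnj (f1 z) + of_real c * (f2 z * cnj (f2 z))"
    "\<And>z. z \<in> ball z0 \<rho> \<Longrightarrow> cmod (f1 z * deriv f2 z - f2 z * deriv f1 z) = cmod (W z)"
proof -
  define a where "a z = deriv W z / W z" for z
  define q where "q z = (P2 z - a z * P1 z) / P z" for z
  have Pnz: "P z \<noteq> 0" if "z \<in> ball z0 r" for z
    using P_real(2)[OF that] by auto
  have W': "(W has_field_derivative deriv W z) (at z)" if "z \<in> ball z0 r" for z
    by (rule holomorphic_derivI[OF W(1) open_ball that])
  have a_hol: "a holomorphic_on ball z0 r"
    unfolding a_def using W by (auto intro!: holomorphic_intros)
  have a': "wirt a (deriv a z) 0 z" if "z \<in> ball z0 r" for z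
    using a_hol that by (intro wirt_holomorphic holomorphic_derivI) auto
  \<comment> \<open>The derivative of \<open>eq\<close> in \<open>z\<close>, whose right side is
    multiplied by \<open>a = W' / W\<close>. It says exactly that \<open>q\<close> has no derivative
    in conjugate \<open>z\<close>.\<close>
  have eq': "P z * P112 z - P2 z * cnj (P1 z) = a z * (P z * P12 z - P1 z * cnj (P1 z))"
    if z: "z \<in> ball z0 r" for z
  proof -
    have L: "wirt (\<lambda>z. P z * P12 z - P1 z * cnj (P1 z))
      (P1 z * P12 z + P z * P112 z - (P2 z * cnj (P1 z) + P1 z * cnj (P12 z)))
      (cnj (P1 z) * P12 z + P z * cnj (P112 z) - (P12 z * cnj (P1 z) + P1 z * cnj (P2 z))) z"
      by (intro wirt_intros wP[OF z] wP1[OF z] wP12[OF z])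
    have R: "wirt (\<lambda>z. of_real c * (W z * cnj (W z)))
       (0 * (W z * cnj (W z)) + of_real c * (deriv W z * cnj (W z) + W z * cnj 0))
       (0 * (W z * cnj (W z)) + of_real c * (0 * cnj (W z) + W z * cnj (deriv W z))) z"
      by (intro wirt_intros wirt_holomorphic[OF W'[OF z]])
    have "wirt (\<lambda>z. P z * P12 z - P1 z * cnj (P1 z))
       (0 * (W z * cnj (W z)) + of_real c * (deriv W z * cnj (W z) + W z * cnj 0))
       (0 * (W z * cnj (W z)) + of_real c * (0 * cnj (W z) + W z * cnj (deriv W z))) z"
      by (rule wirt_cong[OF R open_ball z]) (simp add: eq)
    from wirt_unique(1)[OF L this] have "P z * P112 z - P2 z * cnj (P1 z) = of_real c * (deriv W z * cnj (W z))"
      by (simp add: P12_real[OF z])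
    also have "\<dots> = a z * (of_real c * (W z * cnj (W z)))"
      using W(2)[OF z] by (simp add: a_def)
    finally show ?thesis using eq[OF z] by simp
  qed
  have "q holomorphic_on ball z0 r"
  proof (rule holomorphic_onI_wirt)
    fix z assume z: "z \<in> ball z0 r"
    have "wirt q (((Q z - (deriv a z * P1 z + a z * P2 z)) * P z - (P2 z - a z * P1 z) * P1 z) / (P z)\<^sup>2)
      (((P112 z - (0 * P1 z + a z * P12 z)) * P z - (P2 z - a z * P1 z) * cnj (P1 z)) / (P z)\<^sup>2) z"
      unfolding q_def by (intro wirt_intros wP[OF z] wP1[OF z] wP2[OF z] a'[OF z] Pnz[OF z])
    moreover have "(P112 z - (0 * P1 z + a z * P12 z)) * P z - (P2 z - a z * P1 z) * cnj (P1 z) = 0"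
      using eq'[OF z] by (simp add: algebra_simps)
    ultimately show "wirt q (((Q z - (deriv a z * P1 z + a z * P2 z)) * P z - (P2 z - a z * P1 z) * P1 z) / (P z)\<^sup>2) 0 z"
      by simp
  qed
  from linear_ode_solution[OF r a_hol this]
  obtain \<rho> where \<rho>: "0 < \<rho>" "\<rho> \<le> r"
    "\<And>\<alpha> \<beta>. \<exists>y u. y z0 = \<alpha> \<and> u z0 = \<beta> \<and> (\<forall>z\<in>ball z0 \<rho>. (y has_field_derivative u z) (at z) \<and>
       (u has_field_derivative a z * u z + q z * y z) (at z))" by metis
  define B where "B = ball z0 \<rho>"
  have B: "open B" "connected B" "z0 \<in> B" "B \<subseteq> ball z0 r"
    using \<rho> by (auto simp: B_def)
  obtain y1 u1 where y1: "y1 z0 = 1" "u1 z0 = 0"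
    "\<forall>z\<in>B. (y1 has_field_derivative u1 z) (at z) \<and> (u1 has_field_derivative a z * u1 z + q z * y1 z) (at z)"
    using \<rho>(3)[of 1 0] unfolding B_def by blast
  obtain y2 u2 where y2: "y2 z0 = 0" "u2 z0 = 1"
    "\<forall>z\<in>B. (y2 has_field_derivative u2 z) (at z) \<and> (u2 has_field_derivative a z * u2 z + q z * y2 z) (at z)"
    using \<rho>(3)[of 0 1] unfolding B_def by blast
  note d1 = y1(3)[rule_format, THEN conjunct1] y1(3)[rule_format, THEN conjunct2]
    y2(3)[rule_format, THEN conjunct1] y2(3)[rule_format, THEN conjunct2]
  note wd = d1[THEN wirt_holomorphic]
  have hol: "y1 holomorphic_on B" "u1 holomorphic_on B" "y2 holomorphic_on B" "u2 holomorphic_on B"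
    by (rule holomorphic_onI_wirt, erule wd)+
  define w where "w z = y1 z * u2 z - y2 z * u1 z" for z
  have w': "(w has_field_derivative a z * w z) (at z)" if z: "z \<in> B" for z
    unfolding w_def by (rule derivative_eq_intros d1 z refl | simp add: algebra_simps)+
  \<comment> \<open>Both \<open>w\<close> and \<open>W\<close> solve \<open>y' = a y\<close>, and
    \<open>w z0 = 1\<close> by the choice of the initial values. This later gives the Wronskian of
    the pair the modulus of \<open>W\<close>.\<close>
  have w_eq: "w z = W z / W z0" if z: "z \<in> B" for z
  proof -
    have D: "((\<lambda>z. w z / W z) has_field_derivative 0) (at v)" if v: "v \<in> B" for v
    proof -
      have v': "v \<in> ball z0 r" using v B by auto
      have "((\<lambda>z. w z / W z) has_field_derivative (a v * w v * W v - w v * deriv W v) / (W v * W v)) (at v)"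
        by (rule DERIV_divide[OF w'[OF v] W'[OF v'] W(2)[OF v']])
      then show ?thesis using W(2)[OF v'] by (simp add: a_def)
    qed
    then have "continuous_on B (\<lambda>z. w z / W z)"
      by (intro continuous_at_imp_continuous_on ballI) (rule DERIV_isCont)
    from DERIV_zero_connected_constant[OF B(2,1) finite.emptyI this] D
    obtain k where k: "\<And>v. v \<in> B \<Longrightarrow> w v / W v = k" by auto
    have "W z \<noteq> 0" "W z0 \<noteq> 0" using W(2) B z by auto
    moreover have "w z0 = 1" using y1 y2 by (simp add: w_def)
    ultimately show ?thesis using k[OF z] k[OF B(3)] by (simp add: field_simps)
  qed
  have w_nz: "w z \<noteq> 0" if "z \<in> B" for z
    using w_eq[OF that] W(2) B that by auto
  \<comment> \<open>The coordinates of \<open>P\<close> in the basis \<open>y1\<close>,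
    \<open>y2\<close>, by Cramer's rule from \<open>P\<close> and \<open>P1\<close>. Because
    \<open>P\<close> solves the same equation as the basis, they do not vary with \<open>z\<close>,
    only with its conjugate.\<close>
  define n1 where "n1 z = (u2 z * P z - y2 z * P1 z) / w z" for z
  define n2 where "n2 z = (y1 z * P1 z - u1 z * P z) / w z" for z
  define b1 where "b1 z = (u2 z * cnj (P1 z) - y2 z * P12 z) / w z" for z
  define b2 where "b2 z = (y1 z * P12 z - u1 z * cnj (P1 z)) / w z" for z
  have P2_eq: "P2 z = a z * P1 z + q z * P z" if "z \<in> B" for z
    using Pnz B that by (simp add: q_def subset_iff)
  have n1: "wirt n1 0 (b1 z) z" and n2: "wirt n2 0 (b2 z) z" if z: "z \<in> B" for z
  proof -
    have z': "z \<in> ball z0 r" using z B by auto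
    note ws = wd[OF z] wP[OF z'] wP1[OF z'] wirt_holomorphic[OF w'[OF z]]
    have "wirt n1 ((((a z * u2 z + q z * y2 z) * P z + u2 z * P1 z - (u2 z * P1 z + y2 z * P2 z)) * w z
         - (u2 z * P z - y2 z * P1 z) * (a z * w z)) / (w z)\<^sup>2)
      (((0 * P z + u2 z * cnj (P1 z) - (0 * P1 z + y2 z * P12 z)) * w z - (u2 z * P z - y2 z * P1 z) * 0) / (w z)\<^sup>2) z"
      unfolding n1_def by (intro wirt_intros ws w_nz[OF z])
    then show "wirt n1 0 (b1 z) z"
      by (rule wirt_eq) (use w_nz[OF z] in \<open>simp_all add: P2_eq[OF z] b1_def field_simps power2_eq_square\<close>)
    have "wirt n2 (((u1 z * P1 z + y1 z * P2 z - ((a z * u1 z + q z * y1 z) * P z + u1 z * P1 z)) * w z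
         - (y1 z * P1 z - u1 z * P z) * (a z * w z)) / (w z)\<^sup>2)
      (((0 * P1 z + y1 z * P12 z - (0 * P z + u1 z * cnj (P1 z))) * w z - (y1 z * P1 z - u1 z * P z) * 0) / (w z)\<^sup>2) z"
      unfolding n2_def by (intro wirt_intros ws w_nz[OF z])
    then show "wirt n2 0 (b2 z) z"
      by (rule wirt_eq) (use w_nz[OF z] in \<open>simp_all add: P2_eq[OF z] b2_def field_simps power2_eq_square\<close>)
  qed
  define m1 M1 m2 M2 where "m1 z = cnj (n1 z)" and "M1 z = cnj (b1 z)" and "m2 z = cnj (n2 z)" and "M2 z = cnj (b2 z)" for z
  have m1': "(m1 has_field_derivative M1 z) (at z)" and m2': "(m2 has_field_derivative M2 z) (at z)"
    if z: "z \<in> B" for z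
    using wirt_cnj[OF n1[OF z]] wirt_cnj[OF n2[OF z]]
    by (auto simp: m1_def[abs_def] m2_def[abs_def] M1_def M2_def intro!: wirt_imp_field)
  have m_hol: "m1 holomorphic_on B" "m2 holomorphic_on B"
    by (rule holomorphic_onI_wirt[where f' = M1], rule wirt_holomorphic, erule m1')
      (rule holomorphic_onI_wirt[where f' = M2], rule wirt_holomorphic, erule m2')
  have M_hol: "M1 holomorphic_on B" "M2 holomorphic_on B"
    using holomorphic_field_derivative[OF B(1) m_hol(1) m1'] holomorphic_field_derivative[OF B(1) m_hol(2) m2'] by simp_all
  have w_hol: "w holomorphic_on B" 
    by (rule holomorphic_onI_wirt, rule wirt_holomorphic, erule w')
  \<comment> \<open>The conjugated coordinates are expanded in the same basis. The resulting matrix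
    is holomorphic, and hermitian because \<open>P\<close> and \<open>P12\<close> are real; its
    entries and their conjugates are thus holomorphic, so they are constant.\<close>
  define C11 C12 C21 C22 where "C11 z = (u2 z * m1 z - y2 z * M1 z) / w z"
    and "C12 z = (y1 z * M1 z - u1 z * m1 z) / w z"
    and "C21 z = (u2 z * m2 z - y2 z * M2 z) / w z"
    and "C22 z = (y1 z * M2 z - u1 z * m2 z) / w z" for z
  have C_hol: "C11 holomorphic_on B" "C12 holomorphic_on B" "C21 holomorphic_on B" "C22 holomorphic_on B"
    unfolding C11_def C12_def C21_def C22_def
    by (intro holomorphic_intros hol m_hol M_hol w_hol w_nz; assumption)+
  have C_cnj: "cnj (C11 z) = C11 z" "cnj (C12 z) = C21 z" "cnj (C22 z) = C22 z" if z: "z \<in> B" for z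
  proof -
    have z': "z \<in> ball z0 r" using z B by auto
    show "cnj (C11 z) = C11 z" "cnj (C12 z) = C21 z" "cnj (C22 z) = C22 z"
      using w_nz[OF z]
      by (simp_all add: C11_def C12_def C21_def C22_def m1_def m2_def M1_def M2_def n1_def n2_def b1_def b2_def
         P_real(1)[OF z'] P12_real[OF z'] field_simps)
  qed
  have const: "C11 z = C11 z0" "C12 z = C12 z0" "C21 z = C21 z0" "C22 z = C22 z0" if z: "z \<in> B" for z
  proof -
    have "(\<lambda>z. cnj (C11 z)) holomorphic_on B" "(\<lambda>z. cnj (C12 z)) holomorphic_on B"
      "(\<lambda>z. cnj (C22 z)) holomorphic_on B"
      by (rule holomorphic_transform[OF C_hol(1)], simp add: C_cnj,
          rule holomorphic_transform[OF C_hol(3)], simp add: C_cnj,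
          rule holomorphic_transform[OF C_hol(4)], simp add: C_cnj)
    note cc = holomorphic_cnj_holomorphic_constant[OF B(1,2) C_hol(1) this(1) B(3) z]
      holomorphic_cnj_holomorphic_constant[OF B(1,2) C_hol(2) this(2) B(3) z]
      holomorphic_cnj_holomorphic_constant[OF B(1,2) C_hol(4) this(3) B(3) z]
    show "C11 z = C11 z0" "C12 z = C12 z0" "C22 z = C22 z0"
      using cc by simp_all
    then show "C21 z = C21 z0" using C_cnj(2)[OF z] C_cnj(2)[OF B(3)] by metis
  qed
  have z0: "z0 \<in> ball z0 r" using r by simp
  have w0: "w z0 = 1" using y1 y2 by (simp add: w_def)
  have C0: "C11 z0 = P z0" "C12 z0 = P1 z0" "C21 z0 = cnj (P1 z0)" "C22 z0 = P12 z0"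
    using y1 y2 w0 P_real(1)[OF z0] P12_real[OF z0]
    by (simp_all add: C11_def C12_def C21_def C22_def m1_def m2_def M1_def M2_def n1_def n2_def b1_def b2_def)
  define p b d where "p = Re (P z0)" and "b = P1 z0" and "d = P12 z0"
  have p: "p > 0" "P z0 = of_real p"
    using P_real[OF z0] by (auto simp: p_def complex_eq_iff)
  have P_eq: "P z = y1 z * (of_real p * cnj (y1 z) + cnj b * cnj (y2 z)) + y2 z * (b * cnj (y1 z) + d * cnj (y2 z))"
    if z: "z \<in> B" for z
  proof -
    have cramer: "(u2 z * m - y2 z * m') / w z * y1 z + (y1 z * m' - u1 z * m) / w z * y2 z = m" for m m'
    proof -
      have "(u2 z * m - y2 z * m') / w z * y1 z + (y1 z * m' - u1 z * m) / w z * y2 z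
          = m * (y1 z * u2 z - y2 z * u1 z) / w z"
        by (simp add: add_divide_distrib diff_divide_distrib algebra_simps)
      then show ?thesis using w_nz[OF z] by (simp add: w_def)
    qed
    have "m1 z = C11 z * y1 z + C12 z * y2 z" "m2 z = C21 z * y1 z + C22 z * y2 z"
      unfolding C11_def C12_def C21_def C22_def cramer by simp_all
    then have "m1 z = of_real p * y1 z + b * y2 z" "m2 z = cnj b * y1 z + d * y2 z"
      unfolding const[OF z] C0 p(2) b_def d_def .
    then have "n1 z = of_real p * cnj (y1 z) + cnj b * cnj (y2 z)" "n2 z = b * cnj (y1 z) + d * cnj (y2 z)"
      using P12_real[OF z0] unfolding m1_def m2_def d_def
      by (metis complex_cnj_add complex_cnj_cnj complex_cnj_mult complex_cnj_complex_of_real)+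
    moreover have "P z = y1 z * n1 z + y2 z * n2 z"
      using cramer[of "P z" "P1 z"] by (simp add: n1_def n2_def mult.commute)
    ultimately show ?thesis by simp
  qed
  define s where "s = complex_of_real (sqrt p)"
  define k where "k = complex_of_real (cmod (W z0))"
  have s: "s * s = of_real p" "cnj s = s" "s \<noteq> 0" and k: "cnj k = k"
    using p by (simp_all add: s_def k_def flip: of_real_mult)
  \<comment> \<open>The determinant of the hermitian form is the Liouville equation at
    \<open>z0\<close>.\<close>
  have kk: "of_real p * d - b * cnj b = of_real c * (k * k)"
    using eq[OF z0] p by (simp add: b_def d_def k_def complex_norm_square power2_eq_square flip: of_real_mult)
       (metis complex_norm_square of_real_power power2_eq_square of_real_mult)
  \<comment> \<open>Completing the square, which is possible because the first diagonal entry
    \<open>p = P z0\<close> is positive. Since \<open>c * k^2\<close> is the determinant, with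
    \<open>k = |W z0|\<close>, no root of \<open>c\<close> is extracted and all signs of
    \<open>c\<close>, as well as \<open>c = 0\<close>, are covered.\<close>
  define f1 f2 where "f1 z = s * y1 z + (b / s) * y2 z" and "f2 z = (k / s) * y2 z" for z
  show thesis
  proof (rule that[OF \<rho>(1,2), of f1 f2])
    show "f1 holomorphic_on ball z0 \<rho>" "f2 holomorphic_on ball z0 \<rho>"
      using hol unfolding f1_def f2_def B_def by (auto intro!: holomorphic_intros)
    fix z assume "z \<in> ball z0 \<rho>"
    then have z: "z \<in> B" by (simp add: B_def)
    have "f1 z * cnj (f1 z) + of_real c * (f2 z * cnj (f2 z)) =
       (s * s) * (y1 z * cnj (y1 z)) + cnj b * (y1 z * cnj (y2 z)) + b * (y2 z * cnj (y1 z))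
        + ((b * cnj b + of_real c * (k * k)) / (s * s)) * (y2 z * cnj (y2 z))"
      using s(2,3) k by (simp add: f1_def f2_def field_simps)
    also have "(b * cnj b + of_real c * (k * k)) / (s * s) = d"
      using kk s p by (simp add: field_simps)
    finally show "P z = f1 z * cnj (f1 z) + of_real c * (f2 z * cnj (f2 z))"
      unfolding P_eq[OF z] s(1) by (simp add: algebra_simps)
    have df: "deriv f1 z = s * u1 z + (b / s) * u2 z" "deriv f2 z = (k / s) * u2 z"
      unfolding f1_def[abs_def] f2_def[abs_def]
      by (intro DERIV_imp_deriv DERIV_add DERIV_cmult d1 z)+
    have "f1 z * deriv f2 z - f2 z * deriv f1 z = k * w z"
      unfolding df f1_def f2_def w_def using s(3) by (simp add: field_simps)
    then show "cmod (f1 z * deriv f2 z - f2 z * deriv f1 z) = cmod (W z)"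
      using W(2)[OF z0] by (simp add: w_eq[OF z] k_def norm_mult norm_divide)
  qed
qed

section \<open>Uniqueness of the representation\<close>

text \<open>The relation and its derivative form a linear system whose determinant is the
  Wronskian.\<close>

lemma wronskian_independent:
  assumes S: "open S" "z \<in> S" and f: "f1 holomorphic_on S" "f2 holomorphic_on S"
    and eq: "\<And>z. z \<in> S \<Longrightarrow> \<alpha> * f1 z + \<beta> * f2 z = 0"
    and W: "f1 z * deriv f2 z - f2 z * deriv f1 z \<noteq> 0"
  shows "\<alpha> = 0" "\<beta> = 0"
proof -
  have "((\<lambda>z. \<alpha> * f1 z + \<beta> * f2 z) has_field_derivative \<alpha> * deriv f1 z + \<beta> * deriv f2 z) (at z)"
    using f S by (auto intro!: derivative_eq_intros holomorphic_derivI)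
  moreover have "((\<lambda>z. \<alpha> * f1 z + \<beta> * f2 z) has_field_derivative 0) (at z)"
    by (rule has_field_derivative_transform_within_open[OF DERIV_const[of 0] S]) (simp add: eq)
  ultimately have d: "\<alpha> * deriv f1 z + \<beta> * deriv f2 z = 0"
    using DERIV_unique by blast
  have "\<alpha> * (f1 z * deriv f2 z - f2 z * deriv f1 z)
      = (\<alpha> * f1 z + \<beta> * f2 z) * deriv f2 z - f2 z * (\<alpha> * deriv f1 z + \<beta> * deriv f2 z)"
    "\<beta> * (f1 z * deriv f2 z - f2 z * deriv f1 z)
      = f1 z * (\<alpha> * deriv f1 z + \<beta> * deriv f2 z) - (\<alpha> * f1 z + \<beta> * f2 z) * deriv f1 z"
    by (simp_all add: algebra_simps)
  then show "\<alpha> = 0" "\<beta> = 0" using d eq[OF S(2)] W by simp_all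
qed

text \<open>Differentiation in conjugate \<open>z\<close> leaves \<open>u\<close> and
  \<open>v\<close> untouched. Together with the relation itself this is a linear system with the
  conjugate Wronskian as determinant.\<close>

lemma sesquilinear_independent:
  assumes S: "open S" "z \<in> S"
    and f: "f1 holomorphic_on S" "f2 holomorphic_on S" "u holomorphic_on S" "v holomorphic_on S"
    and eq: "\<And>z. z \<in> S \<Longrightarrow> cnj (f1 z) * u z + cnj (f2 z) * v z = 0"
    and W: "f1 z * deriv f2 z - f2 z * deriv f1 z \<noteq> 0"
  shows "u z = 0" "v z = 0"
proof -
  have h: "wirt h (deriv h z) 0 z" if "h holomorphic_on S" for h
    using that S by (intro wirt_holomorphic holomorphic_derivI) auto
  have "wirt (\<lambda>z. cnj (f1 z) * u z + cnj (f2 z) * v z)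
      (cnj 0 * u z + cnj (f1 z) * deriv u z + (cnj 0 * v z + cnj (f2 z) * deriv v z))
      (cnj (deriv f1 z) * u z + cnj (f1 z) * 0 + (cnj (deriv f2 z) * v z + cnj (f2 z) * 0)) z"
    by (intro wirt_intros h f)
  moreover have "wirt (\<lambda>z. cnj (f1 z) * u z + cnj (f2 z) * v z) 0 0 z"
    by (rule wirt_cong[OF wirt_const[of 0] S]) (simp add: eq)
  ultimately have d: "cnj (deriv f1 z) * u z + cnj (deriv f2 z) * v z = 0"
    using wirt_unique(2) by fastforce
  have W': "cnj (f1 z) * cnj (deriv f2 z) - cnj (f2 z) * cnj (deriv f1 z) \<noteq> 0"
    using W by (metis complex_cnj_cancel_iff complex_cnj_diff complex_cnj_mult complex_cnj_zero)
  have "u z * (cnj (f1 z) * cnj (deriv f2 z) - cnj (f2 z) * cnj (deriv f1 z))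
     = (cnj (f1 z) * u z + cnj (f2 z) * v z) * cnj (deriv f2 z) - cnj (f2 z) * (cnj (deriv f1 z) * u z + cnj (deriv f2 z) * v z)"
    "v z * (cnj (f1 z) * cnj (deriv f2 z) - cnj (f2 z) * cnj (deriv f1 z))
     = cnj (f1 z) * (cnj (deriv f1 z) * u z + cnj (deriv f2 z) * v z) - (cnj (f1 z) * u z + cnj (f2 z) * v z) * cnj (deriv f1 z)"
    by (simp_all add: algebra_simps)
  then show "u z = 0" "v z = 0" using d eq[OF S(2)] W' by simp_all
qed

text \<open>The condition on the determinant is included because for \<open>c = 0\<close> the form
  is degenerate and its invariance does not bound the determinant.\<close>

definition form_isometry :: "real \<Rightarrow> (complex \<times> complex \<Rightarrow> complex \<times> complex) \<Rightarrow> bool" where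
  "form_isometry c M \<longleftrightarrow> (\<exists>a b d e. M = (\<lambda>(x, y). (a * x + b * y, d * x + e * y)) \<and>
     cmod (a * e - b * d) = 1 \<and>
     (\<forall>x y. (cmod (a * x + b * y))\<^sup>2 + c * (cmod (d * x + e * y))\<^sup>2 = (cmod x)\<^sup>2 + c * (cmod y)\<^sup>2))"

lemma form_isometry_id: "form_isometry c (\<lambda>p. p)"
  unfolding form_isometry_def
  by (rule exI[of _ 1], rule exI[of _ 0], rule exI[of _ 0], rule exI[of _ 1]) auto

lemma form_isometry_compose:
  assumes "form_isometry c M" "form_isometry c M'"
  shows "form_isometry c (\<lambda>p. M (M' p))"
proof -
  obtain a b d e where M: "M = (\<lambda>(x, y). (a * x + b * y, d * x + e * y))" "cmod (a * e - b * d) = 1"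
     "\<And>x y. (cmod (a * x + b * y))\<^sup>2 + c * (cmod (d * x + e * y))\<^sup>2 = (cmod x)\<^sup>2 + c * (cmod y)\<^sup>2"
    using assms(1) unfolding form_isometry_def by blast
  obtain a' b' d' e' where M': "M' = (\<lambda>(x, y). (a' * x + b' * y, d' * x + e' * y))" "cmod (a' * e' - b' * d') = 1"
     "\<And>x y. (cmod (a' * x + b' * y))\<^sup>2 + c * (cmod (d' * x + e' * y))\<^sup>2 = (cmod x)\<^sup>2 + c * (cmod y)\<^sup>2"
    using assms(2) unfolding form_isometry_def by blast
  have lin: "(a * a' + b * d') * x + (a * b' + b * e') * y = a * (a' * x + b' * y) + b * (d' * x + e' * y)"
    "(d * a' + e * d') * x + (d * b' + e * e') * y = d * (a' * x + b' * y) + e * (d' * x + e' * y)" for x y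
    by (simp_all add: algebra_simps)
  have det: "(a * a' + b * d') * (d * b' + e * e') - (a * b' + b * e') * (d * a' + e * d')
     = (a * e - b * d) * (a' * e' - b' * d')" by (simp add: algebra_simps)
  show ?thesis
    unfolding form_isometry_def
    by (rule exI[of _ "a * a' + b * d'"], rule exI[of _ "a * b' + b * e'"],
        rule exI[of _ "d * a' + e * d'"], rule exI[of _ "d * b' + e * e'"])
      (simp add: lin det M(2,3) M'(2,3) norm_mult, simp add: M(1) M'(1) fun_eq_iff algebra_simps)
qed

text \<open>\<open>h1\<close> is controlled by the form. \<open>h2\<close> is controlled by the
  Wronskian instead, since the form does not see it when \<open>c = 0\<close>.\<close>

theorem representation_unique:
  fixes f1 f2 h1 h2 :: "complex \<Rightarrow> complex" and c :: real
  assumes S: "open S" "connected S" "S \<noteq> {}"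
    and f: "f1 holomorphic_on S" "f2 holomorphic_on S" and h: "h1 holomorphic_on S" "h2 holomorphic_on S"
    and eq: "\<And>z. z \<in> S \<Longrightarrow> (cmod (h1 z))\<^sup>2 + c * (cmod (h2 z))\<^sup>2 = (cmod (f1 z))\<^sup>2 + c * (cmod (f2 z))\<^sup>2"
    and Wf: "\<And>z. z \<in> S \<Longrightarrow> f1 z * deriv f2 z - f2 z * deriv f1 z \<noteq> 0"
    and Wh: "\<And>z. z \<in> S \<Longrightarrow> cmod (h1 z * deriv h2 z - h2 z * deriv h1 z) = cmod (f1 z * deriv f2 z - f2 z * deriv f1 z)"
  obtains M where "form_isometry c M" "\<And>z. z \<in> S \<Longrightarrow> (h1 z, h2 z) = M (f1 z, f2 z)"
proof -
  obtain z0 where z0: "z0 \<in> S" using S by blast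
  define wf where "wf z = f1 z * deriv f2 z - f2 z * deriv f1 z" for z
  define wh where "wh z = h1 z * deriv h2 z - h2 z * deriv h1 z" for z
  have wf: "wf z \<noteq> 0" "wh z \<noteq> 0" if "z \<in> S" for z
    using Wf[OF that] Wh[OF that] by (auto simp: wf_def wh_def)
  have dh: "deriv u holomorphic_on S" if "u holomorphic_on S" for u
    using that S(1) by (rule holomorphic_deriv)
  have w_hol: "wf holomorphic_on S" "wh holomorphic_on S"
    unfolding wf_def wh_def by (intro holomorphic_intros f h dh)+
  have d: "(u has_field_derivative deriv u z) (at z)" if "u holomorphic_on S" "z \<in> S" for u z
    using that S(1) by (intro holomorphic_derivI)
  have constI: "u z = u z0" if u: "u holomorphic_on S" "\<And>z. z \<in> S \<Longrightarrow> deriv u z = 0" and z: "z \<in> S" for u z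
  proof -
    have "\<And>v. v \<in> S - {} \<Longrightarrow> (u has_field_derivative 0) (at v)" using d[OF u(1)] u(2) by fastforce
    then obtain k where "\<And>v. v \<in> S \<Longrightarrow> u v = k"
      using DERIV_zero_connected_constant[OF S(2,1) finite.emptyI holomorphic_on_imp_continuous_on[OF u(1)]] by auto
    then show ?thesis using z z0 by simp
  qed
  have eqc: "h1 z * cnj (h1 z) + of_real c * (h2 z * cnj (h2 z)) = f1 z * cnj (f1 z) + of_real c * (f2 z * cnj (f2 z))"
    if "z \<in> S" for z
    using arg_cong[OF eq[OF that], of complex_of_real] unfolding of_real_add of_real_mult complex_norm_square .
  have eqd: "h1 z * cnj (deriv h1 z) + of_real c * (h2 z * cnj (deriv h2 z))
      = f1 z * cnj (deriv f1 z) + of_real c * (f2 z * cnj (deriv f2 z))" if z: "z \<in> S" for z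
  proof -
    note ws = wirt_holomorphic[OF d[OF h(1) z]] wirt_holomorphic[OF d[OF h(2) z]]
       wirt_holomorphic[OF d[OF f(1) z]] wirt_holomorphic[OF d[OF f(2) z]]
    have *: "wirt (\<lambda>z. u z * cnj (u z) + of_real c * (v z * cnj (v z)))
        (u' * cnj (u z) + u z * cnj 0 + (0 * (v z * cnj (v z)) + of_real c * (v' * cnj (v z) + v z * cnj 0)))
        (0 * cnj (u z) + u z * cnj u' + (0 * (v z * cnj (v z)) + of_real c * (0 * cnj (v z) + v z * cnj v'))) z"
      if "wirt u u' 0 z" "wirt v v' 0 z" for u v u' v'
      by (intro wirt_intros that)
    from wirt_unique(2)[OF *[OF ws(1,2)] wirt_cong[OF *[OF ws(3,4)] S(1) z eqc[symmetric]]]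
    show ?thesis by simp
  qed
  \<comment> \<open>The form identity and its derivative in conjugate \<open>z\<close> are two
    linear equations for \<open>h1\<close> and \<open>c * h2\<close>. Eliminating
    \<open>c * h2\<close> expresses \<open>h1\<close> by \<open>f1\<close>, \<open>f2\<close> with
    antiholomorphic coefficients \<open>cnj a\<close>, \<open>cnj b\<close>.\<close>
  define a where "a z = (f1 z * deriv h2 z - deriv f1 z * h2 z) / wh z" for z
  define b where "b z = of_real c * (f2 z * deriv h2 z - deriv f2 z * h2 z) / wh z" for z
  have ab_hol: "a holomorphic_on S" "b holomorphic_on S"
    unfolding a_def b_def using wf(2) by (auto intro!: holomorphic_intros f h dh w_hol)
  have h1_eq: "h1 z = cnj (a z) * f1 z + cnj (b z) * f2 z" if z: "z \<in> S" for z
  proof -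
    have "h1 z * cnj (wh z) = (h1 z * cnj (h1 z) + of_real c * (h2 z * cnj (h2 z))) * cnj (deriv h2 z)
        - (h1 z * cnj (deriv h1 z) + of_real c * (h2 z * cnj (deriv h2 z))) * cnj (h2 z)"
      by (simp add: wh_def algebra_simps)
    also have "\<dots> = cnj (f1 z * deriv h2 z - deriv f1 z * h2 z) * f1 z
        + cnj (of_real c * (f2 z * deriv h2 z - deriv f2 z * h2 z)) * f2 z"
      unfolding eqc[OF z] eqd[OF z] by (simp add: algebra_simps)
    finally have "h1 z = (cnj (f1 z * deriv h2 z - deriv f1 z * h2 z) * f1 z
        + cnj (of_real c * (f2 z * deriv h2 z - deriv f2 z * h2 z)) * f2 z) / cnj (wh z)"
      using wf(2)[OF z] by (simp only: eq_divide_eq complex_cnj_zero_iff not_False_eq_True if_True)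
    then show ?thesis
      by (simp only: a_def b_def add_divide_distrib complex_cnj_divide times_divide_eq_left)
  qed
  \<comment> \<open>As \<open>h1\<close> is holomorphic, differentiating the combination in
    conjugate \<open>z\<close> gives a vanishing relation between \<open>f1\<close> and
    \<open>f2\<close>, to which \<open>sesquilinear_independent\<close> applies.\<close>
  have "deriv a z = 0 \<and> deriv b z = 0" if z: "z \<in> S" for z
  proof -
    have "cnj (f1 v) * deriv a v + cnj (f2 v) * deriv b v = 0" if v: "v \<in> S" for v
    proof -
      have "wirt (\<lambda>z. cnj (a z) * f1 z + cnj (b z) * f2 z)
         (cnj 0 * f1 v + cnj (a v) * deriv f1 v + (cnj 0 * f2 v + cnj (b v) * deriv f2 v))
         (cnj (deriv a v) * f1 v + cnj (a v) * 0 + (cnj (deriv b v) * f2 v + cnj (b v) * 0)) v"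
        by (intro wirt_intros wirt_holomorphic d v f ab_hol)
      from wirt_cong[OF this S(1) v h1_eq[symmetric]] wirt_holomorphic[OF d[OF h(1) v]]
      have "cnj (deriv a v) * f1 v + cnj (deriv b v) * f2 v = 0"
        using wirt_unique(2) by fastforce
      then have "cnj (cnj (deriv a v) * f1 v + cnj (deriv b v) * f2 v) = 0" by simp
      then show ?thesis by (simp add: mult.commute)
    qed
    from sesquilinear_independent[OF S(1) z f dh[OF ab_hol(1)] dh[OF ab_hol(2)] this Wf[OF z]]
    show ?thesis by simp
  qed
  then have ab: "a z = a z0" "b z = b z0" if "z \<in> S" for z
    using constI[OF ab_hol(1) _ that] constI[OF ab_hol(2) _ that] by simp_all
  define \<alpha> \<beta> where "\<alpha> = cnj (a z0)" and "\<beta> = cnj (b z0)"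
  have h1: "h1 z = \<alpha> * f1 z + \<beta> * f2 z" if "z \<in> S" for z
    using h1_eq[OF that] ab[OF that] by (simp add: \<alpha>_def \<beta>_def)
  \<comment> \<open>Cramer's rule for \<open>h2\<close> and its derivative; the coefficients
    \<open>x\<close>, \<open>y\<close> are holomorphic functions that have yet to be shown
    constant.\<close>
  define x where "x z = (h2 z * deriv f2 z - deriv h2 z * f2 z) / wf z" for z
  define y where "y z = (f1 z * deriv h2 z - deriv f1 z * h2 z) / wf z" for z
  have xy_hol: "x holomorphic_on S" "y holomorphic_on S"
    unfolding x_def y_def using wf(1) by (auto intro!: holomorphic_intros f h dh w_hol)
  have h2: "h2 z = x z * f1 z + y z * f2 z" "deriv h2 z = x z * deriv f1 z + y z * deriv f2 z" if z: "z \<in> S" for z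
    using wf(1)[OF z] by (simp_all add: x_def y_def field_simps) (simp_all add: wf_def algebra_simps)
  have h1d: "deriv h1 z = \<alpha> * deriv f1 z + \<beta> * deriv f2 z" if z: "z \<in> S" for z
  proof -
    have "((\<lambda>z. \<alpha> * f1 z + \<beta> * f2 z) has_field_derivative \<alpha> * deriv f1 z + \<beta> * deriv f2 z) (at z)"
      by (auto intro!: derivative_eq_intros d f z)
    from has_field_derivative_transform_within_open[OF this S(1) z h1[symmetric]] show ?thesis
      by (rule DERIV_imp_deriv)
  qed
  have whf: "wh z = (\<alpha> * y z - \<beta> * x z) * wf z" if z: "z \<in> S" for z
    unfolding wh_def h1[OF z] h2[OF z] h1d[OF z] by (simp add: wf_def algebra_simps)
  \<comment> \<open>The quotient of the two Wronskians. Being holomorphic of modulus 1, it has the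
    holomorphic function \<open>inverse \<theta>\<close> as its conjugate and is constant.\<close>
  define \<theta> where "\<theta> z = \<alpha> * y z - \<beta> * x z" for z
  have \<theta>1: "cmod (\<theta> z) = 1" if z: "z \<in> S" for z
    using Wh[OF z] whf[OF z] wf(1)[OF z] by (simp add: wh_def[symmetric] wf_def[symmetric] \<theta>_def norm_mult)
  have \<theta>_hol: "\<theta> holomorphic_on S" unfolding \<theta>_def by (intro holomorphic_intros xy_hol)
  have \<theta>_cnj: "(\<lambda>z. cnj (\<theta> z)) holomorphic_on S"
  proof -
    have "cnj (\<theta> z) = inverse (\<theta> z)" if "z \<in> S" for z
    proof -
      have "\<theta> z * cnj (\<theta> z) = 1" using complex_norm_square[of "\<theta> z"] \<theta>1[OF that] by simp
      then show ?thesis by (metis inverse_unique)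
    qed
    moreover have "(\<lambda>z. inverse (\<theta> z)) holomorphic_on S"
      using \<theta>1 by (intro holomorphic_intros \<theta>_hol) force
    ultimately show ?thesis using holomorphic_transform[of "\<lambda>z. inverse (\<theta> z)" S] by simp
  qed
  have \<theta>c: "\<theta> z = \<theta> z0" if "z \<in> S" for z
    using holomorphic_cnj_holomorphic_constant[OF S(1,2) \<theta>_hol \<theta>_cnj z0 that] .
  have xy': "\<alpha> * deriv y z = \<beta> * deriv x z" if z: "z \<in> S" for z
  proof -
    have "(\<theta> has_field_derivative \<alpha> * deriv y z - \<beta> * deriv x z) (at z)"
      unfolding \<theta>_def by (auto intro!: derivative_eq_intros d xy_hol z)
    moreover have "(\<theta> has_field_derivative 0) (at z)"
      by (rule has_field_derivative_transform_within_open[OF DERIV_const[of "\<theta> z0"] S(1) z]) (simp add: \<theta>c)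
    ultimately show ?thesis using DERIV_unique by fastforce
  qed
  have xy0: "deriv x z * f1 z + deriv y z * f2 z = 0" if z: "z \<in> S" for z
  proof -
    have "((\<lambda>z. x z * f1 z + y z * f2 z) has_field_derivative
       deriv x z * f1 z + x z * deriv f1 z + (deriv y z * f2 z + y z * deriv f2 z)) (at z)"
      by (auto intro!: derivative_eq_intros d xy_hol f z)
    from has_field_derivative_transform_within_open[OF this S(1) z h2(1)[symmetric]]
    have "deriv h2 z = deriv x z * f1 z + x z * deriv f1 z + (deriv y z * f2 z + y z * deriv f2 z)"
      by (rule DERIV_imp_deriv)
    then show ?thesis using h2(2)[OF z] by (simp add: algebra_simps)
  qed
  \<comment> \<open>At a zero of \<open>h1\<close> the product is differentiated once: there the
    derivative of \<open>h1\<close> cannot vanish, by the Wronskian.\<close>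
  have zero: "u z = 0" if u: "u holomorphic_on S" "\<And>z. z \<in> S \<Longrightarrow> u z * h1 z = 0" and z: "z \<in> S" for u z
  proof (cases "h1 z = 0")
    case True
    have "((\<lambda>z. u z * h1 z) has_field_derivative deriv u z * h1 z + u z * deriv h1 z) (at z)"
      by (auto intro!: derivative_eq_intros d u h z)
    moreover have "((\<lambda>z. u z * h1 z) has_field_derivative 0) (at z)"
      by (rule has_field_derivative_transform_within_open[OF DERIV_const[of 0] S(1) z]) (simp add: u)
    ultimately have "deriv u z * h1 z + u z * deriv h1 z = 0" using DERIV_unique by blast
    moreover have "deriv h1 z \<noteq> 0" using wf(2)[OF z] True by (auto simp: wh_def)
    ultimately show ?thesis using True by simp
  next
    case False
    then show ?thesis using u(2)[OF z] by simp
  qed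
  have "deriv x z * h1 z = 0" "deriv y z * h1 z = 0" if z: "z \<in> S" for z
  proof -
    have "deriv x z * h1 z = \<alpha> * (deriv x z * f1 z + deriv y z * f2 z) - (\<alpha> * deriv y z - \<beta> * deriv x z) * f2 z"
      "deriv y z * h1 z = \<beta> * (deriv x z * f1 z + deriv y z * f2 z) + (\<alpha> * deriv y z - \<beta> * deriv x z) * f1 z"
      unfolding h1[OF z] by (simp_all add: algebra_simps)
    then show "deriv x z * h1 z = 0" "deriv y z * h1 z = 0" using xy0[OF z] xy'[OF z] by simp_all
  qed
  then have "deriv x z = 0" "deriv y z = 0" if "z \<in> S" for z
    using zero[OF dh[OF xy_hol(1)] _ that] zero[OF dh[OF xy_hol(2)] _ that] by simp_all
  then have xyc: "x z = x z0" "y z = y z0" if "z \<in> S" for z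
    using constI[OF xy_hol(1) _ that] constI[OF xy_hol(2) _ that] by simp_all
  define \<gamma> \<delta> where "\<gamma> = x z0" and "\<delta> = y z0"
  have h2': "h2 z = \<gamma> * f1 z + \<delta> * f2 z" if "z \<in> S" for z
    using h2(1)[OF that] xyc[OF that] by (simp add: \<gamma>_def \<delta>_def)
  \<comment> \<open>The coefficients of the transformed form minus the original one. The difference
    vanishes on all values of the pair \<open>f1\<close>, \<open>f2\<close>; sesquilinear and then
    linear independence annihilate every coefficient.\<close>
  define k11 k21 k12 k22 where "k11 = \<alpha> * cnj \<alpha> + of_real c * (\<gamma> * cnj \<gamma>) - 1"
    and "k21 = \<beta> * cnj \<alpha> + of_real c * (\<delta> * cnj \<gamma>)"
    and "k12 = \<alpha> * cnj \<beta> + of_real c * (\<gamma> * cnj \<delta>)"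
    and "k22 = \<beta> * cnj \<beta> + of_real c * (\<delta> * cnj \<delta>) - of_real c"
  have form: "(\<alpha> * X + \<beta> * Y) * cnj (\<alpha> * X + \<beta> * Y) + of_real c * ((\<gamma> * X + \<delta> * Y) * cnj (\<gamma> * X + \<delta> * Y))
      - (X * cnj X + of_real c * (Y * cnj Y)) = cnj X * (k11 * X + k21 * Y) + cnj Y * (k12 * X + k22 * Y)" for X Y
    by (simp add: k11_def k12_def k21_def k22_def algebra_simps)
  have "k11 * f1 z + k21 * f2 z = 0 \<and> k12 * f1 z + k22 * f2 z = 0" if z: "z \<in> S" for z
  proof -
    have "cnj (f1 v) * (k11 * f1 v + k21 * f2 v) + cnj (f2 v) * (k12 * f1 v + k22 * f2 v) = 0" if v: "v \<in> S" for v
      using eqc[OF v] form[of "f1 v" "f2 v"] h1[OF v] h2'[OF v] by simp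
    moreover have "(\<lambda>z. k11 * f1 z + k21 * f2 z) holomorphic_on S" "(\<lambda>z. k12 * f1 z + k22 * f2 z) holomorphic_on S"
      by (intro holomorphic_intros f)+
    ultimately show ?thesis
      using sesquilinear_independent[OF S(1) z f _ _ _ Wf[OF z],
        of "\<lambda>z. k11 * f1 z + k21 * f2 z" "\<lambda>z. k12 * f1 z + k22 * f2 z"] by simp
  qed
  then have k: "k11 = 0" "k21 = 0" "k12 = 0" "k22 = 0"
    using wronskian_independent[OF S(1) z0 f _ Wf[OF z0], of k11 k21]
      wronskian_independent[OF S(1) z0 f _ Wf[OF z0], of k12 k22] by simp_all
  have "(cmod (\<alpha> * X + \<beta> * Y))\<^sup>2 + c * (cmod (\<gamma> * X + \<delta> * Y))\<^sup>2 = (cmod X)\<^sup>2 + c * (cmod Y)\<^sup>2" for X Y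
  proof -
    have "complex_of_real ((cmod (\<alpha> * X + \<beta> * Y))\<^sup>2 + c * (cmod (\<gamma> * X + \<delta> * Y))\<^sup>2) = of_real ((cmod X)\<^sup>2 + c * (cmod Y)\<^sup>2)"
      using form[of X Y] k unfolding of_real_add of_real_mult complex_norm_square by simp
    then show ?thesis by (simp only: of_real_eq_iff)
  qed
  moreover have "cmod (\<alpha> * \<delta> - \<beta> * \<gamma>) = 1"
    using \<theta>1[OF z0] by (simp add: \<theta>_def \<gamma>_def \<delta>_def)
  ultimately have "form_isometry c (\<lambda>(x, y). (\<alpha> * x + \<beta> * y, \<gamma> * x + \<delta> * y))"
    unfolding form_isometry_def by blast
  then show thesis using that h1 h2' by auto
qed

section \<open>Wirtinger operators on smooth functions\<close>

definition Dz :: "(complex \<Rightarrow> complex) \<Rightarrow> complex \<Rightarrow> complex" where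
  "Dz f z = (du f z - \<i> * dv f z) / 2"

definition Db :: "(complex \<Rightarrow> complex) \<Rightarrow> complex \<Rightarrow> complex" where
  "Db f z = (du f z + \<i> * dv f z) / 2"

lemma wirt_Dz_Db:
  assumes "f differentiable (at z)"
  shows "wirt f (Dz f z) (Db f z) z"
proof -
  have "(\<lambda>h. Re h *\<^sub>R du f z + Im h *\<^sub>R dv f z) = (\<lambda>h. Dz f z * h + Db f z * cnj h)"
    by (rule ext) (auto simp: Dz_def Db_def complex_eq_iff field_simps)
  with differentiable_has_derivative_du_dv[OF assms] show ?thesis by (simp add: wirt_def)
qed

lemma wirt_imp_Dz_Db:
  assumes "wirt f a b z"
  shows "Dz f z = a" "Db f z = b"
proof -
  have "f differentiable (at z)" using assms by (auto simp: wirt_def differentiable_def)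
  from wirt_unique[OF wirt_Dz_Db[OF this] assms] show "Dz f z = a" "Db f z = b" by auto
qed

lemma Ck_on_cmult: "open W \<Longrightarrow> Ck_on k W f \<Longrightarrow> Ck_on k W (\<lambda>w. c * f w :: complex)"
  by (rule Ck_on_bounded_linear[OF _ bounded_linear_mult_right])

lemma Ck_on_Dz_Db:
  assumes "open W" "Ck_on (Suc k) W f"
  shows "Ck_on k W (Dz f)" "Ck_on k W (Db f)"
proof -
  have "Ck_on k W (\<lambda>z. (1/2) * du f z + (- \<i> / 2) * dv f z)" "Ck_on k W (\<lambda>z. (1/2) * du f z + (\<i> / 2) * dv f z)"
    by (intro Ck_on_add Ck_on_cmult; use assms in simp)+
  moreover have "(\<lambda>z. (1/2) * du f z + (- \<i> / 2) * dv f z) = Dz f" "(\<lambda>z. (1/2) * du f z + (\<i> / 2) * dv f z) = Db f"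
    by (simp_all add: fun_eq_iff Dz_def Db_def field_simps)
  ultimately show "Ck_on k W (Dz f)" "Ck_on k W (Db f)" by simp_all
qed

lemma Ck_on_differentiable: "Ck_on (Suc k) W f \<Longrightarrow> z \<in> W \<Longrightarrow> f differentiable (at z)"
  by simp

lemma du_dv_comb:
  fixes f g :: "complex \<Rightarrow> complex"
  assumes "f differentiable (at z)" "g differentiable (at z)"
  shows "du (\<lambda>w. (f w + c * g w) / 2) z = (du f z + c * du g z) / 2"
    "dv (\<lambda>w. (f w + c * g w) / 2) z = (dv f z + c * dv g z) / 2"
proof -
  have D: "((\<lambda>w. (f w + c * g w) * (1/2)) has_derivative
     (\<lambda>h. ((Re h *\<^sub>R du f z + Im h *\<^sub>R dv f z) + c * (Re h *\<^sub>R du g z + Im h *\<^sub>R dv g z)) * (1/2))) (at z)"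
    by (intro has_derivative_mult_left has_derivative_add has_derivative_mult_right
        differentiable_has_derivative_du_dv assms)
  show "du (\<lambda>w. (f w + c * g w) / 2) z = (du f z + c * du g z) / 2"
    "dv (\<lambda>w. (f w + c * g w) / 2) z = (dv f z + c * dv g z) / 2"
    using du_dv_has_derivative[OF D] by simp_all
qed

lemma Dz_Db_commute:
  assumes "open W" "z \<in> W" "Ck_on 2 W f"
  shows "Dz (Db f) z = Db (Dz f) z"
proof -
  have d: "du f differentiable (at z)" "dv f differentiable (at z)"
    using assms by (auto simp: numeral_2_eq_2)
  have "Db f = (\<lambda>w. (du f w + \<i> * dv f w) / 2)" "Dz f = (\<lambda>w. (du f w + (- \<i>) * dv f w) / 2)"
    by (simp_all add: fun_eq_iff Dz_def Db_def)
  then have *: "Dz (Db f) z = ((du (du f) z + \<i> * du (dv f) z) / 2 - \<i> * ((dv (du f) z + \<i> * dv (dv f) z) / 2)) / 2"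
    "Db (Dz f) z = ((du (du f) z + (- \<i>) * du (dv f) z) / 2 + \<i> * ((dv (du f) z + (- \<i>) * dv (dv f) z) / 2)) / 2"
    unfolding Dz_def[of "Db f"] Db_def[of "Dz f"] by (simp_all only: du_dv_comb[OF d])
  show ?thesis
    unfolding * mixed_partials[OF assms] by (simp add: field_simps)
qed

lemma Ck_on_of_real: "open W \<Longrightarrow> Ck_on k W p \<Longrightarrow> Ck_on k W (\<lambda>w. complex_of_real (p w))"
  by (rule Ck_on_bounded_linear[OF _ bounded_linear_of_real])

lemma Dz_of_real:
  assumes "p differentiable (at z)"
  shows "Dz (\<lambda>w. complex_of_real (p w)) z = (of_real (du p z) - \<i> * of_real (dv p z)) / 2"
    "Db (\<lambda>w. complex_of_real (p w)) z = cnj (Dz (\<lambda>w. complex_of_real (p w)) z)"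
  using du_dv_bounded_linear[OF bounded_linear_of_real[where ?'a = complex] assms]
  by (simp_all add: Dz_def Db_def)

lemma laplacian_wirt:
  fixes p :: "complex \<Rightarrow> real"
  assumes W: "open W" "z \<in> W" "Ck_on 2 W p"
  shows "Db (Dz (\<lambda>w. complex_of_real (p w))) z = of_real ((du (du p) z + dv (dv p) z) / 4)"
proof -
  have d: "w \<in> W \<Longrightarrow> p differentiable (at w)" "w \<in> W \<Longrightarrow> du p differentiable (at w)" "w \<in> W \<Longrightarrow> dv p differentiable (at w)" for w
    using W by (auto simp: numeral_2_eq_2)
  note lin = bounded_linear_of_real[where ?'a = complex]
  have dd: "(\<lambda>w. complex_of_real (du p w)) differentiable (at z)" "(\<lambda>w. complex_of_real (dv p w)) differentiable (at z)"
    using d W by (auto intro!: bounded_linear_differentiable[OF lin])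
  have eq: "Dz (\<lambda>w. complex_of_real (p w)) w = (of_real (du p w) + (- \<i>) * of_real (dv p w)) / 2" if "w \<in> W" for w
    using Dz_of_real(1)[OF d(1)[OF that]] by simp
  have *: "du (Dz (\<lambda>w. complex_of_real (p w))) z = (of_real (du (du p) z) - \<i> * of_real (du (dv p) z)) / 2"
    "dv (Dz (\<lambda>w. complex_of_real (p w))) z = (of_real (dv (du p) z) - \<i> * of_real (dv (dv p) z)) / 2"
    using du_dv_cong(1,2)[OF W(1,2) eq] du_dv_comb[OF dd, of "- \<i>"]
      du_dv_bounded_linear[OF lin d(2)[OF W(2)]] du_dv_bounded_linear[OF lin d(3)[OF W(2)]] by simp_all
  show ?thesis
    unfolding Db_def * mixed_partials[OF W] by (simp add: field_simps)
qed

lemma Ck_on_norm_square_holomorphic: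
  assumes "open W" "f holomorphic_on W"
  shows "Ck_on k W (\<lambda>w. (cmod (f w))\<^sup>2)"
proof -
  have "(\<lambda>w. - \<i> * f w) holomorphic_on W"
    by (intro holomorphic_intros assms)
  then have "Ck_on k W (\<lambda>w. Re (f w) * Re (f w) + Re (- \<i> * f w) * Re (- \<i> * f w))"
    by (intro Ck_on_add Ck_on_mult Ck_on_Re_holomorphic assms)
  moreover have "(\<lambda>w. Re (f w) * Re (f w) + Re (- \<i> * f w) * Re (- \<i> * f w)) = (\<lambda>w. (cmod (f w))\<^sup>2)"
    by (simp add: fun_eq_iff cmod_power2 flip: power2_eq_square)
  ultimately show ?thesis by simp
qed

text \<open>The derivative hypotheses of \<open>liouville_local\<close> for a real function of class
  C^3: the mixed derivatives commute, and the derivative in \<open>z\<close> and its conjugate is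
  real, being a quarter of the Laplacian.\<close>

lemma wirt_real_facts:
  fixes p :: "complex \<Rightarrow> real"
  assumes W: "open W" "z \<in> W" "Ck_on 3 W p"
  defines "P \<equiv> \<lambda>w. complex_of_real (p w)"
  shows "wirt P (Dz P z) (cnj (Dz P z)) z"
    "wirt (Dz P) (Dz (Dz P) z) (Db (Dz P) z) z"
    "wirt (Dz (Dz P)) (Dz (Dz (Dz P)) z) (Dz (Db (Dz P)) z) z"
    "wirt (Db (Dz P)) (Dz (Db (Dz P)) z) (cnj (Dz (Db (Dz P)) z)) z"
    "cnj (Db (Dz P) z) = Db (Dz P) z"
proof -
  have C: "Ck_on (Suc 2) W P" "Ck_on (Suc 2) W p"
    using Ck_on_of_real[OF W(1,3)] W(3) by (simp_all add: P_def numeral_3_eq_3 numeral_2_eq_2)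
  have C2: "Ck_on 2 W p" "Ck_on (Suc 1) W (Dz P)" "Ck_on 2 W (Dz P)"
    using Ck_on_Suc_imp[OF C(2)] Ck_on_Dz_Db[OF W(1) C(1)] by (simp_all add: numeral_2_eq_2)
  have C1: "Ck_on (Suc 0) W (Dz (Dz P))" "Ck_on (Suc 0) W (Db (Dz P))"
    using Ck_on_Dz_Db[OF W(1) C2(2)] by simp_all
  show "wirt P (Dz P z) (cnj (Dz P z)) z"
    using wirt_Dz_Db[OF Ck_on_differentiable[OF C(1) W(2)]]
      Dz_of_real(2)[OF Ck_on_differentiable[OF C(2) W(2)]] by (simp add: P_def)
  show "wirt (Dz P) (Dz (Dz P) z) (Db (Dz P) z) z"
    using wirt_Dz_Db[OF Ck_on_differentiable[OF C2(2) W(2)]] .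
  show "wirt (Dz (Dz P)) (Dz (Dz (Dz P)) z) (Dz (Db (Dz P)) z) z"
    using wirt_Dz_Db[OF Ck_on_differentiable[OF C1(1) W(2)]] Dz_Db_commute[OF W(1,2) C2(3)] by simp
  have real: "Db (Dz P) w = complex_of_real ((du (du p) w + dv (dv p) w) / 4)" if "w \<in> W" for w
    using laplacian_wirt[OF W(1) that C2(1)] by (simp add: P_def)
  have real': "cnj (Db (Dz P) w) = Db (Dz P) w" if "w \<in> W" for w
    unfolding real[OF that] by (simp only: complex_cnj_complex_of_real)
  then show "cnj (Db (Dz P) z) = Db (Dz P) z" using W(2) .
  have "wirt (Db (Dz P)) (Dz (Db (Dz P)) z) (Db (Db (Dz P)) z) z"
    using wirt_Dz_Db[OF Ck_on_differentiable[OF C1(2) W(2)]] .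
  moreover from wirt_cong[OF wirt_cnj[OF this] W(1,2) real']
  have "wirt (Db (Dz P)) (cnj (Db (Db (Dz P)) z)) (cnj (Dz (Db (Dz P)) z)) z" by simp
  ultimately show "wirt (Db (Dz P)) (Dz (Db (Dz P)) z) (cnj (Dz (Db (Dz P)) z)) z"
    using wirt_unique(2) by metis
qed

text \<open>
  The support function \<open>2 s\<^sup>2\<close> of a surface with Gauss map \<open>G\<close> becomes a solution of Liouville's
  equation after multiplication of \<open>s\<close> by \<open>1 + |G|\<^sup>2\<close>.
\<close>

lemma support_liouville_identity:
  fixes s :: "complex \<Rightarrow> real"
  assumes V: "open V" "z \<in> V" and s: "Ck_on 2 V s" and G: "G holomorphic_on V" and e: "e * e = (1::real)"
  defines "\<psi> \<equiv> \<lambda>w. e * (2 * (s w * s w))"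
    and "P \<equiv> \<lambda>w. complex_of_real (s w * (1 + (cmod (G w))\<^sup>2))"
    and "T \<equiv> 1 + (cmod (G z))\<^sup>2"
  shows "complex_of_real (\<psi> z * (du (du \<psi>) z + dv (dv \<psi>) z) + 2 * (4 * (cmod (deriv G z))\<^sup>2 / T\<^sup>2) * (\<psi> z)\<^sup>2
      - ((du \<psi> z)\<^sup>2 + (dv \<psi> z)\<^sup>2))
    = of_real (32 * (s z)\<^sup>2 / T\<^sup>2) * (P z * Db (Dz P) z - Dz P z * cnj (Dz P z))"
proof -
  define S where "S w = complex_of_real (s w)" for w
  have C: "Ck_on (Suc 1) V s" using s by (simp add: numeral_2_eq_2)
  have dS: "wirt S (Dz S w) (cnj (Dz S w)) w" if "w \<in> V" for w
    using wirt_Dz_Db[OF Ck_on_differentiable[OF Ck_on_of_real[OF V(1) C] that]]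
      Dz_of_real(2)[OF Ck_on_differentiable[OF C that]] by (simp add: S_def[abs_def])
  have dS1: "wirt (Dz S) (Dz (Dz S) w) (Db (Dz S) w) w" if "w \<in> V" for w
    using wirt_Dz_Db[OF Ck_on_differentiable[OF Ck_on_Dz_Db(1)[OF V(1)] that], of 0 S]
      Ck_on_of_real[OF V(1) C] by (simp add: S_def[abs_def])
  have dG: "wirt G (deriv G w) 0 w" if "w \<in> V" for w
    using holomorphic_derivI[OF G V(1) that] by (rule wirt_holomorphic)
  have dG': "wirt (deriv G) (deriv (deriv G) w) 0 w" if "w \<in> V" for w
    using holomorphic_derivI[OF holomorphic_deriv[OF G V(1)] V(1) that] by (rule wirt_holomorphic)
  define E where "E = complex_of_real e"
  \<comment> \<open>The identity is homogeneous of degree two in the support function, so the sign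
    \<open>e\<close> cancels.\<close>
  have E: "E * E = 1" using e by (simp add: E_def flip: of_real_mult)
  define \<Psi> where "\<Psi> w = complex_of_real (\<psi> w)" for w
  have \<Psi>: "\<Psi> = (\<lambda>w. E * (2 * (S w * S w)))" by (auto simp: \<Psi>_def \<psi>_def S_def E_def)
  have P: "P = (\<lambda>w. S w * (1 + G w * cnj (G w)))"
    unfolding P_def S_def of_real_mult of_real_add complex_norm_square by simp
  define T' where "T' = 1 + G z * cnj (G z)"
  have "T > 0" by (simp add: T_def add_pos_nonneg)
  moreover have "complex_of_real T = T'"
    unfolding T_def T'_def of_real_add complex_norm_square by simp
  ultimately have T': "complex_of_real T = T'" "T' \<noteq> 0" by auto
  have \<Psi>1: "Dz \<Psi> w = E * (4 * (S w * Dz S w))" if w: "w \<in> V" for w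
  proof -
    have "wirt \<Psi> (0 * (2 * (S w * S w)) + E * (0 * (S w * S w) + 2 * (Dz S w * S w + S w * Dz S w)))
      (0 * (2 * (S w * S w)) + E * (0 * (S w * S w) + 2 * (cnj (Dz S w) * S w + S w * cnj (Dz S w)))) w"
      unfolding \<Psi> by (intro wirt_intros dS w)
    from wirt_imp_Dz_Db(1)[OF this] show ?thesis by (simp add: algebra_simps)
  qed
  have \<Psi>12: "Db (Dz \<Psi>) z = E * (4 * (cnj (Dz S z) * Dz S z + S z * Db (Dz S) z))"
  proof -
    have "wirt (\<lambda>w. E * (4 * (S w * Dz S w)))
      (0 * (4 * (S z * Dz S z)) + E * (0 * (S z * Dz S z) + 4 * (Dz S z * Dz S z + S z * Dz (Dz S) z)))
      (0 * (4 * (S z * Dz S z)) + E * (0 * (S z * Dz S z) + 4 * (cnj (Dz S z) * Dz S z + S z * Db (Dz S) z))) z"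
      by (intro wirt_intros dS dS1 V)
    from wirt_imp_Dz_Db(2)[OF wirt_cong[OF this V \<Psi>1[symmetric]]] show ?thesis by simp
  qed
  have P1: "Dz P w = Dz S w * (1 + G w * cnj (G w)) + S w * (deriv G w * cnj (G w))" if w: "w \<in> V" for w
  proof -
    have "wirt P (Dz S w * (1 + G w * cnj (G w)) + S w * (0 + (deriv G w * cnj (G w) + G w * cnj 0)))
      (cnj (Dz S w) * (1 + G w * cnj (G w)) + S w * (0 + (0 * cnj (G w) + G w * cnj (deriv G w)))) w"
      unfolding P by (intro wirt_intros dS dG w)
    from wirt_imp_Dz_Db(1)[OF this] show ?thesis by simp
  qed
  have P12: "Db (Dz P) z = Db (Dz S) z * T' + Dz S z * (G z * cnj (deriv G z))
      + (cnj (Dz S z) * (deriv G z * cnj (G z)) + S z * (deriv G z * cnj (deriv G z)))"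
  proof -
    have "wirt (\<lambda>w. Dz S w * (1 + G w * cnj (G w)) + S w * (deriv G w * cnj (G w)))
      (Dz (Dz S) z * (1 + G z * cnj (G z)) + Dz S z * (0 + (deriv G z * cnj (G z) + G z * cnj 0))
        + (Dz S z * (deriv G z * cnj (G z)) + S z * (deriv (deriv G) z * cnj (G z) + deriv G z * cnj 0)))
      (Db (Dz S) z * (1 + G z * cnj (G z)) + Dz S z * (0 + (0 * cnj (G z) + G z * cnj (deriv G z)))
        + (cnj (Dz S z) * (deriv G z * cnj (G z)) + S z * (0 * cnj (G z) + deriv G z * cnj (deriv G z)))) z"
      by (intro wirt_intros dS dS1 dG dG' V)
    from wirt_imp_Dz_Db(2)[OF wirt_cong[OF this V P1[symmetric]]] show ?thesis by (simp add: T'_def)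
  qed
  have Sr: "cnj (S z) = S z" by (simp add: S_def)
  \<comment> \<open>The first order cross terms of the product \<open>S * (1 + |G|^2)\<close>
    cancel. What remains besides the expression for \<open>S\<close> is
    \<open>(1 + |G|^2) |G'|^2 - |G'|^2 |G|^2 = |G'|^2\<close>, the contribution of the second
    factor.\<close>
  have Y: "P z * Db (Dz P) z - Dz P z * cnj (Dz P z)
      = T'\<^sup>2 * (S z * Db (Dz S) z - Dz S z * cnj (Dz S z)) + (S z)\<^sup>2 * (deriv G z * cnj (deriv G z))"
    unfolding P12 P1[OF V(2)] unfolding P T'_def by (simp add: Sr algebra_simps power2_eq_square)
  have C\<psi>: "Ck_on 2 V \<psi>"
    unfolding \<psi>_def by (intro Ck_on_mult Ck_on_const s V)
  have d\<psi>: "\<psi> differentiable (at z)" using C\<psi> V by (simp add: numeral_2_eq_2)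
  have lap: "complex_of_real (du (du \<psi>) z + dv (dv \<psi>) z) = 4 * Db (Dz \<Psi>) z"
    unfolding \<Psi>_def[abs_def] laplacian_wirt[OF V C\<psi>] by simp
  have grad: "complex_of_real ((du \<psi> z)\<^sup>2 + (dv \<psi> z)\<^sup>2) = 4 * (Dz \<Psi> z * cnj (Dz \<Psi> z))"
    unfolding \<Psi>_def[abs_def] Dz_of_real(1)[OF d\<psi>] by (simp add: field_simps power2_eq_square)
  have cE: "cnj E = E" by (simp add: E_def)
  have "complex_of_real (\<psi> z * (du (du \<psi>) z + dv (dv \<psi>) z) + 2 * (4 * (cmod (deriv G z))\<^sup>2 / T\<^sup>2) * (\<psi> z)\<^sup>2
      - ((du \<psi> z)\<^sup>2 + (dv \<psi> z)\<^sup>2))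
    = \<Psi> z * (4 * Db (Dz \<Psi>) z) + 2 * (4 * (deriv G z * cnj (deriv G z)) / T'\<^sup>2) * (\<Psi> z)\<^sup>2
      - 4 * (Dz \<Psi> z * cnj (Dz \<Psi> z))"
    unfolding of_real_diff grad lap[symmetric]
    by (simp add: \<Psi>_def complex_norm_square[symmetric] flip: T'(1))
  also have "\<dots> = (E * E) * (32 * (S z)\<^sup>2 * (S z * Db (Dz S) z - Dz S z * cnj (Dz S z))
      + 32 * (deriv G z * cnj (deriv G z)) / T'\<^sup>2 * (S z)\<^sup>2 * (S z)\<^sup>2)"
    unfolding \<Psi>12 \<Psi>1[OF V(2)] unfolding \<Psi> by (simp add: Sr cE algebra_simps power2_eq_square)
  also have "\<dots> = (32 * (S z)\<^sup>2 / T'\<^sup>2) * (P z * Db (Dz P) z - Dz P z * cnj (Dz P z))"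
    unfolding E Y using T'(2) by (simp add: field_simps)
  finally show ?thesis
    by (simp add: T'(1)[symmetric] S_def)
qed

text \<open>Harmonicity says that the derivative of \<open>\<mu>\<close> in \<open>z\<close> is
  holomorphic. Twice the real part of a primitive gives \<open>\<mu>\<close> up to a constant, and
  exponentiation gives \<open>h\<close>.\<close>

lemma harmonic_exp:
  fixes \<mu> :: "complex \<Rightarrow> real"
  assumes r: "r > 0" and C: "Ck_on 2 (ball z0 r) \<mu>"
    and harm: "\<And>z. z \<in> ball z0 r \<Longrightarrow> du (du \<mu>) z + dv (dv \<mu>) z = 0"
  obtains h where "h holomorphic_on ball z0 r" "\<And>z. z \<in> ball z0 r \<Longrightarrow> cmod (h z) = exp (\<mu> z)"
proof -
  define B where "B = ball z0 r"
  have B: "open B" "convex B" "z0 \<in> B" using r by (auto simp: B_def)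
  define M where "M w = complex_of_real (\<mu> w)" for w
  have C': "Ck_on (Suc 1) B \<mu>" "Ck_on 2 B \<mu>" using C by (simp_all add: B_def numeral_2_eq_2)
  have dM: "wirt M (Dz M w) (cnj (Dz M w)) w" if "w \<in> B" for w
    using wirt_Dz_Db[OF Ck_on_differentiable[OF Ck_on_of_real[OF B(1) C'(1)] that]]
      Dz_of_real(2)[OF Ck_on_differentiable[OF C'(1) that]] by (simp add: M_def[abs_def])
  have "Dz M holomorphic_on B"
  proof (rule holomorphic_onI_wirt)
    fix z assume z: "z \<in> B"
    have "Db (Dz M) z = 0"
      unfolding M_def[abs_def] laplacian_wirt[OF B(1) z C'(2)] harm[OF z[unfolded B_def]] by simp
    then show "wirt (Dz M) (Dz (Dz M) z) 0 z"
      using wirt_Dz_Db[OF Ck_on_differentiable[OF Ck_on_Dz_Db(1)[OF B(1)] z], of 0 M]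
        Ck_on_of_real[OF B(1) C'(1)] by (simp add: M_def[abs_def])
  qed
  then obtain H where H: "\<And>z. z \<in> B \<Longrightarrow> (H has_field_derivative Dz M z) (at z)"
    using convex_primitive_at[OF B(2,1,3)] by blast
  have Hh: "H holomorphic_on B"
    by (rule holomorphic_onI_wirt[where f' = "Dz M"], rule wirt_holomorphic, erule H)
  define k where "k z = H z + cnj (H z) - M z" for z
  have "(k has_derivative (\<lambda>h. 0)) (at z within B)" if z: "z \<in> B" for z
  proof -
    have "wirt k (Dz M z + cnj 0 - Dz M z) (0 + cnj (Dz M z) - cnj (Dz M z)) z"
      unfolding k_def by (intro wirt_intros dM z wirt_holomorphic H)
    then show ?thesis by (simp add: wirt_def has_derivative_at_withinI)
  qed
  from has_derivative_zero_constant[OF B(2) this] obtain l where l: "\<And>z. z \<in> B \<Longrightarrow> k z = l" by blast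
  have "\<mu> z = Re (2 * H z - l)" if "z \<in> B" for z
    using arg_cong[OF l[OF that], of Re] by (simp add: k_def M_def)
  moreover have "(\<lambda>z. exp (2 * H z - l)) holomorphic_on B"
    using Hh by (intro holomorphic_intros)
  ultimately show thesis
    using that[of "\<lambda>z. exp (2 * H z - l)"] by (simp add: B_def norm_exp_eq_Re)
qed

section \<open>The Gauss map and the representation formula\<close>

text \<open>Inverse stereographic projection, the formula for \<open>N\<close> in terms of
  \<open>g\<close>. The last component \<open>(1 - |g|^2) / (1 + |g|^2)\<close> is written so that
  \<open>2 / (1 + |g|^2)\<close> is the only quotient to differentiate.\<close>

definition gauss_inv :: "complex \<Rightarrow> complex \<times> real" where
  "gauss_inv g = ((2 / (1 + (cmod g)\<^sup>2)) *\<^sub>R g, 2 / (1 + (cmod g)\<^sup>2) - 1)"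

definition gauss_inv_deriv :: "complex \<Rightarrow> complex \<Rightarrow> complex \<times> real" where
  "gauss_inv_deriv g h = (let T = 1 + (cmod g)\<^sup>2; t = 2 * (g \<bullet> h)
     in ((2 / T) *\<^sub>R h - (2 * t / T\<^sup>2) *\<^sub>R g, - 2 * t / T\<^sup>2))"

lemma one_plus_norm_pos: "1 + (cmod g)\<^sup>2 > 0"
  by (simp add: add_pos_nonneg)

lemma gauss_inv_has_derivative:
  "(gauss_inv has_derivative gauss_inv_deriv g) (at g)"
proof -
  have "((\<lambda>g. 1 + (g \<bullet> g)) has_derivative (\<lambda>h. 2 * (g \<bullet> h))) (at g)"
    by (auto intro!: derivative_eq_intros simp: inner_commute)
  then have n: "((\<lambda>g. 1 + (cmod g)\<^sup>2) has_derivative (\<lambda>h. 2 * (g \<bullet> h))) (at g)"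
    by (simp only: power2_norm_eq_inner)
  have T: "((\<lambda>g. 2 / (1 + (cmod g)\<^sup>2)) has_derivative (\<lambda>h. - (2 * (2 * (g \<bullet> h))) / (1 + (cmod g)\<^sup>2)\<^sup>2)) (at g)"
    using has_derivative_divide'[OF has_derivative_const[of 2] n] one_plus_norm_pos[of g]
    by (simp add: power2_eq_square[of "1 + _"])
  have "((\<lambda>g. ((2 / (1 + (cmod g)\<^sup>2)) *\<^sub>R g, 2 / (1 + (cmod g)\<^sup>2) - 1)) has_derivative
      (\<lambda>h. ((2 / (1 + (cmod g)\<^sup>2)) *\<^sub>R h + (- (2 * (2 * (g \<bullet> h))) / (1 + (cmod g)\<^sup>2)\<^sup>2) *\<^sub>R g,
        - (2 * (2 * (g \<bullet> h))) / (1 + (cmod g)\<^sup>2)\<^sup>2 - 0))) (at g)"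
    by (intro has_derivative_Pair has_derivative_scaleR has_derivative_diff T has_derivative_const has_derivative_ident)
  moreover have "gauss_inv = (\<lambda>g. ((2 / (1 + (cmod g)\<^sup>2)) *\<^sub>R g, 2 / (1 + (cmod g)\<^sup>2) - 1))"
    by (simp add: fun_eq_iff gauss_inv_def)
  ultimately have "(gauss_inv has_derivative (\<lambda>h. ((2 / (1 + (cmod g)\<^sup>2)) *\<^sub>R h + (- (2 * (2 * (g \<bullet> h))) / (1 + (cmod g)\<^sup>2)\<^sup>2) *\<^sub>R g,
        - (2 * (2 * (g \<bullet> h))) / (1 + (cmod g)\<^sup>2)\<^sup>2 - 0))) (at g)" by simp
  then show ?thesis
    by (rule has_derivative_eq_rhs) (auto simp: gauss_inv_deriv_def Let_def fun_eq_iff)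
qed

lemma gauss_inv_comp:
  assumes "(G has_field_derivative G') (at z)"
  shows "(\<lambda>w. gauss_inv (G w)) differentiable (at z)"
    "du (\<lambda>w. gauss_inv (G w)) z = gauss_inv_deriv (G z) G'"
    "dv (\<lambda>w. gauss_inv (G w)) z = gauss_inv_deriv (G z) (\<i> * G')"
proof -
  have D: "((\<lambda>w. gauss_inv (G w)) has_derivative (\<lambda>h. gauss_inv_deriv (G z) (G' * h))) (at z)"
    using has_derivative_compose[OF assms[unfolded has_field_derivative_def] gauss_inv_has_derivative] .
  then show "(\<lambda>w. gauss_inv (G w)) differentiable (at z)" by (auto simp: differentiable_def)
  show "du (\<lambda>w. gauss_inv (G w)) z = gauss_inv_deriv (G z) G'"
    "dv (\<lambda>w. gauss_inv (G w)) z = gauss_inv_deriv (G z) (\<i> * G')"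
    using du_dv_has_derivative[OF D] by (simp_all add: mult.commute)
qed

lemma gauss_inv_unit: "gauss_inv g \<bullet> gauss_inv g = 1"
proof -
  define T where "T = 1 + (cmod g)\<^sup>2"
  have T: "T > 0" "g \<bullet> g = T - 1" using one_plus_norm_pos[of g] by (simp_all add: T_def power2_norm_eq_inner)
  have "gauss_inv g \<bullet> gauss_inv g = (2 / T) * ((2 / T) * (T - 1)) + (2 / T - 1) * (2 / T - 1)"
    by (simp add: gauss_inv_def T_def[symmetric] T(2))
  also have "\<dots> = 1" using T(1) by (simp add: field_simps)
  finally show ?thesis .
qed

text \<open>Conformality of stereographic projection; this is where the factor 4 in
  \<open>lam\<close> comes from.\<close>

lemma gauss_inv_deriv_sqnorm:
  "gauss_inv_deriv g h \<bullet> gauss_inv_deriv g h = 4 * (cmod h)\<^sup>2 / (1 + (cmod g)\<^sup>2)\<^sup>2"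
proof -
  define T where "T = 1 + (cmod g)\<^sup>2"
  define t where "t = 2 * (g \<bullet> h)"
  have T: "T > 0" "g \<bullet> g = T - 1" "g \<bullet> h = t / 2" "h \<bullet> g = t / 2" "h \<bullet> h = (cmod h)\<^sup>2"
    using one_plus_norm_pos[of g] by (simp_all add: T_def t_def power2_norm_eq_inner inner_commute)
  define \<alpha> \<beta> where "\<alpha> = 2 / T" and "\<beta> = 2 * t / T\<^sup>2"
  have "gauss_inv_deriv g h = (\<alpha> *\<^sub>R h - \<beta> *\<^sub>R g, - \<beta>)"
    by (simp add: gauss_inv_deriv_def Let_def T_def t_def \<alpha>_def \<beta>_def)
  then have "gauss_inv_deriv g h \<bullet> gauss_inv_deriv g h
     = \<alpha> * (\<alpha> * (cmod h)\<^sup>2) - 2 * (\<alpha> * (\<beta> * (t / 2))) + \<beta> * (\<beta> * (T - 1)) + \<beta> * \<beta>"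
    by (simp add: inner_diff_left inner_diff_right T(2-)) (simp add: algebra_simps)
  also have "\<dots> = 4 * (cmod h)\<^sup>2 / T\<^sup>2"
    unfolding \<alpha>_def \<beta>_def using T(1) by (simp add: field_simps power2_eq_square)
  finally show ?thesis by (simp add: T_def)
qed

text \<open>The representation formula with \<open>P\<close> and \<open>B\<close> as independent
  numbers. For a pair, \<open>P\<close> is the form and \<open>B\<close> its derivative in
  \<open>z\<close> divided by \<open>g'\<close>; this separates the algebra of the formula from the
  calculus.\<close>

definition rep_point :: "complex \<Rightarrow> real \<Rightarrow> complex \<Rightarrow> complex \<times> real" where
  "rep_point g P B = (let T = 1 + (cmod g)\<^sup>2; R = P / T\<^sup>2 * (4 * T * Re (B * g) - (3 * (cmod g)\<^sup>2 + 1) * P)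
     in (of_real (2 * P / T\<^sup>2) * (2 * of_real T * cnj B - g * of_real P), 0) - (2 * R / T) *\<^sub>R (g, 1))"

lemma hqsf_X_eq_rep_point:
  "hqsf_X c g f1 f2 z = rep_point (g z) ((cmod (f1 z))\<^sup>2 + c * (cmod (f2 z))\<^sup>2)
     ((cnj (f1 z) * deriv f1 z + of_real c * cnj (f2 z) * deriv f2 z) / deriv g z)"
proof -
  have "cnj ((cnj (f1 z) * deriv f1 z + of_real c * cnj (f2 z) * deriv f2 z) / deriv g z)
     = f1 z * cnj (deriv f1 z / deriv g z) + of_real c * f2 z * cnj (deriv f2 z / deriv g z)"
    by (simp add: add_divide_distrib)
  moreover have "1 \<bullet> ((cnj (f1 z) * deriv f1 z + of_real c * cnj (f2 z) * deriv f2 z) * g z / deriv g z)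
     = Re ((cnj (f1 z) * deriv f1 z + of_real c * cnj (f2 z) * deriv f2 z) / deriv g z * g z)"
    by (simp add: inner_complex_def)
  ultimately show ?thesis
    by (simp only: hqsf_X_def hqsf_R_def rep_point_def Let_def)
qed

text \<open>When \<open>P\<close> varies by \<open>2 * Re (B * h)\<close> as \<open>g\<close> moves
  in direction \<open>h\<close>, the second value is the differential of the first. So the formula
  describes the point with support function \<open>2 P^2 / T^2\<close> and with the gradient of that
  function as tangential part.\<close>

lemma rep_point_inner:
  fixes g :: complex and P :: real
  defines "T \<equiv> 1 + (cmod g)\<^sup>2"
  shows "rep_point g P B \<bullet> gauss_inv g = 2 * P\<^sup>2 / T\<^sup>2"
    "rep_point g P B \<bullet> gauss_inv_deriv g h = 4 * P * (2 * Re (B * h)) / T\<^sup>2 - 4 * P\<^sup>2 * (2 * (g \<bullet> h)) / T ^ 3"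
proof -
  define b where "b = Re (B * g)"
  define R where "R = P / T\<^sup>2 * (4 * T * b - (3 * (T - 1) + 1) * P)"
  have T: "T > 0" "g \<bullet> g = T - 1" "(cmod g)\<^sup>2 = T - 1"
    using one_plus_norm_pos[of g] by (simp_all add: T_def power2_norm_eq_inner)
  define \<beta> where "\<beta> x = Re (B * x)" for x
  have in_B: "cnj B \<bullet> x = \<beta> x" for x by (simp add: inner_complex_def \<beta>_def)
  have b\<beta>: "b = \<beta> g" unfolding b_def \<beta>_def ..
  have \<beta>: "\<beta> (r *\<^sub>R x) = r * \<beta> x" "\<beta> (x - y) = \<beta> x - \<beta> y" for r x y
    by (simp_all add: \<beta>_def algebra_simps)
  have v: "rep_point g P B = ((2 * P / T\<^sup>2) *\<^sub>R ((2 * T) *\<^sub>R cnj B - P *\<^sub>R g) - (2 * R / T) *\<^sub>R g, - (2 * R / T))"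
    unfolding rep_point_def Let_def T(3) R_def b_def by (simp add: scaleR_conv_of_real algebra_simps)
  have in_v: "rep_point g P B \<bullet> (x, y) = 2 * P / T\<^sup>2 * (2 * T * \<beta> x - P * (g \<bullet> x)) - 2 * R / T * (g \<bullet> x + y)" for x y
    unfolding v by (simp add: inner_diff_left in_B) (simp add: distrib_left add_divide_distrib)
  have "rep_point g P B \<bullet> gauss_inv g
      = 2 * P / T\<^sup>2 * (2 * T * (2 / T * b) - P * (2 / T * (T - 1))) - 2 * R / T * (2 / T * (T - 1) + (2 / T - 1))"
    unfolding gauss_inv_def in_v by (simp add: T_def[symmetric] T(2) b\<beta> \<beta>)
  also have "\<dots> = 2 * P\<^sup>2 / T\<^sup>2"
    using T(1) unfolding R_def by (simp add: divide_simps power2_eq_square) (simp add: algebra_simps)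
  finally show "rep_point g P B \<bullet> gauss_inv g = 2 * P\<^sup>2 / T\<^sup>2" .
  define t d where "t = 2 * (g \<bullet> h)" and "d = Re (B * h)"
  have gh: "g \<bullet> h = t / 2" by (simp add: t_def)
  have d\<beta>: "d = \<beta> h" unfolding d_def \<beta>_def ..
  have "rep_point g P B \<bullet> gauss_inv_deriv g h
      = 2 * P / T\<^sup>2 * (2 * T * (2 / T * d - 2 * t / T\<^sup>2 * b) - P * (2 / T * (t / 2) - 2 * t / T\<^sup>2 * (T - 1)))
        - 2 * R / T * (2 / T * (t / 2) - 2 * t / T\<^sup>2 * (T - 1) + - 2 * t / T\<^sup>2)"
    unfolding gauss_inv_deriv_def Let_def t_def[symmetric] T_def[symmetric] in_v
    by (simp add: inner_diff_right T(2) gh b\<beta> d\<beta> \<beta>)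
  also have "\<dots> = 4 * P * (2 * d) / T\<^sup>2 - 4 * P\<^sup>2 * t / T ^ 3"
    using T(1) unfolding R_def by (simp add: divide_simps power2_eq_square power3_eq_cube) (simp add: algebra_simps)
  finally show "rep_point g P B \<bullet> gauss_inv_deriv g h = 4 * P * (2 * Re (B * h)) / T\<^sup>2 - 4 * P\<^sup>2 * (2 * (g \<bullet> h)) / T ^ 3"
    by (simp add: t_def d_def)
qed

text \<open>\<open>rot\<close> is the relation \<open>oriented_by 1\<close> written in components.
  It amounts to the Cauchy-Riemann equations for \<open>m / (1 + n)\<close>, and the derivative of
  that quotient carries the whole metric.\<close>

lemma stereographic:
  fixes m :: "complex \<Rightarrow> complex" and n :: "complex \<Rightarrow> real"
  assumes m: "m differentiable (at z)" and n: "n differentiable (at z)"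
    and unit: "(cmod (m z))\<^sup>2 + (n z)\<^sup>2 = 1" and orth: "m z \<bullet> du m z + n z * du n z = 0"
    and rot: "dv m z = \<i> * (of_real (n z) * du m z - of_real (du n z) * m z)" "dv n z = Im (cnj (m z) * du m z)"
    and ne: "n z \<noteq> - 1"
  defines "G \<equiv> \<lambda>w. m w / of_real (1 + n w)"
  shows "\<exists>G'. (G has_field_derivative G') (at z) \<and>
      4 * (cmod G')\<^sup>2 / (1 + (cmod (G z))\<^sup>2)\<^sup>2 = (cmod (du m z))\<^sup>2 + (du n z)\<^sup>2"
    "gauss_inv (G z) = (m z, n z)"
proof -
  define k where "k = 1 + n z"
  have k: "k \<noteq> 0" using ne by (simp add: k_def)
  have nsq: "(cmod (m z))\<^sup>2 = k * (2 - k)" using unit by (simp add: k_def algebra_simps power2_eq_square)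
  have Gz: "G z = m z / of_real k" by (simp add: G_def k_def)
  have "(cmod (G z))\<^sup>2 = k * (2 - k) / k\<^sup>2"
    unfolding Gz norm_divide power_divide nsq by simp
  also have "\<dots> = (2 - k) / k" using k by (simp add: power2_eq_square)
  finally have "(cmod (G z))\<^sup>2 = (2 - k) / k" .
  then have TG: "1 + (cmod (G z))\<^sup>2 = 2 / k"
    using k by (simp add: field_simps)
  then show "gauss_inv (G z) = (m z, n z)"
  proof -
    have a: "2 / (2 / k) = k" and b: "k *\<^sub>R (m z / of_real k) = m z"
      using k by (simp_all add: scaleR_conv_of_real)
    show ?thesis unfolding gauss_inv_def TG a unfolding Gz b by (simp add: k_def)
  qed
  define a \<nu> where "a = du m z" and "\<nu> = du n z"
  define G' where "G' = (a * of_real k - m z * of_real \<nu>) / (of_real k)\<^sup>2"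
  have orth': "Re (cnj (m z) * a) = - (k - 1) * \<nu>"
    using orth by (simp add: inner_complex_def a_def \<nu>_def k_def algebra_simps)
  have mm: "cnj (m z) * m z = of_real (k * (2 - k))"
    using nsq complex_norm_square[of "m z"] by (metis mult.commute)
  \<comment> \<open>The Cauchy-Riemann equation for the numerator of the derivative. Orthogonality
    gives the real part of \<open>cnj (m z) * a\<close>, the vector product its imaginary part, and
    multiplication by \<open>m z\<close> recovers \<open>a\<close>.\<close>
  have rot': "dv m z * of_real k - m z * of_real (dv n z) = \<i> * (a * of_real k - m z * of_real \<nu>)"
  proof -
    have ca: "cnj (m z) * a = of_real (- (k - 1) * \<nu>) + \<i> * of_real (dv n z)"
      using orth' rot(2) by (simp add: complex_eq_iff a_def)
    have nz: "n z = k - 1" by (simp add: k_def)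
    have "m z * (cnj (m z) * a) = of_real (k * (2 - k)) * a" using mm by (simp add: mult.commute mult.left_commute)
    then have "m z * \<i> * of_real (dv n z) = of_real (k * (2 - k)) * a + m z * of_real ((k - 1) * \<nu>)"
      unfolding ca by (simp add: algebra_simps)
    moreover have "m z * of_real (dv n z) = - \<i> * (m z * \<i> * of_real (dv n z))"
      by (simp add: complex_eq_iff)
    ultimately have "m z * of_real (dv n z) = - \<i> * (of_real (k * (2 - k)) * a + m z * of_real ((k - 1) * \<nu>))"
      by (simp only:)
    then show ?thesis
      unfolding rot(1) a_def[symmetric] \<nu>_def[symmetric] nz by (simp add: algebra_simps)
  qed
  have D: "(G has_derivative (\<lambda>h. ((Re h *\<^sub>R a + Im h *\<^sub>R dv m z) * of_real k - m z * of_real (Re h *\<^sub>R \<nu> + Im h *\<^sub>R dv n z)) / (of_real k * of_real k))) (at z)"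
  proof -
    have "((\<lambda>w. of_real (1 + n w)) has_derivative (\<lambda>h. complex_of_real (0 + (Re h *\<^sub>R \<nu> + Im h *\<^sub>R dv n z)))) (at z)"
      unfolding \<nu>_def by (intro has_derivative_of_real has_derivative_add has_derivative_const differentiable_has_derivative_du_dv n)
    from has_derivative_divide'[OF differentiable_has_derivative_du_dv[OF m] this]
    show ?thesis unfolding G_def using k by (simp add: k_def a_def del: of_real_add)
  qed
  have "(\<lambda>h. ((Re h *\<^sub>R a + Im h *\<^sub>R dv m z) * of_real k - m z * of_real (Re h *\<^sub>R \<nu> + Im h *\<^sub>R dv n z)) / (of_real k * of_real k))
      = (\<lambda>h. G' * h)"
  proof
    fix h
    have "(Re h *\<^sub>R a + Im h *\<^sub>R dv m z) * of_real k - m z * of_real (Re h *\<^sub>R \<nu> + Im h *\<^sub>R dv n z)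
      = of_real (Re h) * (a * of_real k - m z * of_real \<nu>) + of_real (Im h) * (dv m z * of_real k - m z * of_real (dv n z))"
      by (simp add: scaleR_conv_of_real algebra_simps)
    also have "\<dots> = (of_real (Re h) + \<i> * of_real (Im h)) * (a * of_real k - m z * of_real \<nu>)"
      unfolding rot' by (simp add: algebra_simps)
    also have "of_real (Re h) + \<i> * of_real (Im h) = h" by (simp add: complex_eq_iff)
    finally show "((Re h *\<^sub>R a + Im h *\<^sub>R dv m z) * of_real k - m z * of_real (Re h *\<^sub>R \<nu> + Im h *\<^sub>R dv n z)) / (of_real k * of_real k) = G' * h"
      by (simp add: G'_def power2_eq_square)
  qed
  with D have "(G has_field_derivative G') (at z)" by (simp add: has_field_derivative_def)
  moreover have "4 * (cmod G')\<^sup>2 / (1 + (cmod (G z))\<^sup>2)\<^sup>2 = (cmod a)\<^sup>2 + \<nu>\<^sup>2"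
  proof -
    have "(cmod (a * of_real k - m z * of_real \<nu>))\<^sup>2 = (cmod a)\<^sup>2 * k\<^sup>2 - 2 * k * \<nu> * Re (cnj (m z) * a) + (cmod (m z))\<^sup>2 * \<nu>\<^sup>2"
      unfolding cmod_power2 by (simp add: power2_eq_square algebra_simps)
    also have "\<dots> = k\<^sup>2 * ((cmod a)\<^sup>2 + \<nu>\<^sup>2)"
      unfolding orth' nsq by (simp add: power2_eq_square algebra_simps)
    finally have num: "(cmod (a * of_real k - m z * of_real \<nu>))\<^sup>2 = k\<^sup>2 * ((cmod a)\<^sup>2 + \<nu>\<^sup>2)" .
    have "(cmod G')\<^sup>2 = (cmod (a * of_real k - m z * of_real \<nu>))\<^sup>2 / (k\<^sup>2)\<^sup>2"
      by (simp add: G'_def norm_divide norm_power power_divide)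
    also have "\<dots> = ((cmod a)\<^sup>2 + \<nu>\<^sup>2) / k\<^sup>2"
      unfolding num using k by (simp add: power2_eq_square)
    finally have "(cmod G')\<^sup>2 = ((cmod a)\<^sup>2 + \<nu>\<^sup>2) / k\<^sup>2" .
    then show ?thesis unfolding TG using k by (simp add: field_simps power2_eq_square)
  qed
  ultimately show "\<exists>G'. (G has_field_derivative G') (at z) \<and>
      4 * (cmod G')\<^sup>2 / (1 + (cmod (G z))\<^sup>2)\<^sup>2 = (cmod (du m z))\<^sup>2 + (du n z)\<^sup>2"
    unfolding a_def \<nu>_def by blast
qed

text \<open>For the flag \<open>True\<close> this is the half-turn about the real axis of the
  complex factor, which exchanges the two poles. As it preserves the orientation of space, the
  second projection of a Gauss map is holomorphic together with the first.\<close>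

definition reflect :: "bool \<Rightarrow> complex \<times> real \<Rightarrow> complex \<times> real" where
  "reflect b p = (if b then (cnj (fst p), - snd p) else p)"

text \<open>
  Stereographic projection. The flag selects the pole of the sphere from which one projects; the
  two projections of a unit vector are inverse to each other, also at the poles because
  \<open>inverse 0 = 0\<close>.
\<close>

definition stereo :: "bool \<Rightarrow> complex \<times> real \<Rightarrow> complex" where
  "stereo b p = fst (reflect b p) / of_real (1 + snd (reflect b p))"

lemma stereo_True:
  assumes "p \<bullet> p = 1"
  shows "stereo True p = inverse (stereo False p)"
proof -
  obtain m n where p: "p = (m, n)" by fastforce
  have "(cmod m)\<^sup>2 + n * n = 1" using assms by (simp add: p power2_norm_eq_inner)
  then have mm: "m * cnj m = of_real ((1 + n) * (1 - n))"
    unfolding complex_norm_square[symmetric] by (simp add: algebra_simps flip: of_real_power of_real_diff of_real_add of_real_mult)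
  show ?thesis
  proof (cases "m = 0")
    case True
    then show ?thesis by (simp add: p stereo_def reflect_def)
  next
    case False
    then have "m * cnj m \<noteq> 0" by simp
    then have "(1 + n) * (1 - n) \<noteq> 0" unfolding mm of_real_eq_0_iff .
    then have "1 + n \<noteq> 0" "1 - n \<noteq> 0" by auto
    then have nz: "complex_of_real (1 + n) \<noteq> 0" "complex_of_real (1 - n) \<noteq> 0" by (simp_all only: of_real_eq_0_iff not_False_eq_True)
    have "cnj m * m = of_real (1 + n) * of_real (1 - n)"
      using mm by (simp only: of_real_mult mult.commute)
    then have "cnj m / of_real (1 - n) = of_real (1 + n) / m"
      by (simp only: frac_eq_eq[OF nz(2) False])
    then show ?thesis by (simp add: p stereo_def reflect_def)
  qed
qed

section \<open>Support functions built from a pair of holomorphic functions\<close>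

lemma wirt_form:
  assumes "(f1 has_field_derivative f1') (at z)" "(f2 has_field_derivative f2') (at z)"
  shows "wirt (\<lambda>w. complex_of_real ((cmod (f1 w))\<^sup>2 + c * (cmod (f2 w))\<^sup>2))
     (cnj (f1 z) * f1' + of_real c * (cnj (f2 z) * f2')) (cnj (cnj (f1 z) * f1' + of_real c * (cnj (f2 z) * f2'))) z"
proof -
  have "wirt (\<lambda>w. f1 w * cnj (f1 w) + of_real c * (f2 w * cnj (f2 w)))
    (f1' * cnj (f1 z) + f1 z * cnj 0 + (0 * (f2 z * cnj (f2 z)) + of_real c * (f2' * cnj (f2 z) + f2 z * cnj 0)))
    (0 * cnj (f1 z) + f1 z * cnj f1' + (0 * (f2 z * cnj (f2 z)) + of_real c * (0 * cnj (f2 z) + f2 z * cnj f2'))) z"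
    by (intro wirt_intros wirt_holomorphic assms)
  then show ?thesis
    unfolding of_real_add of_real_mult complex_norm_square by (rule wirt_eq) (simp_all add: mult.commute)
qed

text \<open>Lagrange's identity: in the product of the form for \<open>f1\<close>, \<open>f2\<close>
  with the form for the derivatives, minus the squared modulus of the polar form, only
  \<open>c\<close> times the squared Wronskian survives.\<close>

lemma form_liouville:
  fixes c :: real
  assumes V: "open V" "z \<in> V" and f: "f1 holomorphic_on V" "f2 holomorphic_on V"
  defines "P \<equiv> \<lambda>w. complex_of_real ((cmod (f1 w))\<^sup>2 + c * (cmod (f2 w))\<^sup>2)"
  shows "P z * Db (Dz P) z - Dz P z * cnj (Dz P z)
     = of_real (c * (cmod (f1 z * deriv f2 z - f2 z * deriv f1 z))\<^sup>2)"
proof -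
  have d: "(f1 has_field_derivative deriv f1 w) (at w)" "(f2 has_field_derivative deriv f2 w) (at w)"
    "(deriv f1 has_field_derivative deriv (deriv f1) w) (at w)" "(deriv f2 has_field_derivative deriv (deriv f2) w) (at w)"
    if "w \<in> V" for w
    using holomorphic_derivI[OF f(1) V(1) that] holomorphic_derivI[OF f(2) V(1) that]
      holomorphic_derivI[OF holomorphic_deriv[OF f(1) V(1)] V(1) that]
      holomorphic_derivI[OF holomorphic_deriv[OF f(2) V(1)] V(1) that] by simp_all
  have P1: "Dz P w = cnj (f1 w) * deriv f1 w + of_real c * (cnj (f2 w) * deriv f2 w)" if "w \<in> V" for w
    unfolding P_def using wirt_imp_Dz_Db(1)[OF wirt_form[OF d(1,2)[OF that]]] .
  have "wirt (\<lambda>w. cnj (f1 w) * deriv f1 w + of_real c * (cnj (f2 w) * deriv f2 w))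
     (cnj 0 * deriv f1 z + cnj (f1 z) * deriv (deriv f1) z + (0 * (cnj (f2 z) * deriv f2 z) + of_real c * (cnj 0 * deriv f2 z + cnj (f2 z) * deriv (deriv f2) z)))
     (cnj (deriv f1 z) * deriv f1 z + cnj (f1 z) * 0 + (0 * (cnj (f2 z) * deriv f2 z) + of_real c * (cnj (deriv f2 z) * deriv f2 z + cnj (f2 z) * 0))) z"
    by (intro wirt_intros wirt_holomorphic d V)
  from wirt_imp_Dz_Db(2)[OF wirt_cong[OF this V P1[symmetric]]]
  have P12: "Db (Dz P) z = cnj (deriv f1 z) * deriv f1 z + of_real c * (cnj (deriv f2 z) * deriv f2 z)" by simp
  show ?thesis
    unfolding P12 P1[OF V(2)] unfolding P_def of_real_add of_real_mult complex_norm_square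
    by (simp add: algebra_simps)
qed

text \<open>Pairing the formula with the Gauss map and its derivatives returns a function and its
  differential. The first use is to recover a known surface, the second to see that
  \<open>gauss_inv (G z)\<close> is normal to a surface given by the formula.\<close>

lemma rep_derivative:
  fixes c :: real
  assumes d: "(G has_field_derivative deriv G z) (at z)" "(f1 has_field_derivative deriv f1 z) (at z)"
      "(f2 has_field_derivative deriv f2 z) (at z)"
    and nz: "deriv G z \<noteq> 0"
  defines "P \<equiv> \<lambda>w. (cmod (f1 w))\<^sup>2 + c * (cmod (f2 w))\<^sup>2" and "T \<equiv> \<lambda>w. 1 + (cmod (G w))\<^sup>2"
  shows "hqsf_X c G f1 f2 z \<bullet> gauss_inv (G z) = 2 * (P z)\<^sup>2 / (T z)\<^sup>2"
    "((\<lambda>w. 2 * (P w)\<^sup>2 / (T w)\<^sup>2) has_derivative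
       (\<lambda>h. hqsf_X c G f1 f2 z \<bullet> gauss_inv_deriv (G z) (deriv G z * h))) (at z)"
proof -
  define A where "A = cnj (f1 z) * deriv f1 z + of_real c * cnj (f2 z) * deriv f2 z"
  note X = hqsf_X_eq_rep_point[of c G f1 f2 z, folded A_def]
  show "hqsf_X c G f1 f2 z \<bullet> gauss_inv (G z) = 2 * (P z)\<^sup>2 / (T z)\<^sup>2"
    unfolding X rep_point_inner(1) P_def T_def ..
  have Tp: "T z > 0" unfolding T_def by (rule one_plus_norm_pos)
  have dP: "(P has_derivative (\<lambda>h. 2 * Re (A * h))) (at z)"
    unfolding P_def
    by (rule has_derivative_eq_rhs[OF has_derivative_Re[OF wirt_form[OF d(2,3), of c, unfolded wirt_def], unfolded Re_complex_of_real]])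
      (simp add: A_def fun_eq_iff algebra_simps)
  have dT: "(T has_derivative (\<lambda>h. 2 * (G z \<bullet> (deriv G z * h)))) (at z)"
  proof -
    have "((\<lambda>w. 1 + G w \<bullet> G w) has_derivative (\<lambda>h. 0 + (G z \<bullet> (deriv G z * h) + (deriv G z * h) \<bullet> G z))) (at z)"
      using d(1) by (intro has_derivative_add has_derivative_const has_derivative_inner) (simp_all add: has_field_derivative_def)
    then show ?thesis unfolding T_def power2_norm_eq_inner
      by (rule has_derivative_eq_rhs) (simp add: fun_eq_iff inner_commute)
  qed
  have "((\<lambda>w. 2 * (P w * P w) / (T w * T w)) has_derivative
     (\<lambda>h. ((0 * (P z * P z) + 2 * (P z * (2 * Re (A * h)) + (2 * Re (A * h)) * P z)) * (T z * T z)
        - 2 * (P z * P z) * (T z * (2 * (G z \<bullet> (deriv G z * h))) + (2 * (G z \<bullet> (deriv G z * h))) * T z))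
      / ((T z * T z) * (T z * T z)))) (at z)"
  proof (intro has_derivative_divide')
    show "((\<lambda>w. 2 * (P w * P w)) has_derivative (\<lambda>h. 0 * (P z * P z) + 2 * (P z * (2 * Re (A * h)) + (2 * Re (A * h)) * P z))) (at z)"
      by (rule has_derivative_eq_rhs[OF has_derivative_mult[OF has_derivative_const has_derivative_mult[OF dP dP]]]) (simp add: fun_eq_iff)
    show "((\<lambda>w. T w * T w) has_derivative (\<lambda>h. T z * (2 * (G z \<bullet> (deriv G z * h))) + (2 * (G z \<bullet> (deriv G z * h))) * T z)) (at z)"
      by (intro has_derivative_mult dT)
  qed (use Tp in simp)
  then have D: "((\<lambda>w. 2 * (P w)\<^sup>2 / (T w)\<^sup>2) has_derivative
     (\<lambda>h. ((0 * (P z * P z) + 2 * (P z * (2 * Re (A * h)) + (2 * Re (A * h)) * P z)) * (T z * T z)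
        - 2 * (P z * P z) * (T z * (2 * (G z \<bullet> (deriv G z * h))) + (2 * (G z \<bullet> (deriv G z * h))) * T z))
      / ((T z * T z) * (T z * T z)))) (at z)"
    by (simp only: power2_eq_square)
  show "((\<lambda>w. 2 * (P w)\<^sup>2 / (T w)\<^sup>2) has_derivative
       (\<lambda>h. hqsf_X c G f1 f2 z \<bullet> gauss_inv_deriv (G z) (deriv G z * h))) (at z)"
  proof (rule has_derivative_eq_rhs[OF D], rule ext)
    fix h
    define u t where "u = 2 * Re (A * h)" and "t = 2 * (G z \<bullet> (deriv G z * h))"
    have "A / deriv G z * (deriv G z * h) = A * h" using nz by simp
    then have "hqsf_X c G f1 f2 z \<bullet> gauss_inv_deriv (G z) (deriv G z * h)
        = 4 * P z * u / (T z)\<^sup>2 - 4 * (P z)\<^sup>2 * t / (T z) ^ 3"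
      unfolding X rep_point_inner(2) P_def T_def u_def t_def by simp
    also have "\<dots> = ((0 * (P z * P z) + 2 * (P z * u + u * P z)) * (T z * T z)
        - 2 * (P z * P z) * (T z * t + t * T z)) / ((T z * T z) * (T z * T z))"
      using Tp by (simp add: field_simps power2_eq_square power3_eq_cube)
    finally show "((0 * (P z * P z) + 2 * (P z * (2 * Re (A * h)) + (2 * Re (A * h)) * P z)) * (T z * T z)
        - 2 * (P z * P z) * (T z * (2 * (G z \<bullet> (deriv G z * h))) + (2 * (G z \<bullet> (deriv G z * h))) * T z))
      / ((T z * T z) * (T z * T z)) = hqsf_X c G f1 f2 z \<bullet> gauss_inv_deriv (G z) (deriv G z * h)"
      by (simp add: u_def t_def)
  qed
qed

section \<open>Passage between a surface and a pair of functions in one chart\<close>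

context conformal_surface
begin

text \<open>\<open>reflect\<close> preserves inner and vector products, so the components of the
  turned normal satisfy the hypotheses of \<open>stereographic\<close> for either flag.\<close>

lemma stereo_derivative:
  assumes z: "z \<in> W" and o: "oriented_by 1 z" and ne: "snd (reflect b (N z)) \<noteq> - 1"
  obtains G' where "((\<lambda>w. stereo b (N w)) has_field_derivative G') (at z)" "G' \<noteq> 0"
    "lam z = 4 * (cmod G')\<^sup>2 / (1 + (cmod (stereo b (N z)))\<^sup>2)\<^sup>2" "gauss_inv (stereo b (N z)) = reflect b (N z)"
proof -
  define m where "m w = fst (reflect b (N w))" for w
  define n where "n w = snd (reflect b (N w))" for w
  define fb where "fb x = (if b then cnj x else x)" for x :: complex
  define sb where "sb x = (if b then - x else x)" for x :: real
  have fb: "bounded_linear fb" "fb x \<bullet> fb y = x \<bullet> y" for x y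
    by (cases b; simp add: fb_def[abs_def] inner_complex_def bounded_linear_cnj)+
  have sb: "bounded_linear sb" "sb x * sb y = x * y" for x y
    by (cases b; simp add: sb_def[abs_def] bounded_linear_minus)+
  have m: "m = (\<lambda>w. fb (fst (N w)))" and n: "n = (\<lambda>w. sb (snd (N w)))"
    by (auto simp: m_def n_def fb_def sb_def reflect_def fun_eq_iff)
  note dN = diff(2)[OF z]
  note blf = bounded_linear_compose[OF fb(1) bounded_linear_fst] and bls = bounded_linear_compose[OF sb(1) bounded_linear_snd]
  have dm: "m differentiable (at z)" "du m z = fb (fst (du N z))" "dv m z = fb (fst (dv N z))"
    unfolding m using bounded_linear_differentiable[OF blf dN] du_dv_bounded_linear[OF blf dN] by simp_all
  have dn: "n differentiable (at z)" "du n z = sb (snd (du N z))" "dv n z = sb (snd (dv N z))"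
    unfolding n using bounded_linear_differentiable[OF bls dN] du_dv_bounded_linear[OF bls dN] by simp_all
  have rot: "dv N z = cross (N z) (du N z)" using o by (simp add: oriented_by_def)
  have unit': "(cmod (m z))\<^sup>2 + (n z)\<^sup>2 = 1"
  proof -
    have "(cmod (m z))\<^sup>2 = m z \<bullet> m z" by (rule power2_norm_eq_inner)
    moreover have "(n z)\<^sup>2 = n z * n z" by (rule power2_eq_square)
    ultimately show ?thesis using unit[OF z] by (simp add: m n fb(2) sb(2) inner_prod_def)
  qed
  have orth': "m z \<bullet> du m z + n z * du n z = 0"
    using N_orth(1)[OF z] unfolding dm(2) dn(2) unfolding m n fb(2) sb(2) by (simp add: inner_prod_def)
  have rot': "dv m z = \<i> * (of_real (n z) * du m z - of_real (du n z) * m z)" "dv n z = Im (cnj (m z) * du m z)"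
    unfolding dm dn rot unfolding m n by (simp_all add: cross_def fb_def sb_def algebra_simps)
  have nz: "n z \<noteq> - 1" using ne by (simp add: n_def)
  have S: "(\<lambda>w. stereo b (N w)) = (\<lambda>w. m w / of_real (1 + n w))"
    by (simp add: stereo_def m_def n_def)
  have l: "(cmod (du m z))\<^sup>2 + (du n z)\<^sup>2 = lam z"
  proof -
    have nf: "(cmod (fb x))\<^sup>2 = x \<bullet> x" for x by (rule trans[OF power2_norm_eq_inner fb(2)])
    have ns: "(sb y)\<^sup>2 = y * y" for y by (rule trans[OF power2_eq_square sb(2)])
    show ?thesis unfolding dm(2) dn(2) lam_def nf ns by (simp add: inner_prod_def)
  qed
  obtain G' where G': "((\<lambda>w. stereo b (N w)) has_field_derivative G') (at z)"
    "4 * (cmod G')\<^sup>2 / (1 + (cmod (stereo b (N z)))\<^sup>2)\<^sup>2 = lam z"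
    using stereographic(1)[OF dm(1) dn(1) unit' orth' rot' nz] unfolding S[symmetric] fun_cong[OF S, symmetric] l by blast
  moreover have "G' \<noteq> 0" using G'(2) lam_pos[OF z] by auto
  moreover have "gauss_inv (stereo b (N z)) = reflect b (N z)"
    using stereographic(2)[OF dm(1) dn(1) unit' orth' rot' nz] unfolding fun_cong[OF S, symmetric]
    by (simp add: m_def n_def)
  ultimately show thesis using that by simp
qed

text \<open>The flag \<open>b\<close> chooses a projection that is finite at \<open>z0\<close>, so
  the poles of the Gauss map are no exception here.\<close>

lemma local_representation:
  fixes c :: real
  assumes z0: "z0 \<in> W" and o: "\<And>z. z \<in> W \<Longrightarrow> oriented_by 1 z" and pos: "\<And>z. z \<in> W \<Longrightarrow> supp z > 0"
    and ne: "snd (reflect b (N z0)) \<noteq> - 1"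
    and \<mu>: "Ck_on 2 W \<mu>" "\<And>z. z \<in> W \<Longrightarrow> du (du \<mu>) z + dv (dv \<mu>) z = 0"
    and eq: "\<And>z. z \<in> W \<Longrightarrow> c * exp (2 * \<mu> z) * lam z * supp z =
        supp z * (du (du supp) z + dv (dv supp) z) + 2 * lam z * (supp z)\<^sup>2 - ((du supp z)\<^sup>2 + (dv supp z)\<^sup>2)"
  defines "G \<equiv> \<lambda>w. stereo b (N w)"
  obtains \<rho> f1 f2 where "0 < \<rho>" "ball z0 \<rho> \<subseteq> W" "\<And>z. z \<in> ball z0 \<rho> \<Longrightarrow> snd (reflect b (N z)) \<noteq> - 1"
    "f1 holomorphic_on ball z0 \<rho>" "f2 holomorphic_on ball z0 \<rho>" "G holomorphic_on ball z0 \<rho>"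
    "\<And>z. z \<in> ball z0 \<rho> \<Longrightarrow> deriv G z \<noteq> 0"
    "\<And>z. z \<in> ball z0 \<rho> \<Longrightarrow> (cmod (f1 z))\<^sup>2 + c * (cmod (f2 z))\<^sup>2 = sqrt (supp z / 2) * (1 + (cmod (G z))\<^sup>2)"
    "\<And>z. z \<in> ball z0 \<rho> \<Longrightarrow> cmod (f1 z * deriv f2 z - f2 z * deriv f1 z) = exp (\<mu> z) / 2 * cmod (deriv G z)"
proof -
  have "continuous_on W (\<lambda>w. snd (reflect b (N w)))"
    using Ck_on_imp_continuous_on[OF C2_N] by (cases b) (auto simp: reflect_def intro!: continuous_intros)
  then have "open (W \<inter> (\<lambda>w. snd (reflect b (N w))) -` (- {- 1}))"
    using continuous_open_preimage[OF _ open_W] by blast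
  then obtain r where r: "r > 0" "ball z0 r \<subseteq> W \<inter> (\<lambda>w. snd (reflect b (N w))) -` (- {- 1})"
    using z0 ne by (metis (no_types, lifting) ComplI IntI openE singletonD vimageI)
  define V where "V = ball z0 r"
  have V: "open V" "V \<subseteq> W" "z0 \<in> V" and ne': "\<And>z. z \<in> V \<Longrightarrow> snd (reflect b (N z)) \<noteq> - 1"
    using r by (auto simp: V_def)
  have dG: "(G has_field_derivative deriv G z) (at z) \<and> deriv G z \<noteq> 0 \<and>
      lam z = 4 * (cmod (deriv G z))\<^sup>2 / (1 + (cmod (G z))\<^sup>2)\<^sup>2" if z: "z \<in> V" for z
  proof -
    have zW: "z \<in> W" using V z by blast
    obtain G' where G': "(G has_field_derivative G') (at z)" "G' \<noteq> 0"
      "lam z = 4 * (cmod G')\<^sup>2 / (1 + (cmod (G z))\<^sup>2)\<^sup>2"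
      using stereo_derivative[OF zW o[OF zW] ne'[OF z]] unfolding G_def by metis
    moreover have "deriv G z = G'" using G'(1) by (rule DERIV_imp_deriv)
    ultimately show ?thesis by simp
  qed
  have G: "G holomorphic_on V"
    by (rule holomorphic_onI_wirt, rule wirt_holomorphic) (use dG in blast)
  have dG_hol: "deriv G holomorphic_on V" using holomorphic_deriv[OF G V(1)] .
  obtain h where h: "h holomorphic_on V" "\<And>z. z \<in> V \<Longrightarrow> cmod (h z) = exp (\<mu> z)"
    using harmonic_exp[OF r(1) Ck_on_subset[OF \<mu>(1)], of z0] \<mu>(2) V unfolding V_def by blast
  \<comment> \<open>The squared modulus has to be \<open>exp (2 * \<mu>) * |G'|^2 / 4\<close>; the
    holomorphic function \<open>h\<close> of modulus \<open>exp \<mu>\<close> provides a holomorphic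
    square root.\<close>
  define Wr where "Wr z = h z / 2 * deriv G z" for z
  have Wr: "Wr holomorphic_on V" unfolding Wr_def by (intro holomorphic_intros h dG_hol) simp
  have Wr_nz: "Wr z \<noteq> 0" if "z \<in> V" for z
    using h(2)[OF that] dG[OF that] by (auto simp: Wr_def)
  have Wr_norm: "cmod (Wr z) = exp (\<mu> z) / 2 * cmod (deriv G z)" if "z \<in> V" for z
    using h(2)[OF that] by (simp add: Wr_def norm_mult)
  define s where "s z = sqrt (supp z * (1/2))" for z
  have s: "Ck_on k V s" for k
    unfolding s_def using pos V
    by (intro Ck_on_sqrt Ck_on_mult Ck_on_const V Ck_on_subset[OF Ck_supp]) force
  define p where "p z = s z * (1 + (cmod (G z))\<^sup>2)" for z
  have p: "Ck_on 3 V p"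
    unfolding p_def by (intro Ck_on_mult Ck_on_add Ck_on_const Ck_on_norm_square_holomorphic s V G)
  define P where "P w = complex_of_real (p w)" for w
  note Pf = wirt_real_facts[OF V(1) _ p, folded P_def[abs_def]]
  have sp: "s z > 0" "supp z = 2 * (s z * s z)" if "z \<in> V" for z
    using pos[of z] V(2) that by (auto simp: s_def)
  have Peq: "P z * Db (Dz P) z - Dz P z * cnj (Dz P z) = of_real c * (Wr z * cnj (Wr z))" if z: "z \<in> V" for z
  proof -
    have zW: "z \<in> W" using V z by blast
    define \<psi> where "\<psi> = (\<lambda>w. 1 * (2 * (s w * s w)))"
    have e1: "supp w = \<psi> w" if "w \<in> V" for w using sp that by (simp add: \<psi>_def)
    have e2: "du supp w = du \<psi> w" "dv supp w = dv \<psi> w" if "w \<in> V" for w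
      using du_dv_cong(1,2)[OF V(1) that e1] by auto
    have e3: "du (du supp) z = du (du \<psi>) z" "dv (dv supp) z = dv (dv \<psi>) z"
      using du_dv_cong(1)[OF V(1) z e2(1)] du_dv_cong(2)[OF V(1) z e2(2)] by auto
    define T where "T = 1 + (cmod (G z))\<^sup>2"
    define Y where "Y = P z * Db (Dz P) z - Dz P z * cnj (Dz P z)"
    have T: "T > 0" unfolding T_def by (rule one_plus_norm_pos)
    define R where "R = supp z * (du (du supp) z + dv (dv supp) z) + 2 * lam z * (supp z)\<^sup>2 - ((du supp z)\<^sup>2 + (dv supp z)\<^sup>2)"
    have lam: "lam z = 4 * (cmod (deriv G z))\<^sup>2 / T\<^sup>2" using dG[OF z] by (simp add: T_def)
    have "complex_of_real R = of_real (32 * (s z)\<^sup>2 / T\<^sup>2) * Y"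
      using support_liouville_identity[OF V(1) z s G, of 1]
      unfolding R_def Y_def e1[OF z] e2[OF z] e3 lam \<psi>_def P_def[abs_def] p_def[abs_def] T_def by simp
    moreover have "R = c * exp (2 * \<mu> z) * lam z * supp z" using eq[OF zW] by (simp add: R_def)
    \<comment> \<open>With \<open>lam = 4 |G'|^2 / T^2\<close> and \<open>supp = 2 s^2\<close> the
      factor \<open>8\<close> on the left is \<open>32 / 4\<close>; the quarter is absorbed in
      \<open>Wr\<close>.\<close>
    moreover have "\<dots> = 32 * (s z)\<^sup>2 / T\<^sup>2 * (c * (cmod (Wr z))\<^sup>2)"
      unfolding lam sp(2)[OF z] Wr_norm[OF z]
      by (simp add: power_mult_distrib power_divide exp_double power2_eq_square)
    ultimately have "of_real (32 * (s z)\<^sup>2 / T\<^sup>2) * Y = of_real (32 * (s z)\<^sup>2 / T\<^sup>2) * complex_of_real (c * (cmod (Wr z))\<^sup>2)"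
      by (metis of_real_mult)
    moreover have "complex_of_real (32 * (s z)\<^sup>2 / T\<^sup>2) \<noteq> 0"
      using sp(1)[OF z] T by (simp only: of_real_eq_0_iff) auto
    ultimately have "Y = complex_of_real (c * (cmod (Wr z))\<^sup>2)" by (metis mult_left_cancel)
    then show ?thesis unfolding Y_def of_real_mult complex_norm_square .
  qed
  have Pr: "cnj (P z) = P z" "Re (P z) > 0" if "z \<in> V" for z
    using sp(1)[OF that] one_plus_norm_pos[of "G z"] by (simp_all add: P_def p_def)
  obtain \<rho> f1 f2 where f: "0 < \<rho>" "\<rho> \<le> r" "f1 holomorphic_on ball z0 \<rho>" "f2 holomorphic_on ball z0 \<rho>"
    "\<And>z. z \<in> ball z0 \<rho> \<Longrightarrow> P z = f1 z * cnj (f1 z) + of_real c * (f2 z * cnj (f2 z))"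
    "\<And>z. z \<in> ball z0 \<rho> \<Longrightarrow> cmod (f1 z * deriv f2 z - f2 z * deriv f1 z) = cmod (Wr z)"
    using liouville_local[OF r(1) Pf(1-4)[unfolded V_def] Pr[unfolded V_def] Pf(5)[unfolded V_def] Wr[unfolded V_def] Wr_nz[unfolded V_def] Peq[unfolded V_def]]
    by metis
  have sub: "ball z0 \<rho> \<subseteq> V" using f(2) by (auto simp: V_def)
  show thesis
  proof (rule that[OF f(1) _ _ f(3,4)])
    show "ball z0 \<rho> \<subseteq> W" using sub V by blast
    show "G holomorphic_on ball z0 \<rho>" using G sub holomorphic_on_subset by blast
    fix z assume z: "z \<in> ball z0 \<rho>"
    then have zV: "z \<in> V" using sub by blast
    show "snd (reflect b (N z)) \<noteq> - 1" using ne'[OF zV] .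
    show "deriv G z \<noteq> 0" using dG[OF zV] by blast
    have "complex_of_real (p z) = of_real ((cmod (f1 z))\<^sup>2 + c * (cmod (f2 z))\<^sup>2)"
      using f(5)[OF z] unfolding of_real_add of_real_mult complex_norm_square P_def by simp
    then have "p z = (cmod (f1 z))\<^sup>2 + c * (cmod (f2 z))\<^sup>2" by (simp only: of_real_eq_iff)
    then show "(cmod (f1 z))\<^sup>2 + c * (cmod (f2 z))\<^sup>2 = sqrt (supp z / 2) * (1 + (cmod (G z))\<^sup>2)"
      by (simp add: p_def s_def)
    show "cmod (f1 z * deriv f2 z - f2 z * deriv f1 z) = exp (\<mu> z) / 2 * cmod (deriv G z)"
      using f(6)[OF z] Wr_norm[OF zV] by simp
  qed
qed

text \<open>Both sides have the same inner products with the frame \<open>N\<close>,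
  \<open>du N\<close>, \<open>dv N\<close>: the support function and its two partial
  derivatives.\<close>

lemma position_formula:
  fixes c :: real
  assumes V: "open V" "V \<subseteq> W" "z \<in> V" and hol: "G holomorphic_on V" "f1 holomorphic_on V" "f2 holomorphic_on V"
    and nz: "deriv G z \<noteq> 0" and N: "\<And>w. w \<in> V \<Longrightarrow> N w = gauss_inv (G w)"
    and s: "\<And>w. w \<in> V \<Longrightarrow> supp w = 2 * ((cmod (f1 w))\<^sup>2 + c * (cmod (f2 w))\<^sup>2)\<^sup>2 / (1 + (cmod (G w))\<^sup>2)\<^sup>2"
  shows "X z = hqsf_X c G f1 f2 z"
proof -
  have zW: "z \<in> W" using V by blast
  note d = holomorphic_derivI[OF hol(1) V(1,3)] holomorphic_derivI[OF hol(2) V(1,3)] holomorphic_derivI[OF hol(3) V(1,3)]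
  note rd = rep_derivative[OF d nz, of c]
  have dN: "du N z = gauss_inv_deriv (G z) (deriv G z)" "dv N z = gauss_inv_deriv (G z) (\<i> * deriv G z)"
    using du_dv_cong(1,2)[OF V(1,3) N] gauss_inv_comp(2,3)[OF d(1)] by simp_all
  have "du supp z = hqsf_X c G f1 f2 z \<bullet> du N z" "dv supp z = hqsf_X c G f1 f2 z \<bullet> dv N z"
    using du_dv_cong(1,2)[OF V(1,3) s] du_dv_has_derivative[OF rd(2)] by (simp_all add: dN mult.commute)
  then have "X z \<bullet> du N z = hqsf_X c G f1 f2 z \<bullet> du N z" "X z \<bullet> dv N z = hqsf_X c G f1 f2 z \<bullet> dv N z"
    using supp_derivs[OF zW] by simp_all
  moreover have "X z \<bullet> N z = hqsf_X c G f1 f2 z \<bullet> N z"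
    using rd(1) s[OF V(3)] N[OF V(3)] by (simp add: supp_def)
  ultimately show ?thesis
    using expansion[OF zW, of "X z"] expansion[OF zW, of "hqsf_X c G f1 f2 z"] by simp
qed

text \<open>No hypothesis relates the given normal \<open>N\<close> to \<open>G\<close>. That they
  agree up to sign is deduced from the formula: it gives the pairing with
  \<open>gauss_inv (G w)\<close> the right differential, so \<open>dX\<close> is orthogonal to that
  vector. The sign \<open>e\<close> is the one by which orientation enters the constant.\<close>

lemma parametrization_curvature:
  fixes c :: real
  assumes V: "open V" "V \<subseteq> W" "z \<in> V" and hol: "G holomorphic_on V" "f1 holomorphic_on V" "f2 holomorphic_on V"
    and nz: "\<And>w. w \<in> V \<Longrightarrow> deriv G w \<noteq> 0"
    and X: "\<And>w. w \<in> V \<Longrightarrow> X w = hqsf_X c G f1 f2 w"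
  obtains e where "e = 1 \<or> e = (-1::real)" "N z = e *\<^sub>R gauss_inv (G z)"
    "supp z = e * (2 * ((cmod (f1 z))\<^sup>2 + c * (cmod (f2 z))\<^sup>2)\<^sup>2 / (1 + (cmod (G z))\<^sup>2)\<^sup>2)"
    "supp z * (du (du supp) z + dv (dv supp) z) + 2 * lam z * (supp z)\<^sup>2 - ((du supp z)\<^sup>2 + (dv supp z)\<^sup>2)
      = lam z * supp z * (4 * e * c * (cmod (f1 z * deriv f2 z - f2 z * deriv f1 z))\<^sup>2 / (cmod (deriv G z))\<^sup>2)"
proof -
  define M where "M w = gauss_inv (G w)" for w
  define \<psi> where "\<psi> w = 2 * ((cmod (f1 w))\<^sup>2 + c * (cmod (f2 w))\<^sup>2)\<^sup>2 / (1 + (cmod (G w))\<^sup>2)\<^sup>2" for w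
  have d: "(G has_field_derivative deriv G w) (at w)" "(f1 has_field_derivative deriv f1 w) (at w)"
     "(f2 has_field_derivative deriv f2 w) (at w)" if "w \<in> V" for w
    using holomorphic_derivI[OF hol(1) V(1) that] holomorphic_derivI[OF hol(2) V(1) that] holomorphic_derivI[OF hol(3) V(1) that] by simp_all
  have XM: "X w \<bullet> M w = \<psi> w" if "w \<in> V" for w
    using rep_derivative(1)[OF d[OF that] nz[OF that]] X[OF that] by (simp add: M_def \<psi>_def)
  have M1: "M w \<bullet> M w = 1" for w by (simp add: M_def gauss_inv_unit)
  have NM: "N w = (N w \<bullet> M w) *\<^sub>R M w \<and> (N w \<bullet> M w) * (N w \<bullet> M w) = 1" if w: "w \<in> V" for w
  proof -
    have wW: "w \<in> W" using V w by blast
    have dM: "M differentiable (at w)" "du M w = gauss_inv_deriv (G w) (deriv G w)" "dv M w = gauss_inv_deriv (G w) (\<i> * deriv G w)"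
      using gauss_inv_comp[OF d(1)[OF w]] by (simp_all add: M_def[abs_def])
    note D = du_dv_has_derivative[OF rep_derivative(2)[OF d[OF w] nz[OF w], of c], folded \<psi>_def]
    have "du (\<lambda>w. X w \<bullet> M w) w = X w \<bullet> du M w" "dv (\<lambda>w. X w \<bullet> M w) w = X w \<bullet> dv M w"
      using du_dv_cong(1,2)[OF V(1) w XM] D X[OF w] by (simp_all add: dM mult.commute)
    then have XM0: "du X w \<bullet> M w = 0" "dv X w \<bullet> M w = 0"
      using du_dv_inner[OF diff(1)[OF wW] dM(1)] by simp_all
    define ee f gg where "ee = - (du X w \<bullet> du N w)" and "f = - (du X w \<bullet> dv N w)" and "gg = - (dv X w \<bullet> dv N w)"
    have f': "dv X w \<bullet> du N w = - f" using second_form_symmetric[OF wW] by (simp add: f_def)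
    have K: "ee * gg - f\<^sup>2 \<noteq> 0"
      using curved[OF wW] by (auto simp: gauss_curv_def ee_def f_def gg_def)
    have l: "lam w \<noteq> 0" using lam_pos[OF wW] by simp
    \<comment> \<open>The tangential components of \<open>M w\<close>. They solve a homogeneous
      linear system whose matrix is the second fundamental form, which is nondegenerate because the
      curvature is not 0.\<close>
    define x y where "x = M w \<bullet> du N w" and "y = M w \<bullet> dv N w"
    have "ee * x + f * y = 0" "f * x + gg * y = 0"
      using inner_expansion[OF wW, of "du X w" "M w"] inner_expansion[OF wW, of "dv X w" "M w"] XM0 l f' normal_u[OF wW] normal_v[OF wW]
      by (simp_all add: ee_def f_def gg_def x_def y_def)
    then have "(ee * gg - f\<^sup>2) * x = 0" "(ee * gg - f\<^sup>2) * y = 0"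
      by algebra+
    then have "x = 0" "y = 0" using K by simp_all
    then have Mw: "M w = (M w \<bullet> N w) *\<^sub>R N w" using expansion[OF wW, of "M w"] by (simp add: x_def y_def)
    then have "M w \<bullet> M w = (M w \<bullet> N w) *\<^sub>R N w \<bullet> M w" by metis
    then have t: "(M w \<bullet> N w) * (M w \<bullet> N w) = 1" using M1 by (simp add: inner_commute)
    have "(M w \<bullet> N w) *\<^sub>R M w = ((M w \<bullet> N w) * (M w \<bullet> N w)) *\<^sub>R N w"
      using Mw by (metis scaleR_scaleR)
    then show ?thesis using t by (simp add: inner_commute)
  qed
  define t where "t w = N w \<bullet> M w" for w
  define e where "e = t z"
  have e: "e = 1 \<or> e = -1" "e * e = 1"
    using NM[OF V(3)] by (auto simp: e_def t_def square_eq_1_iff)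
  have "continuous_on V t"
  proof -
    have "continuous_on V M"
      using gauss_inv_comp(1)[OF d(1)] unfolding M_def[abs_def]
      by (intro continuous_at_imp_continuous_on ballI differentiable_imp_continuous_within) auto
    then show ?thesis unfolding t_def
      using continuous_on_subset[OF Ck_on_imp_continuous_on[OF C2_N] V(2)] by (intro continuous_intros)
  qed
  then have "open (V \<inter> (\<lambda>w. e * t w) -` {0<..})"
    using V(1) by (intro continuous_open_preimage continuous_intros) auto
  \<comment> \<open>On this neighbourhood the continuous sign \<open>t\<close> keeps its value
    \<open>e\<close>, so \<open>N w = e *\<^sub>R M w\<close> may be differentiated.\<close>
  define V' where "V' = V \<inter> (\<lambda>w. e * t w) -` {0<..}"
  have V': "open V'" "z \<in> V'" "V' \<subseteq> V" "V' \<subseteq> W"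
    using \<open>open (V \<inter> _)\<close> V e by (auto simp: V'_def e_def)
  have te: "t w = e" if "w \<in> V'" for w
  proof -
    have "t w * t w = 1" "e * t w > 0" using NM[of w] that by (auto simp: V'_def t_def)
    then show ?thesis using e(1) by (auto simp: square_eq_1_iff)
  qed
  have Ne: "N w = e *\<^sub>R M w" if "w \<in> V'" for w
    using NM[of w] te[OF that] V'(3) that by (auto simp: t_def)
  have sup: "supp w = e * \<psi> w" if "w \<in> V'" for w
    using XM[of w] Ne[OF that] V'(3) that by (auto simp: supp_def)
  have lam: "lam z = 4 * (cmod (deriv G z))\<^sup>2 / (1 + (cmod (G z))\<^sup>2)\<^sup>2"
  proof -
    have "du N z = e *\<^sub>R du M z"
      using du_dv_cong(1)[OF V'(1,2) Ne] du_dv_bounded_linear(1)[OF bounded_linear_scaleR_right gauss_inv_comp(1)[OF d(1)[OF V(3)]]]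
      by (simp add: M_def[abs_def])
    then show ?thesis
      using e(2) gauss_inv_comp(2)[OF d(1)[OF V(3)]] gauss_inv_deriv_sqnorm by (simp add: lam_def M_def[abs_def] mult.assoc[symmetric])
  qed
  define T where "T w = 1 + (cmod (G w))\<^sup>2" for w
  have T: "T w > 0" for w unfolding T_def by (rule one_plus_norm_pos)
  define p where "p w = (cmod (f1 w))\<^sup>2 + c * (cmod (f2 w))\<^sup>2" for w
  \<comment> \<open>In contrast to the direct implication, \<open>s\<close> is defined from the pair
    and may be negative; only its square enters the support function.\<close>
  define s where "s w = p w * inverse (T w)" for w
  have s: "Ck_on 2 V' s"
    unfolding s_def p_def T_def using V' hol T
    by (intro Ck_on_mult Ck_on_add Ck_on_const Ck_on_inverse Ck_on_norm_square_holomorphic)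
      (auto intro: holomorphic_on_subset simp: T_def[symmetric] less_imp_neq[symmetric])
  define \<phi> where "\<phi> = (\<lambda>w. e * (2 * (s w * s w)))"
  have e1: "supp w = \<phi> w" if "w \<in> V'" for w
    using sup[OF that] by (simp add: \<phi>_def \<psi>_def s_def p_def T_def power2_eq_square divide_inverse)
  have e2: "du supp w = du \<phi> w" "dv supp w = dv \<phi> w" if "w \<in> V'" for w
    using du_dv_cong(1,2)[OF V'(1) that e1] by auto
  have e3: "du (du supp) z = du (du \<phi>) z" "dv (dv supp) z = dv (dv \<phi>) z"
    using du_dv_cong(1)[OF V'(1,2) e2(1)] du_dv_cong(2)[OF V'(1,2) e2(2)] by auto
  define R where "R = supp z * (du (du supp) z + dv (dv supp) z) + 2 * lam z * (supp z)\<^sup>2 - ((du supp z)\<^sup>2 + (dv supp z)\<^sup>2)"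
  define Q where "Q = (cmod (f1 z * deriv f2 z - f2 z * deriv f1 z))\<^sup>2"
  have hol': "G holomorphic_on V'" "f1 holomorphic_on V'" "f2 holomorphic_on V'"
    using hol V'(3) holomorphic_on_subset by blast+
  have sT: "s w * (1 + (cmod (G w))\<^sup>2) = (cmod (f1 w))\<^sup>2 + c * (cmod (f2 w))\<^sup>2" for w
    using T[of w] by (simp add: s_def p_def T_def[symmetric])
  have "complex_of_real R = of_real (32 * (s z)\<^sup>2 / (T z)\<^sup>2) * of_real (c * Q)"
    using support_liouville_identity[OF V'(1,2) s hol'(1) e(2)] form_liouville[OF V'(1,2) hol'(2,3), of c]
    unfolding R_def e1[OF V'(2)] e2[OF V'(2)] e3 lam \<phi>_def T_def Q_def sT by simp
  then have R: "R = 32 * (s z)\<^sup>2 / (T z)\<^sup>2 * (c * Q)"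
    by (metis of_real_eq_iff of_real_mult)
  have "lam z * supp z * (4 * e * c * Q / (cmod (deriv G z))\<^sup>2) = (e * e) * (32 * (s z)\<^sup>2 / (T z)\<^sup>2 * (c * Q))"
    unfolding lam e1[OF V'(2)] \<phi>_def T_def[symmetric] using nz[OF V(3)] by (simp add: power2_eq_square)
  then have "R = lam z * supp z * (4 * e * c * Q / (cmod (deriv G z))\<^sup>2)" using R e(2) by simp
  then show thesis
    using that[OF e(1)] Ne[OF V'(2)] sup[OF V'(2)] by (simp add: R_def Q_def M_def \<psi>_def)
qed

end

section \<open>Charts\<close>

locale surface_atlas =
  fixes S :: "'a::topological_space set" and A :: "'a chart set"
  assumes rs: "riemann_surface S A"
begin

lemma chart:
  assumes "C \<in> A"
  shows chart_openin: "openin (top_of_set S) (fst C)" and chart_subset: "fst C \<subseteq> S"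
    and chart_open: "open (snd C ` fst C)"
    and chart_homeo: "homeomorphism (fst C) (snd C ` fst C) (snd C) (inv_into (fst C) (snd C))"
proof -
  have "(\<lambda>(V, \<phi>). openin (top_of_set S) V \<and> open (\<phi> ` V) \<and> homeomorphism V (\<phi> ` V) \<phi> (inv_into V \<phi>)) C"
    using rs assms unfolding riemann_surface_def by blast
  then show "openin (top_of_set S) (fst C)" "fst C \<subseteq> S" "open (snd C ` fst C)"
    "homeomorphism (fst C) (snd C ` fst C) (snd C) (inv_into (fst C) (snd C))"
    using rs assms unfolding riemann_surface_def by (auto simp: case_prod_beta)
qed

lemma coords_S:
  assumes "C \<in> A"
  shows "coords C S = snd C ` fst C" "coords C (fst C) = snd C ` fst C"
  using chart_subset[OF assms] by (auto simp: coords_def)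

lemma obtain_chart:
  assumes "x \<in> S"
  obtains C where "C \<in> A" "x \<in> fst C"
  using rs assms unfolding riemann_surface_def by blast

lemma chart_inv:
  assumes "C \<in> A"
  shows "x \<in> fst C \<Longrightarrow> inv_into (fst C) (snd C) (snd C x) = x"
    "z \<in> coords C U \<Longrightarrow> snd C (inv_into (fst C) (snd C) z) = z"
    "z \<in> coords C U \<Longrightarrow> inv_into (fst C) (snd C) z \<in> fst C"
    "z \<in> coords C U \<Longrightarrow> inv_into (fst C) (snd C) z \<in> U"
  using homeomorphism_apply1[OF chart_homeo[OF assms]] homeomorphism_apply2[OF chart_homeo[OF assms]]
  by (auto simp: coords_def)

lemma loc_at: "C \<in> A \<Longrightarrow> x \<in> fst C \<Longrightarrow> loc C F (snd C x) = F x"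
  using chart_inv(1) by (simp add: loc_def)

lemma coordsI: "x \<in> fst C \<Longrightarrow> x \<in> U \<Longrightarrow> snd C x \<in> coords C U"
  by (auto simp: coords_def)

lemma coords_subset: "U \<subseteq> V \<Longrightarrow> coords C U \<subseteq> coords C V"
  by (auto simp: coords_def)

lemma open_coords:
  assumes C: "C \<in> A" and U: "openin (top_of_set S) U"
  shows "open (coords C U)"
proof -
  obtain T where "open T" "U = S \<inter> T" using U by (auto simp: openin_open)
  then have "openin (top_of_set (fst C)) (fst C \<inter> T)" "U \<inter> fst C = fst C \<inter> T"
    using chart_subset[OF C] by (auto intro: openin_open_Int)
  then have "openin (top_of_set (fst C)) (U \<inter> fst C)" by simp
  then have "openin (top_of_set (snd C ` fst C)) (snd C ` (U \<inter> fst C))"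
    using homeomorphism_imp_open_map[OF chart_homeo[OF C]] by blast
  then show ?thesis
    using chart_open[OF C] openin_open_trans unfolding coords_def by blast
qed

lemma open_coords_S: "C \<in> A \<Longrightarrow> open (coords C S)"
  by (rule open_coords) auto

lemma openin_preimage:
  assumes C: "C \<in> A" and Q: "open Q"
  shows "openin (top_of_set S) {x \<in> fst C. snd C x \<in> Q}"
proof -
  have "openin (top_of_set (fst C)) (fst C \<inter> snd C -` Q)"
    using homeomorphism_cont1[OF chart_homeo[OF C]] Q by (rule continuous_openin_preimage_gen)
  moreover have "fst C \<inter> snd C -` Q = {x \<in> fst C. snd C x \<in> Q}" by auto
  ultimately show ?thesis using openin_trans chart_openin[OF C] by metis
qed

lemma transition:
  assumes C: "C \<in> A" and D: "D \<in> A"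
  shows "loc C (snd D) holomorphic_on coords C (fst D)" "open (coords C (fst D))"
    "z \<in> coords C (fst D) \<Longrightarrow> loc C F z = loc D F (loc C (snd D) z)"
    "z \<in> coords C (fst D) \<Longrightarrow> z \<in> coords C U \<Longrightarrow> loc C (snd D) z \<in> coords D U"
proof -
  show "loc C (snd D) holomorphic_on coords C (fst D)"
    using rs C D unfolding riemann_surface_def by blast
  show "open (coords C (fst D))" using open_coords[OF C chart_openin[OF D]] .
  show "loc C F z = loc D F (loc C (snd D) z)" if "z \<in> coords C (fst D)"
    using chart_inv(1)[OF D chart_inv(4)[OF C that]] by (simp add: loc_def)
  show "loc C (snd D) z \<in> coords D U" if "z \<in> coords C (fst D)" "z \<in> coords C U"
    using chart_inv(4)[OF C that(1)] chart_inv(4)[OF C that(2)] by (auto simp: loc_def coords_def)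
qed

text \<open>A property that does not change within small coordinate discs cannot change on a
  connected surface.\<close>

lemma locally_constant_on_connected:
  assumes conn: "connected S" and ab: "a \<in> S" "b \<in> S" "P a"
    and loc: "\<And>C z. C \<in> A \<Longrightarrow> z \<in> coords C S \<Longrightarrow>
      \<exists>r>0. \<forall>w\<in>ball z r \<inter> coords C S. P (inv_into (fst C) (snd C) w) \<longleftrightarrow> P (inv_into (fst C) (snd C) z)"
  shows "P b"
proof (rule connected_induction_simple[where P = P, OF conn ab(1,2,3)])
  fix x assume x: "x \<in> S"
  obtain C where C: "C \<in> A" "x \<in> fst C" using obtain_chart[OF x] .
  have "snd C x \<in> coords C S" using C x by (auto simp: coords_def)
  then obtain r where r: "r > 0" "\<And>w. w \<in> ball (snd C x) r \<inter> coords C S \<Longrightarrow>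
      P (inv_into (fst C) (snd C) w) \<longleftrightarrow> P (inv_into (fst C) (snd C) (snd C x))"
    using loc[OF C(1)] by blast
  define T where "T = {y \<in> fst C. snd C y \<in> ball (snd C x) r}"
  have "P y \<longleftrightarrow> P x" if y: "y \<in> T" for y
  proof -
    have "snd C y \<in> ball (snd C x) r \<inter> coords C S" "y \<in> fst C"
      using y chart_subset[OF C(1)] by (auto simp: T_def coords_def)
    from r(2)[OF this(1)] show ?thesis using chart_inv(1)[OF C(1)] C(2) \<open>y \<in> fst C\<close> by simp
  qed
  then have "\<forall>x\<in>T. \<forall>y\<in>T. P x \<longrightarrow> P y" by simp
  moreover have "openin (top_of_set S) T"
    unfolding T_def by (rule openin_preimage[OF C(1) open_ball])
  moreover have "x \<in> T" using C(2) r(1) by (simp add: T_def)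
  ultimately show "\<exists>T. openin (top_of_set S) T \<and> x \<in> T \<and> (\<forall>x\<in>T. \<forall>y\<in>T. P x \<longrightarrow> P y)" by blast
qed

end

section \<open>The conjugate atlas\<close>

definition conj_chart :: "'a chart \<Rightarrow> 'a chart" where
  "conj_chart C = (fst C, cnj \<circ> snd C)"

lemma conj_atlas_eq: "conj_atlas A = conj_chart ` A"
  by (simp add: conj_atlas_def conj_chart_def case_prod_beta)

lemma conj_chart_conj_chart [simp]: "conj_chart (conj_chart C) = C"
  by (simp add: conj_chart_def fun_eq_iff prod_eq_iff)

lemma conj_atlas_conj_atlas: "conj_atlas (conj_atlas A) = A"
  by (simp add: conj_atlas_eq image_image)

lemma loc_conj_chart: "loc (conj_chart C) F = (\<lambda>z. loc C F (cnj z))"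
proof -
  have "(cnj (snd C x) = z) = (snd C x = cnj z)" for x z by auto
  then show ?thesis by (simp add: loc_def conj_chart_def inv_into_def fun_eq_iff)
qed

lemma coords_conj_chart: "coords (conj_chart C) U = cnj ` coords C U"
  by (auto simp: coords_def conj_chart_def)

lemma mem_cnj_image: "z \<in> cnj ` W \<longleftrightarrow> cnj z \<in> W"
  by (metis complex_cnj_cnj image_iff)

lemma open_cnj_image: "open W \<Longrightarrow> open (cnj ` W)"
proof -
  assume "open W"
  moreover have "cnj ` W = cnj -` W" by (auto simp: mem_cnj_image)
  ultimately show ?thesis by (simp add: open_vimage continuous_on_cnj)
qed

text \<open>The new transition maps are the old ones conjugated before and after, which keeps them
  holomorphic.\<close>

lemma riemann_surface_conj:
  assumes "riemann_surface S A"
  shows "riemann_surface S (conj_atlas A)"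
proof -
  interpret surface_atlas S A by unfold_locales (rule assms)
  have "(\<Union>C\<in>conj_atlas A. fst C) = S"
    using assms by (auto simp: conj_atlas_eq conj_chart_def riemann_surface_def)
  moreover have "openin (top_of_set S) (fst C) \<and> open (snd C ` fst C) \<and>
      homeomorphism (fst C) (snd C ` fst C) (snd C) (inv_into (fst C) (snd C))" if C: "C \<in> conj_atlas A" for C
  proof -
    obtain D where D: "D \<in> A" "C = conj_chart D" using C unfolding conj_atlas_eq by blast
    have img: "snd C ` fst C = cnj ` (snd D ` fst D)" by (auto simp: D conj_chart_def)
    have inv: "inv_into (fst C) (snd C) = (\<lambda>z. inv_into (fst D) (snd D) (cnj z))"
      using loc_conj_chart[of D "\<lambda>x. x"] by (simp add: D loc_def comp_def)
    have "homeomorphism (fst C) (snd C ` fst C) (snd C) (inv_into (fst C) (snd C))"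
      unfolding homeomorphism_def img inv
    proof (intro conjI ballI)
      note h = chart_homeo[OF D(1)]
      show "continuous_on (fst C) (snd C)"
        using homeomorphism_cont1[OF h] by (auto simp: D conj_chart_def comp_def intro!: continuous_intros)
      show "continuous_on (cnj ` snd D ` fst D) (\<lambda>z. inv_into (fst D) (snd D) (cnj z))"
        by (rule continuous_on_compose2[OF homeomorphism_cont2[OF h]]) (auto intro!: continuous_intros)
      show "(\<lambda>z. inv_into (fst D) (snd D) (cnj z)) ` cnj ` snd D ` fst D = fst C"
        using homeomorphism_image2[OF h] by (simp add: image_image D conj_chart_def)
    qed (use homeomorphism_apply1[OF chart_homeo[OF D(1)]] homeomorphism_apply2[OF chart_homeo[OF D(1)]] in
        \<open>auto simp: D conj_chart_def\<close>)
    then show ?thesis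
      using chart_openin[OF D(1)] open_cnj_image[OF chart_open[OF D(1)]] img by (simp add: D conj_chart_def)
  qed
  moreover have "loc C (snd D) holomorphic_on coords C (fst D)" if CD: "C \<in> conj_atlas A" "D \<in> conj_atlas A" for C D
  proof -
    obtain C' D' where C': "C' \<in> A" "C = conj_chart C'" and D': "D' \<in> A" "D = conj_chart D'"
      using CD unfolding conj_atlas_eq by blast
    have "loc C' (snd D') holomorphic_on cnj ` (cnj ` coords C' (fst D'))"
      using transition(1)[OF C'(1) D'(1)] by (simp add: image_image)
    then have "cnj \<circ> loc C' (snd D') \<circ> cnj holomorphic_on cnj ` coords C' (fst D')"
      using open_cnj_image[OF transition(2)[OF C'(1) D'(1)]]
      by (intro holomorphic_on_compose_cnj_cnj) auto
    moreover have "loc C (snd D) = cnj \<circ> loc C' (snd D') \<circ> cnj"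
      unfolding C' loc_conj_chart by (simp add: D' conj_chart_def loc_def comp_def)
    ultimately show ?thesis unfolding C' coords_conj_chart by (simp add: D' conj_chart_def)
  qed
  ultimately show ?thesis unfolding riemann_surface_def by (auto simp: case_prod_beta)
qed

section \<open>Change of orientation\<close>

lemma du_dv_cnj:
  assumes "f differentiable (at (cnj z))"
  shows "(\<lambda>w. f (cnj w)) differentiable (at z)"
    "du (\<lambda>w. f (cnj w)) z = du f (cnj z)" "dv (\<lambda>w. f (cnj w)) z = - dv f (cnj z)"
proof -
  have c: "(cnj has_derivative cnj) (at z)"
    using has_derivative_cnj[OF has_derivative_ident[of "at z"]] by simp
  have D: "((\<lambda>w. f (cnj w)) has_derivative (\<lambda>h. Re (cnj h) *\<^sub>R du f (cnj z) + Im (cnj h) *\<^sub>R dv f (cnj z))) (at z)"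
    using has_derivative_compose[OF c differentiable_has_derivative_du_dv[OF assms]] .
  then show "(\<lambda>w. f (cnj w)) differentiable (at z)" by (auto simp: differentiable_def)
  show "du (\<lambda>w. f (cnj w)) z = du f (cnj z)" "dv (\<lambda>w. f (cnj w)) z = - dv f (cnj z)"
    using du_dv_has_derivative[OF D] by simp_all
qed

lemma Ck_on_minus: "open W \<Longrightarrow> Ck_on k W f \<Longrightarrow> Ck_on k W (\<lambda>w. - f w)"
  by (rule Ck_on_bounded_linear[OF _ bounded_linear_minus[OF bounded_linear_ident]])

lemma Ck_on_cnj:
  assumes "open W" "Ck_on k W f"
  shows "Ck_on k (cnj ` W) (\<lambda>w. f (cnj w))"
  using assms(2)
proof (induction k arbitrary: f)
  case 0
  then have "continuous_on W f" by simp
  then have "continuous_on (cnj ` W) (\<lambda>w. f (cnj w))"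
    by (rule continuous_on_compose2) (auto intro!: continuous_intros)
  then show ?case by simp
next
  case (Suc k)
  note op = open_cnj_image[OF assms(1)]
  have d: "f differentiable (at (cnj z))" if "z \<in> cnj ` W" for z
    using Suc.prems that by (auto simp: mem_cnj_image)
  have "Ck_on k (cnj ` W) (\<lambda>w. du f (cnj w))" "Ck_on k (cnj ` W) (\<lambda>w. - dv f (cnj w))"
    using Suc.IH[of "du f"] Ck_on_minus[OF op Suc.IH[of "dv f"]] Suc.prems by simp_all
  moreover have "Ck_on k (cnj ` W) (du (\<lambda>w. f (cnj w))) = Ck_on k (cnj ` W) (\<lambda>w. du f (cnj w))"
    "Ck_on k (cnj ` W) (dv (\<lambda>w. f (cnj w))) = Ck_on k (cnj ` W) (\<lambda>w. - dv f (cnj w))"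
    by (intro Ck_on_cong op du_dv_cnj d; assumption)+
  moreover have "\<forall>z\<in>cnj ` W. (\<lambda>w. f (cnj w)) differentiable (at z)"
    using du_dv_cnj(1)[OF d] by blast
  ultimately show ?case by simp
qed

text \<open>Conjugating the parameter changes the sign of the two mixed coefficients simultaneously;
  they enter the curvatures only through their squares and their product. The normal itself is
  kept.\<close>

lemma curvatures_cnj:
  assumes "X differentiable (at (cnj z))" "N differentiable (at (cnj z))"
  shows "gauss_curv (\<lambda>w. X (cnj w)) (\<lambda>w. N (cnj w)) z = gauss_curv X N (cnj z)"
    "mean_curv (\<lambda>w. X (cnj w)) (\<lambda>w. N (cnj w)) z = mean_curv X N (cnj z)"
  by (simp_all add: gauss_curv_def mean_curv_def Let_def du_dv_cnj[OF assms(1)] du_dv_cnj[OF assms(2)])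

lemma du_dv_uminus:
  assumes "f differentiable (at z)"
  shows "du (\<lambda>w. - f w) z = - du f z" "dv (\<lambda>w. - f w) z = - dv f z"
  using du_dv_bounded_linear[OF bounded_linear_minus[OF bounded_linear_ident] assms] by simp_all

lemma curvatures_uminus:
  assumes "N differentiable (at z)"
  shows "gauss_curv X (\<lambda>w. - N w) z = gauss_curv X N z"
    "mean_curv X (\<lambda>w. - N w) z = - mean_curv X N z"
  by (simp_all add: gauss_curv_def mean_curv_def du_dv_uminus[OF assms] Let_def minus_divide_left algebra_simps)

lemma conformal_surface_uminus:
  assumes "conformal_surface W X N"
  shows "conformal_surface W X (\<lambda>z. - N z)"
proof -
  interpret conformal_surface W X N by (rule assms)
  note d = du_dv_uminus[OF diff(2)] curvatures_uminus[OF diff(2)]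
  show ?thesis
    by unfold_locales
      (use open_W smooth_X smooth_N unit normal_u normal_v curved conf_norm conf_orth in
        \<open>auto simp: d smooth_on_def intro: Ck_on_minus\<close>)
qed

lemma conformal_surface_cnj:
  assumes "conformal_surface W X N"
  shows "conformal_surface (cnj ` W) (\<lambda>z. X (cnj z)) (\<lambda>z. N (cnj z))"
proof -
  interpret conformal_surface W X N by (rule assms)
  show ?thesis
  proof
    show "open (cnj ` W)" using open_cnj_image[OF open_W] .
    show "smooth_on (cnj ` W) (\<lambda>z. X (cnj z))" "smooth_on (cnj ` W) (\<lambda>z. N (cnj z))"
      using smooth_X smooth_N Ck_on_cnj[OF open_W] by (auto simp: smooth_on_def)
    fix z assume "z \<in> cnj ` W"
    then have z: "cnj z \<in> W" by (simp add: mem_cnj_image)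
    note d = du_dv_cnj[OF diff(1)[OF z]] du_dv_cnj[OF diff(2)[OF z]] curvatures_cnj[OF diff(1)[OF z] diff(2)[OF z]]
    show "N (cnj z) \<bullet> N (cnj z) = 1" "du (\<lambda>z. X (cnj z)) z \<bullet> N (cnj z) = 0"
      "dv (\<lambda>z. X (cnj z)) z \<bullet> N (cnj z) = 0" "gauss_curv (\<lambda>z. X (cnj z)) (\<lambda>z. N (cnj z)) z \<noteq> 0"
      "du (\<lambda>z. N (cnj z)) z \<bullet> du (\<lambda>z. N (cnj z)) z = dv (\<lambda>z. N (cnj z)) z \<bullet> dv (\<lambda>z. N (cnj z)) z"
      "du (\<lambda>z. N (cnj z)) z \<bullet> dv (\<lambda>z. N (cnj z)) z = 0"
      using unit[OF z] normal_u[OF z] normal_v[OF z] curved[OF z] conf_norm[OF z] conf_orth[OF z]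
      by (simp_all add: d)
  qed
qed

text \<open>The HQSF condition in one chart. Harmonicity is expressed by the flat Laplacian, which
  has the same null functions as that of the conformal metric \<open>III\<close>.\<close>

definition hqsf_eq :: "complex set \<Rightarrow> (complex \<Rightarrow> complex \<times> real) \<Rightarrow> (complex \<Rightarrow> complex \<times> real) \<Rightarrow> real \<Rightarrow> (complex \<Rightarrow> real) \<Rightarrow> bool" where
  "hqsf_eq W X N c \<mu> \<longleftrightarrow> Ck_on 2 W \<mu> \<and> (\<forall>z\<in>W. du (du \<mu>) z + dv (dv \<mu>) z = 0) \<and>
    (\<forall>z\<in>W. 2 * (X z \<bullet> N z) * mean_curv X N z
       + (c * (X z \<bullet> N z) * exp (2 * \<mu> z) + X z \<bullet> X z - (X z \<bullet> N z)\<^sup>2) * gauss_curv X N z = 0)"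

text \<open>The support function and \<open>H\<close> both change sign while \<open>K\<close> does
  not, so only the term with \<open>c\<close> needs compensation.\<close>

lemma hqsf_eq_uminus:
  assumes "conformal_surface W X N" "hqsf_eq W X N c \<mu>"
  shows "hqsf_eq W X (\<lambda>z. - N z) (- c) \<mu>"
proof -
  interpret conformal_surface W X N by (rule assms)
  show ?thesis using assms(2) by (simp add: hqsf_eq_def curvatures_uminus[OF diff(2)])
qed

lemma hqsf_eq_cnj:
  assumes "conformal_surface W X N" "hqsf_eq W X N c \<mu>"
  shows "hqsf_eq (cnj ` W) (\<lambda>z. X (cnj z)) (\<lambda>z. N (cnj z)) c (\<lambda>z. \<mu> (cnj z))"
proof -
  interpret conformal_surface W X N by (rule assms)
  have C: "Ck_on 2 W \<mu>" and h: "\<And>z. z \<in> W \<Longrightarrow> du (du \<mu>) z + dv (dv \<mu>) z = 0"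
    using assms(2) by (auto simp: hqsf_eq_def)
  have d: "z \<in> W \<Longrightarrow> \<mu> differentiable (at z)" "z \<in> W \<Longrightarrow> du \<mu> differentiable (at z)" "z \<in> W \<Longrightarrow> dv \<mu> differentiable (at z)" for z
    using C by (auto simp: numeral_2_eq_2)
  note op = open_cnj_image[OF open_W]
  have "du (du (\<lambda>z. \<mu> (cnj z))) z + dv (dv (\<lambda>z. \<mu> (cnj z))) z = 0" if z: "z \<in> cnj ` W" for z
  proof -
    have z': "cnj z \<in> W" using z by (simp add: mem_cnj_image)
    have "du (du (\<lambda>z. \<mu> (cnj z))) z = du (\<lambda>z. du \<mu> (cnj z)) z"
      by (rule du_dv_cong(1)[OF op z]) (simp add: du_dv_cnj d mem_cnj_image)
    moreover have "dv (dv (\<lambda>z. \<mu> (cnj z))) z = dv (\<lambda>z. - dv \<mu> (cnj z)) z"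
      by (rule du_dv_cong(2)[OF op z]) (simp add: du_dv_cnj d mem_cnj_image)
    ultimately show ?thesis
      using h[OF z'] du_dv_cnj[OF d(2)[OF z']] du_dv_cnj[OF d(3)[OF z']]
        du_dv_uminus[OF du_dv_cnj(1)[OF d(3)[OF z']]] by simp
  qed
  then show ?thesis
    using assms(2) Ck_on_cnj[OF open_W C]
    by (auto simp: hqsf_eq_def mem_cnj_image curvatures_cnj[OF diff(1) diff(2)])
qed

text \<open>In dimension two the conformal factor cancels inside the divergence and survives only as
  an outer divisor.\<close>

lemma laplace_beltrami_conformal:
  assumes W: "open W" "z \<in> W" and l: "\<And>w. w \<in> W \<Longrightarrow> E w = l w" "\<And>w. w \<in> W \<Longrightarrow> G w = l w"
    "\<And>w. w \<in> W \<Longrightarrow> F w = 0" "\<And>w. w \<in> W \<Longrightarrow> l w > 0"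
  shows "laplace_beltrami E F G h z = (du (du h) z + dv (dv h) z) / l z"
proof -
  have D: "sqrt (E w * G w - (F w)\<^sup>2) = l w" if "w \<in> W" for w
    using l(4)[OF that] unfolding l(1-3)[OF that] by (simp add: real_sqrt_mult)
  have "du (\<lambda>w. (G w * du h w - F w * dv h w) / sqrt (E w * G w - (F w)\<^sup>2)) z = du (du h) z"
  proof (rule du_dv_cong(1)[OF W])
    fix w assume w: "w \<in> W"
    show "(G w * du h w - F w * dv h w) / sqrt (E w * G w - (F w)\<^sup>2) = du h w"
      using l(4)[OF w] unfolding D[OF w] unfolding l(2)[OF w] l(3)[OF w] by simp
  qed
  moreover have "dv (\<lambda>w. (E w * dv h w - F w * du h w) / sqrt (E w * G w - (F w)\<^sup>2)) z = dv (dv h) z"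
  proof (rule du_dv_cong(2)[OF W])
    fix w assume w: "w \<in> W"
    show "(E w * dv h w - F w * du h w) / sqrt (E w * G w - (F w)\<^sup>2) = dv h w"
      using l(4)[OF w] unfolding D[OF w] unfolding l(1)[OF w] l(3)[OF w] by simp
  qed
  ultimately show ?thesis
    unfolding laplace_beltrami_def Let_def by (simp add: D[OF W(2)])
qed

section \<open>The HQSF condition on the whole surface under change of normal and atlas\<close>

locale conformal_immersion = surface_atlas S A for S :: "'a::topological_space set" and A +
  fixes X N :: "'a \<Rightarrow> complex \<times> real"
  assumes local_surface: "C \<in> A \<Longrightarrow> conformal_surface (coords C S) (loc C X) (loc C N)"
begin

lemma HQSF_iff:
  "HQSF A X N \<longleftrightarrow> (\<exists>c \<mu>. \<forall>C\<in>A. hqsf_eq (coords C S) (loc C X) (loc C N) c (loc C \<mu>))"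
proof -
  have "laplace_beltrami (\<lambda>w. du (loc C N) w \<bullet> du (loc C N) w) (\<lambda>w. du (loc C N) w \<bullet> dv (loc C N) w)
          (\<lambda>w. dv (loc C N) w \<bullet> dv (loc C N) w) h z = 0
      \<longleftrightarrow> du (du h) z + dv (dv h) z = 0"
    if C: "C \<in> A" and z: "z \<in> coords C S" for C h z
  proof -
    interpret c: conformal_surface "coords C S" "loc C X" "loc C N" using local_surface[OF C] .
    have "laplace_beltrami (\<lambda>w. du (loc C N) w \<bullet> du (loc C N) w) (\<lambda>w. du (loc C N) w \<bullet> dv (loc C N) w)
          (\<lambda>w. dv (loc C N) w \<bullet> dv (loc C N) w) h z = (du (du h) z + dv (dv h) z) / c.lam z"
    proof (rule laplace_beltrami_conformal[OF c.open_W z])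
      fix w assume w: "w \<in> coords C S"
      show "du (loc C N) w \<bullet> du (loc C N) w = c.lam w" by (simp only: c.lam_def)
      show "dv (loc C N) w \<bullet> dv (loc C N) w = c.lam w" unfolding c.lam_def by (rule c.conf_norm[OF w, symmetric])
      show "du (loc C N) w \<bullet> dv (loc C N) w = 0" "0 < c.lam w" by (rule c.conf_orth[OF w], rule c.lam_pos[OF w])
    qed
    then show ?thesis using c.lam_pos[OF z] by simp
  qed
  then have III: "III_harmonic A N \<mu> \<longleftrightarrow> (\<forall>C\<in>A. Ck_on 2 (coords C S) (loc C \<mu>) \<and>
      (\<forall>z\<in>coords C S. du (du (loc C \<mu>)) z + dv (dv (loc C \<mu>)) z = 0))" for \<mu>
    unfolding III_harmonic_def by (simp add: coords_S cong: ball_cong)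
  have cs: "C \<in> A \<Longrightarrow> coords C (fst C) = coords C S" for C by (simp add: coords_S)
  show ?thesis
    unfolding HQSF_def hqsf_eq_def Let_def III
    by (simp only: cs ball_conj_distrib conj_assoc cong: ball_cong)
qed

lemma conformal_immersion_uminus: "conformal_immersion S A X (\<lambda>x. - N x)"
proof (intro conformal_immersion.intro conformal_immersion_axioms.intro surface_atlas_axioms)
  fix C assume "C \<in> A"
  from conformal_surface_uminus[OF local_surface[OF this]]
  show "conformal_surface (coords C S) (loc C X) (loc C (\<lambda>x. - N x))" by (simp add: loc_def comp_def)
qed

lemma conformal_immersion_conj: "conformal_immersion S (conj_atlas A) X N"
proof (intro conformal_immersion.intro conformal_immersion_axioms.intro surface_atlas.intro)
  show "riemann_surface S (conj_atlas A)" using riemann_surface_conj[OF rs] .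
  fix C assume "C \<in> conj_atlas A"
  then obtain D where D: "D \<in> A" "C = conj_chart D" unfolding conj_atlas_eq by blast
  from conformal_surface_cnj[OF local_surface[OF D(1)]]
  show "conformal_surface (coords C S) (loc C X) (loc C N)"
    by (simp add: D coords_conj_chart loc_conj_chart)
qed

lemma HQSF_uminus: "HQSF A X N \<Longrightarrow> HQSF A X (\<lambda>x. - N x)"
proof -
  assume "HQSF A X N"
  then obtain c \<mu> where "\<forall>C\<in>A. hqsf_eq (coords C S) (loc C X) (loc C N) c (loc C \<mu>)"
    unfolding HQSF_iff by blast
  then have "\<forall>C\<in>A. hqsf_eq (coords C S) (loc C X) (loc C (\<lambda>x. - N x)) (- c) (loc C \<mu>)"
    using hqsf_eq_uminus[OF local_surface] by (auto simp: loc_def comp_def)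
  then show ?thesis
    unfolding conformal_immersion.HQSF_iff[OF conformal_immersion_uminus] by blast
qed

lemma HQSF_conj: "HQSF A X N \<Longrightarrow> HQSF (conj_atlas A) X N"
proof -
  assume "HQSF A X N"
  then obtain c \<mu> where "\<forall>C\<in>A. hqsf_eq (coords C S) (loc C X) (loc C N) c (loc C \<mu>)"
    unfolding HQSF_iff by blast
  then have "\<forall>C\<in>conj_atlas A. hqsf_eq (coords C S) (loc C X) (loc C N) c (loc C \<mu>)"
    using hqsf_eq_cnj[OF local_surface] by (auto simp: conj_atlas_eq coords_conj_chart loc_conj_chart)
  then show ?thesis
    unfolding conformal_immersion.HQSF_iff[OF conformal_immersion_conj] by blast
qed

end

lemma conformal_immersionI:
  assumes surface: "riemann_surface S A" and immersion: "immersion A X" and oriented: "unit_normal A X N"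
    and curvature: "\<forall>C\<in>A. \<forall>z\<in>coords C (fst C). gauss_curv (loc C X) (loc C N) z \<noteq> 0"
    and conformal: "III_conformal A N"
  shows "conformal_immersion S A X N"
proof -
  interpret surface_atlas S A by unfold_locales (rule surface)
  show ?thesis
  proof (intro conformal_immersion.intro conformal_immersion_axioms.intro surface_atlas_axioms)
    fix C assume C: "C \<in> A"
    have eq: "coords C (fst C) = coords C S" using coords_S[OF C] by simp
    show "conformal_surface (coords C S) (loc C X) (loc C N)"
    proof
      show "open (coords C S)" using open_coords_S[OF C] .
      show "smooth_on (coords C S) (loc C X)" "smooth_on (coords C S) (loc C N)"
        using immersion oriented C eq by (auto simp: immersion_def unit_normal_def)
      fix z assume z: "z \<in> coords C S"
      have n: "norm (loc C N z) = 1" "\<And>v. frechet_derivative (loc C X) (at z) v \<bullet> loc C N z = 0"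
        using oriented C eq z by (auto simp: unit_normal_def)
      show "loc C N z \<bullet> loc C N z = 1" using n(1) by (simp add: norm_eq_1)
      show "du (loc C X) z \<bullet> loc C N z = 0" "dv (loc C X) z \<bullet> loc C N z = 0"
        using n(2) by (simp_all add: du_def dv_def)
      show "gauss_curv (loc C X) (loc C N) z \<noteq> 0" using curvature C z eq by auto
      show "du (loc C N) z \<bullet> du (loc C N) z = dv (loc C N) z \<bullet> dv (loc C N) z"
        "du (loc C N) z \<bullet> dv (loc C N) z = 0"
        using conformal C z eq by (auto simp: III_conformal_def)
    qed
  qed
qed

section \<open>Meromorphic functions near a point\<close>

text \<open>\<open>G\<close> is the expression of the map \<open>f\<close> in a coordinate of the
  sphere that is finite at \<open>z\<close>: \<open>f\<close> itself, or its reciprocal at a pole.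
  In the second case \<open>inverse 0 = 0\<close> provides the value that the normal form
  prescribes.\<close>

lemma sphere_chart_properties:
  assumes V: "open V" "z \<in> V" and G: "G holomorphic_on V" and nz: "deriv G z \<noteq> 0"
    and f: "\<And>w. w \<in> V \<Longrightarrow> f w = (if b then inverse (G w) else G w)" and b: "b \<Longrightarrow> G z = 0"
  shows "f meromorphic_on {z}" "is_pole f z \<longleftrightarrow> b" "(is_pole f z \<and> f z = 0) \<or> f \<midarrow>z\<rightarrow> f z" "sphere_deriv_nz f z"
proof -
  have ev: "eventually (\<lambda>w. f w = (if b then inverse (G w) else G w)) (nhds z)"
    using V f by (intro eventually_nhds_in_open[THEN eventually_mono]) auto
  then have ev': "eventually (\<lambda>w. f w = (if b then inverse (G w) else G w)) (at z)"
    by (rule eventually_nhds_conv_at[THEN iffD1, THEN conjunct1])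
  have an: "G analytic_on {z}" using G V by (metis analytic_at)
  then have mer: "G meromorphic_on {z}" by (rule analytic_on_imp_meromorphic_on)
  have "(\<lambda>w. if b then inverse (G w) else G w) meromorphic_on {z}"
    using mer by (cases b) (auto intro: meromorphic_on_inverse)
  then show "f meromorphic_on {z}"
    using meromorphic_on_cong[of "{z}" f "\<lambda>w. if b then inverse (G w) else G w" "{z}"] ev' by simp
  have dG: "(G has_field_derivative deriv G z) (at z)" using holomorphic_derivI[OF G V] .
  have contG: "G \<midarrow>z\<rightarrow> G z" using dG DERIV_isCont isContD by blast
  show pole: "is_pole f z \<longleftrightarrow> b"
  proof (cases b)
    case True
    have "eventually (\<lambda>w. (G w - G z) / (w - z) \<noteq> 0) (at z)"
      using dG nz tendsto_imp_eventually_ne unfolding has_field_derivative_iff by blast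
    then have "eventually (\<lambda>w. G w \<noteq> 0) (at z)"
      by (rule eventually_mono) (use b[OF True] in auto)
    then have "filterlim G (at 0) (at z)" using contG b[OF True] by (simp add: filterlim_at)
    then have "is_pole (\<lambda>w. inverse (G w)) z"
      unfolding is_pole_def by (rule filterlim_compose[OF filterlim_inverse_at_infinity])
    moreover have "is_pole f z \<longleftrightarrow> is_pole (\<lambda>w. inverse (G w)) z"
      by (rule is_pole_cong) (use ev' True in auto)
    ultimately show ?thesis using True by simp
  next
    case False
    have "f \<midarrow>z\<rightarrow> G z" using contG ev' False by (simp add: tendsto_cong)
    then show ?thesis using not_tendsto_and_filterlim_at_infinity[of "at z" f] False unfolding is_pole_def by auto
  qed
  show "(is_pole f z \<and> f z = 0) \<or> f \<midarrow>z\<rightarrow> f z"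
  proof (cases b)
    case True
    then show ?thesis using pole f[OF V(2)] b by simp
  next
    case False
    have "f \<midarrow>z\<rightarrow> G z" using contG ev' False by (simp add: tendsto_cong)
    then show ?thesis using f[OF V(2)] False by simp
  qed
  show "sphere_deriv_nz f z"
  proof (cases b)
    case True
    have "deriv (\<lambda>w. inverse (f w)) z = deriv G z"
      by (rule deriv_cong_ev) (use ev True in \<open>auto elim: eventually_mono\<close>)
    then show ?thesis using True pole nz by (simp add: sphere_deriv_nz_def)
  next
    case False
    have "deriv f z = deriv G z"
      by (rule deriv_cong_ev) (use ev False in \<open>auto elim: eventually_mono\<close>)
    then show ?thesis using False pole nz by (simp add: sphere_deriv_nz_def)
  qed
qed

lemma deriv_quotient:
  assumes "open V" "z \<in> V" "u holomorphic_on V" "v holomorphic_on V" "v z \<noteq> 0"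
  shows "deriv (\<lambda>w. u w / v w) z = (deriv u z * v z - u z * deriv v z) / (v z * v z)"
  by (rule DERIV_imp_deriv) (rule DERIV_divide[OF holomorphic_derivI[OF assms(3,1,2)] holomorphic_derivI[OF assms(4,1,2)] assms(5)])

text \<open>Where the Gauss map has a pole, the functions on the surface are \<open>f1 / G\<close>
  and \<open>f2 / G\<close> with \<open>G\<close> vanishing to first order. Their quotient does not
  contain \<open>G\<close>, and the derivative of this quotient is governed by the Wronskian of
  \<open>f1\<close>, \<open>f2\<close>.\<close>

lemma sphere_pair_properties:
  assumes V: "open V" "z \<in> V" and G: "G holomorphic_on V" and nz: "deriv G z \<noteq> 0"
    and f: "f1 holomorphic_on V" "f2 holomorphic_on V" and W: "f1 z * deriv f2 z - f2 z * deriv f1 z \<noteq> 0"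
    and b: "b \<Longrightarrow> G z = 0"
    and h: "\<And>w. w \<in> V \<Longrightarrow> h1 w = (if b then inverse (G w) else 1) * f1 w"
       "\<And>w. w \<in> V \<Longrightarrow> h2 w = (if b then inverse (G w) else 1) * f2 w"
    and H: "\<And>w. w \<in> V \<Longrightarrow> H1 w = remove_sings h1 w" "\<And>w. w \<in> V \<Longrightarrow> H2 w = remove_sings h2 w"
  shows "h1 meromorphic_on {z}" "h2 meromorphic_on {z}" "wronskian_nz H1 H2 z"
    "\<not> b \<Longrightarrow> w \<in> V \<Longrightarrow> H1 w = f1 w" "\<not> b \<Longrightarrow> w \<in> V \<Longrightarrow> H2 w = f2 w"
proof -
  have an: "u analytic_on {w}" if "u holomorphic_on V" "w \<in> V" for u w
    using that V by (metis analytic_at)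
  have ev: "eventually (\<lambda>v. v \<in> V) (at w)" if "w \<in> V" for w
    using V(1) that by (rule eventually_at_in_open')
  have mer: "h meromorphic_on {z}" if "u holomorphic_on V" "\<And>w. w \<in> V \<Longrightarrow> h w = (if b then inverse (G w) else 1) * u w" for h u
  proof -
    have "(\<lambda>w. (if b then inverse (G w) else 1) * u w) meromorphic_on {z}"
      using analytic_on_imp_meromorphic_on[OF an[OF G V(2)]] analytic_on_imp_meromorphic_on[OF an[OF that(1) V(2)]]
      by (cases b) (auto intro!: meromorphic_intros)
    then show ?thesis
      using meromorphic_on_cong[of "{z}" h] eventually_mono[OF ev[OF V(2)]] that(2) by (smt (verit, best) singletonD)
  qed
  show "h1 meromorphic_on {z}" "h2 meromorphic_on {z}" using mer f h by blast+
  have Hf: "H w = u w" if u: "u holomorphic_on V" "\<And>w. w \<in> V \<Longrightarrow> h w = (if b then inverse (G w) else 1) * u w"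
      and H: "\<And>w. w \<in> V \<Longrightarrow> H w = remove_sings h w" and nb: "\<not> b" and w: "w \<in> V" for h u H w
  proof -
    have "remove_sings h w = u w"
    proof (rule remove_sings_eqI)
      have "u \<midarrow>w\<rightarrow> u w" using an[OF u(1) w] analytic_at_imp_isCont isContD by blast
      moreover have "eventually (\<lambda>v. h v = u v) (at w)" using ev[OF w] by (rule eventually_mono) (use u(2) nb in simp)
      ultimately show "h \<midarrow>w\<rightarrow> u w" by (simp add: tendsto_cong)
    qed
    then show ?thesis using H w by simp
  qed
  show H12: "\<not> b \<Longrightarrow> w \<in> V \<Longrightarrow> H1 w = f1 w" "\<not> b \<Longrightarrow> w \<in> V \<Longrightarrow> H2 w = f2 w" for w
    using Hf[OF f(1) h(1) H(1)] Hf[OF f(2) h(2) H(2)] by blast+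
  show "wronskian_nz H1 H2 z"
  proof (cases b)
    case False
    have lim: "\<not> is_pole u z" if "v holomorphic_on V" "\<And>w. w \<in> V \<Longrightarrow> u w = v w" for u v
    proof -
      have "v \<midarrow>z\<rightarrow> v z" using an[OF that(1) V(2)] analytic_at_imp_isCont isContD by blast
      moreover have "eventually (\<lambda>w. u w = v w) (at z)" using ev[OF V(2)] by (rule eventually_mono) (use that(2) in simp)
      ultimately have "u \<midarrow>z\<rightarrow> v z" by (simp add: tendsto_cong)
      then show ?thesis using not_tendsto_and_filterlim_at_infinity[of "at z" u] unfolding is_pole_def by auto
    qed
    have "\<not> is_pole H1 z" "\<not> is_pole H2 z" using lim f H12 False by blast+
    moreover have "deriv H1 z = deriv f1 z" "deriv H2 z = deriv f2 z"
      using H12 False eventually_nhds_in_open[OF V]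
      by (auto intro!: deriv_cong_ev elim: eventually_mono)
    ultimately show ?thesis using W H12 False V(2) by (simp add: wronskian_nz_def)
  next
    case True
    note Gz = b[OF True]
    have dG: "(G has_field_derivative deriv G z) (at z)" using holomorphic_derivI[OF G V] .
    have "eventually (\<lambda>w. (G w - G z) / (w - z) \<noteq> 0) (at z)"
      using dG nz tendsto_imp_eventually_ne unfolding has_field_derivative_iff by blast
    then have "eventually (\<lambda>w. G w \<noteq> 0 \<and> w \<in> V) (at z)"
      using ev[OF V(2)] by eventually_elim (use Gz in auto)
    then obtain r where r: "r > 0" "\<And>w. w \<in> ball z r \<Longrightarrow> w \<noteq> z \<Longrightarrow> G w \<noteq> 0 \<and> w \<in> V"
      unfolding eventually_at by (auto simp: dist_commute)
    have Hq: "H w = u w / G w" if u: "u holomorphic_on V" "\<And>w. w \<in> V \<Longrightarrow> h w = (if b then inverse (G w) else 1) * u w"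
      and H: "\<And>w. w \<in> V \<Longrightarrow> H w = remove_sings h w" and w: "w \<in> ball z r" "w \<noteq> z" for h u H w
    proof -
      have wV: "w \<in> V" "G w \<noteq> 0" using r(2)[OF w] by auto
      have "(\<lambda>w. u w / G w) analytic_on {w}" using an[OF u(1) wV(1)] an[OF G wV(1)] wV(2) by (auto intro!: analytic_intros)
      then have "(\<lambda>w. u w / G w) \<midarrow>w\<rightarrow> u w / G w" using analytic_at_imp_isCont isContD by blast
      moreover have "eventually (\<lambda>v. h v = u v / G v) (at w)"
        using ev[OF wV(1)] by (rule eventually_mono) (use u(2) True in \<open>simp add: field_simps\<close>)
      ultimately have "h \<midarrow>w\<rightarrow> u w / G w" by (simp add: tendsto_cong)
      then show ?thesis using H[OF wV(1)] by auto
    qed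
    note H1q = Hq[OF f(1) h(1) H(1)] and H2q = Hq[OF f(2) h(2) H(2)]
    have pole: "is_pole H z" if u: "u holomorphic_on V" "u z \<noteq> 0" and Hu: "\<And>w. w \<in> ball z r \<Longrightarrow> w \<noteq> z \<Longrightarrow> H w = u w / G w" for H u
    proof -
      define V' where "V' = V \<inter> u -` (- {0})"
      have V': "open V'" "z \<in> V'" "V' \<subseteq> V"
        using continuous_open_preimage[OF holomorphic_on_imp_continuous_on[OF u(1)] V(1), of "- {0}"] u(2) V(2)
        by (auto simp: V'_def)
      have hol: "u holomorphic_on V'" "G holomorphic_on V'" using u(1) G V'(3) holomorphic_on_subset by blast+
      have q: "(\<lambda>w. G w / u w) holomorphic_on V'" using hol by (auto intro!: holomorphic_intros simp: V'_def)
      have "deriv (\<lambda>w. G w / u w) z \<noteq> 0"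
        using deriv_quotient[OF V'(1,2) hol(2,1) u(2)] nz u(2) Gz by simp
      then have "is_pole (\<lambda>w. inverse (G w / u w)) z"
        using sphere_chart_properties(2)[OF V'(1,2) q, of "\<lambda>w. inverse (G w / u w)" True] Gz by simp
      moreover have "is_pole (\<lambda>w. inverse (G w / u w)) z \<longleftrightarrow> is_pole H z"
        by (rule is_pole_cong) (use r(1) Hu in \<open>auto simp: eventually_at dist_commute intro!: exI[of _ r]\<close>)
      ultimately show ?thesis by simp
    qed
    \<comment> \<open>The Wronskian excludes a common zero, so division by \<open>G\<close> creates
      a pole in at least one component; the condition \<open>wronskian_nz\<close> then concerns the
      quotient.\<close>
    have one: "f1 z \<noteq> 0 \<or> f2 z \<noteq> 0" using W by auto
    then have "is_pole H1 z \<or> is_pole H2 z"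
      using pole[OF f(1) _ H1q] pole[OF f(2) _ H2q] by blast
    moreover define R where "R = remove_sings (\<lambda>w. H2 w / H1 w)"
    have evq: "eventually (\<lambda>v. H2 v / H1 v = f2 v / f1 v) (at w)" if w: "w \<in> ball z r" for w
    proof -
      have "eventually (\<lambda>v. v \<in> ball z r - {z}) (at w)"
      proof (cases "w = z")
        case True
        then show ?thesis using r(1) by (auto simp: eventually_at dist_commute intro!: exI[of _ r])
      next
        case False
        then show ?thesis using w by (intro eventually_at_in_open') auto
      qed
      then show ?thesis
      proof (rule eventually_mono)
        fix v assume v: "v \<in> ball z r - {z}"
        then have "G v \<noteq> 0" using r(2)[of v] by auto
        then show "H2 v / H1 v = f2 v / f1 v" using H1q[of v] H2q[of v] v by simp
      qed
    qed
    have "sphere_deriv_nz R z"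
    proof (cases "f1 z = 0")
      case False
      define V' where "V' = (V \<inter> f1 -` (- {0})) \<inter> ball z r"
      have V': "open V'" "z \<in> V'" "V' \<subseteq> V"
        using continuous_open_preimage[OF holomorphic_on_imp_continuous_on[OF f(1)] V(1), of "- {0}"] False V(2) r(1)
        by (auto simp: V'_def)
      have hol: "f1 holomorphic_on V'" "f2 holomorphic_on V'" using f V'(3) holomorphic_on_subset by blast+
      have q: "(\<lambda>w. f2 w / f1 w) holomorphic_on V'" using hol by (auto intro!: holomorphic_intros simp: V'_def)
      have "deriv (\<lambda>w. f2 w / f1 w) z \<noteq> 0"
        using deriv_quotient[OF V'(1,2) hol(2,1) False] W False by (simp add: mult.commute)
      moreover have "R w = f2 w / f1 w" if w: "w \<in> V'" for w
      proof -
        have "(\<lambda>w. f2 w / f1 w) analytic_on {w}" using q V'(1) w by (metis analytic_at)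
        then have "(\<lambda>w. f2 w / f1 w) \<midarrow>w\<rightarrow> f2 w / f1 w" using analytic_at_imp_isCont isContD by blast
        moreover have "eventually (\<lambda>v. H2 v / H1 v = f2 v / f1 v) (at w)" using evq w by (simp add: V'_def)
        ultimately have "(\<lambda>w. H2 w / H1 w) \<midarrow>w\<rightarrow> f2 w / f1 w" by (simp add: tendsto_cong)
        then show ?thesis unfolding R_def by auto
      qed
      ultimately show ?thesis
        using sphere_chart_properties(4)[OF V'(1,2) q, of R False] by simp
    next
      \<comment> \<open>Now \<open>f2 / f1\<close> has a simple pole at \<open>z\<close>, and its
        reciprocal \<open>f1 / f2\<close> is the coordinate in which the derivative is taken. The
        value of \<open>R\<close> at this pole is 0 by convention, in accordance with
        \<open>inverse 0 = 0\<close>.\<close>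
      case True
      then have f2: "f2 z \<noteq> 0" using one by simp
      define V0 where "V0 = (V \<inter> f2 -` (- {0})) \<inter> ball z r"
      have V0: "open V0" "z \<in> V0" "V0 \<subseteq> V"
        using continuous_open_preimage[OF holomorphic_on_imp_continuous_on[OF f(2)] V(1), of "- {0}"] f2 V(2) r(1)
        by (auto simp: V0_def)
      have hol: "f1 holomorphic_on V0" "f2 holomorphic_on V0" using f V0(3) holomorphic_on_subset by blast+
      have q: "(\<lambda>w. f1 w / f2 w) holomorphic_on V0" using hol by (auto intro!: holomorphic_intros simp: V0_def)
      have dq: "deriv (\<lambda>w. f1 w / f2 w) z \<noteq> 0"
        using deriv_quotient[OF V0(1,2) hol(1,2) f2] W f2 True by simp
      have p0: "is_pole (\<lambda>w. inverse (f1 w / f2 w)) z"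
        using sphere_chart_properties(2)[OF V0(1,2) q dq, of "\<lambda>w. inverse (f1 w / f2 w)" True] True by simp
      have "is_pole (\<lambda>w. H2 w / H1 w) z \<longleftrightarrow> is_pole (\<lambda>w. inverse (f1 w / f2 w)) z"
        by (rule is_pole_cong) (use evq[of z] r(1) in \<open>auto simp: inverse_eq_divide\<close>)
      then have Rz: "R z = 0" using p0 unfolding R_def by simp
      have "((\<lambda>w. (f1 w / f2 w)) has_field_derivative deriv (\<lambda>w. f1 w / f2 w) z) (at z)"
        using holomorphic_derivI[OF q V0(1,2)] .
      then have "eventually (\<lambda>w. (f1 w / f2 w - f1 z / f2 z) / (w - z) \<noteq> 0) (at z)"
        using dq tendsto_imp_eventually_ne unfolding has_field_derivative_iff by blast
      then have "eventually (\<lambda>w. f1 w \<noteq> 0) (at z)"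
        by (rule eventually_mono) (use True in auto)
      then obtain s where s: "s > 0" "\<And>w. w \<in> ball z s \<Longrightarrow> w \<noteq> z \<Longrightarrow> f1 w \<noteq> 0"
        unfolding eventually_at by (auto simp: dist_commute)
      define V' where "V' = V0 \<inter> ball z s"
      have V': "open V'" "z \<in> V'" "V' \<subseteq> V0" using V0 s(1) by (auto simp: V'_def)
      have "R w = inverse (f1 w / f2 w)" if w: "w \<in> V'" for w
      proof (cases "w = z")
        case True
        then show ?thesis using Rz \<open>f1 z = 0\<close> by simp
      next
        case False
        have nzw: "f1 w \<noteq> 0" "w \<in> V0" using s(2)[of w] w False V' by (auto simp: V'_def)
        have "(\<lambda>w. f2 w / f1 w) analytic_on {w}"
          using an[OF f(1)] an[OF f(2)] nzw V0(3) by (auto intro!: analytic_intros)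
        then have "(\<lambda>w. f2 w / f1 w) \<midarrow>w\<rightarrow> f2 w / f1 w" using analytic_at_imp_isCont isContD by blast
        moreover have "eventually (\<lambda>v. H2 v / H1 v = f2 v / f1 v) (at w)" using evq nzw by (simp add: V0_def)
        ultimately have "(\<lambda>w. H2 w / H1 w) \<midarrow>w\<rightarrow> f2 w / f1 w" by (simp add: tendsto_cong)
        then show ?thesis unfolding R_def by (auto simp: inverse_eq_divide)
      qed
      then show ?thesis
        using sphere_chart_properties(4)[OF V'(1,2) holomorphic_on_subset[OF q V'(3)] dq, of R True] True by simp
    qed
    ultimately show ?thesis by (simp add: wronskian_nz_def R_def)
  qed
qed

section \<open>Orientation and sign of the support function\<close>

lemma cross_linear: "cross a (r *\<^sub>R b + s *\<^sub>R d) = r *\<^sub>R cross a b + s *\<^sub>R cross a d"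
  by (simp add: cross_def prod_eq_iff scaleR_conv_of_real algebra_simps)

lemma cross_cross:
  assumes "a \<bullet> b = 0" "a \<bullet> a = 1"
  shows "cross a (cross a b) = - b"
proof -
  obtain p q n where a: "a = (Complex p q, n)" by (metis complex.collapse surj_pair)
  obtain x y m where b: "b = (Complex x y, m)" by (metis complex.collapse surj_pair)
  have h: "p * x + q * y + n * m = 0" "p * p + q * q + n * n = 1"
    using assms by (simp_all add: a b inner_prod_def inner_complex_def)
  have 1: "- (n * (n * x - m * p)) + (p * y - q * x) * q = - x"
    and 2: "- (n * (n * y - m * q)) - (p * y - q * x) * p = - y"
    and 3: "p * (n * x - m * p) + q * (n * y - m * q) = - m"
    using h by algebra+
  show ?thesis
    unfolding a b cross_def by (simp add: complex_eq_iff) (use 1 2 3 in \<open>simp add: algebra_simps\<close>)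
qed

lemma du_dv_comp_holomorphic:
  assumes "f differentiable (at (t z))" "(t has_field_derivative t') (at z)"
  shows "(\<lambda>w. f (t w)) differentiable (at z)"
    "du (\<lambda>w. f (t w)) z = Re t' *\<^sub>R du f (t z) + Im t' *\<^sub>R dv f (t z)"
    "dv (\<lambda>w. f (t w)) z = - Im t' *\<^sub>R du f (t z) + Re t' *\<^sub>R dv f (t z)"
proof -
  have D: "((\<lambda>w. f (t w)) has_derivative (\<lambda>h. Re (t' * h) *\<^sub>R du f (t z) + Im (t' * h) *\<^sub>R dv f (t z))) (at z)"
    using has_derivative_compose[OF assms(2)[unfolded has_field_derivative_def] differentiable_has_derivative_du_dv[OF assms(1)]] .
  then show "(\<lambda>w. f (t w)) differentiable (at z)" by (auto simp: differentiable_def)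
  show "du (\<lambda>w. f (t w)) z = Re t' *\<^sub>R du f (t z) + Im t' *\<^sub>R dv f (t z)"
    "dv (\<lambda>w. f (t w)) z = - Im t' *\<^sub>R du f (t z) + Re t' *\<^sub>R dv f (t z)"
    using du_dv_has_derivative[OF D] by simp_all
qed

lemma continuous_sign:
  fixes f :: "complex \<Rightarrow> real"
  assumes "continuous_on W f" "open W" "z \<in> W" "f z \<noteq> 0"
  shows "\<exists>r>0. ball z r \<subseteq> W \<and> (\<forall>w\<in>ball z r. f w > 0 \<longleftrightarrow> f z > 0)"
proof -
  define I where "I = (if f z > 0 then {0<..} else {..<0::real})"
  have "open (W \<inter> f -` I)" using assms by (intro continuous_open_preimage) (auto simp: I_def)
  moreover have "z \<in> W \<inter> f -` I" using assms by (auto simp: I_def)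
  ultimately obtain r where r: "r > 0" "ball z r \<subseteq> W \<inter> f -` I" using openE by blast
  have "f w > 0 \<longleftrightarrow> f z > 0" if "w \<in> ball z r" for w
  proof -
    have "f w \<in> I" using r(2) that by blast
    then show ?thesis by (auto simp: I_def split: if_splits)
  qed
  then show ?thesis using r by blast
qed

context conformal_immersion
begin

text \<open>A holomorphic change of parameter rotates and scales the pair of partial derivatives.
  The vector product with \<open>N\<close> is a quarter turn on tangent vectors, with square
  \<open>-1\<close> by \<open>cross_cross\<close>, and commutes with this operation.\<close>

lemma oriented_transition:
  assumes C: "C \<in> A" and D: "D \<in> A" and z: "z \<in> coords C (fst D)"
    and o: "conformal_surface.oriented_by (loc D N) 1 (loc C (snd D) z)"
  shows "conformal_surface.oriented_by (loc C N) 1 z"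
proof -
  define t where "t = loc C (snd D)"
  have zS: "z \<in> coords C S" using z coords_subset[OF chart_subset[OF D]] by blast
  have tS: "t z \<in> coords D S" using transition(4)[OF C D z zS] by (simp add: t_def)
  interpret c: conformal_surface "coords C S" "loc C X" "loc C N" using local_surface[OF C] .
  interpret d: conformal_surface "coords D S" "loc D X" "loc D N" using local_surface[OF D] .
  have dt: "(t has_field_derivative deriv t z) (at z)"
    using holomorphic_derivI[OF transition(1,2)[OF C D] z] by (simp add: t_def)
  have eq: "loc C N w = loc D N (t w)" if "w \<in> coords C (fst D)" for w
    using transition(3)[OF C D that] by (simp add: t_def)
  note comp = du_dv_comp_holomorphic[OF d.diff(2)[OF tS] dt]
  have N: "loc C N z = loc D N (t z)" using eq[OF z] .
  have du: "du (loc C N) z = Re (deriv t z) *\<^sub>R du (loc D N) (t z) + Im (deriv t z) *\<^sub>R dv (loc D N) (t z)"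
    and dv: "dv (loc C N) z = - Im (deriv t z) *\<^sub>R du (loc D N) (t z) + Re (deriv t z) *\<^sub>R dv (loc D N) (t z)"
    using du_dv_cong(1,2)[OF transition(2)[OF C D] z eq] comp by simp_all
  have rot: "dv (loc D N) (t z) = cross (loc D N (t z)) (du (loc D N) (t z))"
    using o by (simp add: d.oriented_by_def t_def)
  have "cross (loc D N (t z)) (dv (loc D N) (t z)) = - du (loc D N) (t z)"
    unfolding rot by (rule cross_cross[OF d.N_orth(1)[OF tS] d.unit[OF tS]])
  then show ?thesis
    unfolding c.oriented_by_def dv N du cross_linear rot[symmetric] by simp
qed

lemma orientation_global:
  assumes conn: "connected S"
  shows "(\<forall>C\<in>A. \<forall>z\<in>coords C S. conformal_surface.oriented_by (loc C N) 1 z) \<or>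
    (\<forall>C\<in>A. \<forall>z\<in>coords C S. conformal_surface.oriented_by (loc C N) (-1) z)"
proof -
  define P where "P x \<longleftrightarrow> (\<exists>C\<in>A. x \<in> fst C \<and> conformal_surface.oriented_by (loc C N) 1 (snd C x))" for x
  have P: "P (inv_into (fst C) (snd C) z) \<longleftrightarrow> conformal_surface.oriented_by (loc C N) 1 z"
    if C: "C \<in> A" and z: "z \<in> coords C S" for C z
  proof
    assume "conformal_surface.oriented_by (loc C N) 1 z"
    then show "P (inv_into (fst C) (snd C) z)"
      using chart_inv(2,3)[OF C z] C unfolding P_def by metis
  next
    assume "P (inv_into (fst C) (snd C) z)"
    then obtain D where D: "D \<in> A" "inv_into (fst C) (snd C) z \<in> fst D"
      "conformal_surface.oriented_by (loc D N) 1 (snd D (inv_into (fst C) (snd C) z))" unfolding P_def by blast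
    have "z \<in> coords C (fst D)" using coordsI[OF chart_inv(3)[OF C z] D(2)] chart_inv(2)[OF C z] by simp
    then show "conformal_surface.oriented_by (loc C N) 1 z"
      using oriented_transition[OF C D(1)] D(3) by (simp add: loc_def)
  qed
  have loc: "\<exists>r>0. \<forall>w\<in>ball z r \<inter> coords C S. P (inv_into (fst C) (snd C) w) \<longleftrightarrow> P (inv_into (fst C) (snd C) z)"
    if C: "C \<in> A" and z: "z \<in> coords C S" for C z
  proof -
    interpret c: conformal_surface "coords C S" "loc C X" "loc C N" using local_surface[OF C] .
    \<comment> \<open>This triple product equals plus or minus \<open>lam\<close>, so its sign is
      the orientation; being continuous and nonzero, it keeps that sign locally.\<close>
    define t where "t w = cross (loc C N w) (du (loc C N) w) \<bullet> dv (loc C N) w" for w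
    have t: "t w \<noteq> 0 \<and> (c.oriented_by 1 w \<longleftrightarrow> t w > 0)" if w: "w \<in> coords C S" for w
    proof -
      have l: "cross (loc C N w) (du (loc C N) w) \<bullet> cross (loc C N w) (du (loc C N) w) = c.lam w"
        using c.unit[OF w] c.N_orth(1)[OF w] by (simp add: inner_cross c.lam_def)
      have s: "c.oriented_by s w \<Longrightarrow> t w = s * c.lam w" for s
        using l by (simp add: t_def c.oriented_by_def)
      show ?thesis
        using c.orientation_cases[OF w] s[of 1] s[of "-1"] c.lam_pos[OF w] by fastforce
    qed
    have "continuous_on (coords C S) t"
    proof -
      have c1: "continuous_on (coords C S) (loc C N)" "continuous_on (coords C S) (du (loc C N))"
         "continuous_on (coords C S) (dv (loc C N))"
        using Ck_on_imp_continuous_on[OF c.C2_N] c.C2_N[of 1] Ck_on_imp_continuous_on by (auto simp: One_nat_def)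
      then show ?thesis unfolding t_def cross_def by (intro continuous_intros)
    qed
    from continuous_sign[OF this c.open_W z] t[OF z]
    obtain r where r: "r > 0" "ball z r \<subseteq> coords C S" "\<And>w. w \<in> ball z r \<Longrightarrow> t w > 0 \<longleftrightarrow> t z > 0" by blast
    have "P (inv_into (fst C) (snd C) w) \<longleftrightarrow> P (inv_into (fst C) (snd C) z)" if "w \<in> ball z r" for w
      using P[OF C] t r that z by blast
    then show ?thesis using r(1) by blast
  qed
  show ?thesis
  proof (cases "\<exists>x\<in>S. P x")
    case True
    then obtain x where x: "x \<in> S" "P x" by blast
    have "conformal_surface.oriented_by (loc C N) 1 z" if C: "C \<in> A" and z: "z \<in> coords C S" for C z
      using locally_constant_on_connected[where P = P, OF conn x(1) chart_inv(4)[OF C z] x(2) loc] P[OF C z] by blast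
    then show ?thesis by blast
  next
    case False
    have "conformal_surface.oriented_by (loc C N) (-1) z" if C: "C \<in> A" and z: "z \<in> coords C S" for C z
    proof -
      have "\<not> conformal_surface.oriented_by (loc C N) 1 z"
        using False P[OF C z] chart_inv(4)[OF C z] by blast
      then show ?thesis using conformal_surface.orientation_cases[OF local_surface[OF C] z] by blast
    qed
    then show ?thesis by blast
  qed
qed

lemma supp_loc: "conformal_surface.supp (loc C X) (loc C N) z = X (inv_into (fst C) (snd C) z) \<bullet> N (inv_into (fst C) (snd C) z)"
  if "C \<in> A"
  using conformal_surface.supp_def[OF local_surface[OF that]] by (simp add: loc_def)

lemma supp_sign_global:
  assumes conn: "connected S" and nz: "\<And>x. x \<in> S \<Longrightarrow> X x \<bullet> N x \<noteq> 0"
  shows "(\<forall>x\<in>S. X x \<bullet> N x > 0) \<or> (\<forall>x\<in>S. X x \<bullet> N x < 0)"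
proof (cases "\<exists>x\<in>S. X x \<bullet> N x > 0")
  case True
  then obtain x where x: "x \<in> S" "X x \<bullet> N x > 0" by blast
  have "X y \<bullet> N y > 0" if y: "y \<in> S" for y
  proof (rule locally_constant_on_connected[where P = "\<lambda>x. X x \<bullet> N x > 0", OF conn x(1) y x(2)])
    fix C z assume C: "C \<in> A" and z: "z \<in> coords C S"
    interpret c: conformal_surface "coords C S" "loc C X" "loc C N" using local_surface[OF C] .
    have "continuous_on (coords C S) c.supp" using Ck_on_imp_continuous_on[OF c.Ck_supp] .
    moreover have "c.supp z \<noteq> 0" unfolding supp_loc[OF C] using nz chart_inv(4)[OF C z] by blast
    ultimately show "\<exists>r>0. \<forall>w\<in>ball z r \<inter> coords C S.
        (X (inv_into (fst C) (snd C) w) \<bullet> N (inv_into (fst C) (snd C) w) > 0) \<longleftrightarrow>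
        (X (inv_into (fst C) (snd C) z) \<bullet> N (inv_into (fst C) (snd C) z) > 0)"
      using continuous_sign[of "coords C S" c.supp z] c.open_W z unfolding supp_loc[OF C] by blast
  qed
  then show ?thesis by blast
next
  case False
  then show ?thesis using nz by (meson linorder_neqE_linordered_idom)
qed

text \<open>At a zero of the support function the reduced equation leaves only the squared gradient,
  which must vanish; then \<open>position_eq_0\<close> puts the point at the origin.\<close>

lemma supp_nonzero:
  assumes hq: "\<forall>C\<in>A. hqsf_eq (coords C S) (loc C X) (loc C N) c (loc C \<mu>)" and origin: "0 \<notin> X ` S" and x: "x \<in> S"
  shows "X x \<bullet> N x \<noteq> 0"
proof
  assume 0: "X x \<bullet> N x = 0"
  obtain C where C: "C \<in> A" "x \<in> fst C" using obtain_chart[OF x] .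
  define z where "z = snd C x"
  have z: "z \<in> coords C S" using coordsI[OF C(2) x] by (simp add: z_def)
  interpret c: conformal_surface "coords C S" "loc C X" "loc C N" using local_surface[OF C(1)] .
  have s0: "c.supp z = 0" using 0 C unfolding supp_loc[OF C(1)] z_def by (simp add: chart_inv)
  have "2 * (loc C X z \<bullet> loc C N z) * mean_curv (loc C X) (loc C N) z + ((c * exp (2 * loc C \<mu> z)) * (loc C X z \<bullet> loc C N z) + loc C X z \<bullet> loc C X z - (loc C X z \<bullet> loc C N z)\<^sup>2) * gauss_curv (loc C X) (loc C N) z = 0"
    using hq C(1) z by (simp add: hqsf_eq_def mult_ac)
  from iffD1[OF c.hqsf_equation_iff[OF z] this]
  have "(du c.supp z)\<^sup>2 + (dv c.supp z)\<^sup>2 = 0"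
    unfolding s0 by (simp del: sum_power2_eq_zero_iff; linarith)
  then have "du c.supp z = 0" "dv c.supp z = 0" using iffD1[OF sum_power2_eq_zero_iff] by blast+
  from c.position_eq_0[OF z s0 this] have "X x = 0" using loc_at[OF C(1,2), of X] by (simp add: z_def)
  then have "0 \<in> X ` S" using imageI[OF x, of X] by simp
  then show False using origin by blast
qed

end

text \<open>The normalized situation: positive support function and a Gauss map that is holomorphic
  in the given atlas. It is reached by changing the sign of \<open>N\<close> and, if necessary,
  conjugating the atlas.\<close>

locale hqsf_surface = conformal_immersion S A X N for S :: "'a::topological_space set" and A X N +
  fixes c :: real and \<mu> :: "'a \<Rightarrow> real"
  assumes hq: "C \<in> A \<Longrightarrow> hqsf_eq (coords C S) (loc C X) (loc C N) c (loc C \<mu>)"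
    and orient: "C \<in> A \<Longrightarrow> z \<in> coords C S \<Longrightarrow> conformal_surface.oriented_by (loc C N) 1 z"
    and pos: "x \<in> S \<Longrightarrow> X x \<bullet> N x > 0"
begin

definition Gm :: "bool \<Rightarrow> 'a chart \<Rightarrow> complex \<Rightarrow> complex" where
  "Gm b C w = stereo b (loc C N w)"

definition regular :: "bool \<Rightarrow> 'a chart \<Rightarrow> complex \<Rightarrow> bool" where
  "regular b C w \<longleftrightarrow> snd (reflect b (loc C N w)) \<noteq> - 1"

definition hgt :: "'a chart \<Rightarrow> complex \<Rightarrow> real" where
  "hgt C w = sqrt ((loc C X w \<bullet> loc C N w) / 2)"

text \<open>Prescribing the modulus of the Wronskian, and not only the value of the form, is what
  makes two pairs differ by a constant \<open>form_isometry\<close> even for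
  \<open>c = 0\<close>.\<close>

definition pair_on :: "bool \<Rightarrow> 'a chart \<Rightarrow> complex \<Rightarrow> real \<Rightarrow> (complex \<Rightarrow> complex) \<Rightarrow> (complex \<Rightarrow> complex) \<Rightarrow> bool" where
  "pair_on b C z r f1 f2 \<longleftrightarrow> 0 < r \<and> ball z r \<subseteq> coords C S \<and> f1 holomorphic_on ball z r \<and> f2 holomorphic_on ball z r \<and>
    (\<forall>w\<in>ball z r. regular b C w \<and> (cmod (f1 w))\<^sup>2 + c * (cmod (f2 w))\<^sup>2 = hgt C w * (1 + (cmod (Gm b C w))\<^sup>2) \<and>
       cmod (f1 w * deriv f2 w - f2 w * deriv f1 w) = exp (loc C \<mu> w) / 2 * cmod (deriv (Gm b C) w))"

text \<open>
  A pair near a pole of the Gauss map is holomorphic only after division by the Gauss map, whose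
  value at the pole is \<open>0\<close> by convention.
\<close>

definition gauge :: "bool \<Rightarrow> 'a chart \<Rightarrow> complex \<Rightarrow> complex" where
  "gauge b C w = (if b then Gm False C w else 1)"

definition sect :: "bool \<Rightarrow> 'a chart \<Rightarrow> complex \<Rightarrow> ('a \<Rightarrow> complex \<times> complex) \<Rightarrow> bool" where
  "sect b C z s \<longleftrightarrow> (\<exists>r f1 f2. pair_on b C z r f1 f2 \<and> (\<forall>w\<in>ball z r. loc C s w = (gauge b C w * f1 w, gauge b C w * f2 w)))"

lemma Gm_True: "C \<in> A \<Longrightarrow> w \<in> coords C S \<Longrightarrow> Gm True C w = inverse (Gm False C w)"
  unfolding Gm_def by (rule stereo_True[OF conformal_surface.unit[OF local_surface]])

lemma Gm_deriv:
  assumes C: "C \<in> A" and w: "w \<in> coords C S" and r: "regular b C w"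
  shows "(Gm b C has_field_derivative deriv (Gm b C) w) (at w)" "deriv (Gm b C) w \<noteq> 0"
    "gauss_inv (Gm b C w) = reflect b (loc C N w)"
proof -
  obtain G' where G': "(Gm b C has_field_derivative G') (at w)" "G' \<noteq> 0" "gauss_inv (Gm b C w) = reflect b (loc C N w)"
    using conformal_surface.stereo_derivative[OF local_surface[OF C] w orient[OF C w], of b] r
    unfolding regular_def Gm_def[abs_def] by metis
  moreover have "deriv (Gm b C) w = G'" using G'(1) by (rule DERIV_imp_deriv)
  ultimately show "(Gm b C has_field_derivative deriv (Gm b C) w) (at w)" "deriv (Gm b C) w \<noteq> 0"
    "gauss_inv (Gm b C w) = reflect b (loc C N w)" by simp_all
qed

lemma regular_ball:
  assumes C: "C \<in> A" and O: "open Q" "z \<in> Q" "Q \<subseteq> coords C S" and r: "regular b C z"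
  obtains r where "r > 0" "ball z r \<subseteq> Q" "\<And>w. w \<in> ball z r \<Longrightarrow> regular b C w"
proof -
  have "continuous_on Q (\<lambda>w. snd (reflect b (loc C N w)))"
    using continuous_on_subset[OF Ck_on_imp_continuous_on[OF conformal_surface.C2_N[OF local_surface[OF C]]] O(3)]
    by (cases b) (auto simp: reflect_def intro!: continuous_intros)
  then have "open (Q \<inter> (\<lambda>w. snd (reflect b (loc C N w))) -` (- {- 1}))"
    using continuous_open_preimage[OF _ O(1)] by blast
  moreover have "z \<in> Q \<inter> (\<lambda>w. snd (reflect b (loc C N w))) -` (- {- 1})" using O r by (simp add: regular_def)
  ultimately obtain r where r: "r > 0" "ball z r \<subseteq> Q \<inter> (\<lambda>w. snd (reflect b (loc C N w))) -` (- {- 1})"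
    using openE by blast
  have "regular b C w" if "w \<in> ball z r" for w using r(2) that unfolding regular_def by blast
  then show thesis using that[OF r(1)] r(2) by blast
qed

lemma Gm_holomorphic:
  assumes "C \<in> A" "Q \<subseteq> coords C S" "\<And>w. w \<in> Q \<Longrightarrow> regular b C w"
  shows "Gm b C holomorphic_on Q"
  by (rule holomorphic_onI_wirt, rule wirt_holomorphic, rule Gm_deriv(1)) (use assms in auto)

lemma pair_on_exists:
  assumes C: "C \<in> A" and z: "z \<in> coords C S" and r: "regular b C z"
  shows "\<exists>r f1 f2. pair_on b C z r f1 f2"
proof -
  interpret s: conformal_surface "coords C S" "loc C X" "loc C N" using local_surface[OF C] .
  have pos': "s.supp w > 0" if "w \<in> coords C S" for w
    unfolding supp_loc[OF C] using pos chart_inv(4)[OF C that] .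
  have eq: "c * exp (2 * loc C \<mu> w) * s.lam w * s.supp w =
      s.supp w * (du (du s.supp) w + dv (dv s.supp) w) + 2 * s.lam w * (s.supp w)\<^sup>2 - ((du s.supp w)\<^sup>2 + (dv s.supp w)\<^sup>2)"
    if w: "w \<in> coords C S" for w
  proof -
    have "2 * (loc C X w \<bullet> loc C N w) * mean_curv (loc C X) (loc C N) w + ((c * exp (2 * loc C \<mu> w)) * (loc C X w \<bullet> loc C N w) + loc C X w \<bullet> loc C X w - (loc C X w \<bullet> loc C N w)\<^sup>2) * gauss_curv (loc C X) (loc C N) w = 0"
      using hq[OF C] w by (simp add: hqsf_eq_def mult_ac)
    from iffD1[OF s.hqsf_equation_iff[OF w] this] show ?thesis .
  qed
  have \<mu>: "Ck_on 2 (coords C S) (loc C \<mu>)" "\<And>w. w \<in> coords C S \<Longrightarrow> du (du (loc C \<mu>)) w + dv (dv (loc C \<mu>)) w = 0"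
    using hq[OF C] by (auto simp: hqsf_eq_def)
  obtain \<rho> f1 f2 where "0 < \<rho>" "ball z \<rho> \<subseteq> coords C S" "\<And>w. w \<in> ball z \<rho> \<Longrightarrow> regular b C w"
    "f1 holomorphic_on ball z \<rho>" "f2 holomorphic_on ball z \<rho>"
    "\<And>w. w \<in> ball z \<rho> \<Longrightarrow> (cmod (f1 w))\<^sup>2 + c * (cmod (f2 w))\<^sup>2 = sqrt (s.supp w / 2) * (1 + (cmod (Gm b C w))\<^sup>2)"
    "\<And>w. w \<in> ball z \<rho> \<Longrightarrow> cmod (f1 w * deriv f2 w - f2 w * deriv f1 w) = exp (loc C \<mu> w) / 2 * cmod (deriv (Gm b C) w)"
    using s.local_representation[OF z orient[OF C] pos' r[unfolded regular_def] \<mu> eq]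
    unfolding regular_def Gm_def[abs_def] by metis
  then show ?thesis unfolding pair_on_def hgt_def s.supp_def by blast
qed

lemma pair_on_sub:
  assumes "pair_on b C z r f1 f2" "0 < r'" "ball w r' \<subseteq> ball z r"
  shows "pair_on b C w r' f1 f2"
  using assms holomorphic_on_subset unfolding pair_on_def by (meson subsetD subset_trans)

lemma pair_on_point:
  assumes "pair_on b C z r f1 f2" "w \<in> ball z r"
  obtains r' where "pair_on b C w r' f1 f2" "ball w r' \<subseteq> ball z r"
proof -
  obtain r' where "r' > 0" "ball w r' \<subseteq> ball z r" using assms(2) open_ball openE by blast
  then show thesis using that pair_on_sub[OF assms(1)] by blast
qed

lemma pair_on_wronskian:
  assumes "C \<in> A" "pair_on b C z r f1 f2" "w \<in> ball z r"
  shows "f1 w * deriv f2 w - f2 w * deriv f1 w \<noteq> 0"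
proof -
  have "w \<in> coords C S" "regular b C w" "cmod (f1 w * deriv f2 w - f2 w * deriv f1 w) = exp (loc C \<mu> w) / 2 * cmod (deriv (Gm b C) w)"
    using assms unfolding pair_on_def by blast+
  then show ?thesis using Gm_deriv(2)[OF assms(1)] by fastforce
qed

text \<open>All conditions are pointwise except that on the Wronskian, where both sides acquire the
  factor \<open>|t'|\<close> of the transition map.\<close>

lemma sect_change_chart:
  assumes C: "C \<in> A" and D: "D \<in> A" and x: "x \<in> fst C" "x \<in> fst D" and s: "sect b C (snd C x) s"
  shows "sect b D (snd D x) s"
proof -
  obtain r f1 f2 where p: "pair_on b C (snd C x) r f1 f2"
    and ls: "\<And>w. w \<in> ball (snd C x) r \<Longrightarrow> loc C s w = (gauge b C w * f1 w, gauge b C w * f2 w)"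
    using s unfolding sect_def by blast
  define t where "t = loc D (snd C)"
  define z where "z = snd D x"
  define Q where "Q = coords D (fst C)"
  have Q: "open Q" "z \<in> Q" "Q \<subseteq> coords D S" "t holomorphic_on Q"
    using transition(1,2)[OF D C] coordsI[OF x(2,1)] coords_subset[OF chart_subset[OF C]] by (auto simp: Q_def z_def t_def)
  have tz: "t z = snd C x" using loc_at[OF D x(2)] by (simp add: t_def z_def)
  have lt: "loc D N w = loc C N (t w)" "loc D X w = loc C X (t w)" "loc D \<mu> w = loc C \<mu> (t w)"
    and lts: "loc D s w = loc C s (t w)" if "w \<in> Q" for w
    using transition(3)[OF D C that[unfolded Q_def]] by (simp_all add: t_def)
  have "open (Q \<inter> t -` ball (snd C x) r)"
    using continuous_open_preimage[OF holomorphic_on_imp_continuous_on[OF Q(4)] Q(1) open_ball] .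
  moreover have "z \<in> Q \<inter> t -` ball (snd C x) r" using Q(2) tz p by (simp add: pair_on_def)
  ultimately obtain r' where r': "r' > 0" "ball z r' \<subseteq> Q \<inter> t -` ball (snd C x) r" using openE by blast
  have tb: "w \<in> Q" "t w \<in> ball (snd C x) r" if "w \<in> ball z r'" for w using r'(2) that by auto
  have thol: "t holomorphic_on ball z r'" using Q(4) r'(2) holomorphic_on_subset by blast
  have dt: "(t has_field_derivative deriv t w) (at w)" if "w \<in> ball z r'" for w
    using holomorphic_derivI[OF thol open_ball that] .
  have f: "f1 holomorphic_on ball (snd C x) r" "f2 holomorphic_on ball (snd C x) r" using p by (simp_all add: pair_on_def)
  have comp: "u \<circ> t holomorphic_on ball z r'" if "u holomorphic_on ball (snd C x) r" for u
    by (rule holomorphic_on_compose_gen[OF thol that]) (use tb in auto)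
  have dcomp: "deriv (u \<circ> t) w = deriv u (t w) * deriv t w" if "(u has_field_derivative deriv u (t w)) (at (t w))" "w \<in> ball z r'" for u w
    using DERIV_chain[OF that(1) dt[OF that(2)]] by (rule DERIV_imp_deriv)
  have "pair_on b D z r' (f1 \<circ> t) (f2 \<circ> t)"
    unfolding pair_on_def
  proof (intro conjI ballI)
    show "0 < r'" "ball z r' \<subseteq> coords D S" using r' Q(3) by auto
    show "f1 \<circ> t holomorphic_on ball z r'" "f2 \<circ> t holomorphic_on ball z r'" using comp f by blast+
    fix w assume w: "w \<in> ball z r'"
    note tw = tb[OF w]
    have pw: "regular b C (t w)" "(cmod (f1 (t w)))\<^sup>2 + c * (cmod (f2 (t w)))\<^sup>2 = hgt C (t w) * (1 + (cmod (Gm b C (t w)))\<^sup>2)"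
       "cmod (f1 (t w) * deriv f2 (t w) - f2 (t w) * deriv f1 (t w)) = exp (loc C \<mu> (t w)) / 2 * cmod (deriv (Gm b C) (t w))"
       "t w \<in> coords C S"
      using p tw(2) by (auto simp: pair_on_def)
    show "regular b D w" using pw(1) lt[OF tw(1)] by (simp add: regular_def)
    show "(cmod ((f1 \<circ> t) w))\<^sup>2 + c * (cmod ((f2 \<circ> t) w))\<^sup>2 = hgt D w * (1 + (cmod (Gm b D w))\<^sup>2)"
      using pw(2) lt[OF tw(1)] by (simp add: hgt_def Gm_def)
    have "deriv (Gm b D) w = deriv (Gm b C \<circ> t) w"
    proof (rule deriv_cong_ev)
      show "eventually (\<lambda>v. Gm b D v = (Gm b C \<circ> t) v) (nhds w)"
        using eventually_nhds_in_open[OF Q(1) tw(1)] by (rule eventually_mono) (simp add: Gm_def lt)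
    qed simp
    also have "\<dots> = deriv (Gm b C) (t w) * deriv t w" using dcomp[OF Gm_deriv(1)[OF C pw(4,1)] w] .
    finally have dG: "deriv (Gm b D) w = deriv (Gm b C) (t w) * deriv t w" .
    have "(f1 \<circ> t) w * deriv (f2 \<circ> t) w - (f2 \<circ> t) w * deriv (f1 \<circ> t) w
        = (f1 (t w) * deriv f2 (t w) - f2 (t w) * deriv f1 (t w)) * deriv t w"
      using dcomp[OF holomorphic_derivI[OF f(1) open_ball tw(2)] w] dcomp[OF holomorphic_derivI[OF f(2) open_ball tw(2)] w]
      by (simp add: algebra_simps)
    then show "cmod ((f1 \<circ> t) w * deriv (f2 \<circ> t) w - (f2 \<circ> t) w * deriv (f1 \<circ> t) w)
       = exp (loc D \<mu> w) / 2 * cmod (deriv (Gm b D) w)"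
      using pw(3) lt[OF tw(1)] dG by (simp add: norm_mult)
  qed
  moreover have "loc D s w = (gauge b D w * (f1 \<circ> t) w, gauge b D w * (f2 \<circ> t) w)" if "w \<in> ball z r'" for w
    using ls[OF tb(2)[OF that]] lts[OF tb(1)[OF that]] lt[OF tb(1)[OF that]] by (simp add: gauge_def Gm_def)
  ultimately show ?thesis unfolding sect_def z_def by blast
qed

text \<open>Multiplying a pair by \<open>g\<close> multiplies the form by \<open>|g|^2\<close> and
  the Wronskian by \<open>g^2\<close>. This matches \<open>1 + |g|^2 = |g|^2 (1 + |1/g|^2)\<close>
  and the derivative of \<open>1/g\<close>.\<close>

lemma sect_True_False:
  assumes C: "C \<in> A" and s: "sect True C z s" and reg: "regular False C z"
  shows "sect False C z s"
proof -
  obtain r f1 f2 where p: "pair_on True C z r f1 f2"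
    and ls: "\<And>w. w \<in> ball z r \<Longrightarrow> loc C s w = (gauge True C w * f1 w, gauge True C w * f2 w)"
    using s unfolding sect_def by blast
  have b: "ball z r \<subseteq> coords C S" "0 < r" using p by (simp_all add: pair_on_def)
  obtain r' where r': "r' > 0" "ball z r' \<subseteq> ball z r" "\<And>w. w \<in> ball z r' \<Longrightarrow> regular False C w"
    using regular_ball[OF C open_ball _ b(1) reg] b(2) by auto
  define g where "g = Gm False C"
  have g: "g holomorphic_on ball z r'" unfolding g_def
    by (rule Gm_holomorphic[OF C]) (use r' b in auto)
  have f: "f1 holomorphic_on ball z r'" "f2 holomorphic_on ball z r'"
    using p r'(2) holomorphic_on_subset unfolding pair_on_def by blast+
  have "pair_on False C z r' (\<lambda>w. g w * f1 w) (\<lambda>w. g w * f2 w)"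
    unfolding pair_on_def
  proof (intro conjI ballI)
    show "0 < r'" "ball z r' \<subseteq> coords C S" using r' b by auto
    show "(\<lambda>w. g w * f1 w) holomorphic_on ball z r'" "(\<lambda>w. g w * f2 w) holomorphic_on ball z r'"
      by (intro holomorphic_intros g f)+
    fix w assume w: "w \<in> ball z r'"
    then have wr: "w \<in> ball z r" using r'(2) by blast
    then have wS: "w \<in> coords C S" using b by blast
    show reg': "regular False C w" using r'(3)[OF w] .
    have pw: "regular True C w" "(cmod (f1 w))\<^sup>2 + c * (cmod (f2 w))\<^sup>2 = hgt C w * (1 + (cmod (Gm True C w))\<^sup>2)"
       "cmod (f1 w * deriv f2 w - f2 w * deriv f1 w) = exp (loc C \<mu> w) / 2 * cmod (deriv (Gm True C) w)"
      using p wr by (auto simp: pair_on_def)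
    \<comment> \<open>A zero of \<open>g\<close> would place \<open>N\<close> at a pole of the
      sphere; one pole is excluded by regularity for \<open>False\<close>, the other by regularity
      for \<open>True\<close>.\<close>
    have gnz: "g w \<noteq> 0"
    proof
      assume g0: "g w = 0"
      have "1 + snd (loc C N w) \<noteq> 0" using reg' unfolding regular_def reflect_def if_False by linarith
      then have "complex_of_real (1 + snd (loc C N w)) \<noteq> 0" by (simp only: of_real_eq_0_iff not_False_eq_True)
      moreover have "fst (loc C N w) / complex_of_real (1 + snd (loc C N w)) = 0"
        using g0 unfolding g_def Gm_def stereo_def reflect_def if_False .
      ultimately have "fst (loc C N w) = 0" unfolding divide_eq_0_iff by blast
      then have "snd (loc C N w) * snd (loc C N w) = 1"
        using conformal_surface.unit[OF local_surface[OF C] wS] by (simp add: inner_prod_def)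
      then show False using reg' pw(1) by (auto simp: regular_def reflect_def square_eq_1_iff)
    qed
    have "(cmod (g w * f1 w))\<^sup>2 + c * (cmod (g w * f2 w))\<^sup>2 = (cmod (g w))\<^sup>2 * ((cmod (f1 w))\<^sup>2 + c * (cmod (f2 w))\<^sup>2)"
      by (simp add: norm_mult power_mult_distrib algebra_simps)
    also have "\<dots> = hgt C w * (1 + (cmod (Gm False C w))\<^sup>2)"
      unfolding pw(2) Gm_True[OF C wS] g_def[symmetric] norm_inverse power_inverse using gnz
      by (simp add: field_simps)
    finally show "(cmod (g w * f1 w))\<^sup>2 + c * (cmod (g w * f2 w))\<^sup>2 = hgt C w * (1 + (cmod (Gm False C w))\<^sup>2)" .
    have d: "(f1 has_field_derivative deriv f1 w) (at w)" "(f2 has_field_derivative deriv f2 w) (at w)" "(g has_field_derivative deriv g w) (at w)"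
      using holomorphic_derivI[OF f(1) open_ball w] holomorphic_derivI[OF f(2) open_ball w] holomorphic_derivI[OF g open_ball w] by simp_all
    have W: "g w * f1 w * deriv (\<lambda>w. g w * f2 w) w - g w * f2 w * deriv (\<lambda>w. g w * f1 w) w = (g w)\<^sup>2 * (f1 w * deriv f2 w - f2 w * deriv f1 w)"
      unfolding DERIV_imp_deriv[OF DERIV_mult[OF d(3,1)]] DERIV_imp_deriv[OF DERIV_mult[OF d(3,2)]]
      by (simp add: power2_eq_square algebra_simps)
    have "deriv (Gm True C) w = deriv (\<lambda>w. inverse (g w)) w"
    proof (rule deriv_cong_ev)
      have "open (coords C S)" using open_coords_S[OF C] .
      from eventually_nhds_in_open[OF this wS]
      show "eventually (\<lambda>v. Gm True C v = inverse (g v)) (nhds w)"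
        by (rule eventually_mono) (simp add: g_def Gm_True[OF C])
    qed simp
    also have "\<dots> = - (inverse (g w) * deriv g w * inverse (g w))"
      using DERIV_inverse'[OF d(3) gnz] by (rule DERIV_imp_deriv)
    finally have "cmod (deriv (Gm True C) w) = cmod (deriv g w) / (cmod (g w))\<^sup>2"
      by (simp add: norm_mult norm_divide norm_inverse power2_eq_square field_simps)
    then show "cmod (g w * f1 w * deriv (\<lambda>w. g w * f2 w) w - g w * f2 w * deriv (\<lambda>w. g w * f1 w) w)
        = exp (loc C \<mu> w) / 2 * cmod (deriv (Gm False C) w)"
      unfolding W norm_mult pw(3) using gnz by (simp add: norm_power g_def)
  qed
  moreover have "loc C s w = (gauge False C w * (g w * f1 w), gauge False C w * (g w * f2 w))" if "w \<in> ball z r'" for w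
    using ls[of w] r'(2) that by (auto simp: gauge_def g_def)
  ultimately show ?thesis unfolding sect_def by blast
qed

lemma form_isometry_scale:
  assumes "form_isometry k M"
  shows "M (q * x, q * y) = (q * fst (M (x, y)), q * snd (M (x, y)))"
  using assms by (auto simp: form_isometry_def algebra_simps)

lemma sect_isometry:
  assumes C: "C \<in> A" and M: "form_isometry c M" and s: "sect b C z s"
  shows "sect b C z (\<lambda>x. M (s x))"
proof -
  obtain r f1 f2 where p: "pair_on b C z r f1 f2"
    and ls: "\<And>w. w \<in> ball z r \<Longrightarrow> loc C s w = (gauge b C w * f1 w, gauge b C w * f2 w)"
    using s unfolding sect_def by blast
  obtain a a' d d' where Md: "M = (\<lambda>(x, y). (a * x + a' * y, d * x + d' * y))" "cmod (a * d' - a' * d) = 1"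
     "\<And>x y. (cmod (a * x + a' * y))\<^sup>2 + c * (cmod (d * x + d' * y))\<^sup>2 = (cmod x)\<^sup>2 + c * (cmod y)\<^sup>2"
    using M unfolding form_isometry_def by blast
  have f: "f1 holomorphic_on ball z r" "f2 holomorphic_on ball z r" using p by (simp_all add: pair_on_def)
  have "pair_on b C z r (\<lambda>w. a * f1 w + a' * f2 w) (\<lambda>w. d * f1 w + d' * f2 w)"
    unfolding pair_on_def
  proof (intro conjI ballI)
    show "0 < r" "ball z r \<subseteq> coords C S" using p by (simp_all add: pair_on_def)
    show "(\<lambda>w. a * f1 w + a' * f2 w) holomorphic_on ball z r" "(\<lambda>w. d * f1 w + d' * f2 w) holomorphic_on ball z r"
      by (intro holomorphic_intros f)+
    fix w assume w: "w \<in> ball z r"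
    have pw: "regular b C w" "(cmod (f1 w))\<^sup>2 + c * (cmod (f2 w))\<^sup>2 = hgt C w * (1 + (cmod (Gm b C w))\<^sup>2)"
       "cmod (f1 w * deriv f2 w - f2 w * deriv f1 w) = exp (loc C \<mu> w) / 2 * cmod (deriv (Gm b C) w)"
      using p w by (auto simp: pair_on_def)
    show "regular b C w" by (rule pw(1))
    show "(cmod (a * f1 w + a' * f2 w))\<^sup>2 + c * (cmod (d * f1 w + d' * f2 w))\<^sup>2 = hgt C w * (1 + (cmod (Gm b C w))\<^sup>2)"
      unfolding Md(3) by (rule pw(2))
    have dd: "deriv (\<lambda>w. x * f1 w + y * f2 w) w = x * deriv f1 w + y * deriv f2 w" for x y
      by (rule DERIV_imp_deriv, rule DERIV_add[OF DERIV_cmult[OF holomorphic_derivI[OF f(1) open_ball w]] DERIV_cmult[OF holomorphic_derivI[OF f(2) open_ball w]]])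
    have "(a * f1 w + a' * f2 w) * deriv (\<lambda>w. d * f1 w + d' * f2 w) w - (d * f1 w + d' * f2 w) * deriv (\<lambda>w. a * f1 w + a' * f2 w) w
        = (a * d' - a' * d) * (f1 w * deriv f2 w - f2 w * deriv f1 w)"
      unfolding dd by (simp add: algebra_simps)
    then show "cmod ((a * f1 w + a' * f2 w) * deriv (\<lambda>w. d * f1 w + d' * f2 w) w - (d * f1 w + d' * f2 w) * deriv (\<lambda>w. a * f1 w + a' * f2 w) w)
        = exp (loc C \<mu> w) / 2 * cmod (deriv (Gm b C) w)"
      using pw(3) Md(2) by (simp add: norm_mult)
  qed
  moreover have "loc C (\<lambda>x. M (s x)) w = (gauge b C w * (a * f1 w + a' * f2 w), gauge b C w * (d * f1 w + d' * f2 w))" if "w \<in> ball z r" for w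
  proof -
    have "loc C (\<lambda>x. M (s x)) w = M (loc C s w)" by (simp add: loc_def)
    then show ?thesis using ls[OF that] by (simp add: Md(1) algebra_simps)
  qed
  ultimately show ?thesis unfolding sect_def by blast
qed

lemma sect_transition:
  assumes C: "C \<in> A" and s: "sect b C z s" and s': "sect b C z s'"
  obtains M r where "form_isometry c M" "r > 0" "ball z r \<subseteq> coords C S" "\<And>w. w \<in> ball z r \<Longrightarrow> loc C s' w = M (loc C s w)"
proof -
  obtain r f1 f2 where p: "pair_on b C z r f1 f2"
    and ls: "\<And>w. w \<in> ball z r \<Longrightarrow> loc C s w = (gauge b C w * f1 w, gauge b C w * f2 w)"
    using s unfolding sect_def by blast
  obtain r' h1 h2 where p': "pair_on b C z r' h1 h2"
    and ls': "\<And>w. w \<in> ball z r' \<Longrightarrow> loc C s' w = (gauge b C w * h1 w, gauge b C w * h2 w)"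
    using s' unfolding sect_def by blast
  define k where "k = min r r'"
  have k: "k > 0" "ball z k \<subseteq> ball z r" "ball z k \<subseteq> ball z r'" using p p' by (auto simp: k_def pair_on_def)
  note q = pair_on_sub[OF p k(1,2)] and q' = pair_on_sub[OF p' k(1,3)]
  obtain M where M: "form_isometry c M" "\<And>w. w \<in> ball z k \<Longrightarrow> (h1 w, h2 w) = M (f1 w, f2 w)"
  proof (rule representation_unique[of "ball z k" f1 f2 h1 h2 c])
    show "open (ball z k)" "connected (ball z k)" "ball z k \<noteq> {}" using k(1) by auto
    show "f1 holomorphic_on ball z k" "f2 holomorphic_on ball z k" "h1 holomorphic_on ball z k" "h2 holomorphic_on ball z k"
      using q q' by (simp_all add: pair_on_def)
    fix w assume w: "w \<in> ball z k"
    have q1: "(cmod (f1 w))\<^sup>2 + c * (cmod (f2 w))\<^sup>2 = hgt C w * (1 + (cmod (Gm b C w))\<^sup>2)"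
        "cmod (f1 w * deriv f2 w - f2 w * deriv f1 w) = exp (loc C \<mu> w) / 2 * cmod (deriv (Gm b C) w)"
      using q w unfolding pair_on_def by blast+
    have q2: "(cmod (h1 w))\<^sup>2 + c * (cmod (h2 w))\<^sup>2 = hgt C w * (1 + (cmod (Gm b C w))\<^sup>2)"
        "cmod (h1 w * deriv h2 w - h2 w * deriv h1 w) = exp (loc C \<mu> w) / 2 * cmod (deriv (Gm b C) w)"
      using q' w unfolding pair_on_def by blast+
    show "(cmod (h1 w))\<^sup>2 + c * (cmod (h2 w))\<^sup>2 = (cmod (f1 w))\<^sup>2 + c * (cmod (f2 w))\<^sup>2"
      "cmod (h1 w * deriv h2 w - h2 w * deriv h1 w) = cmod (f1 w * deriv f2 w - f2 w * deriv f1 w)"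
      by (simp_all only: q1 q2)
    show "f1 w * deriv f2 w - f2 w * deriv f1 w \<noteq> 0" using pair_on_wronskian[OF C q w] .
  qed blast
  have "loc C s' w = M (loc C s w)" if w: "w \<in> ball z k" for w
  proof -
    have "w \<in> ball z r" "w \<in> ball z r'" using k w by auto
    then have "loc C s w = (gauge b C w * f1 w, gauge b C w * f2 w)" "loc C s' w = (gauge b C w * h1 w, gauge b C w * h2 w)"
      using ls ls' by blast+
    then show ?thesis using M(2)[OF w] form_isometry_scale[OF M(1), of "gauge b C w" "f1 w" "f2 w"] by (metis fst_conv snd_conv)
  qed
  then show thesis using that[OF M(1) k(1)] q by (simp add: pair_on_def)
qed

text \<open>An isometry is linear and the two components of a section are linearly independent, so
  its effect on a section near one point determines it.\<close>

lemma sect_rigid: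
  assumes C: "C \<in> A" and s: "sect b C z s" and M: "form_isometry c M" "form_isometry c M'"
    and O: "open Q" "z \<in> Q" and eq: "\<And>w. w \<in> Q \<Longrightarrow> w \<in> coords C S \<Longrightarrow> M (loc C s w) = M' (loc C s w)"
  shows "M = M'"
proof -
  obtain r f1 f2 where p: "pair_on b C z r f1 f2"
    and ls: "\<And>w. w \<in> ball z r \<Longrightarrow> loc C s w = (gauge b C w * f1 w, gauge b C w * f2 w)"
    using s unfolding sect_def by blast
  have z: "z \<in> ball z r" "ball z r \<subseteq> coords C S" using p by (auto simp: pair_on_def)
  define B where "B = Q \<inter> ball z r"
  have B: "open B" "z \<in> B" "B \<subseteq> ball z r" "B \<subseteq> coords C S" using O z by (auto simp: B_def)
  have reg: "regular b C w" if "w \<in> B" for w using p B(3) that by (auto simp: pair_on_def)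
  have Gh: "Gm b C holomorphic_on B" by (rule Gm_holomorphic[OF C B(4) reg])
  \<comment> \<open>The gauge may be 0 at \<open>z\<close> itself, so independence is tested near a
    neighbouring point. One exists because the projected Gauss map has nonzero derivative.\<close>
  have "\<exists>w\<in>B. Gm b C w \<noteq> 0"
  proof (rule ccontr)
    assume "\<not> ?thesis"
    then have "(Gm b C has_field_derivative 0) (at z)"
      by (intro has_field_derivative_transform_within_open[OF DERIV_const[of 0] B(1,2)]) auto
    then show False using Gm_deriv(2)[OF C _ reg[OF B(2)]] B(2,4) DERIV_imp_deriv by blast
  qed
  then obtain w0 where w0: "w0 \<in> B" "Gm b C w0 \<noteq> 0" by blast
  define B' where "B' = B \<inter> Gm b C -` (- {0})"
  have B': "open B'" "w0 \<in> B'" "B' \<subseteq> B"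
    using continuous_open_preimage[OF holomorphic_on_imp_continuous_on[OF Gh] B(1), of "- {0}"] w0 by (auto simp: B'_def)
  have gnz: "gauge b C w \<noteq> 0" if "w \<in> B'" for w
  proof (cases b)
    case True
    then have "inverse (Gm False C w) \<noteq> 0" using that Gm_True[OF C] B(4) by (auto simp: B'_def)
    then show ?thesis using True by (simp add: gauge_def)
  qed (simp add: gauge_def)
  have f: "f1 holomorphic_on B'" "f2 holomorphic_on B'"
    using p B'(3) B(3) holomorphic_on_subset unfolding pair_on_def by (meson subset_trans)+
  have W: "f1 w0 * deriv f2 w0 - f2 w0 * deriv f1 w0 \<noteq> 0" using pair_on_wronskian[OF C p] w0(1) B(3) by blast
  obtain a1 b1 d1 e1 where M1: "M = (\<lambda>(x, y). (a1 * x + b1 * y, d1 * x + e1 * y))" using M(1) unfolding form_isometry_def by blast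
  obtain a2 b2 d2 e2 where M2: "M' = (\<lambda>(x, y). (a2 * x + b2 * y, d2 * x + e2 * y))" using M(2) unfolding form_isometry_def by blast
  have e: "(a1 - a2) * f1 w + (b1 - b2) * f2 w = 0 \<and> (d1 - d2) * f1 w + (e1 - e2) * f2 w = 0" if w: "w \<in> B'" for w
  proof -
    have "w \<in> Q" "w \<in> ball z r" "w \<in> coords C S" using w B'(3) B by (auto simp: B_def)
    then have "M (gauge b C w * f1 w, gauge b C w * f2 w) = M' (gauge b C w * f1 w, gauge b C w * f2 w)" using eq ls by metis
    then have "gauge b C w * ((a1 - a2) * f1 w + (b1 - b2) * f2 w) = 0" "gauge b C w * ((d1 - d2) * f1 w + (e1 - e2) * f2 w) = 0"
      by (simp_all add: M1 M2 algebra_simps)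
    then show ?thesis using gnz[OF w] by simp
  qed
  have "a1 - a2 = 0" "b1 - b2 = 0" "d1 - d2 = 0" "e1 - e2 = 0"
    using wronskian_independent[OF B'(1,2) f _ W, of "a1 - a2" "b1 - b2"] wronskian_independent[OF B'(1,2) f _ W, of "d1 - d2" "e1 - e2"] e
    by blast+
  then show ?thesis by (simp add: M1 M2)
qed

end

section \<open>Global pairs over simply connected sets\<close>

context surface_atlas
begin

lemma filterlim_chart:
  assumes C: "C \<in> A" and x: "x \<in> fst C"
  shows "filterlim (snd C) (at (snd C x)) (at x within S)"
    "filterlim (inv_into (fst C) (snd C)) (at x within S) (at (snd C x))"
proof -
  have xS: "x \<in> S" using chart_subset[OF C] x by blast
  obtain T where T: "open T" "fst C = S \<inter> T" using chart_openin[OF C] by (auto simp: openin_open)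
  have w: "at x within S = at x within fst C"
    by (rule at_within_nhd[of x T]) (use T x in auto)
  have "continuous_on (fst C) (snd C)" "continuous_on (snd C ` fst C) (inv_into (fst C) (snd C))"
    using chart_homeo[OF C] by (simp_all add: homeomorphism_def)
  then have t: "(snd C \<longlongrightarrow> snd C x) (at x within fst C)"
      "(inv_into (fst C) (snd C) \<longlongrightarrow> inv_into (fst C) (snd C) (snd C x)) (at (snd C x) within snd C ` fst C)"
    using x by (auto simp: continuous_on_def)
  have inj: "y \<in> fst C \<Longrightarrow> snd C y = snd C x \<longleftrightarrow> y = x" for y
    using chart_inv(1)[OF C] x by metis
  have "eventually (\<lambda>y. snd C y \<noteq> snd C x) (at x within fst C)"
    unfolding eventually_at_filter by (rule always_eventually) (use inj in auto)
  then show "filterlim (snd C) (at (snd C x)) (at x within S)"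
    unfolding w using t(1) by (simp add: filterlim_at)
  have a: "at (snd C x) within snd C ` fst C = at (snd C x)"
    by (rule at_within_open[OF _ chart_open[OF C]]) (use x in auto)
  have "eventually (\<lambda>z. z \<in> snd C ` fst C - {snd C x}) (at (snd C x))"
    by (rule eventually_at_in_open[OF chart_open[OF C]]) (use x in auto)
  then have "eventually (\<lambda>z. inv_into (fst C) (snd C) z \<in> fst C \<and> inv_into (fst C) (snd C) z \<noteq> x) (at (snd C x))"
    by (rule eventually_mono) (use chart_inv(1)[OF C] in auto)
  then show "filterlim (inv_into (fst C) (snd C)) (at x within S) (at (snd C x))"
    unfolding w using t(2) chart_inv(1)[OF C x] by (simp add: filterlim_at a)
qed

lemma tendsto_loc:
  assumes C: "C \<in> A" and x: "x \<in> fst C"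
  shows "(loc C F \<longlongrightarrow> l) (at (snd C x)) \<longleftrightarrow> (F \<longlongrightarrow> l) (at x within S)"
proof
  assume "(F \<longlongrightarrow> l) (at x within S)"
  from filterlim_compose[OF this filterlim_chart(2)[OF C x]]
  show "(loc C F \<longlongrightarrow> l) (at (snd C x))" by (simp add: loc_def comp_def)
next
  assume "(loc C F \<longlongrightarrow> l) (at (snd C x))"
  from filterlim_compose[OF this filterlim_chart(1)[OF C x]]
  have l: "((\<lambda>y. loc C F (snd C y)) \<longlongrightarrow> l) (at x within S)" .
  obtain T where T: "open T" "fst C = S \<inter> T" using chart_openin[OF C] by (auto simp: openin_open)
  have ev: "eventually (\<lambda>y. y \<in> T \<and> y \<in> S) (at x within S)"
    unfolding eventually_at_topological using T x by blast
  have "eventually (\<lambda>y. loc C F (snd C y) = F y) (at x within S)"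
    by (rule eventually_mono[OF ev]) (use loc_at[OF C, of _ F] T in auto)
  with l show "(F \<longlongrightarrow> l) (at x within S)" by (rule Lim_transform_eventually)
qed

text \<open>The counterpart of \<open>remove_sings\<close> that refers to no chart, so that the
  normal form is one function on the surface and its expression is correct in every chart.\<close>

definition remove_sings_on :: "('a \<Rightarrow> complex) \<Rightarrow> 'a \<Rightarrow> complex" where
  "remove_sings_on F x = (if \<exists>l. (F \<longlongrightarrow> l) (at x within S) then Lim (at x within S) F else 0)"

lemma loc_remove_sings_on:
  assumes C: "C \<in> A" and z: "z \<in> coords C U"
  shows "loc C (remove_sings_on F) z = remove_sings (loc C F) z"
proof -
  define x where "x = inv_into (fst C) (snd C) z"
  have x: "x \<in> fst C" "snd C x = z" using chart_inv(2,3)[OF C z] by (simp_all add: x_def)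
  show ?thesis
    using tendsto_loc[OF C x(1), of F] x(2)
    by (simp add: remove_sings_def remove_sings_on_def t2_space_class.Lim_def loc_def comp_def x_def[symmetric])
qed

end

lemma nicely_meromorphic_on_local_cong:
  assumes f: "f nicely_meromorphic_on W" and W: "open W" and eq: "\<And>w. w \<in> W \<Longrightarrow> f w = g w"
  shows "g nicely_meromorphic_on W"
  unfolding nicely_meromorphic_on_def
proof (intro conjI ballI)
  have ev: "eventually (\<lambda>w. f w = g w) (at z)" if "z \<in> W" for z
    using eventually_at_in_open'[OF W that] by (rule eventually_mono) (rule eq)
  have "f meromorphic_on W" using f by (simp add: nicely_meromorphic_on_def)
  moreover have "f meromorphic_on W \<longleftrightarrow> g meromorphic_on W"
    by (rule meromorphic_on_cong) (use ev in auto)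
  ultimately show "g meromorphic_on W" by simp
  fix z assume z: "z \<in> W"
  have "is_pole f z \<longleftrightarrow> is_pole g z" by (rule is_pole_cong[OF ev[OF z]]) simp
  moreover have "(f \<longlongrightarrow> f z) (at z) \<longleftrightarrow> (g \<longlongrightarrow> g z) (at z)"
    unfolding eq[OF z] by (rule tendsto_cong[OF ev[OF z]])
  moreover have "is_pole f z \<and> f z = 0 \<or> f \<midarrow>z\<rightarrow> f z" using f z by (simp add: nicely_meromorphic_on_def)
  ultimately show "is_pole g z \<and> g z = 0 \<or> g \<midarrow>z\<rightarrow> g z" using eq[OF z] by simp
qed

section \<open>Gluing the local pairs\<close>

context hqsf_surface
begin

definition local_section :: "'a set \<Rightarrow> 'a set \<Rightarrow> ('a \<Rightarrow> complex \<times> complex) \<Rightarrow> bool" where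
  "local_section U V s \<longleftrightarrow> (\<exists>C\<in>A. \<exists>b z r f1 f2. pair_on b C z r f1 f2 \<and> ball z r \<subseteq> coords C U \<and>
     V = {x \<in> fst C. snd C x \<in> ball z r} \<and>
     (\<forall>x\<in>V. s x = (gauge b C (snd C x) * f1 (snd C x), gauge b C (snd C x) * f2 (snd C x))))"

lemma regular_at_point:
  assumes C: "C \<in> A" and x: "x \<in> fst C"
  shows "regular b C (snd C x) \<longleftrightarrow> snd (N x) \<noteq> (if b then 1 else - 1)"
  using loc_at[OF C x, of N] by (auto simp: regular_def reflect_def)

text \<open>The flag in the conclusion depends only on the point: away from the poles of the Gauss
  map, the pole gauge is converted to the ordinary one. This makes sections from different charts
  and gauges comparable.\<close>

lemma local_section_sect:
  assumes l: "local_section U V s" and y: "y \<in> V" and D: "D \<in> A" "y \<in> fst D"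
  shows "sect (snd (N y) = - 1) D (snd D y) s"
proof -
  obtain C b z r f1 f2 where C: "C \<in> A" and p: "pair_on b C z r f1 f2" "ball z r \<subseteq> coords C U"
    and V: "V = {x \<in> fst C. snd C x \<in> ball z r}"
    and s: "\<And>x. x \<in> V \<Longrightarrow> s x = (gauge b C (snd C x) * f1 (snd C x), gauge b C (snd C x) * f2 (snd C x))"
    using l unfolding local_section_def by blast
  have y': "y \<in> fst C" "snd C y \<in> ball z r" using y V by auto
  obtain r' where r': "pair_on b C (snd C y) r' f1 f2" "ball (snd C y) r' \<subseteq> ball z r"
    using pair_on_point[OF p(1) y'(2)] .
  have "loc C s w = (gauge b C w * f1 w, gauge b C w * f2 w)" if "w \<in> ball (snd C y) r'" for w
  proof -
    have w: "w \<in> ball z r" "w \<in> coords C U" using that r'(2) p(2) by auto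
    then have "inv_into (fst C) (snd C) w \<in> V" using chart_inv(2,3)[OF C w(2)] by (simp add: V)
    from s[OF this] show ?thesis using chart_inv(2)[OF C w(2)] by (simp add: loc_def)
  qed
  with r'(1) have sC: "sect b C (snd C y) s" unfolding sect_def by blast
  have reg: "regular b C (snd C y)" using r'(1) by (auto simp: pair_on_def)
  have "sect (snd (N y) = - 1) C (snd C y) s"
  proof (cases "snd (N y) = - 1")
    case True
    then have b using reg regular_at_point[OF C y'(1)] by (cases b) auto
    then show ?thesis using sC True by simp
  next
    case False
    then have "regular False C (snd C y)" using regular_at_point[OF C y'(1)] by simp
    then have "sect False C (snd C y) s" using sC sect_True_False[OF C] by (cases b) auto
    then show ?thesis using False by simp
  qed
  then show ?thesis by (rule sect_change_chart[OF C D(1) y'(1) D(2)])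
qed

lemma local_section_exists:
  assumes U: "openin (top_of_set S) U" and x: "x \<in> U"
  obtains V s where "local_section U V s" "x \<in> V"
proof -
  have xS: "x \<in> S" using U x openin_imp_subset by blast
  obtain C where C: "C \<in> A" "x \<in> fst C" using obtain_chart[OF xS] .
  define b where "b \<longleftrightarrow> snd (N x) = - 1"
  have "regular b C (snd C x)" using regular_at_point[OF C] by (auto simp: b_def)
  then obtain r f1 f2 where p: "pair_on b C (snd C x) r f1 f2"
    using pair_on_exists[OF C(1) coordsI[OF C(2) xS]] by blast
  have "open (coords C U \<inter> ball (snd C x) r)" using open_coords[OF C(1) U] by blast
  moreover have "snd C x \<in> coords C U \<inter> ball (snd C x) r" using coordsI[OF C(2) x] p by (simp add: pair_on_def)
  ultimately obtain r' where r': "r' > 0" "ball (snd C x) r' \<subseteq> coords C U \<inter> ball (snd C x) r" using openE by blast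
  have p': "pair_on b C (snd C x) r' f1 f2" by (rule pair_on_sub[OF p r'(1)]) (use r'(2) in blast)
  show thesis
  proof (rule that)
    show "local_section U {y \<in> fst C. snd C y \<in> ball (snd C x) r'} (\<lambda>y. (gauge b C (snd C y) * f1 (snd C y), gauge b C (snd C y) * f2 (snd C y)))"
      unfolding local_section_def
      by (rule bexI[OF _ C(1)], intro exI conjI) (use p' r' in auto)
    show "x \<in> {y \<in> fst C. snd C y \<in> ball (snd C x) r'}" using C r' by simp
  qed
qed

lemma local_section_domain:
  assumes l: "local_section U V s" and U: "openin (top_of_set S) U"
  shows "openin (top_of_set U) V" "path_connected V" "V \<subseteq> U"
proof -
  obtain C b z r f1 f2 where C: "C \<in> A" and p: "pair_on b C z r f1 f2" "ball z r \<subseteq> coords C U"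
    and V: "V = {x \<in> fst C. snd C x \<in> ball z r}"
    using l unfolding local_section_def by blast
  show sub: "V \<subseteq> U"
  proof
    fix x assume "x \<in> V"
    then have x: "x \<in> fst C" "snd C x \<in> coords C U" using p(2) by (auto simp: V)
    then show "x \<in> U" using chart_inv(4)[OF C x(2)] chart_inv(1)[OF C x(1)] by simp
  qed
  have "openin (top_of_set S) V" unfolding V by (rule openin_preimage[OF C open_ball])
  then show "openin (top_of_set U) V" using sub openin_imp_subset[OF U] openin_subset_trans by blast
  have "V = inv_into (fst C) (snd C) ` ball z r"
  proof (intro equalityI subsetI)
    fix x assume "x \<in> V" then show "x \<in> inv_into (fst C) (snd C) ` ball z r"
      using chart_inv(1)[OF C, of x] by (intro image_eqI[of _ _ "snd C x"]) (auto simp: V)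
  next
    fix x assume "x \<in> inv_into (fst C) (snd C) ` ball z r"
    then obtain w where w: "w \<in> ball z r" "x = inv_into (fst C) (snd C) w" by blast
    have "w \<in> coords C U" using w p(2) by blast
    then show "x \<in> V" using chart_inv(2,3)[OF C, of w U] w by (simp add: V)
  qed
  moreover have "continuous_on (ball z r) (inv_into (fst C) (snd C))"
  proof (rule continuous_on_subset)
    show "continuous_on (snd C ` fst C) (inv_into (fst C) (snd C))" using chart_homeo[OF C] by (simp add: homeomorphism_def)
    show "ball z r \<subseteq> snd C ` fst C" using p(1) coords_S(1)[OF C] by (simp add: pair_on_def)
  qed
  ultimately show "path_connected V"
    using path_connected_continuous_image[OF _ convex_imp_path_connected[OF convex_ball]] by simp
qed

lemma sect_near:
  assumes C: "C \<in> A" and x: "x \<in> fst C" and s: "sect b C (snd C x) s"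
    and Q: "openin (top_of_set S) Q" "x \<in> Q" and eq: "\<And>y. y \<in> Q \<Longrightarrow> F y = s y"
  shows "sect b C (snd C x) F"
proof -
  obtain r f1 f2 where p: "pair_on b C (snd C x) r f1 f2"
    and ls: "\<And>w. w \<in> ball (snd C x) r \<Longrightarrow> loc C s w = (gauge b C w * f1 w, gauge b C w * f2 w)"
    using s unfolding sect_def by blast
  have "open (coords C Q \<inter> ball (snd C x) r)" using open_coords[OF C Q(1)] by blast
  moreover have "snd C x \<in> coords C Q \<inter> ball (snd C x) r" using coordsI[OF x Q(2)] p by (simp add: pair_on_def)
  ultimately obtain r' where r': "r' > 0" "ball (snd C x) r' \<subseteq> coords C Q \<inter> ball (snd C x) r" using openE by blast
  have p': "pair_on b C (snd C x) r' f1 f2" by (rule pair_on_sub[OF p r'(1)]) (use r'(2) in blast)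
  have "loc C F w = (gauge b C w * f1 w, gauge b C w * f2 w)" if w: "w \<in> ball (snd C x) r'" for w
  proof -
    have "w \<in> coords C Q" "w \<in> ball (snd C x) r" using w r'(2) by auto
    then show ?thesis using eq[OF chart_inv(4)[OF C]] ls by (simp add: loc_def)
  qed
  then show ?thesis using p' unfolding sect_def by blast
qed

lemma local_section_transition:
  assumes U: "openin (top_of_set S) U" and l: "local_section U V s" "local_section U V' s'" and y: "y \<in> V" "y \<in> V'"
  obtains M Q where "form_isometry c M" "openin (top_of_set U) Q" "y \<in> Q" "\<And>x. x \<in> Q \<Longrightarrow> s' x = M (s x)"
proof -
  have yU: "y \<in> U" "y \<in> S" using local_section_domain(3)[OF l(1) U] y openin_imp_subset[OF U] by auto
  obtain D where D: "D \<in> A" "y \<in> fst D" using obtain_chart[OF yU(2)] .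
  obtain M r where M: "form_isometry c M" "r > 0" "ball (snd D y) r \<subseteq> coords D S"
    "\<And>w. w \<in> ball (snd D y) r \<Longrightarrow> loc D s' w = M (loc D s w)"
    using sect_transition[OF D(1) local_section_sect[OF l(1) y(1) D] local_section_sect[OF l(2) y(2) D]] by blast
  define Q where "Q = U \<inter> {x \<in> fst D. snd D x \<in> ball (snd D y) r}"
  have "openin (top_of_set S) Q" unfolding Q_def by (intro openin_Int U openin_preimage[OF D(1) open_ball])
  then have "openin (top_of_set U) Q" using openin_imp_subset[OF U] openin_subset_trans by (auto simp: Q_def)
  moreover have "y \<in> Q" using yU D M(2) by (simp add: Q_def)
  moreover have "s' x = M (s x)" if "x \<in> Q" for x
    using M(4)[of "snd D x"] that loc_at[OF D(1), of x s] loc_at[OF D(1), of x s'] by (simp add: Q_def)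
  ultimately show thesis using that[OF M(1)] by blast
qed

lemma local_section_rigid:
  assumes U: "openin (top_of_set S) U" and l: "local_section U V s" and y: "y \<in> V"
    and M: "form_isometry c M" "form_isometry c M'"
    and Q: "openin (top_of_set U) Q" "y \<in> Q" and eq: "\<And>x. x \<in> Q \<Longrightarrow> M (s x) = M' (s x)"
  shows "M = M'"
proof -
  have yS: "y \<in> S" using local_section_domain(3)[OF l(1) U] y openin_imp_subset[OF U] by auto
  obtain D where D: "D \<in> A" "y \<in> fst D" using obtain_chart[OF yS] .
  have QS: "openin (top_of_set S) Q" using openin_trans[OF Q(1) U] .
  show ?thesis
  proof (rule sect_rigid[OF D(1) local_section_sect[OF l y D] M open_coords[OF D(1) QS] coordsI[OF D(2) Q(2)]])
    fix w assume w: "w \<in> coords D Q"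
    show "M (loc D s w) = M' (loc D s w)" using eq[OF chart_inv(4)[OF D(1) w]] by (simp add: loc_def)
  qed
qed

text \<open>The germs of pairs form a covering whose fibres are permuted by the constant isometries,
  so a global section over a simply connected set exists by continuation.\<close>

lemma global_pair:
  assumes U: "openin (top_of_set S) U" "simply_connected U" "U \<noteq> {}"
  obtains F where "\<And>x C. x \<in> U \<Longrightarrow> C \<in> A \<Longrightarrow> x \<in> fst C \<Longrightarrow> sect (snd (N x) = - 1) C (snd C x) F"
proof -
  define \<sigma> where "\<sigma> V = (SOME s. local_section U V s)" for V
  have \<sigma>: "local_section U V (\<sigma> V)" if "local_section U V s" for V s
    using that unfolding \<sigma>_def by (rule someI[of "local_section U V"])
  define \<S> where "\<S> = {(V, \<lambda>x. M (\<sigma> V x)) | V M. (\<exists>s. local_section U V s) \<and> form_isometry c M}"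
  have SE: "\<exists>M s. form_isometry c M \<and> local_section U V s \<and> f = (\<lambda>x. M (\<sigma> V x))" if "(V, f) \<in> \<S>" for V f
    using that unfolding \<S>_def by auto
  have SI: "(V, \<lambda>x. M (\<sigma> V x)) \<in> \<S>" if "local_section U V s" "form_isometry c M" for V s M
    unfolding \<S>_def by (rule CollectI, rule exI[of _ V], rule exI[of _ M], intro conjI HOL.refl exI[of _ s] that)
  let ?near = "\<lambda>x f g. \<exists>Q. openin (top_of_set U) Q \<and> x \<in> Q \<and> (\<forall>w\<in>Q. f w = g w)"
  have ev: "\<exists>V. openin (top_of_set U) V \<and> path_connected V \<and> x \<in> V \<and>
      (\<forall>y\<in>V. \<forall>V' f'. (V', f') \<in> \<S> \<and> y \<in> V' \<longrightarrow> (\<exists>f. (V, f) \<in> \<S> \<and> ?near y f f'))" if x: "x \<in> U" for x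
  proof -
    obtain V s where l: "local_section U V s" "x \<in> V" using local_section_exists[OF U(1) x] .
    have "\<exists>f. (V, f) \<in> \<S> \<and> ?near y f f'" if y: "y \<in> V" and f': "(V', f') \<in> \<S>" "y \<in> V'" for y V' f'
    proof -
      obtain M s' where M: "form_isometry c M" "local_section U V' s'" "f' = (\<lambda>x. M (\<sigma> V' x))" using SE[OF f'(1)] by metis
      obtain M' Q where M': "form_isometry c M'" "openin (top_of_set U) Q" "y \<in> Q" "\<And>x. x \<in> Q \<Longrightarrow> \<sigma> V' x = M' (\<sigma> V x)"
        using local_section_transition[OF U(1) \<sigma>[OF l(1)] \<sigma>[OF M(2)] y f'(2)] by blast
      have S: "(V, \<lambda>x. M (M' (\<sigma> V x))) \<in> \<S>"
        using SI[OF l(1) form_isometry_compose[OF M(1) M'(1)]] .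
      have "\<forall>w\<in>Q. M (M' (\<sigma> V w)) = f' w" using M'(4) by (simp add: M(3))
      then show ?thesis
        by (intro exI[of _ "\<lambda>x. M (M' (\<sigma> V x))"] exI[of _ Q] conjI S M'(2,3))
    qed
    then have "\<forall>y\<in>V. \<forall>V' f'. (V', f') \<in> \<S> \<and> y \<in> V' \<longrightarrow> (\<exists>f. (V, f) \<in> \<S> \<and> ?near y f f')"
      by (intro ballI allI impI, elim conjE)
    with local_section_domain(1,2)[OF l(1) U(1)] l(2) show ?thesis by (intro exI[of _ V] conjI)
  qed
  have ri: "?near x f g" if f: "(V, f) \<in> \<S>" "(V, g) \<in> \<S>" and y: "y \<in> V" and x: "x \<in> V" and n: "?near y f g" for V f g x y
  proof -
    obtain M s where M: "form_isometry c M" "local_section U V s" "f = (\<lambda>x. M (\<sigma> V x))" using SE[OF f(1)] by metis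
    obtain M' where M': "form_isometry c M'" "g = (\<lambda>x. M' (\<sigma> V x))" using SE[OF f(2)] by metis
    obtain Q where Q: "openin (top_of_set U) Q" "y \<in> Q" "\<forall>w\<in>Q. f w = g w" using n by blast
    have "M = M'"
      by (rule local_section_rigid[OF U(1) \<sigma>[OF M(2)] y M(1) M'(1) Q(1,2)]) (use Q(3) M(3) M'(2) in auto)
    then have "f = g" using M(3) M'(2) by simp
    with local_section_domain(1)[OF M(2) U(1)] x show ?thesis by (intro exI[of _ V]) simp
  qed
  interpret cont: continuation U \<S> ?near
  proof (unfold_locales, goal_cases)
    case (1 x) then show ?case by (rule ev)
  next
    case (2 V f g y x) show ?case by (rule ri[OF 2])
  qed
  obtain x0 where x0: "x0 \<in> U" using U(3) by blast
  obtain V0 s0 where l0: "local_section U V0 s0" "x0 \<in> V0" using local_section_exists[OF U(1) x0] .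
  obtain F where F: "\<And>x. x \<in> U \<Longrightarrow> \<exists>V f. (V, f) \<in> \<S> \<and> x \<in> V \<and> ?near x F f"
    using cont.global_section[OF U(2) SI[OF l0(1) form_isometry_id] l0(2) x0] by metis
  show thesis
  proof (rule that)
    fix x C assume x: "x \<in> U" and C: "C \<in> A" "x \<in> fst C"
    obtain V f Q where V: "(V, f) \<in> \<S>" "x \<in> V" "openin (top_of_set U) Q" "x \<in> Q" "\<forall>w\<in>Q. F w = f w"
      using F[OF x] by metis
    obtain M s where M: "form_isometry c M" "local_section U V s" "f = (\<lambda>x. M (\<sigma> V x))" using SE[OF V(1)] by metis
    have "sect (snd (N x) = - 1) C (snd C x) f"
      unfolding M(3) by (rule sect_isometry[OF C(1) M(1) local_section_sect[OF \<sigma>[OF M(2)] V(2) C]])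
    then show "sect (snd (N x) = - 1) C (snd C x) F"
      by (rule sect_near[OF C _ openin_trans[OF V(3) U(1)] V(4)]) (use V(5) in blast)
  qed
qed

section \<open>The Gauss map and the pair as maps into the sphere\<close>

definition gauss_map :: "'a \<Rightarrow> complex" where
  "gauss_map x = stereo False (N x)"

lemma loc_gauss_map: "loc C gauss_map = Gm False C"
  by (simp add: fun_eq_iff loc_def gauss_map_def Gm_def)

lemma Gm_False:
  assumes "C \<in> A" "w \<in> coords C S"
  shows "Gm False C w = (if b then inverse (Gm b C w) else Gm b C w)"
  using Gm_True[OF assms] by (cases b) auto

lemma Gm_pole:
  assumes C: "C \<in> A" and z: "z \<in> coords C S" and b: "snd (loc C N z) = - 1"
  shows "Gm True C z = 0"
proof -
  have "fst (loc C N z) \<bullet> fst (loc C N z) = 0"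
    using conformal_surface.unit[OF local_surface[OF C] z] b by (simp add: inner_prod_def)
  then show ?thesis by (simp add: Gm_def stereo_def reflect_def)
qed

lemma gauss_map_sphere:
  assumes C: "C \<in> A" and z: "z \<in> coords C S"
  shows "loc C gauss_map meromorphic_on {z}" "is_pole (loc C gauss_map) z \<longleftrightarrow> snd (loc C N z) = - 1"
    "(is_pole (loc C gauss_map) z \<and> loc C gauss_map z = 0) \<or> loc C gauss_map \<midarrow>z\<rightarrow> loc C gauss_map z"
    "sphere_deriv_nz (loc C gauss_map) z"
proof -
  define b where "b \<longleftrightarrow> snd (loc C N z) = - 1"
  have reg: "regular b C z" by (auto simp: b_def regular_def reflect_def)
  obtain r where r: "r > 0" "ball z r \<subseteq> coords C S" "\<And>w. w \<in> ball z r \<Longrightarrow> regular b C w"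
    using regular_ball[OF C open_coords_S[OF C] z order.refl reg] by blast
  have G: "Gm b C holomorphic_on ball z r" by (rule Gm_holomorphic[OF C r(2,3)])
  have zr: "z \<in> ball z r" using r(1) by simp
  have b0: "b \<Longrightarrow> Gm b C z = 0" using Gm_pole[OF C z] by (auto simp: b_def)
  have f: "loc C gauss_map w = (if b then inverse (Gm b C w) else Gm b C w)" if "w \<in> ball z r" for w
    unfolding loc_gauss_map by (rule Gm_False[OF C]) (use r(2) that in blast)
  note P = sphere_chart_properties[OF open_ball zr G Gm_deriv(2)[OF C z reg] f b0]
  show "loc C gauss_map meromorphic_on {z}" "is_pole (loc C gauss_map) z \<longleftrightarrow> snd (loc C N z) = - 1"
    "(is_pole (loc C gauss_map) z \<and> loc C gauss_map z = 0) \<or> loc C gauss_map \<midarrow>z\<rightarrow> loc C gauss_map z"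
    "sphere_deriv_nz (loc C gauss_map) z"
    using P unfolding b_def by blast+
qed

lemma gauss_map_sphere_holomorphic: "sphere_holomorphic A S gauss_map"
  unfolding sphere_holomorphic_def nicely_meromorphic_on_def
proof (intro ballI conjI)
  fix C assume C: "C \<in> A"
  show "loc C gauss_map meromorphic_on coords C S"
    by (subst meromorphic_on_meromorphic_at) (use gauss_map_sphere(1)[OF C] in blast)
  show "(is_pole (loc C gauss_map) z \<and> loc C gauss_map z = 0) \<or> loc C gauss_map \<midarrow>z\<rightarrow> loc C gauss_map z"
    if "z \<in> coords C S" for z using gauss_map_sphere(3)[OF C that] .
qed

lemma hqsf_X_cong:
  assumes "open V" "z \<in> V" "\<And>w. w \<in> V \<Longrightarrow> f1 w = h1 w" "\<And>w. w \<in> V \<Longrightarrow> f2 w = h2 w"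
  shows "hqsf_X c' g f1 f2 z = hqsf_X c' g h1 h2 z"
proof -
  have ev: "eventually (\<lambda>w. f1 w = h1 w) (nhds z)" "eventually (\<lambda>w. f2 w = h2 w) (nhds z)"
    using assms eventually_nhds_in_open[OF assms(1,2)] by (auto elim!: eventually_mono)
  then have "deriv f1 z = deriv h1 z" "deriv f2 z = deriv h2 z" by (auto intro: deriv_cong_ev)
  then show ?thesis using assms by (simp add: hqsf_X_def hqsf_R_def)
qed

lemma pair_parametrization:
  assumes U: "openin (top_of_set S) U" "simply_connected U"
  shows "\<exists>f1 f2. sphere_holomorphic A U f1 \<and> sphere_holomorphic A U f2 \<and>
     (\<forall>C\<in>A. \<forall>z\<in>coords C U. wronskian_nz (loc C f1) (loc C f2) z) \<and> hqsf_parametrized A U X c gauss_map f1 f2"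
proof (cases "U = {}")
  case True
  \<comment> \<open>For the empty set there is no germ to continue, and the assertions are
    vacuous.\<close>
  then have "coords C U = {}" for C :: "'a chart" by (simp add: coords_def)
  then have "sphere_holomorphic A U f" "hqsf_parametrized A U X c gauss_map f h" for f h
    by (simp_all add: sphere_holomorphic_def hqsf_parametrized_def nicely_meromorphic_on_def meromorphic_on_def)
  then show ?thesis using \<open>\<And>C. coords C U = {}\<close> by auto
next
  case False
  have US: "U \<subseteq> S" using openin_imp_subset[OF U(1)] .
  obtain F where F: "\<And>x C. x \<in> U \<Longrightarrow> C \<in> A \<Longrightarrow> x \<in> fst C \<Longrightarrow> sect (snd (N x) = - 1) C (snd C x) F"
    using global_pair[OF U False] by blast
  define F1 where "F1 x = fst (F x)" for x
  define F2 where "F2 x = snd (F x)" for x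
  \<comment> \<open>The gauge assigns the value 0 at every pole of the Gauss map, also where one
    component stays finite; removing singularities corrects these values.\<close>
  define h1 where "h1 = remove_sings_on F1"
  define h2 where "h2 = remove_sings_on F2"
  have main: "loc C F1 meromorphic_on {z} \<and> loc C F2 meromorphic_on {z} \<and> wronskian_nz (loc C h1) (loc C h2) z \<and>
      (\<not> is_pole (loc C gauss_map) z \<longrightarrow> loc C X z = hqsf_X c (loc C gauss_map) (loc C h1) (loc C h2) z)"
    if C: "C \<in> A" and z: "z \<in> coords C U" for C z
  proof -
    have zS: "z \<in> coords C S" using z coords_subset[OF US] by blast
    define b where "b \<longleftrightarrow> snd (loc C N z) = - 1"
    have "sect b C z F"
      using F[OF chart_inv(4)[OF C z] C chart_inv(3)[OF C z]] chart_inv(2)[OF C z] by (simp add: b_def loc_def)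
    then obtain r f1 f2 where p: "pair_on b C z r f1 f2"
      and lF: "\<And>w. w \<in> ball z r \<Longrightarrow> loc C F w = (gauge b C w * f1 w, gauge b C w * f2 w)"
      unfolding sect_def by blast
    have zr: "z \<in> ball z r" and rS: "ball z r \<subseteq> coords C S" and reg: "\<And>w. w \<in> ball z r \<Longrightarrow> regular b C w"
      and hol: "f1 holomorphic_on ball z r" "f2 holomorphic_on ball z r"
      and P: "\<And>w. w \<in> ball z r \<Longrightarrow> (cmod (f1 w))\<^sup>2 + c * (cmod (f2 w))\<^sup>2 = hgt C w * (1 + (cmod (Gm b C w))\<^sup>2)"
      using p by (auto simp: pair_on_def)
    have G: "Gm b C holomorphic_on ball z r" by (rule Gm_holomorphic[OF C rS reg])
    have b0: "b \<Longrightarrow> Gm b C z = 0" using Gm_pole[OF C zS] by (auto simp: b_def)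
    have ga: "gauge b C w = (if b then inverse (Gm b C w) else 1)" if "w \<in> ball z r" for w
      using Gm_False[OF C, of w b] rS that by (auto simp: gauge_def)
    have l1: "loc C F1 w = (if b then inverse (Gm b C w) else 1) * f1 w"
      and l2: "loc C F2 w = (if b then inverse (Gm b C w) else 1) * f2 w" if "w \<in> ball z r" for w
      using lF[OF that] ga[OF that] by (simp_all add: loc_def F1_def F2_def split del: if_split)
    have H: "loc C h1 w = remove_sings (loc C F1) w" "loc C h2 w = remove_sings (loc C F2) w" if "w \<in> ball z r" for w
      unfolding h1_def h2_def using loc_remove_sings_on[OF C, of w S] rS that by auto
    note Q = sphere_pair_properties[OF open_ball zr G Gm_deriv(2)[OF C zS reg[OF zr]] hol pair_on_wronskian[OF C p zr] b0 l1 l2 H]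
    have "loc C X z = hqsf_X c (loc C gauss_map) (loc C h1) (loc C h2) z" if np: "\<not> is_pole (loc C gauss_map) z"
    proof -
      have nb: "\<not> b" using np gauss_map_sphere(2)[OF C zS] by (simp add: b_def)
      interpret s: conformal_surface "coords C S" "loc C X" "loc C N" using local_surface[OF C] .
      have "loc C X z = hqsf_X c (Gm False C) f1 f2 z"
      proof (rule s.position_formula[OF open_ball rS zr _ hol])
        show "Gm False C holomorphic_on ball z r" "deriv (Gm False C) z \<noteq> 0"
          using G Gm_deriv(2)[OF C zS reg[OF zr]] nb by simp_all
        fix w assume w: "w \<in> ball z r"
        then have wS: "w \<in> coords C S" using rS by blast
        show "loc C N w = gauss_inv (Gm False C w)" using Gm_deriv(3)[OF C wS reg[OF w]] nb by (simp add: reflect_def)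
        have "s.supp w > 0" unfolding supp_loc[OF C] using pos chart_inv(4)[OF C wS] .
        then have "s.supp w = 2 * (hgt C w)\<^sup>2" by (simp add: hgt_def s.supp_def)
        moreover have "1 + (cmod (Gm False C w))\<^sup>2 \<noteq> 0" by (metis add_nonneg_eq_0_iff zero_le_one zero_le_power2 zero_neq_one)
        ultimately show "s.supp w = 2 * ((cmod (f1 w))\<^sup>2 + c * (cmod (f2 w))\<^sup>2)\<^sup>2 / (1 + (cmod (Gm False C w))\<^sup>2)\<^sup>2"
          using P[OF w] nb by (simp add: power_mult_distrib)
      qed
      also have "\<dots> = hqsf_X c (loc C gauss_map) (loc C h1) (loc C h2) z"
        unfolding loc_gauss_map by (rule hqsf_X_cong[OF open_ball zr]; rule sym, rule Q(4) Q(5); (assumption | rule nb))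
      finally show ?thesis .
    qed
    then show ?thesis using Q(1,2,3) by blast
  qed
  have "sphere_holomorphic A U (remove_sings_on F)" if "\<And>C z. C \<in> A \<Longrightarrow> z \<in> coords C U \<Longrightarrow> loc C F meromorphic_on {z}" for F
    unfolding sphere_holomorphic_def
  proof
    fix C assume C: "C \<in> A"
    have "loc C F meromorphic_on coords C U" by (subst meromorphic_on_meromorphic_at) (use that[OF C] in blast)
    from remove_sings_nicely_meromorphic[OF this]
    show "loc C (remove_sings_on F) nicely_meromorphic_on coords C U"
      by (rule nicely_meromorphic_on_local_cong[OF _ open_coords[OF C U(1)]]) (simp add: loc_remove_sings_on[OF C])
  qed
  then have "sphere_holomorphic A U h1" "sphere_holomorphic A U h2" unfolding h1_def h2_def using main by blast+
  moreover have "hqsf_parametrized A U X c gauss_map h1 h2" unfolding hqsf_parametrized_def using main by blast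
  ultimately show ?thesis using main by blast
qed

end

section \<open>Bounds near poles\<close>

lemma tendsto_bounded_near:
  fixes f :: "complex \<Rightarrow> real"
  assumes "(f \<longlongrightarrow> l) (at z)"
  shows "\<exists>B. eventually (\<lambda>w. f w \<le> B) (at z)"
proof -
  have "eventually (\<lambda>w. f w < l + 1) (at z)" by (rule order_tendstoD(2)[OF assms]) simp
  then have "eventually (\<lambda>w. f w \<le> l + 1) (at z)" by (rule eventually_mono) simp
  then show ?thesis by blast
qed

lemma eventually_deriv_cong:
  assumes "eventually (\<lambda>w. f w = g w) (at z)"
  shows "eventually (\<lambda>w. f w = g w \<and> deriv f w = deriv g w) (at z)"
proof -
  obtain Q where Q: "open Q" "z \<in> Q" "\<And>w. w \<in> Q \<Longrightarrow> w \<noteq> z \<Longrightarrow> f w = g w"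
    using assms unfolding eventually_at_topological by blast
  have "f w = g w \<and> deriv f w = deriv g w" if w: "w \<in> Q - {z}" for w
  proof -
    have o: "open (Q - {z})" using Q(1) by (intro open_delete)
    have "eventually (\<lambda>v. f v = g v) (nhds w)"
      using eventually_nhds_in_open[OF o w] by (rule eventually_mono) (use Q(3) in auto)
    then show ?thesis using deriv_cong_ev[of f g w w] Q(3) w by auto
  qed
  then show ?thesis using eventually_at_in_open[OF Q(1,2)] by (auto elim!: eventually_mono)
qed

lemma analytic_at_tendsto:
  fixes f :: "complex \<Rightarrow> complex"
  assumes "f analytic_on {z}"
  shows "(f \<longlongrightarrow> f z) (at z)" "(deriv f \<longlongrightarrow> deriv f z) (at z)"
  using analytic_at_imp_isCont[OF assms] analytic_at_imp_isCont[OF analytic_deriv[OF assms]]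
  by (simp_all add: isCont_def)

lemma analytic_at_eventually_derivative:
  fixes f :: "complex \<Rightarrow> complex"
  assumes "f analytic_on {z}"
  shows "eventually (\<lambda>w. (f has_field_derivative deriv f w) (at w)) (at z)"
proof -
  obtain Q where Q: "open Q" "z \<in> Q" "f holomorphic_on Q" using assms unfolding analytic_at by blast
  show ?thesis
    using eventually_at_in_open'[OF Q(1,2)] by (rule eventually_mono) (rule holomorphic_derivI[OF Q(3,1)])
qed

lemma nicely_meromorphic_inverse_at_pole:
  assumes f: "f nicely_meromorphic_on W" and z: "z \<in> W" and p: "is_pole f z"
  shows "(\<lambda>w. inverse (f w)) analytic_on {z}" "((\<lambda>w. inverse (f w)) \<longlongrightarrow> 0) (at z)"
    "eventually (\<lambda>w. f w \<noteq> 0) (at z)"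
proof -
  show t: "((\<lambda>w. inverse (f w)) \<longlongrightarrow> 0) (at z)"
    using p unfolding is_pole_def by (rule tendsto_inverse_0[THEN filterlim_compose])
  have "\<not> is_pole (\<lambda>w. inverse (f w)) z"
    using t not_tendsto_and_filterlim_at_infinity[OF trivial_limit_at] unfolding is_pole_def by blast
  then show "(\<lambda>w. inverse (f w)) analytic_on {z}"
    using nicely_meromorphic_on_imp_analytic_at[OF nicely_meromorphic_on_inverse[OF f] z] by blast
  show "eventually (\<lambda>w. f w \<noteq> 0) (at z)" by (rule non_zero_neighbour_pole[OF p])
qed

text \<open>The quotient of \<open>|G'|\<close> by \<open>1 + |G|^2\<close> is the spherical
  derivative up to a constant. It is the same for \<open>1 / G\<close> and hence stays bounded at a
  pole.\<close>

lemma deriv_le_spherical: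
  assumes G: "G nicely_meromorphic_on W" and z: "z \<in> W"
  shows "\<exists>B. eventually (\<lambda>w. cmod (deriv G w) \<le> B * (1 + (cmod (G w))\<^sup>2)) (at z)"
proof (cases "is_pole G z")
  case False
  then have an: "G analytic_on {z}" using nicely_meromorphic_on_imp_analytic_at[OF G z] by blast
  obtain B where B: "eventually (\<lambda>w. cmod (deriv G w) \<le> B) (at z)"
    using tendsto_bounded_near[OF tendsto_norm[OF analytic_at_tendsto(2)[OF an]]] by blast
  have "cmod (deriv G w) \<le> B * (1 + (cmod (G w))\<^sup>2)" if w: "cmod (deriv G w) \<le> B" for w
  proof -
    have "0 \<le> B" using w norm_ge_zero order_trans by blast
    then have "B \<le> B * (1 + (cmod (G w))\<^sup>2)" by (simp add: distrib_left)
    then show ?thesis using w by linarith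
  qed
  then show ?thesis using B by (blast intro: eventually_mono)
next
  case True
  define h where "h w = inverse (G w)" for w
  note P = nicely_meromorphic_inverse_at_pole[OF G z True, folded h_def]
  obtain B where B: "eventually (\<lambda>w. cmod (deriv h w) \<le> B) (at z)"
    using tendsto_bounded_near[OF tendsto_norm[OF analytic_at_tendsto(2)[OF P(1)]]] by blast
  have "eventually (\<lambda>w. G w = inverse (h w)) (at z)" by (simp add: h_def)
  from eventually_deriv_cong[OF this]
  have ev: "eventually (\<lambda>w. deriv G w = deriv (\<lambda>w. inverse (h w)) w) (at z)" by (rule eventually_mono) simp
  have "eventually (\<lambda>w. cmod (deriv G w) \<le> B * (1 + (cmod (G w))\<^sup>2)) (at z)"
    using ev B P(3) analytic_at_eventually_derivative[OF P(1)]
  proof eventually_elim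
    case (elim w)
    have hnz: "h w \<noteq> 0" using elim(3) by (simp add: h_def)
    have "deriv G w = - (inverse (h w) * deriv h w * inverse (h w))"
      unfolding elim(1) using DERIV_inverse'[OF elim(4) hnz] by (rule DERIV_imp_deriv)
    also have "\<dots> = - (deriv h w * (G w)\<^sup>2)" by (simp add: h_def power2_eq_square)
    finally have "cmod (deriv G w) = cmod (deriv h w) * (cmod (G w))\<^sup>2" by (simp add: norm_mult norm_power)
    also have "\<dots> \<le> B * (cmod (G w))\<^sup>2" using elim(2) by (simp add: mult_right_mono)
    also have "\<dots> \<le> B * (1 + (cmod (G w))\<^sup>2)"
    proof -
      have "0 \<le> B" using elim(2) norm_ge_zero order_trans by blast
      then show ?thesis by (simp add: distrib_left)
    qed
    finally show ?case .
  qed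
  then show ?thesis by blast
qed

text \<open>With \<open>q = f2 / f1\<close> the quotient of the two sides is
  \<open>|1 + c |q|^2| / |q'|\<close>, and \<open>||p|^2 + c| / |p'|\<close> with
  \<open>p = 1 / q\<close> at a pole of \<open>q\<close>. Only the nonvanishing of these derivatives
  matters, not the order of the poles of \<open>f1\<close> and \<open>f2\<close>.\<close>

lemma form_le_wronskian:
  fixes c :: real
  assumes f: "f1 nicely_meromorphic_on W" "f2 nicely_meromorphic_on W" and z: "z \<in> W" and nz: "wronskian_nz f1 f2 z"
  shows "\<exists>B. eventually (\<lambda>w. \<bar>(cmod (f1 w))\<^sup>2 + c * (cmod (f2 w))\<^sup>2\<bar> \<le> B * cmod (f1 w * deriv f2 w - f2 w * deriv f1 w)) (at z)"
proof (cases "is_pole f1 z \<or> is_pole f2 z")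
  case False
  then have an: "f1 analytic_on {z}" "f2 analytic_on {z}"
    using nicely_meromorphic_on_imp_analytic_at[OF f(1) z] nicely_meromorphic_on_imp_analytic_at[OF f(2) z] by blast+
  define V where "V w = f1 w * deriv f2 w - f2 w * deriv f1 w" for w
  have V: "V z \<noteq> 0" using nz False by (simp add: wronskian_nz_def V_def)
  have tV: "(V \<longlongrightarrow> V z) (at z)" unfolding V_def
    by (intro tendsto_intros analytic_at_tendsto an)
  have "((\<lambda>w. \<bar>(cmod (f1 w))\<^sup>2 + c * (cmod (f2 w))\<^sup>2\<bar> / cmod (V w)) \<longlongrightarrow> \<bar>(cmod (f1 z))\<^sup>2 + c * (cmod (f2 z))\<^sup>2\<bar> / cmod (V z)) (at z)"
    using V by (intro tendsto_intros analytic_at_tendsto an tV) auto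
  then obtain B where B: "eventually (\<lambda>w. \<bar>(cmod (f1 w))\<^sup>2 + c * (cmod (f2 w))\<^sup>2\<bar> / cmod (V w) \<le> B) (at z)"
    using tendsto_bounded_near by blast
  have "eventually (\<lambda>w. \<bar>(cmod (f1 w))\<^sup>2 + c * (cmod (f2 w))\<^sup>2\<bar> \<le> B * cmod (V w)) (at z)"
    using B tendsto_imp_eventually_ne[OF tV V]
    by eventually_elim (simp add: divide_le_eq)
  then show ?thesis unfolding V_def by blast
next
  case True
  define q0 where "q0 w = f2 w / f1 w" for w
  define q where "q = remove_sings q0"
  have qnz: "sphere_deriv_nz q z" using nz True by (simp add: wronskian_nz_def q_def q0_def[abs_def])
  have mf: "f1 meromorphic_on {z}" "f2 meromorphic_on {z}"
    using f z meromorphic_on_subset[of _ W "{z}"] by (auto simp: nicely_meromorphic_on_def)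
  have mq: "q0 meromorphic_on {z}" unfolding q0_def by (intro meromorphic_on_divide mf)
  have nq: "q nicely_meromorphic_on {z}" unfolding q_def by (rule remove_sings_nicely_meromorphic[OF mq])
  have "eventually (\<lambda>w. q w = q0 w) (at z)"
    unfolding q_def using mq by (intro eventually_remove_sings_eq_at) (simp add: meromorphic_at_iff)
  then have ev: "eventually (\<lambda>w. q w = f2 w / f1 w \<and> deriv q w = deriv (\<lambda>w. f2 w / f1 w) w) (at z)"
    by (intro eventually_deriv_cong) (simp add: q0_def)
  \<comment> \<open>If \<open>f1\<close> vanished identically near \<open>z\<close>, then
    \<open>q\<close> would too because division by 0 gives 0, contradicting the condition on its
    derivative.\<close>
  have f1nz: "eventually (\<lambda>w. f1 w \<noteq> 0) (at z)"
  proof (rule ccontr)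
    assume "\<not> ?thesis"
    then have "frequently (\<lambda>w. f1 w = 0) (at z)" by (simp add: frequently_def)
    then have "eventually (\<lambda>w. f1 w = 0) (at z)"
      using not_essential_frequently_0_imp_eventually_0 mf(1) by (simp add: meromorphic_at_iff)
    with ev have e0: "eventually (\<lambda>w. q w = 0) (at z)" by eventually_elim simp
    then have t: "(q \<longlongrightarrow> 0) (at z)" by (rule tendsto_eventually)
    then have np: "\<not> is_pole q z"
      using not_tendsto_and_filterlim_at_infinity[OF trivial_limit_at] unfolding is_pole_def by blast
    have "q analytic_on {z}" using nicely_meromorphic_on_imp_analytic_at[OF nq _ np] by simp
    from analytic_at_tendsto(2)[OF this] have d: "(deriv q \<longlongrightarrow> deriv q z) (at z)" .
    have "eventually (\<lambda>w. deriv q w = 0) (at z)"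
      using eventually_deriv_cong[OF e0] by (rule eventually_mono) simp
    then have "deriv q z = 0" using tendsto_unique[OF trivial_limit_at d tendsto_eventually] by blast
    then show False using qnz np by (simp add: sphere_deriv_nz_def)
  qed
  have der: "eventually (\<lambda>w. (f has_field_derivative deriv f w) (at w)) (at z)" if "f meromorphic_on {z}" for f
  proof -
    have "isolated_singularity_at f z" using that by (simp add: meromorphic_at_iff)
    then obtain r where r: "r > 0" "f analytic_on ball z r - {z}" unfolding isolated_singularity_at_def by blast
    have "eventually (\<lambda>w. w \<in> ball z r - {z}) (at z)" using eventually_at_in_open[OF open_ball, of z z r] r(1) by simp
    then show ?thesis
      by (rule eventually_mono) (rule holomorphic_derivI[OF analytic_imp_holomorphic[OF r(2)] open_delete[OF open_ball]])
  qed
  have W: "eventually (\<lambda>w. f1 w * deriv f2 w - f2 w * deriv f1 w = (f1 w)\<^sup>2 * deriv q w \<and> f2 w = q w * f1 w \<and> f1 w \<noteq> 0) (at z)"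
    using ev f1nz der[OF mf(1)] der[OF mf(2)]
  proof eventually_elim
    case (elim w)
    have "deriv q w = (deriv f2 w * f1 w - f2 w * deriv f1 w) / (f1 w * f1 w)"
      using elim DERIV_imp_deriv[OF DERIV_divide[OF elim(4,3,2)]] by simp
    then have "(f1 w)\<^sup>2 * deriv q w = deriv f2 w * f1 w - f2 w * deriv f1 w"
      using elim(2) by (simp add: power2_eq_square)
    then show ?case using elim(1,2) by simp
  qed
  show ?thesis
  proof (cases "is_pole q z")
    case False
    have an: "q analytic_on {z}" using nicely_meromorphic_on_imp_analytic_at[OF nq _ False] by simp
    have d: "deriv q z \<noteq> 0" using qnz False by (simp add: sphere_deriv_nz_def)
    have "((\<lambda>w. \<bar>1 + c * (cmod (q w))\<^sup>2\<bar> / cmod (deriv q w)) \<longlongrightarrow> \<bar>1 + c * (cmod (q z))\<^sup>2\<bar> / cmod (deriv q z)) (at z)"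
      using d by (intro tendsto_intros analytic_at_tendsto an) auto
    then obtain B where B: "eventually (\<lambda>w. \<bar>1 + c * (cmod (q w))\<^sup>2\<bar> / cmod (deriv q w) \<le> B) (at z)"
      using tendsto_bounded_near by blast
    have "eventually (\<lambda>w. \<bar>(cmod (f1 w))\<^sup>2 + c * (cmod (f2 w))\<^sup>2\<bar> \<le> B * cmod (f1 w * deriv f2 w - f2 w * deriv f1 w)) (at z)"
      using B tendsto_imp_eventually_ne[OF analytic_at_tendsto(2)[OF an] d] W
    proof eventually_elim
      case (elim w)
      have "(cmod (f1 w))\<^sup>2 + c * (cmod (f2 w))\<^sup>2 = (cmod (f1 w))\<^sup>2 * (1 + c * (cmod (q w))\<^sup>2)"
        using elim(3) by (simp add: norm_mult power_mult_distrib algebra_simps)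
      then have "\<bar>(cmod (f1 w))\<^sup>2 + c * (cmod (f2 w))\<^sup>2\<bar> = (cmod (f1 w))\<^sup>2 * \<bar>1 + c * (cmod (q w))\<^sup>2\<bar>" by (simp add: abs_mult)
      also have "\<dots> \<le> (cmod (f1 w))\<^sup>2 * (B * cmod (deriv q w))"
        using elim(1,2) by (intro mult_left_mono) (auto simp: divide_le_eq)
      also have "\<dots> = B * cmod (f1 w * deriv f2 w - f2 w * deriv f1 w)"
      proof -
        have "cmod (f1 w * deriv f2 w - f2 w * deriv f1 w) = (cmod (f1 w))\<^sup>2 * cmod (deriv q w)"
          unfolding elim(3)[THEN conjunct1] by (simp add: norm_mult norm_power)
        then show ?thesis by simp
      qed
      finally show ?case .
    qed
    then show ?thesis by blast
  next
    case True
    define p where "p w = inverse (q w)" for w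
    note P = nicely_meromorphic_inverse_at_pole[OF nq singletonI True, folded p_def]
    have d: "deriv p z \<noteq> 0" using qnz True by (simp add: sphere_deriv_nz_def p_def[abs_def])
    have "((\<lambda>w. \<bar>(cmod (p w))\<^sup>2 + c\<bar> / cmod (deriv p w)) \<longlongrightarrow> \<bar>(cmod (p z))\<^sup>2 + c\<bar> / cmod (deriv p z)) (at z)"
      using d by (intro tendsto_intros analytic_at_tendsto P(1)) auto
    then obtain B where B: "eventually (\<lambda>w. \<bar>(cmod (p w))\<^sup>2 + c\<bar> / cmod (deriv p w) \<le> B) (at z)"
      using tendsto_bounded_near by blast
    have "eventually (\<lambda>w. q w = inverse (p w)) (at z)" by (simp add: p_def)
    from eventually_deriv_cong[OF this]
    have dq: "eventually (\<lambda>w. deriv q w = deriv (\<lambda>w. inverse (p w)) w) (at z)" by (rule eventually_mono) simp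
    have "eventually (\<lambda>w. \<bar>(cmod (f1 w))\<^sup>2 + c * (cmod (f2 w))\<^sup>2\<bar> \<le> B * cmod (f1 w * deriv f2 w - f2 w * deriv f1 w)) (at z)"
      using B tendsto_imp_eventually_ne[OF analytic_at_tendsto(2)[OF P(1)] d] W P(3) dq analytic_at_eventually_derivative[OF P(1)]
    proof eventually_elim
      case (elim w)
      have pnz: "p w \<noteq> 0" using elim(4) by (simp add: p_def)
      have dqp: "deriv q w = - (inverse (p w) * deriv p w * inverse (p w))"
        unfolding elim(5) using DERIV_inverse'[OF elim(6) pnz] by (rule DERIV_imp_deriv)
      have f1: "f1 w = p w * f2 w" using elim(3,4) by (simp add: p_def)
      have "f1 w * deriv f2 w - f2 w * deriv f1 w = - ((f2 w)\<^sup>2 * deriv p w)"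
        using elim(3) pnz unfolding dqp f1 by (simp add: power2_eq_square field_simps)
      then have Wp: "cmod (f1 w * deriv f2 w - f2 w * deriv f1 w) = (cmod (f2 w))\<^sup>2 * cmod (deriv p w)" by (simp add: norm_mult norm_power)
      have "(cmod (f1 w))\<^sup>2 + c * (cmod (f2 w))\<^sup>2 = (cmod (f2 w))\<^sup>2 * ((cmod (p w))\<^sup>2 + c)"
        unfolding f1 by (simp add: norm_mult power_mult_distrib algebra_simps)
      then have "\<bar>(cmod (f1 w))\<^sup>2 + c * (cmod (f2 w))\<^sup>2\<bar> = (cmod (f2 w))\<^sup>2 * \<bar>(cmod (p w))\<^sup>2 + c\<bar>" by (simp add: abs_mult)
      also have "\<dots> \<le> (cmod (f2 w))\<^sup>2 * (B * cmod (deriv p w))"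
        using elim(1,2) by (intro mult_left_mono) (auto simp: divide_le_eq)
      also have "\<dots> = B * cmod (f1 w * deriv f2 w - f2 w * deriv f1 w)" unfolding Wp by simp
      finally show ?case .
    qed
    then show ?thesis by blast
  qed
qed

lemma harmonic_Re:
  assumes W: "open W" "z \<in> W" and h: "h holomorphic_on W"
  shows "du (du (\<lambda>w. Re (h w))) z + dv (dv (\<lambda>w. Re (h w))) z = 0"
proof -
  have D: "du (\<lambda>w. Re (f w)) w = Re (deriv f w) \<and> dv (\<lambda>w. Re (f w)) w = Re (\<i> * deriv f w)"
    if f: "f holomorphic_on W" and w: "w \<in> W" for f w
    using du_dv_has_derivative[OF has_derivative_Re[OF holomorphic_derivI[OF f W(1) w, of UNIV, unfolded has_field_derivative_def]]]
    by simp
  have h': "deriv h holomorphic_on W" "(\<lambda>w. \<i> * deriv h w) holomorphic_on W"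
    using h W(1) by (auto intro!: holomorphic_intros)
  have "du (du (\<lambda>w. Re (h w))) z = du (\<lambda>w. Re (deriv h w)) z" "dv (dv (\<lambda>w. Re (h w))) z = dv (\<lambda>w. Re (\<i> * deriv h w)) z"
    by (rule du_dv_cong(1)[OF W], use D[OF h] in blast, rule du_dv_cong(2)[OF W], use D[OF h] in blast)
  moreover have "deriv (\<lambda>w. \<i> * deriv h w) z = \<i> * deriv (deriv h) z"
    using DERIV_cmult[OF holomorphic_derivI[OF h'(1) W]] by (rule DERIV_imp_deriv)
  ultimately show ?thesis using D[OF h'(1) W(2)] D[OF h'(2) W(2)] by simp
qed

text \<open>Every term of the formula contains the form as a factor. Used contrapositively: a
  surface that avoids the origin has a nonvanishing form.\<close>

lemma hqsf_X_eq_0: "(cmod (f1 z))\<^sup>2 + c * (cmod (f2 z))\<^sup>2 = 0 \<Longrightarrow> hqsf_X c g f1 f2 z = 0"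
  by (simp add: hqsf_X_def hqsf_R_def zero_prod_def)

section \<open>The potential of a parametrized surface\<close>

context conformal_surface
begin

text \<open>The value that the coefficient \<open>c * exp (2 * \<mu> z)\<close> must have for the
  HQSF equation to hold at \<open>z\<close>, obtained by solving the equation for it.\<close>

definition potential :: "complex \<Rightarrow> real" where
  "potential z = (supp z * (du (du supp) z + dv (dv supp) z) + 2 * lam z * (supp z)\<^sup>2
     - ((du supp z)\<^sup>2 + (dv supp z)\<^sup>2)) / (lam z * supp z)"

lemma potential_hqsf:
  assumes z: "z \<in> W" and s: "supp z \<noteq> 0"
  shows "2 * (X z \<bullet> N z) * mean_curv X N z
    + (potential z * (X z \<bullet> N z) + X z \<bullet> X z - (X z \<bullet> N z)\<^sup>2) * gauss_curv X N z = 0"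
proof (rule iffD2[OF hqsf_equation_iff[OF z]])
  have "lam z * supp z \<noteq> 0" using lam_pos[OF z] s by simp
  then show "potential z * lam z * supp z = supp z * (du (du supp) z + dv (dv supp) z) + 2 * lam z * (supp z)\<^sup>2
      - ((du supp z)\<^sup>2 + (dv supp z)\<^sup>2)" by (simp add: potential_def mult.assoc)
qed

text \<open>In this form the parameter enters only through a quotient of a trace by
  \<open>lam\<close>, from which independence of the chart is apparent.\<close>

lemma potential_eq:
  assumes z: "z \<in> W" and s: "supp z \<noteq> 0"
  shows "potential z = (du X z \<bullet> du N z + dv X z \<bullet> dv N z) / lam z - (X z \<bullet> X z - (supp z)\<^sup>2) / supp z"
proof -
  have l: "lam z \<noteq> 0" using lam_pos[OF z] by simp
  show ?thesis
    unfolding potential_def laplace_supp[OF z] sqnorm_X[OF z] using l s by (simp add: field_simps power2_eq_square)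
qed

lemma continuous_on_potential:
  assumes "V \<subseteq> W" "\<And>z. z \<in> V \<Longrightarrow> supp z \<noteq> 0"
  shows "continuous_on V potential"
proof -
  have c: "continuous_on W supp" "continuous_on W lam" "continuous_on W (du supp)" "continuous_on W (dv supp)"
    "continuous_on W (du (du supp))" "continuous_on W (dv (dv supp))"
    using Ck_on_imp_continuous_on[OF Ck_supp] Ck_on_imp_continuous_on[OF Ck_lam] Ck_supp[of "Suc 0"] Ck_supp[of "Suc (Suc 0)"]
    by simp_all
  have "lam z \<noteq> 0" if "z \<in> V" for z using lam_pos[of z] assms(1) that by auto
  then show ?thesis
    unfolding potential_def[abs_def] using assms
    by (intro continuous_intros continuous_on_subset[OF _ assms(1)] c) auto
qed

text \<open>At a pole the formula says nothing, so everything is computed on a punctured disc and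
  carried to \<open>z0\<close> by smoothness of the surface there. The bounds of the previous
  section prevent the limit of \<open>u\<close> from being 0.\<close>

lemma representation_at_point:
  fixes c :: real
  assumes r: "0 < r" "ball z0 r \<subseteq> W"
    and nm: "G nicely_meromorphic_on ball z0 r" "f1 nicely_meromorphic_on ball z0 r" "f2 nicely_meromorphic_on ball z0 r"
    and dG: "\<And>z. z \<in> ball z0 r \<Longrightarrow> sphere_deriv_nz G z" and wr: "\<And>z. z \<in> ball z0 r \<Longrightarrow> wronskian_nz f1 f2 z"
    and X: "\<And>z. z \<in> ball z0 r \<Longrightarrow> \<not> is_pole G z \<Longrightarrow> \<not> is_pole f1 z \<Longrightarrow> \<not> is_pole f2 z \<Longrightarrow> X z = hqsf_X c G f1 f2 z"
    and X0: "\<And>z. z \<in> ball z0 r \<Longrightarrow> X z \<noteq> 0"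
  shows "supp z0 \<noteq> 0"
    "\<exists>\<rho> u. 0 < \<rho> \<and> \<rho> \<le> r \<and> u holomorphic_on ball z0 \<rho> \<and>
       (\<forall>z\<in>ball z0 \<rho>. u z \<noteq> 0 \<and> potential z = 4 * sgn (supp z0) * c * (cmod (u z))\<^sup>2)"
proof -
  have z0: "z0 \<in> ball z0 r" "z0 \<in> W" using r by auto
  have iso: "\<exists>r>0. F analytic_on ball z0 r - {z0}" if "F nicely_meromorphic_on ball z0 r" for F
  proof -
    have "F meromorphic_on {z0}" using that z0 meromorphic_on_subset[of F "ball z0 r" "{z0}"] by (auto simp: nicely_meromorphic_on_def)
    then show ?thesis by (simp add: meromorphic_at_iff isolated_singularity_at_def)
  qed
  obtain ra rb rc where rr: "ra > 0" "G analytic_on ball z0 ra - {z0}" "rb > 0" "f1 analytic_on ball z0 rb - {z0}"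
    "rc > 0" "f2 analytic_on ball z0 rc - {z0}" using iso[OF nm(1)] iso[OF nm(2)] iso[OF nm(3)] by blast
  \<comment> \<open>The punctured disc of this radius contains no pole of the three functions,
    whether or not \<open>z0\<close> is one.\<close>
  define \<rho> where "\<rho> = Min {r, ra, rb, rc}"
  have \<rho>: "\<rho> > 0" "\<rho> \<le> r" "\<rho> \<le> ra" "\<rho> \<le> rb" "\<rho> \<le> rc" using r rr by (auto simp: \<rho>_def)
  define D where "D = ball z0 \<rho> - {z0}"
  have D: "open D" "D \<subseteq> ball z0 r" "D \<subseteq> W" "connected D"
    using \<rho> r(2) subset_ball[OF \<rho>(2), of z0] unfolding D_def
    by (auto intro!: open_delete connected_open_delete)
  have sub: "D \<subseteq> ball z0 ra - {z0}" "D \<subseteq> ball z0 rb - {z0}" "D \<subseteq> ball z0 rc - {z0}" using \<rho> by (auto simp: D_def)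
  have an: "G analytic_on D" "f1 analytic_on D" "f2 analytic_on D"
    using analytic_on_subset[OF rr(2) sub(1)] analytic_on_subset[OF rr(4) sub(2)] analytic_on_subset[OF rr(6) sub(3)] by blast+
  have hol: "G holomorphic_on D" "f1 holomorphic_on D" "f2 holomorphic_on D" using an analytic_imp_holomorphic by blast+
  have np: "\<not> is_pole G z" "\<not> is_pole f1 z" "\<not> is_pole f2 z" if "z \<in> D" for z
    using not_is_pole_holomorphic[OF D(1) that] hol by blast+
  have dGnz: "deriv G z \<noteq> 0" and Wnz: "f1 z * deriv f2 z - f2 z * deriv f1 z \<noteq> 0" if "z \<in> D" for z
    using dG[of z] wr[of z] np[OF that] that D(2) by (auto simp: sphere_deriv_nz_def wronskian_nz_def)
  have XD: "X z = hqsf_X c G f1 f2 z" if "z \<in> D" for z using X[of z] np[OF that] that D(2) by blast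
  have Pnz: "(cmod (f1 z))\<^sup>2 + c * (cmod (f2 z))\<^sup>2 \<noteq> 0" if "z \<in> D" for z
    using hqsf_X_eq_0[of f1 z c f2 G] XD[OF that] X0[of z] that D(2) by auto
  have off: "supp z \<noteq> 0 \<and> \<bar>supp z\<bar> = 2 * ((cmod (f1 z))\<^sup>2 + c * (cmod (f2 z))\<^sup>2)\<^sup>2 / (1 + (cmod (G z))\<^sup>2)\<^sup>2 \<and>
      potential z = 4 * sgn (supp z) * c * (cmod ((f1 z * deriv f2 z - f2 z * deriv f1 z) / deriv G z))\<^sup>2" if z: "z \<in> D" for z
  proof -
    define k where "k = 2 * ((cmod (f1 z))\<^sup>2 + c * (cmod (f2 z))\<^sup>2)\<^sup>2 / (1 + (cmod (G z))\<^sup>2)\<^sup>2"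
    obtain e where e: "e = 1 \<or> e = (-1::real)" "supp z = e * k"
      "supp z * (du (du supp) z + dv (dv supp) z) + 2 * lam z * (supp z)\<^sup>2 - ((du supp z)\<^sup>2 + (dv supp z)\<^sup>2)
      = lam z * supp z * (4 * e * c * (cmod (f1 z * deriv f2 z - f2 z * deriv f1 z))\<^sup>2 / (cmod (deriv G z))\<^sup>2)"
      using parametrization_curvature[OF D(1,3) z hol dGnz XD] unfolding k_def by blast
    have "0 < (1 + (cmod (G z))\<^sup>2)\<^sup>2" by (rule zero_less_power) (rule one_plus_norm_pos)
    then have k: "k > 0" unfolding k_def using Pnz[OF z] by simp
    have sg: "sgn (supp z) = e" "supp z \<noteq> 0" "\<bar>supp z\<bar> = k" using e(1,2) k by (auto simp: sgn_mult abs_mult)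
    have "lam z * supp z \<noteq> 0" using sg(2) lam_pos[of z] z D(3) by auto
    then have "potential z = 4 * e * c * (cmod (f1 z * deriv f2 z - f2 z * deriv f1 z))\<^sup>2 / (cmod (deriv G z))\<^sup>2"
      unfolding potential_def e(3) by (rule nonzero_mult_div_cancel_left)
    then show ?thesis using sg by (simp add: k_def norm_divide power_divide)
  qed
  have cs: "continuous_on W supp" using Ck_on_imp_continuous_on[OF Ck_supp] .
  \<comment> \<open>The support function has constant sign on the connected punctured disc, so a
    zero at \<open>z0\<close> would be an extremum. Its gradient would vanish, and the surface would
    pass through the origin.\<close>
  show s0: "supp z0 \<noteq> 0"
  proof
    assume s0: "supp z0 = 0"
    have "connected (supp ` D)" by (rule connected_continuous_image[OF continuous_on_subset[OF cs D(3)] D(4)])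
    moreover have "0 \<notin> supp ` D" using off by force
    ultimately have "(\<forall>z\<in>D. supp z \<le> 0) \<or> (\<forall>z\<in>D. 0 \<le> supp z)"
      unfolding connected_iff_interval by (metis image_eqI linear)
    then have "(\<forall>z\<in>ball z0 \<rho>. supp z \<le> supp z0) \<or> (\<forall>z\<in>ball z0 \<rho>. supp z0 \<le> supp z)"
      unfolding s0 by (auto simp: D_def s0)
    moreover have "(supp has_derivative (\<lambda>h. Re h *\<^sub>R du supp z0 + Im h *\<^sub>R dv supp z0)) (at z0)"
      by (rule differentiable_has_derivative_du_dv, rule Ck_on_differentiable[OF Ck_supp[of "Suc 0"] z0(2)])
    ultimately have 0: "(\<lambda>h. Re h *\<^sub>R du supp z0 + Im h *\<^sub>R dv supp z0) = (\<lambda>h. 0)"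
      using differential_zero_maxmin[of z0 "ball z0 \<rho>" supp] \<rho>(1) by auto
    have "du supp z0 = 0" "dv supp z0 = 0" using fun_cong[OF 0, of 1] fun_cong[OF 0, of \<i>] by simp_all
    then show False using position_eq_0[OF z0(2) s0] X0[OF z0(1)] by blast
  qed
  have cp0: "continuous_on W (\<lambda>z. supp z0 * supp z)" by (intro continuous_intros cs)
  have p0: "supp z0 * supp z0 > 0" using s0 not_real_square_gt_zero by blast
  obtain r1 where r1: "r1 > 0" "\<And>z. z \<in> ball z0 r1 \<Longrightarrow> supp z0 * supp z > 0 \<longleftrightarrow> supp z0 * supp z0 > 0"
    using continuous_sign[OF cp0 open_W z0(2) p0[THEN less_imp_neq, THEN not_sym]] by blast
  have sgn: "sgn (supp z) = sgn (supp z0)" "supp z \<noteq> 0" if "z \<in> ball z0 r1" for z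
  proof -
    have "supp z0 * supp z > 0" using r1(2)[OF that] p0 by blast
    then show "sgn (supp z) = sgn (supp z0)" "supp z \<noteq> 0" by (auto simp: zero_less_mult_iff)
  qed
  define \<rho>' where "\<rho>' = min \<rho> r1"
  have \<rho>': "0 < \<rho>'" "\<rho>' \<le> r" "ball z0 \<rho>' \<subseteq> ball z0 r1" "ball z0 \<rho>' \<subseteq> W" "ball z0 \<rho>' - {z0} \<subseteq> D"
    using \<rho> r1(1) r(2) by (auto simp: \<rho>'_def D_def)
  define \<epsilon> where "\<epsilon> = sgn (supp z0)"
  have \<epsilon>: "\<epsilon> \<noteq> 0" "\<epsilon> * \<epsilon> = 1" using s0 by (auto simp: \<epsilon>_def sgn_if)
  define u0 where "u0 z = (f1 z * deriv f2 z - f2 z * deriv f1 z) / deriv G z" for z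
  have pot: "potential z = 4 * \<epsilon> * c * (cmod (u0 z))\<^sup>2" if "z \<in> ball z0 \<rho>' - {z0}" for z
  proof -
    have "z \<in> D" "z \<in> ball z0 r1" using that \<rho>'(3,5) by blast+
    then show ?thesis using off[of z] sgn(1)[of z] unfolding u0_def \<epsilon>_def by simp
  qed
  have cp: "continuous_on (ball z0 \<rho>') potential"
    by (rule continuous_on_potential[OF \<rho>'(4)]) (use sgn(2) \<rho>'(3) in blast)
  have ib: "isCont F z0" if "continuous_on (ball z0 \<rho>') F" for F :: "complex \<Rightarrow> real"
    using that \<rho>'(1) by (simp add: continuous_on_eq_continuous_at)
  have lim: "potential z0 = l" if "(F \<longlongrightarrow> l) (at z0)" "\<And>z. z \<in> ball z0 \<rho>' - {z0} \<Longrightarrow> potential z = F z" for F l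
  proof -
    have "eventually (\<lambda>z. F z = potential z) (at z0)"
      using eventually_at_in_open[OF open_ball, of z0 z0 \<rho>'] \<rho>'(1) that(2) by (auto elim!: eventually_mono)
    with that(1) have "(potential \<longlongrightarrow> l) (at z0)" by (rule Lim_transform_eventually)
    then show ?thesis using ib[OF cp] tendsto_unique[OF trivial_limit_at] unfolding isCont_def by blast
  qed
  show "\<exists>\<rho> u. 0 < \<rho> \<and> \<rho> \<le> r \<and> u holomorphic_on ball z0 \<rho> \<and>
       (\<forall>z\<in>ball z0 \<rho>. u z \<noteq> 0 \<and> potential z = 4 * sgn (supp z0) * c * (cmod (u z))\<^sup>2)"
  \<comment> \<open>For \<open>c = 0\<close> the potential vanishes and carries no information on
    the Wronskian; the constant 1 serves as \<open>u\<close>. Otherwise \<open>|u0|^2\<close> is a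
    multiple of the potential.\<close>
  proof (cases "c = 0")
    case True
    have "potential z = 0" if "z \<in> ball z0 \<rho>' - {z0}" for z using pot[OF that] True by simp
    moreover from this have "potential z0 = 0" using lim[of "\<lambda>_. 0" 0] by simp
    ultimately have "potential z = 0" if "z \<in> ball z0 \<rho>'" for z using that by (cases "z = z0") blast+
    then have "\<forall>z\<in>ball z0 \<rho>'. (1::complex) \<noteq> 0 \<and> potential z = 4 * sgn (supp z0) * c * (cmod 1)\<^sup>2" using True by simp
    moreover have "(\<lambda>_. 1) holomorphic_on ball z0 \<rho>'" by simp
    ultimately show ?thesis using \<rho>'(1,2) by blast
  next
    case False
    have u0h: "u0 holomorphic_on ball z0 \<rho>' - {z0}" unfolding u0_def
      by (rule holomorphic_on_subset[OF _ \<rho>'(5)])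
        (use hol D(1) dGnz in \<open>auto intro!: holomorphic_intros\<close>)
    have sq: "(cmod (u0 z))\<^sup>2 = potential z / (4 * \<epsilon> * c)" if "z \<in> ball z0 \<rho>' - {z0}" for z
      using pot[OF that] \<epsilon>(1) False by simp
    have ev0: "eventually (\<lambda>z. z \<in> ball z0 \<rho>' - {z0}) (at z0)"
      using eventually_at_in_open[OF open_ball, of z0 z0 \<rho>'] \<rho>'(1) by simp
    have "((\<lambda>z. potential z / (4 * \<epsilon> * c)) \<longlongrightarrow> potential z0 / (4 * \<epsilon> * c)) (at z0)"
      using ib[OF cp] \<epsilon>(1) False unfolding isCont_def by (intro tendsto_intros) auto
    then obtain B where B: "eventually (\<lambda>z. potential z / (4 * \<epsilon> * c) \<le> B) (at z0)" using tendsto_bounded_near by blast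
    \<comment> \<open>Continuity of the potential bounds \<open>u0\<close> near \<open>z0\<close>,
      so the singularity is removable.\<close>
    have "eventually (\<lambda>z. cmod (u0 z) \<le> sqrt B) (at z0)"
      using B ev0
    proof eventually_elim
      case (elim z)
      then show ?case using sq[of z] by (intro real_le_rsqrt) simp
    qed
    then obtain u where u: "u holomorphic_on ball z0 \<rho>'" "\<And>z. z \<in> ball z0 \<rho>' - {z0} \<Longrightarrow> u z = u0 z"
      using holomorphic_on_extend_bounded[OF u0h] \<rho>'(1) by (auto simp: interior_open)
    have cu: "isCont u z0" using holomorphic_on_imp_continuous_on[OF u(1)] \<rho>'(1) by (simp add: continuous_on_eq_continuous_at)
    have potu: "potential z = 4 * \<epsilon> * c * (cmod (u z))\<^sup>2" if "z \<in> ball z0 \<rho>' - {z0}" for z using pot[OF that] u(2)[OF that] by simp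
    have "((\<lambda>z. 4 * \<epsilon> * c * (cmod (u z))\<^sup>2) \<longlongrightarrow> 4 * \<epsilon> * c * (cmod (u z0))\<^sup>2) (at z0)"
      using cu unfolding isCont_def by (intro tendsto_intros)
    from lim[OF this potu] have potu0: "potential z0 = 4 * \<epsilon> * c * (cmod (u z0))\<^sup>2" .
    \<comment> \<open>With \<open>T = 1 + |G|^2\<close>, the root of half the support function is
      \<open>|P| / T\<close>, at most a multiple of the Wronskian over \<open>T\<close>, hence of
      the Wronskian over \<open>|G'|\<close>, which is \<open>|u|\<close>. A zero of
      \<open>u\<close> at \<open>z0\<close> would force one of the support function.\<close>
    have "u z0 \<noteq> 0"
    proof
      assume uz: "u z0 = 0"
      obtain B1 where B1: "eventually (\<lambda>z. cmod (deriv G z) \<le> B1 * (1 + (cmod (G z))\<^sup>2)) (at z0)"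
        using deriv_le_spherical[OF nm(1) z0(1)] by blast
      obtain B2 where B2: "eventually (\<lambda>z. \<bar>(cmod (f1 z))\<^sup>2 + c * (cmod (f2 z))\<^sup>2\<bar> \<le> B2 * cmod (f1 z * deriv f2 z - f2 z * deriv f1 z)) (at z0)"
        using form_le_wronskian[OF nm(2,3) z0(1) wr[OF z0(1)]] by blast
      have ev: "eventually (\<lambda>z. sqrt (\<bar>supp z\<bar> / 2) \<le> B2 * B1 * cmod (u z)) (at z0)"
        using B1 B2 ev0
      proof eventually_elim
        case (elim z)
        have zD: "z \<in> D" using elim(3) \<rho>'(5) by blast
        define T where "T = 1 + (cmod (G z))\<^sup>2"
        define P where "P = (cmod (f1 z))\<^sup>2 + c * (cmod (f2 z))\<^sup>2"
        define V where "V = cmod (f1 z * deriv f2 z - f2 z * deriv f1 z)"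
        have T: "T > 0" unfolding T_def by (rule one_plus_norm_pos)
        have V: "V > 0" using Wnz[OF zD] by (simp add: V_def)
        have g: "cmod (deriv G z) > 0" using dGnz[OF zD] by simp
        have e1: "cmod (deriv G z) \<le> B1 * T" and e2: "\<bar>P\<bar> \<le> B2 * V" using elim by (simp_all add: T_def P_def V_def)
        have "0 < \<bar>P\<bar>" using Pnz[OF zD] by (simp add: P_def)
        then have B2V: "0 < B2 * V" using e2 by linarith
        have "\<bar>supp z\<bar> / 2 = (\<bar>P\<bar> / T)\<^sup>2" using off[OF zD] by (simp add: T_def P_def power_divide)
        then have "sqrt (\<bar>supp z\<bar> / 2) = \<bar>P\<bar> / T" using T by (simp add: real_sqrt_unique)
        also have "\<dots> \<le> B2 * V / T" using e2 T by (simp add: divide_right_mono)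
        also have "\<dots> \<le> B2 * V * (B1 / cmod (deriv G z))"
        proof -
          have "1 / T \<le> B1 / cmod (deriv G z)" using e1 T g by (simp add: field_simps)
          from mult_left_mono[OF this, of "B2 * V"] show ?thesis using B2V by simp
        qed
        also have "\<dots> = B2 * B1 * cmod (u z)" using u(2)[OF elim(3)] by (simp add: u0_def V_def norm_divide)
        finally show ?case .
      qed
      have t1: "((\<lambda>z. sqrt (\<bar>supp z\<bar> / 2)) \<longlongrightarrow> sqrt (\<bar>supp z0\<bar> / 2)) (at z0)"
        using ib[OF continuous_on_subset[OF cs \<rho>'(4)]] unfolding isCont_def by (intro tendsto_intros) auto
      have t2: "((\<lambda>z. B2 * B1 * cmod (u z)) \<longlongrightarrow> B2 * B1 * cmod (u z0)) (at z0)"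
        using cu unfolding isCont_def by (intro tendsto_intros)
      have "sqrt (\<bar>supp z0\<bar> / 2) \<le> B2 * B1 * cmod (u z0)" by (rule tendsto_le[OF trivial_limit_at t2 t1 ev])
      then show False using uz s0 by simp
    qed
    have "\<forall>z\<in>ball z0 \<rho>'. u z \<noteq> 0 \<and> potential z = 4 * sgn (supp z0) * c * (cmod (u z))\<^sup>2"
    proof
      fix z assume z: "z \<in> ball z0 \<rho>'"
      show "u z \<noteq> 0 \<and> potential z = 4 * sgn (supp z0) * c * (cmod (u z))\<^sup>2"
      proof (cases "z = z0")
        case True then show ?thesis using \<open>u z0 \<noteq> 0\<close> potu0 by (simp add: \<epsilon>_def)
      next
        case False
        then have z': "z \<in> ball z0 \<rho>' - {z0}" using z by simp
        then have "z \<in> D" using \<rho>'(5) by blast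
        then have "u0 z \<noteq> 0" using Wnz dGnz by (simp add: u0_def)
        then show ?thesis using u(2)[OF z'] potu[OF z'] by (simp add: \<epsilon>_def)
      qed
    qed
    then show ?thesis using u(1) \<rho>'(1,2) by blast
  qed
qed

end

section \<open>Characterization of HQSF-surfaces\<close>

text \<open>The right-hand side of the characterization for a single atlas, so that the given atlas
  and its conjugate can be treated alike.\<close>

definition representable :: "'a::topological_space chart set \<Rightarrow> 'a set \<Rightarrow> ('a \<Rightarrow> complex \<times> real) \<Rightarrow> bool" where
  "representable B S X \<longleftrightarrow> (\<exists>(c::real) g.
     sphere_holomorphic B S g \<and>
     (\<forall>C\<in>B. \<forall>z\<in>coords C S. sphere_deriv_nz (loc C g) z) \<and>
     (\<forall>U. openin (top_of_set S) U \<and> simply_connected U \<longrightarrow>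
        (\<exists>f1 f2. sphere_holomorphic B U f1 \<and> sphere_holomorphic B U f2 \<and>
           (\<forall>C\<in>B. \<forall>z\<in>coords C U. wronskian_nz (loc C f1) (loc C f2) z) \<and>
           hqsf_parametrized B U X c g f1 f2)))"

lemma (in hqsf_surface) representable: "representable A S X"
  unfolding representable_def
proof (rule exI[of _ c], rule exI[of _ gauss_map], intro conjI ballI allI impI)
  show "sphere_holomorphic A S gauss_map" by (rule gauss_map_sphere_holomorphic)
  show "sphere_deriv_nz (loc C gauss_map) z" if "C \<in> A" "z \<in> coords C S" for C z
    by (rule gauss_map_sphere(4)[OF that])
  fix U assume "openin (top_of_set S) U \<and> simply_connected U"
  then show "\<exists>f1 f2. sphere_holomorphic A U f1 \<and> sphere_holomorphic A U f2 \<and>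
      (\<forall>C\<in>A. \<forall>z\<in>coords C U. wronskian_nz (loc C f1) (loc C f2) z) \<and> hqsf_parametrized A U X c gauss_map f1 f2"
    using pair_parametrization by simp
qed

context conformal_immersion
begin

text \<open>The sign of \<open>N\<close> is spent on making the support function positive, which may
  leave the Gauss map antiholomorphic; this is repaired by conjugating the atlas. Neither change
  affects \<open>X\<close>, which is all that the formula describes.\<close>

lemma HQSF_imp_representable:
  assumes hq: "HQSF A X N" and conn: "connected S" and origin: "0 \<notin> X ` S"
  shows "representable A S X \<or> representable (conj_atlas A) S X"
proof -
  obtain c \<mu> where h: "\<forall>C\<in>A. hqsf_eq (coords C S) (loc C X) (loc C N) c (loc C \<mu>)" using hq unfolding HQSF_iff by blast
  have ci: "conformal_immersion S A X N" by unfold_locales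
  from supp_sign_global[OF conn supp_nonzero[OF h origin]]
  have "\<exists>M. conformal_immersion S A X M \<and> HQSF A X M \<and> (\<forall>x\<in>S. X x \<bullet> M x > 0)"
  proof
    assume "\<forall>x\<in>S. X x \<bullet> N x > 0"
    with ci hq show ?thesis by (intro exI[of _ N] conjI)
  next
    assume "\<forall>x\<in>S. X x \<bullet> N x < 0"
    then have "\<forall>x\<in>S. X x \<bullet> - N x > 0" by simp
    with conformal_immersion_uminus HQSF_uminus[OF hq] show ?thesis by (intro exI[of _ "\<lambda>x. - N x"] conjI)
  qed
  then obtain M where M: "conformal_immersion S A X M" "HQSF A X M" "\<forall>x\<in>S. X x \<bullet> M x > 0" by blast
  interpret p: conformal_immersion S A X M by (rule M(1))
  from p.orientation_global[OF conn] show ?thesis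
  proof
    assume o: "\<forall>C\<in>A. \<forall>z\<in>coords C S. conformal_surface.oriented_by (loc C M) 1 z"
    obtain c' \<nu> where k: "\<forall>C\<in>A. hqsf_eq (coords C S) (loc C X) (loc C M) c' (loc C \<nu>)" using M(2) unfolding p.HQSF_iff by blast
    have "hqsf_surface S A X M c' \<nu>"
      by (intro hqsf_surface.intro hqsf_surface_axioms.intro M(1)) (use k o M(3) in blast)+
    then show ?thesis using hqsf_surface.representable by blast
  next
    assume o: "\<forall>C\<in>A. \<forall>z\<in>coords C S. conformal_surface.oriented_by (loc C M) (- 1) z"
    interpret q: conformal_immersion S "conj_atlas A" X M by (rule p.conformal_immersion_conj)
    obtain c' \<nu> where k: "\<forall>C\<in>conj_atlas A. hqsf_eq (coords C S) (loc C X) (loc C M) c' (loc C \<nu>)"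
      using p.HQSF_conj[OF M(2)] unfolding q.HQSF_iff by blast
    have o': "conformal_surface.oriented_by (loc C M) 1 z" if C: "C \<in> conj_atlas A" and z: "z \<in> coords C S" for C z
    proof -
      obtain D where D: "D \<in> A" "C = conj_chart D" using C unfolding conj_atlas_eq by blast
      have z': "cnj z \<in> coords D S" using z unfolding D(2) coords_conj_chart mem_cnj_image .
      interpret d: conformal_surface "coords D S" "loc D X" "loc D M" using p.local_surface[OF D(1)] .
      interpret e: conformal_surface "coords C S" "loc C X" "loc C M" using q.local_surface[OF C] .
      have "d.oriented_by (- 1) (cnj z)" using o D(1) z' by blast
      then have "dv (loc D M) (cnj z) = - cross (loc D M (cnj z)) (du (loc D M) (cnj z))" unfolding d.oriented_by_def by simp
      then have "dv (loc C M) z = cross (loc C M z) (du (loc C M) z)"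
        unfolding D(2) loc_conj_chart du_dv_cnj(2,3)[OF d.diff(2)[OF z']] by simp
      then show ?thesis unfolding e.oriented_by_def by simp
    qed
    have "hqsf_surface S (conj_atlas A) X M c' \<nu>"
      by (intro hqsf_surface.intro hqsf_surface_axioms.intro p.conformal_immersion_conj) (use k o' M(3) in blast)+
    then show ?thesis using hqsf_surface.representable by blast
  qed
qed

text \<open>The trace of the second form and \<open>lam\<close> both scale by the squared modulus of
  the derivative of the transition map.\<close>

lemma potential_transition:
  assumes C: "C \<in> A" and D: "D \<in> A" and z: "z \<in> coords C (fst D)"
    and s: "conformal_surface.supp (loc C X) (loc C N) z \<noteq> 0"
  shows "conformal_surface.potential (loc C X) (loc C N) z = conformal_surface.potential (loc D X) (loc D N) (loc C (snd D) z)"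
proof -
  define t where "t = loc C (snd D)"
  have zS: "z \<in> coords C S" using z coords_subset[OF chart_subset[OF D]] by blast
  have tS: "t z \<in> coords D S" using transition(4)[OF C D z zS] by (simp add: t_def)
  interpret c: conformal_surface "coords C S" "loc C X" "loc C N" using local_surface[OF C] .
  interpret d: conformal_surface "coords D S" "loc D X" "loc D N" using local_surface[OF D] .
  have dt: "(t has_field_derivative deriv t z) (at z)"
    using holomorphic_derivI[OF transition(1,2)[OF C D] z] by (simp add: t_def)
  have eq: "loc C N w = loc D N (t w)" "loc C X w = loc D X (t w)" if "w \<in> coords C (fst D)" for w
    using transition(3)[OF C D that] by (simp_all add: t_def)
  note compN = du_dv_comp_holomorphic[OF d.diff(2)[OF tS] dt] and compX = du_dv_comp_holomorphic[OF d.diff(1)[OF tS] dt]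
  define a b where "a = Re (deriv t z)" and "b = Im (deriv t z)"
  have N: "du (loc C N) z = a *\<^sub>R du (loc D N) (t z) + b *\<^sub>R dv (loc D N) (t z)"
    "dv (loc C N) z = - b *\<^sub>R du (loc D N) (t z) + a *\<^sub>R dv (loc D N) (t z)"
    using du_dv_cong(1,2)[OF transition(2)[OF C D] z eq(1)] compN by (simp_all add: a_def b_def)
  have X: "du (loc C X) z = a *\<^sub>R du (loc D X) (t z) + b *\<^sub>R dv (loc D X) (t z)"
    "dv (loc C X) z = - b *\<^sub>R du (loc D X) (t z) + a *\<^sub>R dv (loc D X) (t z)"
    using du_dv_cong(1,2)[OF transition(2)[OF C D] z eq(2)] compX by (simp_all add: a_def b_def)
  have S: "c.supp z = d.supp (t z)" "loc C X z = loc D X (t z)" unfolding c.supp_def d.supp_def by (simp_all add: eq[OF z])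
  have T: "du (loc C X) z \<bullet> du (loc C N) z + dv (loc C X) z \<bullet> dv (loc C N) z
      = (a\<^sup>2 + b\<^sup>2) * (du (loc D X) (t z) \<bullet> du (loc D N) (t z) + dv (loc D X) (t z) \<bullet> dv (loc D N) (t z))"
    unfolding N X by (simp add: inner_add_left inner_add_right inner_diff_left inner_diff_right algebra_simps power2_eq_square)
  have "du (loc C N) z \<bullet> du (loc C N) z = a * a * (du (loc D N) (t z) \<bullet> du (loc D N) (t z)) + b * b * (dv (loc D N) (t z) \<bullet> dv (loc D N) (t z))"
    unfolding N using d.conf_orth[OF tS] by (simp add: inner_add_left inner_add_right inner_commute algebra_simps)
  then have L: "c.lam z = (a\<^sup>2 + b\<^sup>2) * d.lam (t z)"
    unfolding c.lam_def d.lam_def d.conf_norm[OF tS, symmetric] by (simp add: algebra_simps power2_eq_square)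
  have "a\<^sup>2 + b\<^sup>2 \<noteq> 0" using L c.lam_pos[OF zS] by (metis less_irrefl mult_zero_left)
  then have "(du (loc C X) z \<bullet> du (loc C N) z + dv (loc C X) z \<bullet> dv (loc C N) z) / c.lam z
      = (du (loc D X) (t z) \<bullet> du (loc D N) (t z) + dv (loc D X) (t z) \<bullet> dv (loc D N) (t z)) / d.lam (t z)"
    unfolding T L by (rule mult_divide_mult_cancel_left)
  moreover have "d.supp (t z) \<noteq> 0" using s S(1) by simp
  ultimately show ?thesis
    using c.potential_eq[OF zS s] d.potential_eq[OF tS] S by (simp add: t_def)
qed

text \<open>The hypothesis on simply connected open sets is applied to the preimage of a coordinate
  disc.\<close>

lemma representable_local:
  assumes rep: "sphere_holomorphic A S g" "\<And>C z. C \<in> A \<Longrightarrow> z \<in> coords C S \<Longrightarrow> sphere_deriv_nz (loc C g) z"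
    and pairs: "\<And>U. openin (top_of_set S) U \<Longrightarrow> simply_connected U \<Longrightarrow>
        \<exists>f1 f2. sphere_holomorphic A U f1 \<and> sphere_holomorphic A U f2 \<and>
           (\<forall>C\<in>A. \<forall>z\<in>coords C U. wronskian_nz (loc C f1) (loc C f2) z) \<and> hqsf_parametrized A U X c g f1 f2"
    and origin: "0 \<notin> X ` S" and C: "C \<in> A" and z0: "z0 \<in> coords C S"
  shows "conformal_surface.supp (loc C X) (loc C N) z0 \<noteq> 0"
    "\<exists>\<rho> u. 0 < \<rho> \<and> ball z0 \<rho> \<subseteq> coords C S \<and> u holomorphic_on ball z0 \<rho> \<and> (\<forall>z\<in>ball z0 \<rho>. u z \<noteq> 0 \<and>
       conformal_surface.potential (loc C X) (loc C N) z
         = 4 * sgn (conformal_surface.supp (loc C X) (loc C N) z0) * c * (cmod (u z))\<^sup>2)"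
proof -
  interpret s: conformal_surface "coords C S" "loc C X" "loc C N" using local_surface[OF C] .
  obtain r where r: "r > 0" "ball z0 r \<subseteq> coords C S" using open_coords_S[OF C] z0 openE by blast
  define U where "U = {x \<in> fst C. snd C x \<in> ball z0 r}"
  have US: "openin (top_of_set S) U" unfolding U_def by (rule openin_preimage[OF C open_ball])
  have inv: "inv_into (fst C) (snd C) w \<in> U" "snd C (inv_into (fst C) (snd C) w) = w" if "w \<in> ball z0 r" for w
    using chart_inv(2,3)[OF C, of w S] r(2) that by (auto simp: U_def)
  have invU: "inv_into (fst C) (snd C) (snd C y) = y" "snd C y \<in> ball z0 r" if "y \<in> U" for y
    using chart_inv(1)[OF C] that by (auto simp: U_def)
  have cU: "coords C U = ball z0 r"
  proof
    show "coords C U \<subseteq> ball z0 r" by (auto simp: coords_def U_def)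
    show "ball z0 r \<subseteq> coords C U"
    proof
      fix w assume w: "w \<in> ball z0 r"
      have "inv_into (fst C) (snd C) w \<in> U \<inter> fst C" using inv(1)[OF w] by (simp add: U_def)
      from imageI[OF this, of "snd C"] show "w \<in> coords C U" unfolding coords_def using inv(2)[OF w] by simp
    qed
  qed
  have "simply_connected U"
  proof (rule simply_connected_retraction_gen)
    show "simply_connected (ball z0 r)" by (rule convex_imp_simply_connected[OF convex_ball])
    show "continuous_on (ball z0 r) (inv_into (fst C) (snd C))" "continuous_on U (snd C)"
      using chart_homeo[OF C] r(2) coords_S(1)[OF C] unfolding homeomorphism_def
      by (auto intro: continuous_on_subset simp: U_def)
    show "inv_into (fst C) (snd C) ` ball z0 r = U"
    proof (intro equalityI subsetI)
      fix y assume y: "y \<in> U"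
      show "y \<in> inv_into (fst C) (snd C) ` ball z0 r" by (rule image_eqI[where x = "snd C y"], simp only: invU(1)[OF y], rule invU(2)[OF y])
    qed (use inv(1) in auto)
    show "snd C \<in> U \<rightarrow> ball z0 r" using invU(2) by blast
    show "inv_into (fst C) (snd C) (snd C y) = y" if "y \<in> U" for y by (rule invU(1)[OF that])
  qed
  from pairs[OF US this] obtain f1 f2 where f: "sphere_holomorphic A U f1" "sphere_holomorphic A U f2"
    "\<forall>C\<in>A. \<forall>z\<in>coords C U. wronskian_nz (loc C f1) (loc C f2) z" "hqsf_parametrized A U X c g f1 f2" by blast
  have nm: "loc C g nicely_meromorphic_on ball z0 r" "loc C f1 nicely_meromorphic_on ball z0 r" "loc C f2 nicely_meromorphic_on ball z0 r"
    using rep(1) f(1,2) C nicely_meromorphic_on_subset[OF _ r(2)] unfolding sphere_holomorphic_def cU[symmetric] by blast+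
  have dG: "sphere_deriv_nz (loc C g) z" and wr: "wronskian_nz (loc C f1) (loc C f2) z" and X0: "loc C X z \<noteq> 0"
    if z: "z \<in> ball z0 r" for z
  proof -
    have zS: "z \<in> coords C S" using z r(2) by blast
    show "sphere_deriv_nz (loc C g) z" by (rule rep(2)[OF C zS])
    show "wronskian_nz (loc C f1) (loc C f2) z" using f(3) C z unfolding cU[symmetric] by blast
    have "X (inv_into (fst C) (snd C) z) \<noteq> 0" using origin imageI[OF chart_inv(4)[OF C zS], of X] by metis
    then show "loc C X z \<noteq> 0" by (simp add: loc_def)
  qed
  have par: "loc C X z = hqsf_X c (loc C g) (loc C f1) (loc C f2) z"
    if "z \<in> ball z0 r" "\<not> is_pole (loc C g) z" "\<not> is_pole (loc C f1) z" "\<not> is_pole (loc C f2) z" for z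
    using f(4) C that unfolding hqsf_parametrized_def cU[symmetric] by blast
  note R = s.representation_at_point[OF r nm dG wr par X0]
  show "s.supp z0 \<noteq> 0" using R(1) by simp
  show "\<exists>\<rho> u. 0 < \<rho> \<and> ball z0 \<rho> \<subseteq> coords C S \<and> u holomorphic_on ball z0 \<rho> \<and> (\<forall>z\<in>ball z0 \<rho>. u z \<noteq> 0 \<and>
       s.potential z = 4 * sgn (s.supp z0) * c * (cmod (u z))\<^sup>2)"
  proof -
    obtain \<rho> u where u: "0 < \<rho>" "\<rho> \<le> r" "u holomorphic_on ball z0 \<rho>"
      "\<forall>z\<in>ball z0 \<rho>. u z \<noteq> 0 \<and> s.potential z = 4 * sgn (s.supp z0) * c * (cmod (u z))\<^sup>2" using R(2) by auto
    have "ball z0 \<rho> \<subseteq> coords C S" using subset_ball[OF u(2), of z0] r(2) by blast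
    with u show ?thesis by (intro exI[of _ \<rho>] exI[of _ u] conjI)
  qed
qed

lemma HQSF_by_potential:
  fixes c :: real
  assumes nz: "\<And>C z. C \<in> A \<Longrightarrow> z \<in> coords C S \<Longrightarrow> conformal_surface.supp (loc C X) (loc C N) z \<noteq> 0"
    and pot: "\<And>C z. C \<in> A \<Longrightarrow> z \<in> coords C S \<Longrightarrow>
      conformal_surface.potential (loc C X) (loc C N) z = c * exp (2 * loc C \<mu> z)"
    and harm: "\<And>C z. C \<in> A \<Longrightarrow> z \<in> coords C S \<Longrightarrow>
      \<exists>\<rho> h. 0 < \<rho> \<and> h holomorphic_on ball z \<rho> \<and> (\<forall>w\<in>ball z \<rho>. loc C \<mu> w = Re (h w))"
  shows "HQSF A X N"
proof -
  have "hqsf_eq (coords C S) (loc C X) (loc C N) c (loc C \<mu>)" if C: "C \<in> A" for C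
    unfolding hqsf_eq_def
  proof (intro conjI ballI)
    interpret s: conformal_surface "coords C S" "loc C X" "loc C N" using local_surface[OF C] .
    show "Ck_on 2 (coords C S) (loc C \<mu>)"
    proof (rule Ck_on_local)
      fix z assume z: "z \<in> coords C S"
      obtain \<rho> h where h: "0 < \<rho>" "h holomorphic_on ball z \<rho>" "\<forall>w\<in>ball z \<rho>. loc C \<mu> w = Re (h w)" using harm[OF C z] by blast
      have "Ck_on 2 (ball z \<rho>) (loc C \<mu>) = Ck_on 2 (ball z \<rho>) (\<lambda>w. Re (h w))"
        by (rule Ck_on_cong[OF open_ball]) (use h(3) in blast)
      then show "\<exists>V. open V \<and> z \<in> V \<and> Ck_on 2 V (loc C \<mu>)"
        using Ck_on_Re_holomorphic[OF open_ball h(2)] h(1) by (intro exI[of _ "ball z \<rho>"]) simp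
    qed
    fix z assume z: "z \<in> coords C S"
    obtain \<rho> h where h: "0 < \<rho>" "h holomorphic_on ball z \<rho>" "\<And>w. w \<in> ball z \<rho> \<Longrightarrow> loc C \<mu> w = Re (h w)" using harm[OF C z] by blast
    have zb: "z \<in> ball z \<rho>" using h(1) by simp
    have "du (du (loc C \<mu>)) z = du (du (\<lambda>w. Re (h w))) z"
      by (rule du_dv_cong(1)[OF open_ball zb], rule du_dv_cong(1)[OF open_ball _ h(3)])
    moreover have "dv (dv (loc C \<mu>)) z = dv (dv (\<lambda>w. Re (h w))) z"
      by (rule du_dv_cong(2)[OF open_ball zb], rule du_dv_cong(2)[OF open_ball _ h(3)])
    ultimately show "du (du (loc C \<mu>)) z + dv (dv (loc C \<mu>)) z = 0"
      using harmonic_Re[OF open_ball zb h(2)] by simp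
    show "2 * (loc C X z \<bullet> loc C N z) * mean_curv (loc C X) (loc C N) z +
        (c * (loc C X z \<bullet> loc C N z) * exp (2 * loc C \<mu> z) + loc C X z \<bullet> loc C X z - (loc C X z \<bullet> loc C N z)\<^sup>2) * gauss_curv (loc C X) (loc C N) z = 0"
      using s.potential_hqsf[OF z nz[OF C z]] unfolding pot[OF C z] by (simp add: mult.commute mult.left_commute)
  qed
  then show ?thesis unfolding HQSF_iff by blast
qed

text \<open>The pairs are given separately on each simply connected set and need not fit together.
  The function \<open>\<mu>\<close> is therefore read off from the potential, which is globally
  defined by the surface.\<close>

lemma representable_imp_HQSF:
  assumes rep: "representable A S X" and conn: "connected S" and origin: "0 \<notin> X ` S"
  shows "HQSF A X N"
proof -
  let ?pot = "\<lambda>C. conformal_surface.potential (loc C X) (loc C N)"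
  obtain c g where G: "sphere_holomorphic A S g \<and>
       (\<forall>C\<in>A. \<forall>z\<in>coords C S. sphere_deriv_nz (loc C g) z) \<and>
       (\<forall>U. openin (top_of_set S) U \<and> simply_connected U \<longrightarrow>
          (\<exists>f1 f2. sphere_holomorphic A U f1 \<and> sphere_holomorphic A U f2 \<and>
             (\<forall>C\<in>A. \<forall>z\<in>coords C U. wronskian_nz (loc C f1) (loc C f2) z) \<and>
             hqsf_parametrized A U X c g f1 f2))"
    using rep unfolding representable_def by blast
  have loc: "conformal_surface.supp (loc C X) (loc C N) z0 \<noteq> 0"
    "\<exists>\<rho> u. 0 < \<rho> \<and> ball z0 \<rho> \<subseteq> coords C S \<and> u holomorphic_on ball z0 \<rho> \<and> (\<forall>z\<in>ball z0 \<rho>. u z \<noteq> 0 \<and>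
       ?pot C z = 4 * sgn (conformal_surface.supp (loc C X) (loc C N) z0) * c * (cmod (u z))\<^sup>2)"
    if C: "C \<in> A" and z0: "z0 \<in> coords C S" for C z0
  proof -
    have 1: "sphere_holomorphic A S g" using G by (rule conjunct1)
    have 2: "sphere_deriv_nz (loc C g) z" if "C \<in> A" "z \<in> coords C S" for C z using G that by simp
    have 3: "\<exists>f1 f2. sphere_holomorphic A U f1 \<and> sphere_holomorphic A U f2 \<and>
             (\<forall>C\<in>A. \<forall>z\<in>coords C U. wronskian_nz (loc C f1) (loc C f2) z) \<and> hqsf_parametrized A U X c g f1 f2"
      if "openin (top_of_set S) U" "simply_connected U" for U
      using conjunct2[OF conjunct2[OF G]] that by simp
    show "conformal_surface.supp (loc C X) (loc C N) z0 \<noteq> 0" by (rule representable_local(1)[OF 1 2 3 origin C z0])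
    show "\<exists>\<rho> u. 0 < \<rho> \<and> ball z0 \<rho> \<subseteq> coords C S \<and> u holomorphic_on ball z0 \<rho> \<and> (\<forall>z\<in>ball z0 \<rho>. u z \<noteq> 0 \<and>
       ?pot C z = 4 * sgn (conformal_surface.supp (loc C X) (loc C N) z0) * c * (cmod (u z))\<^sup>2)"
      by (rule representable_local(2)[OF 1 2 3 origin C z0])
  qed
  have nz: "X x \<bullet> N x \<noteq> 0" if x: "x \<in> S" for x
  proof -
    obtain C where C: "C \<in> A" "x \<in> fst C" using obtain_chart[OF x] .
    show ?thesis using loc(1)[OF C(1) coordsI[OF C(2) x]] unfolding supp_loc[OF C(1)] chart_inv(1)[OF C] .
  qed
  \<comment> \<open>The sign of the support function is constant on the connected surface and can be
    absorbed into the constant of the HQSF equation.\<close>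
  obtain \<epsilon> where \<epsilon>: "\<epsilon> = 1 \<or> \<epsilon> = (- 1 :: real)" "\<And>x. x \<in> S \<Longrightarrow> sgn (X x \<bullet> N x) = \<epsilon>"
    using supp_sign_global[OF conn nz] by (metis sgn_neg sgn_pos)
  have pot: "\<exists>\<rho> u. 0 < \<rho> \<and> ball z0 \<rho> \<subseteq> coords C S \<and> u holomorphic_on ball z0 \<rho> \<and>
      (\<forall>z\<in>ball z0 \<rho>. u z \<noteq> 0 \<and> ?pot C z = 4 * \<epsilon> * c * (cmod (u z))\<^sup>2)"
    if C: "C \<in> A" and z0: "z0 \<in> coords C S" for C z0
  proof -
    have "sgn (conformal_surface.supp (loc C X) (loc C N) z0) = \<epsilon>"
      unfolding supp_loc[OF C] by (rule \<epsilon>(2)[OF chart_inv(4)[OF C z0]])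
    then show ?thesis using loc(2)[OF C z0] by simp
  qed
  show ?thesis
  proof (cases "c = 0")
    case True
    show ?thesis
    proof (rule HQSF_by_potential[of 0 "\<lambda>_. 0", OF loc(1)])
      fix C z assume C: "C \<in> A" and z: "z \<in> coords C S"
      obtain \<rho> u where "0 < \<rho>" "\<forall>w\<in>ball z \<rho>. u w \<noteq> 0 \<and> ?pot C w = 4 * \<epsilon> * c * (cmod (u w))\<^sup>2" using pot[OF C z] by blast
      then show "?pot C z = 0 * exp (2 * loc C (\<lambda>_. 0) z)" using True by simp
      show "\<exists>\<rho> h. 0 < \<rho> \<and> h holomorphic_on ball z \<rho> \<and> (\<forall>w\<in>ball z \<rho>. loc C (\<lambda>_. 0) w = Re (h w))"
        by (intro exI[of _ 1] exI[of _ "\<lambda>_. 0"]) (simp add: loc_def)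
    qed
  next
    case False
    define k where "k = 4 * \<epsilon> * c"
    have k: "k \<noteq> 0" using \<epsilon>(1) False by (auto simp: k_def)
    \<comment> \<open>A chart is chosen at every point to make \<open>\<mu>\<close> a function on
      the surface; by \<open>potential_transition\<close> the choice does not affect its
      value.\<close>
    define ch where "ch x = (SOME C. C \<in> A \<and> x \<in> fst C)" for x
    define \<mu> where "\<mu> x = ln (?pot (ch x) (snd (ch x) x) / k) / 2" for x
    have \<mu>: "loc C \<mu> z = ln (?pot C z / k) / 2" if C: "C \<in> A" and z: "z \<in> coords C S" for C z
    proof -
      define x where "x = inv_into (fst C) (snd C) z"
      have x: "x \<in> fst C" "snd C x = z" using chart_inv(2,3)[OF C z] by (simp_all add: x_def)
      have D: "ch x \<in> A \<and> x \<in> fst (ch x)" unfolding ch_def by (rule someI[of _ C]) (use C x in simp)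
      have zD: "z \<in> coords C (fst (ch x))" using coordsI[OF x(1), of "fst (ch x)"] D x(2) by simp
      have "?pot C z = ?pot (ch x) (loc C (snd (ch x)) z)"
        by (rule potential_transition[OF C _ zD loc(1)[OF C z]]) (use D in simp)
      moreover have "loc C (snd (ch x)) z = snd (ch x) x" "loc C \<mu> z = \<mu> x" by (simp_all add: loc_def x_def)
      ultimately show ?thesis by (simp add: \<mu>_def)
    qed
    have \<mu>u: "loc C \<mu> z = ln (cmod v)" if "C \<in> A" "z \<in> coords C S" "v \<noteq> 0" "?pot C z = 4 * \<epsilon> * c * (cmod v)\<^sup>2" for C z v
      using \<mu>[OF that(1,2)] that(3,4) k by (simp add: k_def[symmetric] ln_realpow)
    show ?thesis
    proof (rule HQSF_by_potential[of k \<mu>, OF loc(1)])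
      fix C z assume C: "C \<in> A" and z: "z \<in> coords C S"
      obtain \<rho> u where u: "0 < \<rho>" "ball z \<rho> \<subseteq> coords C S" "u holomorphic_on ball z \<rho>"
        "\<And>w. w \<in> ball z \<rho> \<Longrightarrow> u w \<noteq> 0" "\<And>w. w \<in> ball z \<rho> \<Longrightarrow> ?pot C w = 4 * \<epsilon> * c * (cmod (u w))\<^sup>2" using pot[OF C z] by blast
      have zb: "z \<in> ball z \<rho>" using u(1) by simp
      have "exp (2 * loc C \<mu> z) = (cmod (u z))\<^sup>2"
        unfolding \<mu>u[OF C z u(4)[OF zb] u(5)[OF zb]] using u(4)[OF zb] by (simp add: exp_double)
      then show "?pot C z = k * exp (2 * loc C \<mu> z)" using u(5)[OF zb] by (simp add: k_def)
      \<comment> \<open>On a disc the zero-free function \<open>u\<close> has a holomorphic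
        logarithm, whose real part is \<open>\<mu>\<close>.\<close>
      have "simply_connected (ball z \<rho>)" by (rule convex_imp_simply_connected[OF convex_ball])
      then obtain h where h: "h holomorphic_on ball z \<rho>" "\<forall>w\<in>ball z \<rho>. u w = exp (h w)"
        using u(3,4) simply_connected_eq_holomorphic_log[OF open_ball, of z \<rho>] by blast
      have "loc C \<mu> w = Re (h w)" if w: "w \<in> ball z \<rho>" for w
      proof -
        have wS: "w \<in> coords C S" using u(2) w by blast
        have uw: "u w = exp (h w)" using h(2) w by blast
        have "loc C \<mu> w = ln (cmod (u w))" by (rule \<mu>u[OF C wS u(4)[OF w] u(5)[OF w]])
        then show ?thesis unfolding uw by (simp add: norm_exp_eq_Re)
      qed
      then show "\<exists>\<rho> h. 0 < \<rho> \<and> h holomorphic_on ball z \<rho> \<and> (\<forall>w\<in>ball z \<rho>. loc C \<mu> w = Re (h w))"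
        using u(1) h(1) by blast
    qed
  qed
qed

end

theorem theorem2:
  fixes S :: "'a::{t2_space, second_countable_topology} set"
    and A :: "'a chart set"
    and X N :: "'a \<Rightarrow> complex \<times> real"
  assumes surface: "riemann_surface S A" and connected: "connected S"
    and immersion: "immersion A X" and oriented: "unit_normal A X N"
    and curvature: "\<forall>C\<in>A. \<forall>z\<in>coords C (fst C). gauss_curv (loc C X) (loc C N) z \<noteq> 0"
    and conformal: "III_conformal A N"
    and origin: "0 \<notin> X ` S"
  shows "HQSF A X N \<longleftrightarrow>
    (\<exists>B\<in>{A, conj_atlas A}. \<exists>(c::real) g.
       sphere_holomorphic B S g \<and>
       (\<forall>C\<in>B. \<forall>z\<in>coords C S. sphere_deriv_nz (loc C g) z) \<and>
       (\<forall>U. openin (top_of_set S) U \<and> simply_connected U \<longrightarrow>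
          (\<exists>f1 f2. sphere_holomorphic B U f1 \<and> sphere_holomorphic B U f2 \<and>
             (\<forall>C\<in>B. \<forall>z\<in>coords C U. wronskian_nz (loc C f1) (loc C f2) z) \<and>
             hqsf_parametrized B U X c g f1 f2)))"
proof -
  interpret p: conformal_immersion S A X N
    by (rule conformal_immersionI[OF surface immersion oriented curvature conformal])
  interpret q: conformal_immersion S "conj_atlas A" X N
    by (rule p.conformal_immersion_conj)
  have "HQSF A X N \<longleftrightarrow> (\<exists>B\<in>{A, conj_atlas A}. representable B S X)"
  proof
    assume "HQSF A X N"
    from p.HQSF_imp_representable[OF this connected origin]
    show "\<exists>B\<in>{A, conj_atlas A}. representable B S X" by blast
  next
    assume "\<exists>B\<in>{A, conj_atlas A}. representable B S X"
    then consider "representable A S X" | "representable (conj_atlas A) S X" by blast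
    then show "HQSF A X N"
    proof cases
      case 1
      then show ?thesis by (rule p.representable_imp_HQSF[OF _ connected origin])
    next
      case 2
      \<comment> \<open>The HQSF property is invariant under conjugation of the atlas, and
        conjugating twice returns the original one.\<close>
      from q.HQSF_conj[OF q.representable_imp_HQSF[OF this connected origin]]
      show ?thesis by (simp only: conj_atlas_conj_atlas)
    qed
  qed
  then show ?thesis unfolding representable_def .
qed

end
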